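(* Let $\lambda\in V_{\mathbb{C}}^*$. (i) The propagation operator $T_k$ restricts to an isomorphism $T_k:E(\lambda)_{Q_k}\overset{\sim}{\longrightarrow}\mathrm{BVP}_k(\lambda)_{\pi_k}$ of left $H_k$-modules. (ii) The map $G$ restricts to an isomorphism $G:E(\lambda)_{Q_k}^{W}\overset{\sim}{\longrightarrow}\mathrm{BVP}_k(\lambda)_{\pi_k}^W$.
   Context: Root systems. Let $V$ be a Euclidean space of dimension $n$ and $V^*$ the dual Euclidean space, with norm $\|\cdot\|$ and inner product $\langle\cdot,\cdot\rangle$ on $V^*$. Let $\Sigma_0\subset V^*$ be a finite, irreducible, reduced crystallographic root system. The co-root $\alpha^\vee\in V$ of $\alpha\in\Sigma_0$ is determined by $\xi(\alpha^\vee)=2\langle\xi,\alpha\rangle/\|\alpha\|^2$ for all $\xi\in V^*$. Fix a basis $I_0=\{a_1,\ldots,a_n\}$ of $\Sigma_0$, with highest root $\varphi$. The Weyl group $W_0$ is generated by the reflections $s_\alpha v=v-\alpha(v)\alpha^\vee$ ($\alpha\in\Sigma_0$) of $V$. $V_{\mathbb{C}}^*$ is the complexification of $V^*$. $S(V)$ is the symmetric algebra of $V$, identified with the polynomial functions on $V^*$ (and $S(V)_{\mathbb{C}}$ its complexification), with $W_0$-invariants $S(V)^{W_0}$, $S(V)_{\mathbb{C}}^{W_0}$; $p(\partial)$ is the constant coefficient differential operator obtained from $v\mapsto\partial_v$ (directional derivative). Affine root system. Affine linear functionals on $V$ are written as elements of $V^*\oplus\mathbb{R}$, and $D$ denotes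 the projection onto $V^*$ (the gradient). The affine root system is $\Sigma=\Sigma_0+\mathbb{Z}$, with basis $I=\{a_0=-\varphi+1,a_1,\ldots,a_n\}$ and corresponding positive roots $\Sigma^+$. For $a\in\Sigma$ write $Da^\vee=(Da)^\vee$, $V_a=a^{-1}(0)$, and $s_a(v)=v-a(v)Da^\vee$. The affine Weyl group $W$ is generated by all $s_a$ ($a\in\Sigma$); it is a Coxeter group with generators $s_a$ ($a\in I$). $W$ acts on functions on $V$ (including affine functionals) and on $V_{reg}=V\setminus\bigcup_{a\in\Sigma^+}V_a$ by $(wf)(v)=f(w^{-1}v)$. The connected components of $V_{reg}$ are called alcoves; $C_+=\{v\in V:a_j(v)>0,\ j=0,\ldots,n\}$. A vector $v\in V_a$ ($a\in\Sigma^+$) is sub-regular if it lies on no other $V_b$ ($b\in\Sigma^+$, $b\ne a$). Multiplicity function. $k:\Sigma\to\mathbb{R}_{>0}$ is a fixed $W$-invariant function with $k(a)=k(Da)$ for all $a\in\Sigma$; write $k_a=k(a)$. The algebra $H_k$. $H_k$ is the unique complex unital associative algebra with $H_k=S(V)_{\mathbb{C}}\otimes\mathbb{C}[W]$ as vector spaces, containing $S(V)_{\mathbb{C}}$ and $\mathbb{C}[W]$ as subalgebras via $p\mapsto p\otimes e$, $w\mapsto1\otimes w$, and with cross relations $s_a\cdot v-(s_{Da}v)\cdot s_a=k_aDa(v)$ for $a\in I$, $v\in V$. The representation $\pi_k$. Let $\chi_a(v)=1$ if $a(v)<0$ and $0$ if $a(v)>0$ ($v\in V_{reg}$). On the space $C^\infty(V_{reg})$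 of complex-valued smooth functions put $\mathcal{D}_v^k=\partial_v+\sum_{a\in\Sigma^+}k_aDa(v)\chi_a(\cdot)s_a$ ($v\in V$). The assignment $v\mapsto\mathcal{D}_v^k$ together with the $W$-action $(wf)(v)=f(w^{-1}v)$ defines a representation $\pi_k$ of $H_k$ on $C^\infty(V_{reg})$. The representation $Q_k$. On the space $C(V)$ of complex-valued continuous functions put $(Q_{k,a}f)(v)=f(s_av)+k_a\int_0^{a(v)}f(v-tDa^\vee)\,dt$. The assignment $s_a\mapsto Q_{k,a}$ ($a\in I$) extends to an action $w\mapsto Q_k(w)$ of $W$ on $C(V)$; on $C^\infty(V)$, together with $v\mapsto\partial_v$, it defines a representation $Q_k$ of $H_k$. Operators. $T_k$ is the endomorphism of $C(V)$ defined by $(T_kf)(w^{-1}v)=(Q_k(w)f)(v)$ for $v\in\overline{C_+}$, $w\in W$. With $C^\omega(V)$ the complex-valued real analytic functions on $V$ and $C(V)^W$ the $W$-invariant continuous functions, $G:C^\omega(V)\to C(V)^W$ is defined by $(Gf)(w^{-1}v)=f(v)$ for $w\in W$, $v\in\overline{C_+}$. Spaces. $E(\lambda)=\{f\in C^\omega(V):p(\partial)f=p(\lambda)f\ \forall p\in S(V)_{\mathbb{C}}^{W_0}\}$, an $H_k$-submodule $E(\lambda)_{Q_k}$ of $C^\infty(V)$ for the $Q_k$-action; $E(\lambda)_{Q_k}^W$ is its subspace of $Q_k(W)$-invariants. $CB^1(V)$ is the space of complex-valued continuous $f$ on $V$ such that for each alcove $C$, $f|_C$ has a continuously differentiable extension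 to an open neighborhood of $\overline{C}$. $\mathrm{BVP}_k(\lambda)$ is the space of $f\in CB^1(V)$ such that $(\partial_{Da^\vee}f)(v+0Da^\vee)-(\partial_{Da^\vee}f)(v-0Da^\vee)=2k_af(v)$ for all sub-regular $v\in V_a$, $a\in\Sigma^+$ (one-sided limits along $v\pm tDa^\vee$, $t\downarrow0$), and $p(\partial)f|_{V_{reg}}=p(\lambda)f|_{V_{reg}}$ in the distributional sense for all $p\in S(V)^{W_0}$. Its elements are smooth on $V_{reg}$, and via restriction to $V_{reg}$ it is an $H_k$-submodule $\mathrm{BVP}_k(\lambda)_{\pi_k}$ of $C^\infty(V_{reg})$ for the $\pi_k$-action; $\mathrm{BVP}_k(\lambda)_{\pi_k}^W$ is its subspace of $W$-invariant functions. *)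

theory Defs
  imports "HOL-Analysis.Analysis" "HOL-Library.Poly_Mapping"
begin

section \<open>Root systems and affine root systems\<close>

text \<open>
  The Euclidean space \<open>V\<close> is a type of class \<^class>\<open>euclidean_space\<close>.  Its dual Euclidean space
  is identified with \<open>V\<close> by the inner product: \<open>\<xi> :: 'a\<close> stands for the functional
  \<open>v \<mapsto> \<xi> \<bullet> v\<close>.  An affine linear functional, an element of the direct sum of the dual and the
  reals, is a pair; its gradient is \<^const>\<open>fst\<close>.
\<close>

type_synonym 'a affine_functional = "'a \<times> real"

definition coroot :: "'a::euclidean_space \<Rightarrow> 'a" where
  "coroot \<alpha> = (2 / (\<alpha> \<bullet> \<alpha>)) *\<^sub>R \<alpha>"

text \<open>Under the identification this is also the contragredient action on the dual space,
  \<open>\<xi> - \<xi>(\<alpha>\<^sup>\<or>) \<alpha>\<close>.\<close>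

definition refl :: "'a::euclidean_space \<Rightarrow> 'a \<Rightarrow> 'a" where
  "refl \<alpha> v = v - (\<alpha> \<bullet> v) *\<^sub>R coroot \<alpha>"

definition irreducible_root_system :: "'a::euclidean_space set \<Rightarrow> bool" where
  "irreducible_root_system R \<longleftrightarrow>
     finite R \<and> span R = UNIV \<and> 0 \<notin> R \<and>
     (\<forall>\<alpha>\<in>R. \<forall>\<beta>\<in>R. refl \<alpha> \<beta> \<in> R) \<and>
     (\<forall>\<alpha>\<in>R. \<forall>\<beta>\<in>R. \<beta> \<bullet> coroot \<alpha> \<in> \<int>) \<and>
     (\<forall>\<alpha>\<in>R. \<forall>c::real. c *\<^sub>R \<alpha> \<in> R \<longrightarrow> c = 1 \<or> c = - 1) \<and>
     \<not> (\<exists>R\<^sub>1 R\<^sub>2. R = R\<^sub>1 \<union> R\<^sub>2 \<and> R\<^sub>1 \<noteq> {} \<and> R\<^sub>2 \<noteq> {} \<and> (\<forall>\<alpha>\<in>R\<^sub>1. \<forall>\<beta>\<in>R\<^sub>2. \<alpha> \<bullet> \<beta> = 0))"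

definition nat_cone :: "'b::real_vector set \<Rightarrow> 'b set" where
  "nat_cone B = {(\<Sum>b\<in>B. real (c b) *\<^sub>R b) | c. True}"

definition root_basis :: "'a::euclidean_space set \<Rightarrow> 'a set \<Rightarrow> bool" where
  "root_basis R B \<longleftrightarrow>
     B \<subseteq> R \<and> independent B \<and> (\<forall>\<alpha>\<in>R. \<alpha> \<in> nat_cone B \<or> - \<alpha> \<in> nat_cone B)"

definition highest_root :: "'a::euclidean_space set \<Rightarrow> 'a set \<Rightarrow> 'a \<Rightarrow> bool" where
  "highest_root R B \<phi> \<longleftrightarrow> \<phi> \<in> R \<and> (\<forall>\<alpha>\<in>R. \<phi> - \<alpha> \<in> nat_cone B)"

definition aeval :: "'a::euclidean_space affine_functional \<Rightarrow> 'a \<Rightarrow> real" where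
  "aeval a v = fst a \<bullet> v + snd a"

definition arefl :: "'a::euclidean_space affine_functional \<Rightarrow> 'a \<Rightarrow> 'a" where
  "arefl a v = v - aeval a v *\<^sub>R coroot (fst a)"

definition affine_roots :: "'a set \<Rightarrow> 'a affine_functional set" where
  "affine_roots R = R \<times> \<int>"

definition affine_basis :: "'a::euclidean_space set \<Rightarrow> 'a \<Rightarrow> 'a affine_functional set" where
  "affine_basis B \<phi> = insert (- \<phi>, 1) ((\<lambda>\<alpha>. (\<alpha>, 0)) ` B)"

definition pos_affine_roots ::
    "'a::euclidean_space set \<Rightarrow> 'a set \<Rightarrow> 'a \<Rightarrow> 'a affine_functional set" where
  "pos_affine_roots R B \<phi> = affine_roots R \<inter> nat_cone (affine_basis B \<phi>)"

text \<open>The generators are involutions, so closure under composition yields the groups they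
  generate.\<close>

inductive_set weyl_group :: "'a::euclidean_space set \<Rightarrow> ('a \<Rightarrow> 'a) set" for R where
  "id \<in> weyl_group R"
| "\<alpha> \<in> R \<Longrightarrow> w \<in> weyl_group R \<Longrightarrow> refl \<alpha> \<circ> w \<in> weyl_group R"

inductive_set affine_weyl_group :: "'a::euclidean_space set \<Rightarrow> ('a \<Rightarrow> 'a) set" for R where
  "id \<in> affine_weyl_group R"
| "a \<in> affine_roots R \<Longrightarrow> w \<in> affine_weyl_group R \<Longrightarrow> arefl a \<circ> w \<in> affine_weyl_group R"

definition regular_set :: "'a::euclidean_space set \<Rightarrow> 'a set \<Rightarrow> 'a \<Rightarrow> 'a set" where
  "regular_set R B \<phi> = {v. \<forall>a\<in>pos_affine_roots R B \<phi>. aeval a v \<noteq> 0}"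

definition alcoves :: "'a::euclidean_space set \<Rightarrow> 'a set \<Rightarrow> 'a \<Rightarrow> 'a set set" where
  "alcoves R B \<phi> = components (regular_set R B \<phi>)"

definition fund_alcove :: "'a::euclidean_space set \<Rightarrow> 'a \<Rightarrow> 'a set" where
  "fund_alcove B \<phi> = {v. \<forall>a\<in>affine_basis B \<phi>. aeval a v > 0}"

definition subregular ::
    "'a::euclidean_space set \<Rightarrow> 'a set \<Rightarrow> 'a \<Rightarrow> 'a affine_functional \<Rightarrow> 'a \<Rightarrow> bool" where
  "subregular R B \<phi> a v \<longleftrightarrow>
     aeval a v = 0 \<and> (\<forall>b\<in>pos_affine_roots R B \<phi>. b \<noteq> a \<longrightarrow> aeval b v \<noteq> 0)"

text \<open>Invariance: if \<open>b\<close> is the affine root \<open>w a\<close>, that is \<open>b(v) = a(w\<^sup>-\<^sup>1 v)\<close>, then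
  \<open>k b = k a\<close>.\<close>

definition multiplicity_function ::
    "'a::euclidean_space set \<Rightarrow> ('a affine_functional \<Rightarrow> real) \<Rightarrow> bool" where
  "multiplicity_function R k \<longleftrightarrow>
     (\<forall>a\<in>affine_roots R. k a > 0 \<and> k a = k (fst a, 0)) \<and>
     (\<forall>w\<in>affine_weyl_group R. \<forall>a\<in>affine_roots R. \<forall>b\<in>affine_roots R.
        (\<forall>v. aeval b v = aeval a (inv w v)) \<longrightarrow> k b = k a)"


section \<open>The symmetric algebra\<close>

text \<open>
  The complexified symmetric algebra of \<open>V\<close> is the algebra of complex polynomials in the
  elements of the orthonormal basis \<^const>\<open>Basis\<close>; a monomial is a multi-index supported on
  \<^const>\<open>Basis\<close>.
\<close>

type_synonym 'a sympoly = "('a \<Rightarrow>\<^sub>0 nat) \<Rightarrow>\<^sub>0 complex"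

definition multi_indices :: "('a::euclidean_space \<Rightarrow>\<^sub>0 nat) set" where
  "multi_indices = {m. Poly_Mapping.keys m \<subseteq> Basis}"

definition sym_algebra :: "'a::euclidean_space sympoly set" where
  "sym_algebra = {p. Poly_Mapping.keys p \<subseteq> multi_indices}"

definition real_sym_algebra :: "'a::euclidean_space sympoly set" where
  "real_sym_algebra = {p \<in> sym_algebra. \<forall>m. Poly_Mapping.lookup p m \<in> \<real>}"

definition sym_vec :: "'a::euclidean_space \<Rightarrow> 'a sympoly" where
  "sym_vec v =
     (\<Sum>b\<in>Basis. Poly_Mapping.single (Poly_Mapping.single b 1) (complex_of_real (v \<bullet> b)))"

definition sym_const :: "complex \<Rightarrow> 'a sympoly" where
  "sym_const c = Poly_Mapping.single 0 c"

text \<open>Points of the complexified dual space are real-linear maps from \<open>V\<close> to the complex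
  numbers.\<close>

definition sym_eval :: "('a::euclidean_space \<Rightarrow> complex) \<Rightarrow> 'a sympoly \<Rightarrow> complex" where
  "sym_eval lam p = (\<Sum>m\<in>Poly_Mapping.keys p.
     Poly_Mapping.lookup p m * (\<Prod>b\<in>Basis. lam b ^ Poly_Mapping.lookup m b))"

definition real_point :: "'a::euclidean_space \<Rightarrow> 'a \<Rightarrow> complex" where
  "real_point \<xi> v = complex_of_real (\<xi> \<bullet> v)"

definition sym_invariant :: "'a::euclidean_space set \<Rightarrow> 'a sympoly \<Rightarrow> bool" where
  "sym_invariant R p \<longleftrightarrow>
     (\<forall>w\<in>weyl_group R. \<forall>\<xi>. sym_eval (real_point (w \<xi>)) p = sym_eval (real_point \<xi>) p)"

definition basis_list :: "'a::euclidean_space list" where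
  "basis_list = (SOME xs. distinct xs \<and> set xs = Basis)"

text \<open>Substitution of operators \<open>T b\<close> for the basis elements \<open>b\<close> in a polynomial.  It is used
  for operators that commute on the functions in question, so the order in which
  \<open>basis_list\<close> enumerates the basis is immaterial.\<close>

definition sym_subst ::
    "('a::euclidean_space \<Rightarrow> ('a \<Rightarrow> complex) \<Rightarrow> 'a \<Rightarrow> complex) \<Rightarrow> 'a sympoly
       \<Rightarrow> ('a \<Rightarrow> complex) \<Rightarrow> 'a \<Rightarrow> complex" where
  "sym_subst T p f = (\<lambda>x. \<Sum>m\<in>Poly_Mapping.keys p. Poly_Mapping.lookup p m *
     foldr (\<lambda>b g. (T b ^^ Poly_Mapping.lookup m b) g) basis_list f x)"


section \<open>Function spaces\<close>

definition dir_deriv ::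
    "'a::euclidean_space \<Rightarrow> ('a \<Rightarrow> complex) \<Rightarrow> 'a \<Rightarrow> complex" where
  "dir_deriv v f x = vector_derivative (\<lambda>t. f (x + t *\<^sub>R v)) (at 0)"

primrec Ck_on :: "nat \<Rightarrow> 'a::euclidean_space set \<Rightarrow> ('a \<Rightarrow> complex) \<Rightarrow> bool" where
  "Ck_on 0 U f \<longleftrightarrow> continuous_on U f"
| "Ck_on (Suc n) U f \<longleftrightarrow>
     (\<forall>x\<in>U. f differentiable (at x)) \<and> (\<forall>v. Ck_on n U (dir_deriv v f))"

definition smooth_on :: "'a::euclidean_space set \<Rightarrow> ('a \<Rightarrow> complex) \<Rightarrow> bool" where
  "smooth_on U f \<longleftrightarrow> (\<forall>n. Ck_on n U f)"

definition real_analytic :: "('a::euclidean_space \<Rightarrow> complex) \<Rightarrow> bool" where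
  "real_analytic f \<longleftrightarrow> (\<forall>x. \<exists>r>0. \<exists>c. \<forall>y\<in>ball x r.
     ((\<lambda>m. c m * complex_of_real (\<Prod>b\<in>Basis. ((y - x) \<bullet> b) ^ Poly_Mapping.lookup m b))
        has_sum f y) multi_indices)"

definition test_function :: "'a::euclidean_space set \<Rightarrow> ('a \<Rightarrow> complex) \<Rightarrow> bool" where
  "test_function U \<psi> \<longleftrightarrow>
     smooth_on UNIV \<psi> \<and> (\<exists>K. compact K \<and> K \<subseteq> U \<and> (\<forall>x. x \<notin> K \<longrightarrow> \<psi> x = 0))"

text \<open>The equation \<open>p(\<partial>)f = cf\<close> of distributions on \<open>U\<close>, where \<open>\<partial>\<^sub>v\<close> acts on distributions
  as the transpose of \<open>-\<partial>\<^sub>v\<close>.\<close>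

definition distributional_eigen ::
    "'a::euclidean_space set \<Rightarrow> 'a sympoly \<Rightarrow> complex \<Rightarrow> ('a \<Rightarrow> complex) \<Rightarrow> bool" where
  "distributional_eigen U p c f \<longleftrightarrow>
     (\<forall>\<psi>. test_function U \<psi> \<longrightarrow>
        (LINT x:U|lborel. f x * sym_subst (\<lambda>v g y. - dir_deriv v g y) p \<psi> x) =
        c * (LINT x:U|lborel. f x * \<psi> x))"

definition CB1 :: "'a::euclidean_space set \<Rightarrow> 'a set \<Rightarrow> 'a \<Rightarrow> ('a \<Rightarrow> complex) set" where
  "CB1 R B \<phi> = {f. continuous_on UNIV f \<and>
     (\<forall>C\<in>alcoves R B \<phi>. \<exists>U g. open U \<and> closure C \<subseteq> U \<and> Ck_on 1 U g \<and> (\<forall>x\<in>C. g x = f x))}"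

definition E_space :: "'a::euclidean_space set \<Rightarrow> ('a \<Rightarrow> complex) \<Rightarrow> ('a \<Rightarrow> complex) set" where
  "E_space R lam = {f. real_analytic f \<and>
     (\<forall>p\<in>sym_algebra. sym_invariant R p \<longrightarrow>
        sym_subst dir_deriv p f = (\<lambda>x. sym_eval lam p * f x))}"

definition jump_condition ::
    "('a::euclidean_space affine_functional \<Rightarrow> real) \<Rightarrow> 'a affine_functional
       \<Rightarrow> ('a \<Rightarrow> complex) \<Rightarrow> 'a \<Rightarrow> bool" where
  "jump_condition k a f v \<longleftrightarrow> (let d = coroot (fst a) in
     \<exists>l\<^sub>1 l\<^sub>2. ((\<lambda>t. dir_deriv d f (v + t *\<^sub>R d)) \<longlongrightarrow> l\<^sub>1) (at_right 0) \<and>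
            ((\<lambda>t. dir_deriv d f (v - t *\<^sub>R d)) \<longlongrightarrow> l\<^sub>2) (at_right 0) \<and>
            l\<^sub>1 - l\<^sub>2 = 2 * complex_of_real (k a) * f v)"

definition BVP :: "'a::euclidean_space set \<Rightarrow> 'a set \<Rightarrow> 'a \<Rightarrow> ('a affine_functional \<Rightarrow> real)
    \<Rightarrow> ('a \<Rightarrow> complex) \<Rightarrow> ('a \<Rightarrow> complex) set" where
  "BVP R B \<phi> k lam = {f \<in> CB1 R B \<phi>.
     (\<forall>a\<in>pos_affine_roots R B \<phi>. \<forall>v. subregular R B \<phi> a v \<longrightarrow> jump_condition k a f v) \<and>
     (\<forall>p\<in>real_sym_algebra. sym_invariant R p \<longrightarrow>
        distributional_eigen (regular_set R B \<phi>) p (sym_eval lam p) f)}"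


section \<open>The algebra \<open>H\<^sub>k\<close> and its modules\<close>

text \<open>
  The tensor product of the symmetric algebra with the group algebra of the affine Weyl group:
  finitely supported functions from the group to the symmetric algebra, with
  \<^term>\<open>Poly_Mapping.single w p\<close> in the role of \<open>p \<otimes> w\<close>.
\<close>

type_synonym 'a hecke = "('a \<Rightarrow> 'a) \<Rightarrow>\<^sub>0 'a sympoly"

definition hecke_carrier :: "'a::euclidean_space set \<Rightarrow> 'a hecke set" where
  "hecke_carrier R =
     {h. Poly_Mapping.keys h \<subseteq> affine_weyl_group R \<and> (\<forall>w. Poly_Mapping.lookup h w \<in> sym_algebra)}"

abbreviation hecke_tensor :: "'a sympoly \<Rightarrow> ('a \<Rightarrow> 'a) \<Rightarrow> 'a hecke" where
  "hecke_tensor p w \<equiv> Poly_Mapping.single w p"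

definition hecke_scale :: "complex \<Rightarrow> 'a hecke \<Rightarrow> 'a hecke" where
  "hecke_scale c h = Poly_Mapping.map (\<lambda>p. sym_const c * p) h"

text \<open>\<^term>\<open>mul\<close> is the multiplication of \<open>H\<^sub>k\<close>.  The identification with the tensor product is
  given by multiplication: \<open>p \<otimes> w\<close> is the product of \<open>p \<otimes> e\<close> and \<open>1 \<otimes> w\<close>.\<close>

definition hecke_mult :: "'a::euclidean_space set \<Rightarrow> 'a set \<Rightarrow> 'a
    \<Rightarrow> ('a affine_functional \<Rightarrow> real) \<Rightarrow> ('a hecke \<Rightarrow> 'a hecke \<Rightarrow> 'a hecke) \<Rightarrow> bool" where
  "hecke_mult R B \<phi> k mul \<longleftrightarrow>
     (\<forall>x\<in>hecke_carrier R. \<forall>y\<in>hecke_carrier R. mul x y \<in> hecke_carrier R) \<and>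
     (\<forall>x\<in>hecke_carrier R. \<forall>y\<in>hecke_carrier R. \<forall>z\<in>hecke_carrier R.
        mul (x + y) z = mul x z + mul y z \<and>
        mul x (y + z) = mul x y + mul x z \<and>
        mul (mul x y) z = mul x (mul y z)) \<and>
     (\<forall>c. \<forall>x\<in>hecke_carrier R. \<forall>y\<in>hecke_carrier R.
        mul (hecke_scale c x) y = hecke_scale c (mul x y) \<and>
        mul x (hecke_scale c y) = hecke_scale c (mul x y)) \<and>
     (\<forall>x\<in>hecke_carrier R. mul (hecke_tensor 1 id) x = x \<and> mul x (hecke_tensor 1 id) = x) \<and>
     (\<forall>p\<in>sym_algebra. \<forall>q\<in>sym_algebra.
        mul (hecke_tensor p id) (hecke_tensor q id) = hecke_tensor (p * q) id) \<and>
     (\<forall>w\<in>affine_weyl_group R. \<forall>w'\<in>affine_weyl_group R.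
        mul (hecke_tensor 1 w) (hecke_tensor 1 w') = hecke_tensor 1 (w \<circ> w')) \<and>
     (\<forall>p\<in>sym_algebra. \<forall>w\<in>affine_weyl_group R.
        mul (hecke_tensor p id) (hecke_tensor 1 w) = hecke_tensor p w) \<and>
     (\<forall>a\<in>affine_basis B \<phi>. \<forall>v.
        mul (hecke_tensor 1 (arefl a)) (hecke_tensor (sym_vec v) id) -
        mul (hecke_tensor (sym_vec (refl (fst a) v)) id) (hecke_tensor 1 (arefl a)) =
        hecke_tensor (sym_const (complex_of_real (k a * (fst a \<bullet> v)))) id)"

definition csubspace_fun :: "('a \<Rightarrow> complex) set \<Rightarrow> bool" where
  "csubspace_fun M \<longleftrightarrow> (\<lambda>x. 0) \<in> M \<and>
     (\<forall>f\<in>M. \<forall>g\<in>M. (\<lambda>x. f x + g x) \<in> M) \<and> (\<forall>c. \<forall>f\<in>M. (\<lambda>x. c * f x) \<in> M)"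

definition clinear_fun_on ::
    "('a \<Rightarrow> complex) set \<Rightarrow> (('a \<Rightarrow> complex) \<Rightarrow> 'a \<Rightarrow> complex) \<Rightarrow> bool" where
  "clinear_fun_on M T \<longleftrightarrow>
     (\<forall>f\<in>M. \<forall>g\<in>M. T (\<lambda>x. f x + g x) = (\<lambda>x. T f x + T g x)) \<and>
     (\<forall>c. \<forall>f\<in>M. T (\<lambda>x. c * f x) = (\<lambda>x. c * T f x))"

definition clinear_iso ::
    "('a \<Rightarrow> complex) set \<Rightarrow> ('a \<Rightarrow> complex) set
       \<Rightarrow> (('a \<Rightarrow> complex) \<Rightarrow> 'a \<Rightarrow> complex) \<Rightarrow> bool" where
  "clinear_iso M N T \<longleftrightarrow>
     csubspace_fun M \<and> csubspace_fun N \<and> clinear_fun_on M T \<and> bij_betw T M N"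

definition hecke_module :: "'a::euclidean_space set \<Rightarrow> ('a hecke \<Rightarrow> 'a hecke \<Rightarrow> 'a hecke)
    \<Rightarrow> ('a \<Rightarrow> complex) set \<Rightarrow> ('a hecke \<Rightarrow> ('a \<Rightarrow> complex) \<Rightarrow> 'a \<Rightarrow> complex) \<Rightarrow> bool" where
  "hecke_module R mul M \<rho> \<longleftrightarrow>
     csubspace_fun M \<and>
     (\<forall>h\<in>hecke_carrier R. clinear_fun_on M (\<rho> h) \<and> (\<forall>f\<in>M. \<rho> h f \<in> M)) \<and>
     (\<forall>h\<in>hecke_carrier R. \<forall>h'\<in>hecke_carrier R. \<forall>f\<in>M.
        \<rho> (h + h') f = (\<lambda>x. \<rho> h f x + \<rho> h' f x) \<and> \<rho> (mul h h') f = \<rho> h (\<rho> h' f)) \<and>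
     (\<forall>c. \<forall>h\<in>hecke_carrier R. \<forall>f\<in>M. \<rho> (hecke_scale c h) f = (\<lambda>x. c * \<rho> h f x)) \<and>
     (\<forall>f\<in>M. \<rho> (hecke_tensor 1 id) f = f)"

definition hecke_module_iso :: "'a::euclidean_space set \<Rightarrow> ('a hecke \<Rightarrow> 'a hecke \<Rightarrow> 'a hecke)
    \<Rightarrow> ('a \<Rightarrow> complex) set \<Rightarrow> ('a hecke \<Rightarrow> ('a \<Rightarrow> complex) \<Rightarrow> 'a \<Rightarrow> complex)
    \<Rightarrow> ('a \<Rightarrow> complex) set \<Rightarrow> ('a hecke \<Rightarrow> ('a \<Rightarrow> complex) \<Rightarrow> 'a \<Rightarrow> complex)
    \<Rightarrow> (('a \<Rightarrow> complex) \<Rightarrow> 'a \<Rightarrow> complex) \<Rightarrow> bool" where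
  "hecke_module_iso R mul M \<rho> N \<sigma> T \<longleftrightarrow>
     hecke_module R mul M \<rho> \<and> hecke_module R mul N \<sigma> \<and> clinear_iso M N T \<and>
     (\<forall>h\<in>hecke_carrier R. \<forall>f\<in>M. T (\<rho> h f) = \<sigma> h (T f))"


section \<open>The representation \<open>\<pi>\<^sub>k\<close>\<close>

text \<open>Functions on the regular set are represented by their extensions by zero.\<close>

definition reg_restrict ::
    "'a::euclidean_space set \<Rightarrow> 'a set \<Rightarrow> 'a \<Rightarrow> ('a \<Rightarrow> complex) \<Rightarrow> 'a \<Rightarrow> complex" where
  "reg_restrict R B \<phi> f = (\<lambda>x. if x \<in> regular_set R B \<phi> then f x else 0)"

definition weyl_act :: "('a \<Rightarrow> 'a) \<Rightarrow> ('a \<Rightarrow> complex) \<Rightarrow> 'a \<Rightarrow> complex" where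
  "weyl_act w f = (\<lambda>x. f (inv w x))"

definition chi :: "'a::euclidean_space affine_functional \<Rightarrow> 'a \<Rightarrow> complex" where
  "chi a v = (if aeval a v < 0 then 1 else 0)"

text \<open>The sum over all positive affine roots has finitely many nonzero terms at each point; it
  is restricted to those because a \<^const>\<open>sum\<close> over an infinite set is zero.\<close>

definition dunkl_op :: "'a::euclidean_space set \<Rightarrow> 'a set \<Rightarrow> 'a \<Rightarrow> ('a affine_functional \<Rightarrow> real)
    \<Rightarrow> 'a \<Rightarrow> ('a \<Rightarrow> complex) \<Rightarrow> 'a \<Rightarrow> complex" where
  "dunkl_op R B \<phi> k v f = reg_restrict R B \<phi> (\<lambda>x. dir_deriv v f x +
     (\<Sum>a\<in>{a \<in> pos_affine_roots R B \<phi>. chi a x \<noteq> 0}.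
        complex_of_real (k a * (fst a \<bullet> v)) * chi a x * weyl_act (arefl a) f x))"

definition pi_rep :: "'a::euclidean_space set \<Rightarrow> 'a set \<Rightarrow> 'a \<Rightarrow> ('a affine_functional \<Rightarrow> real)
    \<Rightarrow> 'a hecke \<Rightarrow> ('a \<Rightarrow> complex) \<Rightarrow> 'a \<Rightarrow> complex" where
  "pi_rep R B \<phi> k h f = (\<lambda>x. \<Sum>w\<in>Poly_Mapping.keys h.
     sym_subst (dunkl_op R B \<phi> k) (Poly_Mapping.lookup h w) (weyl_act w f) x)"

definition BVP_pi :: "'a::euclidean_space set \<Rightarrow> 'a set \<Rightarrow> 'a \<Rightarrow> ('a affine_functional \<Rightarrow> real)
    \<Rightarrow> ('a \<Rightarrow> complex) \<Rightarrow> ('a \<Rightarrow> complex) set" where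
  "BVP_pi R B \<phi> k lam = reg_restrict R B \<phi> ` BVP R B \<phi> k lam"

definition BVP_pi_inv :: "'a::euclidean_space set \<Rightarrow> 'a set \<Rightarrow> 'a \<Rightarrow> ('a affine_functional \<Rightarrow> real)
    \<Rightarrow> ('a \<Rightarrow> complex) \<Rightarrow> ('a \<Rightarrow> complex) set" where
  "BVP_pi_inv R B \<phi> k lam =
     {g \<in> BVP_pi R B \<phi> k lam. \<forall>w\<in>affine_weyl_group R. weyl_act w g = g}"


section \<open>The representation \<open>Q\<^sub>k\<close>, the propagation operator and the map \<open>G\<close>\<close>

text \<open>The interval integral is signed, as needed for negative upper limits.\<close>

definition Q_gen :: "('a::euclidean_space affine_functional \<Rightarrow> real) \<Rightarrow> 'a affine_functional
    \<Rightarrow> ('a \<Rightarrow> complex) \<Rightarrow> 'a \<Rightarrow> complex" where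
  "Q_gen k a f = (\<lambda>v. f (arefl a v) + complex_of_real (k a) *
     (LBINT t=ereal 0..ereal (aeval a v). f (v - t *\<^sub>R coroot (fst a))))"

text \<open>The action of \<open>w\<close> is the composition of the operators \<^const>\<open>Q_gen\<close> along an expression of
  \<open>w\<close> in the simple reflections; on continuous functions it does not depend on the
  expression.\<close>

definition simple_word :: "'a::euclidean_space set \<Rightarrow> 'a \<Rightarrow> ('a \<Rightarrow> 'a) \<Rightarrow> 'a affine_functional list" where
  "simple_word B \<phi> w =
     (SOME as. set as \<subseteq> affine_basis B \<phi> \<and> foldr (\<circ>) (map arefl as) id = w)"

definition Q_weyl :: "'a::euclidean_space set \<Rightarrow> 'a \<Rightarrow> ('a affine_functional \<Rightarrow> real)
    \<Rightarrow> ('a \<Rightarrow> 'a) \<Rightarrow> ('a \<Rightarrow> complex) \<Rightarrow> 'a \<Rightarrow> complex" where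
  "Q_weyl B \<phi> k w f = foldr (Q_gen k) (simple_word B \<phi> w) f"

definition Q_rep :: "'a::euclidean_space set \<Rightarrow> 'a \<Rightarrow> ('a affine_functional \<Rightarrow> real)
    \<Rightarrow> 'a hecke \<Rightarrow> ('a \<Rightarrow> complex) \<Rightarrow> 'a \<Rightarrow> complex" where
  "Q_rep B \<phi> k h f = (\<lambda>x. \<Sum>w\<in>Poly_Mapping.keys h.
     sym_subst dir_deriv (Poly_Mapping.lookup h w) (Q_weyl B \<phi> k w f) x)"

definition E_Q_inv :: "'a::euclidean_space set \<Rightarrow> 'a set \<Rightarrow> 'a \<Rightarrow> ('a affine_functional \<Rightarrow> real)
    \<Rightarrow> ('a \<Rightarrow> complex) \<Rightarrow> ('a \<Rightarrow> complex) set" where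
  "E_Q_inv R B \<phi> k lam =
     {f \<in> E_space R lam. \<forall>w\<in>affine_weyl_group R. Q_weyl B \<phi> k w f = f}"

definition T_op :: "'a::euclidean_space set \<Rightarrow> 'a set \<Rightarrow> 'a \<Rightarrow> ('a affine_functional \<Rightarrow> real)
    \<Rightarrow> ('a \<Rightarrow> complex) \<Rightarrow> 'a \<Rightarrow> complex" where
  "T_op R B \<phi> k f x = (THE y. \<exists>w\<in>affine_weyl_group R. \<exists>v\<in>closure (fund_alcove B \<phi>).
     x = inv w v \<and> y = Q_weyl B \<phi> k w f v)"

definition G_op :: "'a::euclidean_space set \<Rightarrow> 'a set \<Rightarrow> 'a \<Rightarrow> ('a \<Rightarrow> complex) \<Rightarrow> 'a \<Rightarrow> complex" where
  "G_op R B \<phi> f x = (THE y. \<exists>w\<in>affine_weyl_group R. \<exists>v\<in>closure (fund_alcove B \<phi>).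
     x = inv w v \<and> y = f v)"

end

theory Submission
  imports Defs
begin

text \<open>
  The eigenvalue equations for the invariants turn into constant coefficient ordinary differential
  equations in every coordinate direction, because \<open>\<Prod>\<^sub>w (X - w v)\<close> has invariant coefficients.
  Hence the solutions on a box form a finite-dimensional space, are real analytic, extend to the whole
  space and are determined by all their derivatives at one point.  On \<open>E(\<lambda>)\<close> the operators \<open>Q\<close> of
  the simple affine reflections satisfy the relations of the affine Weyl group: at a point \<open>y\<close> on the
  wall of \<open>s\<close>, the pairing \<open>p(\<partial>)f(y)\<close> makes \<open>Q\<^sub>s\<close> the transpose of \<open>s\<close> acting on the \<open>H\<^sub>k\<close>-module \<open>S(V)\<close>
  induced from the trivial representation, which settles the relations between generators whose walls
  meet, and the general relation follows from these by Tits' argument.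

  On the alcove \<open>w\<^sup>-\<^sup>1 C\<^sub>+\<close> the function \<open>T f\<close> is \<open>(Q(w) f) \<circ> w\<close>.  The derivative of \<open>Q\<^sub>s g\<close> across the
  wall of \<open>s\<close> is that of \<open>g \<circ> s\<close> up to the term \<open>2 k g\<close>, so \<open>T f\<close> has the required jumps, and commuting
  \<open>\<partial>\<^sub>v\<close> past \<open>Q(w)\<close> produces exactly the sum over inversions in the Dunkl operator.  Conversely, a weak
  solution is a limit of mollified solutions on every small box, hence agrees on each alcove with an
  element of \<open>E(\<lambda>)\<close>.  The jump condition says that the elements for two adjacent alcoves have the
  Cauchy data on the common wall that \<open>Q\<^sub>s\<close> predicts, and the Laplacian, being invariant, makes
  solutions with vanishing Cauchy data vanish.
\<close>

text \<open>The integral in \<open>Q_gen\<close> is awkward to differentiate and to iterate. It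
  disappears once an antiderivative F of f in the direction of the coroot is chosen:
  \<open>Q_gen k a f\<close> is then f o s + k (F - F o s), with s the reflection in a, and
  smoothness, linearity and the commutation with invariant operators can be read off.
  \<open>Q_weyl\<close> picks some word for w, so it becomes usable only when Qw ws is known to
  depend on the product of the word alone. The relations behind this are not computed: they come
  from associativity in H_k, which is given only as an abstract multiplication \<open>mul\<close>.
  The transpose argument for them needs one point on all the walls involved. Two simple reflections
  with disjoint walls have no such point, but then no nonempty alternating word in them is a
  relation, because the barycentre of the points visited by such a relation would lie on both walls.
  The module axioms for pi_k on the boundary value problem are transported from E(lambda) along T,
  which turns Dunkl operators into directional derivatives.\<close>

section \<open>Directional derivatives and functions of class C^k\<close>

lemma dir_deriv_eq:
  assumes "(f has_derivative f') (at x)"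
  shows "dir_deriv v f x = f' v"
proof -
  have "((\<lambda>t. f (x + t *\<^sub>R v)) has_derivative (\<lambda>t. f' (t *\<^sub>R v))) (at 0)"
    by (rule has_derivative_compose[where f="\<lambda>t. x + t *\<^sub>R v" and g=f])
      (auto intro!: derivative_eq_intros simp: assms)
  then have "((\<lambda>t. f (x + t *\<^sub>R v)) has_vector_derivative f' v) (at 0)"
    unfolding has_vector_derivative_def
    using assms by (simp add: linear_scale[OF has_derivative_linear])
  then show ?thesis
    by (simp add: dir_deriv_def vector_derivative_at)
qed

lemma has_derivative_dir_deriv:
  assumes "f differentiable (at x)"
  shows "(f has_derivative (\<lambda>v. dir_deriv v f x)) (at x)"
proof -
  obtain f' where f': "(f has_derivative f') (at x)"
    using assms unfolding differentiable_def by blast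
  moreover have "(\<lambda>v. dir_deriv v f x) = f'"
    using dir_deriv_eq[OF f'] by auto
  ultimately show ?thesis by simp
qed

lemma has_vector_derivative_dir_deriv:
  assumes "f differentiable (at (x + t *\<^sub>R v))"
  shows "((\<lambda>t. f (x + t *\<^sub>R v)) has_vector_derivative dir_deriv v f (x + t *\<^sub>R v)) (at t)"
proof -
  have "((\<lambda>t. f (x + t *\<^sub>R v)) has_derivative (\<lambda>s. dir_deriv (s *\<^sub>R v) f (x + t *\<^sub>R v))) (at t)"
    by (rule has_derivative_compose[where f="\<lambda>t. x + t *\<^sub>R v" and g=f])
      (auto intro!: derivative_eq_intros has_derivative_dir_deriv assms)
  moreover have "dir_deriv (s *\<^sub>R v) f (x + t *\<^sub>R v) = s *\<^sub>R dir_deriv v f (x + t *\<^sub>R v)" for s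
    by (rule linear_scale[OF has_derivative_linear[OF has_derivative_dir_deriv[OF assms]]])
  ultimately show ?thesis unfolding has_vector_derivative_def by simp
qed

lemma dir_deriv_linear:
  assumes "f differentiable (at x)"
  shows "linear (\<lambda>v. dir_deriv v f x)"
  using has_derivative_dir_deriv[OF assms] has_derivative_linear by blast

lemma dir_deriv_cong_open:
  assumes "open U" "x \<in> U" "\<And>y. y \<in> U \<Longrightarrow> f y = g y"
  shows "dir_deriv v f x = dir_deriv v g x"
proof -
  have "((\<lambda>t. x + t *\<^sub>R v) \<longlongrightarrow> x + 0 *\<^sub>R v) (at 0)"
    by (intro tendsto_intros)
  then have "((\<lambda>t. x + t *\<^sub>R v) \<longlongrightarrow> x) (at 0)" by simp
  then have "eventually (\<lambda>t. x + t *\<^sub>R v \<in> U) (at 0)"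
    using assms(1,2) by (rule topological_tendstoD)
  then have "eventually (\<lambda>t. f (x + t *\<^sub>R v) = g (x + t *\<^sub>R v)) (nhds 0)"
    using assms unfolding eventually_at_filter
    by (auto elim!: eventually_mono)
  then show ?thesis
    unfolding dir_deriv_def using assms
    by (intro vector_derivative_cong_eq) (auto intro!: refl)
qed

lemma differentiable_cong_open:
  assumes "open U" "x \<in> U" "\<And>y. y \<in> U \<Longrightarrow> f y = g y"
  shows "f differentiable (at x) \<longleftrightarrow> g differentiable (at x)"
  unfolding differentiable_def
  using assms by (metis has_derivative_transform_within_open)

lemma Ck_on_cong:
  assumes "open U" "\<And>y. y \<in> U \<Longrightarrow> f y = g y"
  shows "Ck_on n U f \<longleftrightarrow> Ck_on n U g"
  using assms(2)
proof (induction n arbitrary: f g)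
  case 0
  then show ?case by (simp cong: continuous_on_cong)
next
  case (Suc n)
  have "Ck_on n U (dir_deriv v f) \<longleftrightarrow> Ck_on n U (dir_deriv v g)" for v
    by (rule Suc.IH) (rule dir_deriv_cong_open[OF assms(1)], auto simp: Suc.prems)
  moreover have "\<And>x. x \<in> U \<Longrightarrow> f differentiable (at x) \<longleftrightarrow> g differentiable (at x)"
    by (rule differentiable_cong_open[OF assms(1)]) (auto simp: Suc.prems)
  ultimately show ?case by auto
qed

lemma Ck_on_Suc_imp: "Ck_on (Suc n) U f \<Longrightarrow> Ck_on n U f"
proof (induction n arbitrary: f)
  case 0
  then show ?case
    by (auto intro!: continuous_at_imp_continuous_on differentiable_imp_continuous_within)
next
  case (Suc n)
  then show ?case by (metis Ck_on.simps(2))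
qed

lemma Ck_on_subset: "Ck_on n U f \<Longrightarrow> V \<subseteq> U \<Longrightarrow> Ck_on n V f"
proof (induction n arbitrary: f)
  case 0
  then show ?case by (simp add: continuous_on_subset)
next
  case (Suc n)
  then show ?case by (simp add: subset_eq)
qed

lemma dir_deriv_add:
  assumes "f differentiable (at x)" "g differentiable (at x)"
  shows "dir_deriv v (\<lambda>x. f x + g x) x = dir_deriv v f x + dir_deriv v g x"
  by (rule dir_deriv_eq)
    (intro derivative_intros has_derivative_dir_deriv assms)

lemma dir_deriv_mult:
  assumes "f differentiable (at x)" "g differentiable (at x)"
  shows "dir_deriv v (\<lambda>x. f x * g x) x = f x * dir_deriv v g x + dir_deriv v f x * g x"
  by (rule dir_deriv_eq)
    (intro derivative_intros has_derivative_dir_deriv assms)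

lemma dir_deriv_cmult:
  assumes "f differentiable (at x)"
  shows "dir_deriv v (\<lambda>x. c * f x) x = c * dir_deriv v f x"
  by (rule dir_deriv_eq)
    (intro derivative_intros has_derivative_dir_deriv assms)

lemma dir_deriv_const [simp]: "dir_deriv v (\<lambda>x. c) = (\<lambda>x. 0)"
  by (rule ext, rule dir_deriv_eq) (rule derivative_intros)

lemma dir_deriv_affine:
  assumes "bounded_linear L" "f differentiable (at (L x + c))"
  shows "dir_deriv v (\<lambda>x. f (L x + c)) x = dir_deriv (L v) f (L x + c)"
proof (rule dir_deriv_eq)
  have "((\<lambda>x. L x + c) has_derivative L) (at x)"
    using bounded_linear_imp_has_derivative[OF assms(1)] by (auto intro!: derivative_eq_intros)
  from has_derivative_compose[OF this has_derivative_dir_deriv[OF assms(2)]]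
  show "((\<lambda>x. f (L x + c)) has_derivative (\<lambda>v. dir_deriv (L v) f (L x + c))) (at x)" .
qed

lemma differentiable_affine:
  fixes f :: "'b::euclidean_space \<Rightarrow> complex"
  assumes "bounded_linear L" "f differentiable (at (L x + c))"
  shows "(\<lambda>x. f (L x + c)) differentiable (at x)"
proof -
  have "((\<lambda>x. L x + c) has_derivative L) (at x)"
    using bounded_linear_imp_has_derivative[OF assms(1)] by (auto intro!: derivative_eq_intros)
  from has_derivative_compose[OF this has_derivative_dir_deriv[OF assms(2)]]
  show ?thesis unfolding differentiable_def by blast
qed

lemma Ck_on_const [simp]: "Ck_on n U (\<lambda>x. c)"
  by (induction n arbitrary: c) auto

lemma Ck_on_add:
  assumes "open U"
  shows "Ck_on n U f \<Longrightarrow> Ck_on n U g \<Longrightarrow> Ck_on n U (\<lambda>x. f x + g x)"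
proof (induction n arbitrary: f g)
  case 0
  then show ?case by (auto intro: continuous_intros)
next
  case (Suc n)
  have "Ck_on n U (dir_deriv v (\<lambda>x. f x + g x)) \<longleftrightarrow>
        Ck_on n U (\<lambda>x. dir_deriv v f x + dir_deriv v g x)" for v
    using Suc.prems by (intro Ck_on_cong[OF assms] dir_deriv_add) auto
  with Suc show ?case by auto
qed

lemma Ck_on_mult:
  assumes "open U"
  shows "Ck_on n U f \<Longrightarrow> Ck_on n U g \<Longrightarrow> Ck_on n U (\<lambda>x. f x * g x)"
proof (induction n arbitrary: f g)
  case 0
  then show ?case by (auto intro: continuous_intros)
next
  case (Suc n)
  have eq: "Ck_on n U (dir_deriv v (\<lambda>x. f x * g x)) \<longleftrightarrow>
        Ck_on n U (\<lambda>x. f x * dir_deriv v g x + dir_deriv v f x * g x)" for v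
    using Suc.prems by (intro Ck_on_cong[OF assms] dir_deriv_mult) auto
  have "Ck_on n U f" "Ck_on n U g" using Suc.prems Ck_on_Suc_imp by blast+
  with Suc show ?case unfolding Ck_on.simps eq
    by (auto intro!: Ck_on_add[OF assms] Suc.IH)
qed

lemma Ck_on_affine:
  assumes "open U" "bounded_linear L"
  shows "Ck_on n U f \<Longrightarrow> Ck_on n ((\<lambda>x. L x + c) -` U) (\<lambda>x. f (L x + c))"
proof (induction n arbitrary: f)
  case 0
  then show ?case
    using assms(2) by (auto intro!: continuous_on_compose2[where g=f and t=U] continuous_intros
        bounded_linear.continuous_on[OF assms(2)])
next
  case (Suc n)
  have op: "open ((\<lambda>x. L x + c) -` U)"
    by (intro open_vimage assms(1) continuous_intros bounded_linear.continuous_on[OF assms(2)])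
  have eq: "Ck_on n ((\<lambda>x. L x + c) -` U) (dir_deriv v (\<lambda>x. f (L x + c))) \<longleftrightarrow>
        Ck_on n ((\<lambda>x. L x + c) -` U) (\<lambda>x. dir_deriv (L v) f (L x + c))" for v
    using Suc.prems by (intro Ck_on_cong[OF op] dir_deriv_affine assms) auto
  from Suc show ?case unfolding Ck_on.simps eq
    by (auto intro!: differentiable_affine assms)
qed

lemma smooth_onD:
  assumes "smooth_on U f"
  shows "x \<in> U \<Longrightarrow> f differentiable (at x)" "smooth_on U (dir_deriv v f)" "continuous_on U f"
    "Ck_on n U f"
  using assms unfolding smooth_on_def by (metis Ck_on.simps)+

lemma smooth_on_iff:
  "smooth_on U f \<longleftrightarrow> (\<forall>x\<in>U. f differentiable (at x)) \<and> (\<forall>v. smooth_on U (dir_deriv v f))"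
  by (metis Ck_on.simps(2) Ck_on_Suc_imp smooth_onD(1,2) smooth_on_def)

lemma smooth_on_const [simp]: "smooth_on U (\<lambda>x. c)"
  by (simp add: smooth_on_def)

lemma smooth_on_add: "open U \<Longrightarrow> smooth_on U f \<Longrightarrow> smooth_on U g \<Longrightarrow> smooth_on U (\<lambda>x. f x + g x)"
  by (simp add: smooth_on_def Ck_on_add)

lemma smooth_on_mult: "open U \<Longrightarrow> smooth_on U f \<Longrightarrow> smooth_on U g \<Longrightarrow> smooth_on U (\<lambda>x. f x * g x)"
  by (simp add: smooth_on_def Ck_on_mult)

lemma smooth_on_cmult: "open U \<Longrightarrow> smooth_on U f \<Longrightarrow> smooth_on U (\<lambda>x. c * f x)"
  by (simp add: smooth_on_mult)

lemma smooth_on_uminus: "open U \<Longrightarrow> smooth_on U f \<Longrightarrow> smooth_on U (\<lambda>x. - f x)"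
  using smooth_on_cmult[of U f "-1"] by simp

lemma smooth_on_diff: "open U \<Longrightarrow> smooth_on U f \<Longrightarrow> smooth_on U g \<Longrightarrow> smooth_on U (\<lambda>x. f x - g x)"
  using smooth_on_add[of U f "\<lambda>x. - g x"] smooth_on_uminus by auto

lemma smooth_on_sum:
  "open U \<Longrightarrow> (\<And>i. i \<in> I \<Longrightarrow> smooth_on U (f i)) \<Longrightarrow> smooth_on U (\<lambda>x. \<Sum>i\<in>I. f i x)"
  by (induction I rule: infinite_finite_induct) (auto intro: smooth_on_add)

lemma smooth_on_prod:
  "open U \<Longrightarrow> (\<And>i. i \<in> I \<Longrightarrow> smooth_on U (f i)) \<Longrightarrow> smooth_on U (\<lambda>x. \<Prod>i\<in>I. f i x)"
  by (induction I rule: infinite_finite_induct) (auto intro: smooth_on_mult)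

lemma smooth_on_cong:
  "open U \<Longrightarrow> (\<And>y. y \<in> U \<Longrightarrow> f y = g y) \<Longrightarrow> smooth_on U f \<longleftrightarrow> smooth_on U g"
  unfolding smooth_on_def using Ck_on_cong by blast

lemma smooth_on_subset: "smooth_on U f \<Longrightarrow> V \<subseteq> U \<Longrightarrow> smooth_on V f"
  unfolding smooth_on_def using Ck_on_subset by blast

lemma smooth_on_affine:
  assumes "open U" "bounded_linear L" "smooth_on U f" "\<And>x. x \<in> V \<Longrightarrow> L x + c \<in> U"
  shows "smooth_on V (\<lambda>x. f (L x + c))"
proof -
  have "V \<subseteq> (\<lambda>x. L x + c) -` U" using assms(4) by auto
  then show ?thesis
    using assms(3) Ck_on_affine[OF assms(1,2)] Ck_on_subset unfolding smooth_on_def by blast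
qed

lemma smooth_on_linear:
  assumes "bounded_linear L" shows "smooth_on U L"
proof -
  have d: "(L has_derivative L) (at x)" for x
    by (rule bounded_linear_imp_has_derivative[OF assms])
  then have "dir_deriv v L = (\<lambda>x. L v)" for v using dir_deriv_eq by blast
  then show ?thesis using d by (subst smooth_on_iff) (auto simp: differentiable_def)
qed

lemma dir_deriv_expand:
  assumes "f differentiable (at x)"
  shows "dir_deriv v f x = (\<Sum>b\<in>Basis. complex_of_real (v \<bullet> b) * dir_deriv b f x)"
proof -
  interpret linear "\<lambda>v. dir_deriv v f x" by (rule dir_deriv_linear[OF assms])
  have "dir_deriv (\<Sum>b\<in>Basis. (v \<bullet> b) *\<^sub>R b) f x = (\<Sum>b\<in>Basis. (v \<bullet> b) *\<^sub>R dir_deriv b f x)"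
    by (simp add: sum scale)
  then show ?thesis by (simp add: euclidean_representation scaleR_conv_of_real)
qed

text \<open>Schwarz: both mixed derivatives are limits of the same second difference quotient.\<close>

lemma dir_deriv_commute_real:
  fixes f fu fv fuv fvu :: "real \<Rightarrow> real \<Rightarrow> real"
  assumes r: "r > 0"
    and fu: "\<And>s t. \<bar>s\<bar> < r \<Longrightarrow> \<bar>t\<bar> < r \<Longrightarrow> ((\<lambda>s. f s t) has_real_derivative fu s t) (at s)"
    and fv: "\<And>s t. \<bar>s\<bar> < r \<Longrightarrow> \<bar>t\<bar> < r \<Longrightarrow> ((\<lambda>t. f s t) has_real_derivative fv s t) (at t)"
    and fuv: "\<And>s t. \<bar>s\<bar> < r \<Longrightarrow> \<bar>t\<bar> < r \<Longrightarrow> ((\<lambda>t. fu s t) has_real_derivative fuv s t) (at t)"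
    and fvu: "\<And>s t. \<bar>s\<bar> < r \<Longrightarrow> \<bar>t\<bar> < r \<Longrightarrow> ((\<lambda>s. fv s t) has_real_derivative fvu s t) (at s)"
    and c1: "isCont (\<lambda>(s,t). fuv s t) (0,0)" and c2: "isCont (\<lambda>(s,t). fvu s t) (0,0)"
  shows "fuv 0 0 = fvu 0 0"
proof (rule ccontr)
  assume "fuv 0 0 \<noteq> fvu 0 0"
  define e where "e = \<bar>fuv 0 0 - fvu 0 0\<bar> / 2"
  have e: "e > 0" using \<open>fuv 0 0 \<noteq> fvu 0 0\<close> by (simp add: e_def)
  obtain d1 where d1: "d1 > 0" "\<And>p. dist p (0,0) < d1 \<Longrightarrow> dist (case p of (s,t) \<Rightarrow> fuv s t) (fuv 0 0) < e"
    using c1 e unfolding continuous_at_eps_delta by fastforce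
  obtain d2 where d2: "d2 > 0" "\<And>p. dist p (0,0) < d2 \<Longrightarrow> dist (case p of (s,t) \<Rightarrow> fvu s t) (fvu 0 0) < e"
    using c2 e unfolding continuous_at_eps_delta by fastforce
  \<comment> \<open>The factor 3 gives 2 h < d1 and 2 h < d2, and a point (s,t) of the open square
    has distance at most s + t < 2 h from the origin.\<close>
  define h where "h = min r (min d1 d2) / 3"
  have h: "h > 0" "h < r" "2 * h < d1" "2 * h < d2" using r d1 d2 by (auto simp: h_def min_def)
  have small: "dist (s,t) (0,0) < d1 \<and> dist (s,t) (0,0) < d2" if "0 < s" "s < h" "0 < t" "t < h" for s t :: real
  proof -
    have "dist (s,t) (0,0) \<le> \<bar>s\<bar> + \<bar>t\<bar>"
      by (simp add: dist_prod_def sqrt_sum_squares_le_sum_abs)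
    then show ?thesis using h that by auto
  qed
  define D where "D = f h h - f h 0 - f 0 h + f 0 0"
  have "\<exists>s t. 0 < s \<and> s < h \<and> 0 < t \<and> t < h \<and> D = h * h * fuv s t"
  proof -
    have "\<exists>z>0. z < h \<and> (f h h - f h 0) - (f 0 h - f 0 0) = (h - 0) * (fu z h - fu z 0)"
      by (rule MVT2[where f="\<lambda>s. f s h - f s 0"]) (use h in \<open>auto intro!: derivative_eq_intros fu\<close>)
    then obtain z where z: "0 < z" "z < h" "D = h * (fu z h - fu z 0)" by (auto simp: D_def)
    have "\<exists>y>0. y < h \<and> fu z h - fu z 0 = (h - 0) * fuv z y"
      by (rule MVT2) (use h z in \<open>auto intro!: fuv\<close>)
    then show ?thesis using z by auto
  qed
  then obtain s t where st: "0 < s" "s < h" "0 < t" "t < h" "D = h * h * fuv s t" by blast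
  have "\<exists>s t. 0 < s \<and> s < h \<and> 0 < t \<and> t < h \<and> D = h * h * fvu s t"
  proof -
    have "\<exists>z>0. z < h \<and> (f h h - f 0 h) - (f h 0 - f 0 0) = (h - 0) * (fv h z - fv 0 z)"
      by (rule MVT2[where f="\<lambda>t. f h t - f 0 t"]) (use h in \<open>auto intro!: derivative_eq_intros fv\<close>)
    then obtain z where z: "0 < z" "z < h" "D = h * (fv h z - fv 0 z)" by (auto simp: D_def)
    have "\<exists>y>0. y < h \<and> fv h z - fv 0 z = (h - 0) * fvu y z"
      by (rule MVT2[where f="\<lambda>s. fv s z"]) (use h z in \<open>auto intro!: fvu\<close>)
    then show ?thesis using z by auto
  qed
  then obtain s' t' where st': "0 < s'" "s' < h" "0 < t'" "t' < h" "D = h * h * fvu s' t'" by blast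
  have "fuv s t = fvu s' t'" using st st' h by simp
  moreover have "\<bar>fuv s t - fuv 0 0\<bar> < e" using d1(2)[of "(s,t)"] small[OF st(1-4)] by (simp add: dist_real_def)
  moreover have "\<bar>fvu s' t' - fvu 0 0\<bar> < e" using d2(2)[of "(s',t')"] small[OF st'(1-4)] by (simp add: dist_real_def)
  ultimately show False unfolding e_def by (simp add: abs_if split: if_splits)
qed

lemma dir_deriv_commute:
  assumes "open U" "Ck_on 2 U f" "x \<in> U"
  shows "dir_deriv u (dir_deriv v f) x = dir_deriv v (dir_deriv u f) x"
proof -
  define P where "P s t = x + s *\<^sub>R u + t *\<^sub>R v" for s t
  have C: "\<And>y. y \<in> U \<Longrightarrow> f differentiable (at y)"
     "\<And>w y. y \<in> U \<Longrightarrow> dir_deriv w f differentiable (at y)"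
     "\<And>w z. continuous_on U (dir_deriv w (dir_deriv z f))"
    using assms(2) by (auto simp: numeral_2_eq_2)
  obtain e where e: "e > 0" "ball x e \<subseteq> U" using assms(1,3) openE by blast
  \<comment> \<open>With this r the parallelogram of all x + s u + t v with |s|, |t| < r stays in
    the ball of radius e; the summand 1 covers u = v = 0.\<close>
  define r where "r = e / (1 + norm u + norm v)"
  have pos: "1 + norm u + norm v > 0" by (simp add: add_pos_nonneg)
  have r: "r > 0" using e pos by (simp add: r_def)
  have PU: "P s t \<in> U" if "\<bar>s\<bar> < r" "\<bar>t\<bar> < r" for s t
  proof -
    have "norm (s *\<^sub>R u + t *\<^sub>R v) \<le> \<bar>s\<bar> * norm u + \<bar>t\<bar> * norm v"
      by (metis norm_scaleR norm_triangle_ineq)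
    also have "\<dots> \<le> r * norm u + r * norm v"
      using that by (intro add_mono mult_right_mono) auto
    also have "\<dots> < r * (1 + norm u + norm v)" using r by (simp add: algebra_simps)
    also have "\<dots> = e" using pos by (simp add: r_def)
    finally have "P s t \<in> ball x e"
      by (metis P_def add.assoc dist_norm mem_ball norm_minus_commute add_diff_cancel_left')
    then show ?thesis using e by blast
  qed
  \<comment> \<open>The mean value theorem is about real functions, so the claim is proved after
    composition with a real-linear functional and then used for Re and Im.\<close>
  have part: "\<phi> (dir_deriv u (dir_deriv v f) x) = \<phi> (dir_deriv v (dir_deriv u f) x)"
    if phi: "bounded_linear \<phi>" for \<phi> :: "complex \<Rightarrow> real"
  proof -
    have du: "((\<lambda>s. \<phi> (g (P s t))) has_real_derivative \<phi> (dir_deriv u g (P s t))) (at s)"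
      if "g differentiable (at (P s t))" for g s t
    proof -
      have "P s t = (x + t *\<^sub>R v) + s *\<^sub>R u" for s by (simp add: P_def algebra_simps)
      then show ?thesis
        using bounded_linear.has_vector_derivative[OF phi has_vector_derivative_dir_deriv[of g "x + t *\<^sub>R v" s u]] that
        by (simp add: has_real_derivative_iff_has_vector_derivative)
    qed
    have dv: "((\<lambda>t. \<phi> (g (P s t))) has_real_derivative \<phi> (dir_deriv v g (P s t))) (at t)"
      if "g differentiable (at (P s t))" for g s t
      using bounded_linear.has_vector_derivative[OF phi has_vector_derivative_dir_deriv[of g "x + s *\<^sub>R u" t v]] that
      by (simp add: has_real_derivative_iff_has_vector_derivative P_def)
    have cont: "isCont (\<lambda>(s,t). \<phi> (g (P s t))) (0,0)" if "continuous_on U g" for g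
    proof -
      have "isCont g (P 0 0)"
        using that PU[of 0 0] r assms(1) by (simp add: continuous_on_eq_continuous_at)
      moreover have "isCont (\<lambda>p. P (fst p) (snd p)) (0,0)"
      proof -
        have "continuous_on UNIV (\<lambda>p::real\<times>real. P (fst p) (snd p))"
          unfolding P_def by (intro continuous_intros)
        then show ?thesis by (simp add: continuous_on_eq_continuous_at)
      qed
      ultimately have "isCont (\<lambda>p. g (P (fst p) (snd p))) (0,0)"
        by (simp add: isCont_o2[of "(0,0)" "\<lambda>p. P (fst p) (snd p)" g])
      then have "isCont (\<lambda>p. \<phi> (g (P (fst p) (snd p)))) (0,0)"
        by (rule bounded_linear.isCont[OF phi])
      then show ?thesis by (simp add: case_prod_unfold)
    qed
    have "\<phi> (dir_deriv v (dir_deriv u f) (P 0 0)) = \<phi> (dir_deriv u (dir_deriv v f) (P 0 0))"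
      by (rule dir_deriv_commute_real[OF r, where f="\<lambda>s t. \<phi> (f (P s t))" and fu="\<lambda>s t. \<phi> (dir_deriv u f (P s t))"
            and fv="\<lambda>s t. \<phi> (dir_deriv v f (P s t))"
            and fuv="\<lambda>s t. \<phi> (dir_deriv v (dir_deriv u f) (P s t))" and fvu="\<lambda>s t. \<phi> (dir_deriv u (dir_deriv v f) (P s t))"])
        (auto intro!: du dv cont C PU)
    then show ?thesis by (simp add: P_def)
  qed
  show ?thesis
    using part[OF bounded_linear_Re] part[OF bounded_linear_Im] by (simp add: complex_eq_iff)
qed

section \<open>Polynomials as finite sums over their support\<close>

lemma poly_mapping_eq_sum: "p = (\<Sum>m\<in>Poly_Mapping.keys p. Poly_Mapping.single m (Poly_Mapping.lookup p m))"
  by (rule poly_mapping_eqI) (auto simp: lookup_sum lookup_single when_def not_in_keys_iff_lookup_eq_zero)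

lemma basis_list: "distinct (basis_list :: 'a::euclidean_space list)" "set (basis_list :: 'a list) = Basis"
proof -
  have "\<exists>xs :: 'a list. distinct xs \<and> set xs = Basis"
    using finite_distinct_list[OF finite_Basis] by blast
  from someI_ex[OF this] show "distinct (basis_list :: 'a list)" "set (basis_list :: 'a list) = Basis"
    unfolding basis_list_def by auto
qed

lemma sum_keys_superset:
  fixes h :: "'k \<Rightarrow> complex"
  assumes "finite A" "Poly_Mapping.keys p \<subseteq> A"
  shows "(\<Sum>m\<in>Poly_Mapping.keys p. Poly_Mapping.lookup p m * h m) = (\<Sum>m\<in>A. Poly_Mapping.lookup p m * h m)"
  by (rule sum.mono_neutral_left) (use assms in \<open>auto simp: in_keys_iff\<close>)

lemma sum_keys_add:
  fixes h :: "'k \<Rightarrow> complex"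
  shows "(\<Sum>m\<in>Poly_Mapping.keys (p + q). Poly_Mapping.lookup (p + q) m * h m) =
    (\<Sum>m\<in>Poly_Mapping.keys p. Poly_Mapping.lookup p m * h m) + (\<Sum>m\<in>Poly_Mapping.keys q. Poly_Mapping.lookup q m * h m)"
proof -
  let ?A = "Poly_Mapping.keys p \<union> Poly_Mapping.keys q"
  have "Poly_Mapping.keys (p + q) \<subseteq> ?A" by (rule keys_add)
  then show ?thesis
    by (subst (1 2 3) sum_keys_superset[of ?A]) (simp_all add: lookup_add distrib_right sum.distrib)
qed

section \<open>Commuting families of operators\<close>

text \<open>Three families are instances: directional derivatives on functions smooth on an open set
  and zero elsewhere, negated directional derivatives on test functions, and directional derivatives
  on the zero function alone.\<close>

locale comm_ops =
  fixes M :: "('a::euclidean_space \<Rightarrow> complex) set" and T :: "'a \<Rightarrow> ('a \<Rightarrow> complex) \<Rightarrow> 'a \<Rightarrow> complex"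
  assumes csub: "csubspace_fun M"
    and T_closed: "\<And>b f. b \<in> Basis \<Longrightarrow> f \<in> M \<Longrightarrow> T b f \<in> M"
    and T_linear: "\<And>b. b \<in> Basis \<Longrightarrow> clinear_fun_on M (T b)"
    and T_commute: "\<And>b c f. b \<in> Basis \<Longrightarrow> c \<in> Basis \<Longrightarrow> f \<in> M \<Longrightarrow> T b (T c f) = T c (T b f)"
begin

lemma M_add: "f \<in> M \<Longrightarrow> g \<in> M \<Longrightarrow> (\<lambda>x. f x + g x) \<in> M"
  and M_zero: "(\<lambda>x. 0) \<in> M" and M_scale: "f \<in> M \<Longrightarrow> (\<lambda>x. c * f x) \<in> M"
  using csub unfolding csubspace_fun_def by auto

lemma M_sum: "(\<And>i. i \<in> I \<Longrightarrow> f i \<in> M) \<Longrightarrow> (\<lambda>x. \<Sum>i\<in>I. f i x) \<in> M"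
  by (induction I rule: infinite_finite_induct) (auto intro: M_zero M_add)

definition commuting :: "(('a \<Rightarrow> complex) \<Rightarrow> 'a \<Rightarrow> complex) \<Rightarrow> bool" where
  "commuting A \<longleftrightarrow> (\<forall>f\<in>M. A f \<in> M) \<and> clinear_fun_on M A \<and> (\<forall>b\<in>Basis. \<forall>f\<in>M. A (T b f) = T b (A f))"

lemma commuting_T: "b \<in> Basis \<Longrightarrow> commuting (T b)"
  unfolding commuting_def using T_closed T_linear T_commute by blast

lemma commuting_id: "commuting (\<lambda>f. f)"
  unfolding commuting_def clinear_fun_on_def by auto

lemma commuting_comp: "commuting A \<Longrightarrow> commuting C \<Longrightarrow> commuting (\<lambda>f. A (C f))"
  unfolding commuting_def clinear_fun_on_def by (auto simp: T_closed)

lemma commuting_funpow: "b \<in> Basis \<Longrightarrow> commuting (\<lambda>f. (T b ^^ n) f)"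
proof (induction n)
  case (Suc n)
  then show ?case using commuting_comp[OF commuting_T[of b] Suc.IH] by simp
qed (use commuting_id in \<open>simp add: id_def\<close>)

lemma commuting_funpow_commute: "commuting A \<Longrightarrow> b \<in> Basis \<Longrightarrow> f \<in> M \<Longrightarrow> (T b ^^ n) (A f) = A ((T b ^^ n) f)"
proof (induction n)
  case (Suc n)
  have "(T b ^^ n) f \<in> M" using commuting_funpow[OF Suc.prems(2), of n] Suc.prems(3) unfolding commuting_def by auto
  then show ?case using Suc unfolding commuting_def by simp
qed simp

text \<open>An arbitrary list stands in place of \<open>basis_list\<close>, so that statements can
  be proved by induction on the list.\<close>

definition monl :: "'a list \<Rightarrow> ('a \<Rightarrow>\<^sub>0 nat) \<Rightarrow> ('a \<Rightarrow> complex) \<Rightarrow> 'a \<Rightarrow> complex" where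
  "monl xs m f = foldr (\<lambda>b g. (T b ^^ Poly_Mapping.lookup m b) g) xs f"

abbreviation "mon m f \<equiv> monl basis_list m f"

lemma monl_simps [simp]: "monl [] m f = f"
  "monl (b # xs) m f = (T b ^^ Poly_Mapping.lookup m b) (monl xs m f)"
  by (simp_all add: monl_def)

lemma commuting_monl: "set xs \<subseteq> Basis \<Longrightarrow> commuting (monl xs m)"
proof (induction xs)
  case Nil
  then show ?case using commuting_id by (simp add: commuting_def clinear_fun_on_def)
next
  case (Cons b xs)
  then show ?case using commuting_comp[OF commuting_funpow[of b] Cons.IH] by (simp add: commuting_def clinear_fun_on_def)
qed

lemma monl_add: "set xs \<subseteq> Basis \<Longrightarrow> f \<in> M \<Longrightarrow> monl xs (m + m') f = monl xs m (monl xs m' f)"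
proof (induction xs)
  case (Cons b xs)
  have M': "monl xs m' f \<in> M" using commuting_monl[of xs m'] Cons.prems unfolding commuting_def by auto
  show ?case
    using Cons commuting_funpow_commute[OF commuting_monl[of xs m], of b "monl xs m' f" "Poly_Mapping.lookup m' b"] M'
    by (simp add: lookup_add funpow_add)
qed simp

lemma commuting_mon: "commuting (mon m)" by (rule commuting_monl) (simp add: basis_list)

lemma mon_closed: "f \<in> M \<Longrightarrow> mon m f \<in> M" using commuting_mon unfolding commuting_def by blast

lemma mon_add: "f \<in> M \<Longrightarrow> mon (m + m') f = mon m (mon m' f)"
  by (rule monl_add) (simp_all add: basis_list)

lemma mon_lin: "f \<in> M \<Longrightarrow> g \<in> M \<Longrightarrow> mon m (\<lambda>x. f x + g x) = (\<lambda>x. mon m f x + mon m g x)"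
  "f \<in> M \<Longrightarrow> mon m (\<lambda>x. c * f x) = (\<lambda>x. c * mon m f x)"
  using commuting_mon[of m] unfolding commuting_def clinear_fun_on_def by auto

lemma mon_zero: "mon 0 f = f"
proof -
  have "monl xs 0 f = f" for xs by (induction xs) auto
  then show ?thesis .
qed

lemma mon_single:
  assumes "b \<in> Basis" shows "mon (Poly_Mapping.single b n) f = (T b ^^ n) f"
proof -
  have "distinct xs \<Longrightarrow> monl xs (Poly_Mapping.single b n) f = (if b \<in> set xs then (T b ^^ n) f else f)" for xs
    by (induction xs) (auto simp: lookup_single when_def)
  then show ?thesis using assms by (simp add: basis_list)
qed

lemma subst_mon: "sym_subst T p f = (\<lambda>x. \<Sum>m\<in>Poly_Mapping.keys p. Poly_Mapping.lookup p m * mon m f x)"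
  by (simp add: sym_subst_def monl_def)

lemma subst_add: "sym_subst T (p + q) f = (\<lambda>x. sym_subst T p f x + sym_subst T q f x)"
  unfolding subst_mon sum_keys_add ..

lemma subst_zero: "sym_subst T 0 f = (\<lambda>x. 0)"
  by (simp add: subst_mon)

lemma subst_sum: "sym_subst T (\<Sum>i\<in>I. p i) f = (\<lambda>x. \<Sum>i\<in>I. sym_subst T (p i) f x)"
  by (induction I rule: infinite_finite_induct) (auto simp: subst_zero subst_add)

lemma subst_single: "sym_subst T (Poly_Mapping.single m c) f = (\<lambda>x. c * mon m f x)"
  by (simp add: subst_mon)

lemma subst_closed: "f \<in> M \<Longrightarrow> sym_subst T p f \<in> M"
  unfolding subst_mon by (intro M_sum M_scale mon_closed)

lemma subst_fun_add: "f \<in> M \<Longrightarrow> g \<in> M \<Longrightarrow> sym_subst T p (\<lambda>x. f x + g x) = (\<lambda>x. sym_subst T p f x + sym_subst T p g x)"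
  unfolding subst_mon by (simp add: mon_lin distrib_left sum.distrib)

lemma subst_fun_scale: "f \<in> M \<Longrightarrow> sym_subst T p (\<lambda>x. c * f x) = (\<lambda>x. c * sym_subst T p f x)"
  unfolding subst_mon by (simp add: mon_lin sum_distrib_left mult_ac)

lemma mon_fun_sum: "(\<And>i. i \<in> I \<Longrightarrow> f i \<in> M) \<Longrightarrow> mon m (\<lambda>x. \<Sum>i\<in>I. f i x) = (\<lambda>x. \<Sum>i\<in>I. mon m (f i) x)"
proof (induction I rule: infinite_finite_induct)
  case (insert a I)
  then show ?case by (simp add: mon_lin M_sum)
qed (use mon_lin(2)[OF M_zero, of m 0] in auto)

text \<open>Exponents of monomials add under multiplication, and \<open>mon_add\<close> turns this
  into composition; the commutativity of the operators enters there.\<close>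

lemma subst_mult:
  assumes "f \<in> M" shows "sym_subst T (p * q) f = sym_subst T p (sym_subst T q f)"
proof -
  have "p * q = (\<Sum>m\<in>Poly_Mapping.keys p. Poly_Mapping.single m (Poly_Mapping.lookup p m)) *
      (\<Sum>n\<in>Poly_Mapping.keys q. Poly_Mapping.single n (Poly_Mapping.lookup q n))"
    using poly_mapping_eq_sum[of p] poly_mapping_eq_sum[of q] by simp
  also have "\<dots> = (\<Sum>m\<in>Poly_Mapping.keys p. \<Sum>n\<in>Poly_Mapping.keys q.
      Poly_Mapping.single (m + n) (Poly_Mapping.lookup p m * Poly_Mapping.lookup q n))"
    by (simp add: sum_product mult_single)
  finally have "sym_subst T (p * q) f = (\<lambda>x. \<Sum>m\<in>Poly_Mapping.keys p. \<Sum>n\<in>Poly_Mapping.keys q.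
      Poly_Mapping.lookup p m * Poly_Mapping.lookup q n * mon m (mon n f) x)"
    by (simp add: subst_sum subst_single mon_add assms)
  also have "\<dots> = sym_subst T p (sym_subst T q f)"
    unfolding subst_mon
    by (simp add: mon_fun_sum mon_lin M_scale mon_closed assms sum_distrib_left mult.assoc)
  finally show ?thesis .
qed

lemma subst_const: "sym_subst T (sym_const c) f = (\<lambda>x. c * f x)"
  by (simp add: sym_const_def subst_single mon_zero)

lemma subst_one: "sym_subst T 1 f = f"
  using subst_const[of 1 f] by (simp add: sym_const_def)

lemma subst_vec: "sym_subst T (sym_vec v) f = (\<lambda>x. \<Sum>b\<in>Basis. complex_of_real (v \<bullet> b) * T b f x)"
  by (simp add: sym_vec_def subst_sum subst_single mon_single)

end

section \<open>The symmetric algebra\<close>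

lemma sym_eval_add: "sym_eval lam (p + q) = sym_eval lam p + sym_eval lam q"
  by (simp add: sym_eval_def sum_keys_add)

lemma sym_eval_zero [simp]: "sym_eval lam 0 = 0" by (simp add: sym_eval_def)

lemma sym_eval_sum: "sym_eval lam (\<Sum>i\<in>I. p i) = (\<Sum>i\<in>I. sym_eval lam (p i))"
  by (induction I rule: infinite_finite_induct) (auto simp: sym_eval_add)

lemma sym_eval_single: "sym_eval lam (Poly_Mapping.single m c) = c * (\<Prod>b\<in>Basis. lam b ^ Poly_Mapping.lookup m b)"
  by (simp add: sym_eval_def)

lemma sym_eval_mult: "sym_eval lam (p * q) = sym_eval lam p * sym_eval lam q"
proof -
  have "p * q = (\<Sum>m\<in>Poly_Mapping.keys p. Poly_Mapping.single m (Poly_Mapping.lookup p m)) *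
      (\<Sum>n\<in>Poly_Mapping.keys q. Poly_Mapping.single n (Poly_Mapping.lookup q n))"
    using poly_mapping_eq_sum[of p] poly_mapping_eq_sum[of q] by simp
  then have "p * q = (\<Sum>m\<in>Poly_Mapping.keys p. \<Sum>n\<in>Poly_Mapping.keys q.
      Poly_Mapping.single (m + n) (Poly_Mapping.lookup p m * Poly_Mapping.lookup q n))"
    by (simp add: sum_product mult_single)
  then show ?thesis
    by (simp add: sym_eval_sum sym_eval_single lookup_add power_add prod.distrib)
      (simp add: sym_eval_def sum_product mult_ac)
qed

lemma sym_eval_const [simp]: "sym_eval lam (sym_const c) = c"
  by (simp add: sym_const_def sym_eval_single)

lemma sym_eval_one [simp]: "sym_eval lam 1 = 1"
  using sym_eval_const[of lam 1] by (simp add: sym_const_def)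

lemma sym_eval_prod: "sym_eval lam (\<Prod>i\<in>I. p i) = (\<Prod>i\<in>I. sym_eval lam (p i))"
  by (induction I rule: infinite_finite_induct) (auto simp: sym_eval_mult)

lemma sym_eval_power: "sym_eval lam (p ^ n) = sym_eval lam p ^ n"
  by (induction n) (auto simp: sym_eval_mult)

lemma sym_eval_uminus: "sym_eval lam (- p) = - sym_eval lam p"
  using sym_eval_add[of lam p "- p"] by (simp add: eq_neg_iff_add_eq_0 add.commute)

lemma sym_eval_diff: "sym_eval lam (p - q) = sym_eval lam p - sym_eval lam q"
  using sym_eval_add[of lam p "- q"] by (simp add: sym_eval_uminus)

lemma sym_eval_vec:
  assumes "linear lam" shows "sym_eval lam (sym_vec v) = lam v"
proof -
  interpret linear lam by (rule assms)
  have "sym_eval lam (sym_vec v) = (\<Sum>b\<in>Basis. complex_of_real (v \<bullet> b) * lam b)"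
    unfolding sym_vec_def sym_eval_sum sym_eval_single
    by (intro sum.cong refl arg_cong2[where f=times], subst prod.remove[OF finite_Basis])
      (auto simp: lookup_single when_def intro!: prod.neutral split: if_splits)
  also have "\<dots> = lam (\<Sum>b\<in>Basis. (v \<bullet> b) *\<^sub>R b)" by (simp add: sum scale scaleR_conv_of_real)
  finally show ?thesis by (simp add: euclidean_representation)
qed

lemma linear_real_point: "linear (real_point \<xi>)"
  by (rule linearI) (auto simp: real_point_def inner_add_right scaleR_conv_of_real)

section \<open>Closure properties of the symmetric algebra and induction on its elements\<close>

lemma multi_indices_add: "m \<in> multi_indices \<Longrightarrow> n \<in> multi_indices \<Longrightarrow> m + n \<in> multi_indices"
  unfolding multi_indices_def using keys_add[of m n] by auto

lemma multi_indices_zero: "0 \<in> multi_indices" by (simp add: multi_indices_def)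

lemma multi_indices_single: "b \<in> Basis \<Longrightarrow> Poly_Mapping.single b n \<in> multi_indices"
  by (simp add: multi_indices_def)

lemma sym_algebra_add: "p \<in> sym_algebra \<Longrightarrow> q \<in> sym_algebra \<Longrightarrow> p + q \<in> sym_algebra"
  unfolding sym_algebra_def using keys_add[of p q] by auto

lemma sym_algebra_zero: "0 \<in> sym_algebra" by (simp add: sym_algebra_def)

lemma sym_algebra_sum: "(\<And>i. i \<in> I \<Longrightarrow> p i \<in> sym_algebra) \<Longrightarrow> (\<Sum>i\<in>I. p i) \<in> sym_algebra"
  by (induction I rule: infinite_finite_induct) (auto intro: sym_algebra_add sym_algebra_zero)

lemma sym_algebra_single: "m \<in> multi_indices \<Longrightarrow> Poly_Mapping.single m c \<in> sym_algebra"
  by (simp add: sym_algebra_def)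

lemma sym_algebra_mult:
  assumes "p \<in> sym_algebra" "q \<in> sym_algebra" shows "p * q \<in> sym_algebra"
  using keys_mult[of p q] assms unfolding sym_algebra_def by (fastforce intro: multi_indices_add)

lemma sym_algebra_const: "sym_const c \<in> sym_algebra"
  unfolding sym_const_def by (rule sym_algebra_single[OF multi_indices_zero])

lemma sym_algebra_one: "1 \<in> sym_algebra"
  using sym_algebra_const[of 1] by (simp add: sym_const_def)

lemma sym_algebra_uminus: "p \<in> sym_algebra \<Longrightarrow> - p \<in> sym_algebra"
  by (simp add: sym_algebra_def)

lemma sym_algebra_diff: "p \<in> sym_algebra \<Longrightarrow> q \<in> sym_algebra \<Longrightarrow> p - q \<in> sym_algebra"
  using sym_algebra_add[of p "- q"] sym_algebra_uminus by auto

lemma sym_algebra_prod: "(\<And>i. i \<in> I \<Longrightarrow> p i \<in> sym_algebra) \<Longrightarrow> (\<Prod>i\<in>I. p i) \<in> sym_algebra"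
  by (induction I rule: infinite_finite_induct) (auto intro: sym_algebra_mult sym_algebra_one)

lemma sym_algebra_power: "p \<in> sym_algebra \<Longrightarrow> p ^ n \<in> sym_algebra"
  by (induction n) (auto intro: sym_algebra_mult sym_algebra_one)

lemma sym_algebra_vec: "sym_vec v \<in> sym_algebra"
  unfolding sym_vec_def by (intro sym_algebra_sum sym_algebra_single multi_indices_single)

lemmas sym_algebra_intros = sym_algebra_add sym_algebra_diff sym_algebra_mult sym_algebra_const
  sym_algebra_one sym_algebra_vec sym_algebra_power sym_algebra_prod sym_algebra_sum
  sym_algebra_uminus sym_algebra_zero

lemma sym_vec_Basis: "b \<in> Basis \<Longrightarrow> sym_vec b = Poly_Mapping.single (Poly_Mapping.single b 1) 1"
proof -
  assume b: "b \<in> Basis"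
  have "sym_vec b = (\<Sum>c\<in>Basis. if c = b then Poly_Mapping.single (Poly_Mapping.single b 1) 1 else 0)"
    unfolding sym_vec_def by (rule sum.cong) (use b in \<open>auto simp: inner_Basis single_zero\<close>)
  then show ?thesis using b by simp
qed

text \<open>Induction on the total degree: in a monomial of positive degree some variable has a
  positive exponent, and one factor of it can be split off.\<close>

lemma sym_algebra_monomial_induct:
  fixes m :: "'a::euclidean_space \<Rightarrow>\<^sub>0 nat"
  assumes "m \<in> multi_indices"
    and const: "\<And>c. P (sym_const c)"
    and vec: "\<And>v q. q \<in> sym_algebra \<Longrightarrow> P q \<Longrightarrow> P (sym_vec v * q)"
  shows "P (Poly_Mapping.single m c)"
  using assms(1)
proof (induction "\<Sum>b\<in>Basis. Poly_Mapping.lookup m b" arbitrary: m)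
  case 0
  have "Poly_Mapping.lookup m b = 0" for b
    using 0 by (cases "b \<in> Basis") (auto simp: multi_indices_def in_keys_iff)
  then have "m = 0" by (intro poly_mapping_eqI) auto
  then show ?case using const by (simp add: sym_const_def)
next
  case (Suc n)
  then obtain b where b: "b \<in> Basis" "Poly_Mapping.lookup m b \<noteq> 0"
    by (metis finite_Basis nat.simps(3) sum.neutral)
  define m' where "m' = m - Poly_Mapping.single b 1"
  have lk: "Poly_Mapping.lookup m' c = Poly_Mapping.lookup m c - (if c = b then 1 else 0)" for c
    by (simp add: m'_def lookup_minus lookup_single when_def)
  have m: "m = Poly_Mapping.single b 1 + m'"
    by (rule poly_mapping_eqI) (use b in \<open>auto simp: lookup_add lk lookup_single when_def\<close>)
  have m': "m' \<in> multi_indices"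
    using Suc.prems unfolding multi_indices_def by (auto simp: in_keys_iff lk subset_iff)
  have "(\<Sum>b\<in>Basis. Poly_Mapping.lookup m b) = 1 + (\<Sum>b\<in>Basis. Poly_Mapping.lookup m' b)"
    using b by (simp add: m lookup_add lookup_single sum.distrib when_def)
  then have "P (Poly_Mapping.single m' c)" using Suc m' by simp
  then have "P (sym_vec b * Poly_Mapping.single m' c)" by (intro vec sym_algebra_single m')
  then show ?case using m by (simp add: sym_vec_Basis[OF b(1)] mult_single)
qed

lemma sym_algebra_induct [consumes 1, case_names const vec add]:
  fixes p :: "'a::euclidean_space sympoly"
  assumes "p \<in> sym_algebra"
    and const: "\<And>c. P (sym_const c)"
    and vec: "\<And>v q. q \<in> sym_algebra \<Longrightarrow> P q \<Longrightarrow> P (sym_vec v * q)"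
    and add: "\<And>p q. p \<in> sym_algebra \<Longrightarrow> q \<in> sym_algebra \<Longrightarrow> P p \<Longrightarrow> P q \<Longrightarrow> P (p + q)"
  shows "P p"
proof -
  have P0: "P 0" using const[of 0] by (simp add: sym_const_def)
  have "K \<subseteq> Poly_Mapping.keys p \<Longrightarrow> P (\<Sum>m\<in>K. Poly_Mapping.single m (Poly_Mapping.lookup p m))" if "finite K" for K
    using that
  proof (induction K)
    case (insert m K)
    have sub: "\<And>n. n \<in> insert m K \<Longrightarrow> n \<in> multi_indices"
      using insert.prems assms(1) unfolding sym_algebra_def by auto
    show ?case unfolding sum.insert[OF insert.hyps]
      by (intro add sym_algebra_sum sym_algebra_single sub insert.IH
          sym_algebra_monomial_induct[of m P, OF _ const vec]) (use insert in auto)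
  qed (simp add: P0)
  then show ?thesis using poly_mapping_eq_sum[of p] by (metis finite_keys order_refl)
qed

text \<open>Kronecker substitution: along the curve with coordinates \<open>t, t\<^sup>N, (t\<^sup>N)\<^sup>N, \<dots>\<close> distinct
  monomials with exponents below \<open>N\<close> become distinct powers of \<open>t\<close>.\<close>

fun kron :: "nat \<Rightarrow> 'a list \<Rightarrow> ('a \<Rightarrow> nat) \<Rightarrow> nat" where
  "kron N [] m = 0"
| "kron N (b # xs) m = m b + N * kron N xs m"

fun kron_point :: "nat \<Rightarrow> 'a list \<Rightarrow> real \<Rightarrow> 'a \<Rightarrow> real" where
  "kron_point N [] t = (\<lambda>_. 0)"
| "kron_point N (b # xs) t = (kron_point N xs (t ^ N))(b := t)"

lemma kron_prod:
  "distinct xs \<Longrightarrow> (\<Prod>b\<in>set xs. kron_point N xs t b ^ m b) = t ^ kron N xs m"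
proof (induction xs arbitrary: t)
  case (Cons b xs)
  have "(\<Prod>c\<in>set xs. ((kron_point N xs (t ^ N))(b := t)) c ^ m c) = (\<Prod>c\<in>set xs. kron_point N xs (t ^ N) c ^ m c)"
    by (rule prod.cong) (use Cons.prems in auto)
  then show ?case using Cons by (simp add: power_add power_mult)
qed simp

lemma kron_inj:
  "(\<And>b. b \<in> set xs \<Longrightarrow> m b < N \<and> m' b < N) \<Longrightarrow> kron N xs m = kron N xs m' \<Longrightarrow> b \<in> set xs \<Longrightarrow> m b = m' b"
proof (induction xs)
  case (Cons c xs)
  have lt: "m c < N" "m' c < N" using Cons.prems(1)[of c] by auto
  then have "m c = kron N (c # xs) m mod N" "m' c = kron N (c # xs) m' mod N" by simp_all
  moreover have "kron N xs m = kron N (c # xs) m div N" "kron N xs m' = kron N (c # xs) m' div N" using lt by simp_all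
  ultimately have "m c = m' c" "kron N xs m = kron N xs m'" using Cons.prems(2) by presburger+
  then show ?case using Cons by auto
qed simp

text \<open>Along the Kronecker curve p becomes a polynomial in t with the same coefficients, one
  monomial for each power that occurs, and every real t is a root. Through
  \<open>sym_algebra_eqI\<close> identities in the symmetric algebra can be checked at real
  points.\<close>

lemma sym_algebra_eval_zero:
  fixes p :: "'a::euclidean_space sympoly"
  assumes p: "p \<in> sym_algebra" and z: "\<And>\<xi>. sym_eval (real_point \<xi>) p = 0"
  shows "p = 0"
proof (rule ccontr)
  assume "p \<noteq> 0"
  then obtain m0 where m0: "m0 \<in> Poly_Mapping.keys p" using keys_eq_empty[of p] by blast
  define K where "K = Poly_Mapping.keys p"
  \<comment> \<open>N exceeds all exponents that occur, so these are digits in base N and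
    \<open>kron_inj\<close> applies.\<close>
  define N where "N = Suc (Max ((\<lambda>(m,b). Poly_Mapping.lookup m b) ` (K \<times> (Basis :: 'a set))))"
  have fin: "finite K" by (simp add: K_def)
  have N: "Poly_Mapping.lookup m b < N" if "m \<in> K" "b \<in> Basis" for m b
  proof -
    have "Poly_Mapping.lookup m b \<le> Max ((\<lambda>(m,b). Poly_Mapping.lookup m b) ` (K \<times> (Basis :: 'a set)))"
      by (rule Max_ge) (use that fin in force)+
    then show ?thesis by (simp add: N_def)
  qed
  define h where "h m = kron N basis_list (Poly_Mapping.lookup m)" for m :: "'a \<Rightarrow>\<^sub>0 nat"
  have inj: "m = m'" if "m \<in> K" "m' \<in> K" "h m = h m'" for m m'
  proof (rule poly_mapping_eqI)
    fix b
    show "Poly_Mapping.lookup m b = Poly_Mapping.lookup m' b"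
    proof (cases "b \<in> Basis")
      case True
      show ?thesis
        by (rule kron_inj[where xs=basis_list and N=N]) (use that True N in \<open>auto simp: basis_list h_def\<close>)
    next
      case False
      then show ?thesis
        using that p unfolding K_def sym_algebra_def multi_indices_def by (metis in_keys_iff mem_Collect_eq subsetD)
    qed
  qed
  define n where "n = Max (h ` K)"
  have hn: "h m \<le> n" if "m \<in> K" for m using that fin by (simp add: n_def)
  define c where "c i = (\<Sum>m\<in>K. if h m = i then Poly_Mapping.lookup p m else 0)" for i
  have roots: "(\<Sum>i\<le>n. c i * complex_of_real t ^ i) = 0" for t
  proof -
    define \<xi> :: 'a where "\<xi> = (\<Sum>b\<in>Basis. kron_point N basis_list t b *\<^sub>R b) "
    have "(\<Sum>i\<le>n. c i * complex_of_real t ^ i) = (\<Sum>m\<in>K. \<Sum>i\<le>n. if h m = i then Poly_Mapping.lookup p m * complex_of_real t ^ i else 0)"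
      unfolding c_def sum_distrib_right by (subst sum.swap) (auto intro!: sum.cong)
    also have "\<dots> = (\<Sum>m\<in>K. Poly_Mapping.lookup p m * complex_of_real t ^ h m)"
      by (rule sum.cong) (auto simp: hn)
    also have "\<dots> = sym_eval (real_point \<xi>) p"
      unfolding sym_eval_def K_def[symmetric]
    proof (intro sum.cong refl arg_cong2[where f=times])
      fix m :: "'a \<Rightarrow>\<^sub>0 nat"
      have "complex_of_real t ^ h m = complex_of_real (\<Prod>b\<in>Basis. kron_point N basis_list t b ^ Poly_Mapping.lookup m b)"
        using kron_prod[of basis_list N t "Poly_Mapping.lookup m"] by (simp add: h_def basis_list)
      also have "\<dots> = (\<Prod>b\<in>Basis. real_point \<xi> b ^ Poly_Mapping.lookup m b)"
        by (simp add: real_point_def \<xi>_def inner_sum_left_Basis)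
      finally show "complex_of_real t ^ h m = (\<Prod>b\<in>Basis. real_point \<xi> b ^ Poly_Mapping.lookup m b)" .
    qed
    finally show ?thesis using z by simp
  qed
  have "infinite (range complex_of_real)"
    using infinite_UNIV_char_0[where 'a=real] by (simp add: finite_image_iff inj_of_real)
  moreover have "range complex_of_real \<subseteq> {x. (\<Sum>i\<le>n. c i * x ^ i) = 0}" using roots by auto
  ultimately have "\<not> finite {x. (\<Sum>i\<le>n. c i * x ^ i) = 0}" using finite_subset by blast
  then have "c (h m0) = 0" using polyfun_finite_roots[of c n] hn m0 K_def by auto
  moreover have "c (h m0) = (\<Sum>m\<in>K. if m = m0 then Poly_Mapping.lookup p m else 0)"
    unfolding c_def by (rule sum.cong) (use inj m0 K_def in auto)
  ultimately show False using m0 fin by (simp add: K_def in_keys_iff)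
qed

lemma sym_algebra_eqI:
  assumes "p \<in> sym_algebra" "q \<in> sym_algebra"
    "\<And>\<xi>. sym_eval (real_point \<xi>) p = sym_eval (real_point \<xi>) q"
  shows "p = q"
  using sym_algebra_eval_zero[of "p - q"] assms by (simp add: sym_algebra_diff sym_eval_diff)

lemma real_sym_algebraD: "p \<in> real_sym_algebra \<Longrightarrow> p \<in> sym_algebra"
  by (simp add: real_sym_algebra_def)

section \<open>Linear substitutions in polynomials\<close>

text \<open>For linear w this is the algebra endomorphism extending w; on polynomial functions it is
  composition with the transpose of w.\<close>

definition sym_map :: "('a::euclidean_space \<Rightarrow> 'a) \<Rightarrow> 'a sympoly \<Rightarrow> 'a sympoly" where
  "sym_map w p = (\<Sum>m\<in>Poly_Mapping.keys p. sym_const (Poly_Mapping.lookup p m) *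
     (\<Prod>b\<in>Basis. sym_vec (w b) ^ Poly_Mapping.lookup m b))"

lemma sym_algebra_map: "sym_map w p \<in> sym_algebra"
  unfolding sym_map_def by (intro sym_algebra_intros)

lemma sym_eval_map:
  assumes "linear lam" shows "sym_eval lam (sym_map w p) = sym_eval (\<lambda>b. lam (w b)) p"
  unfolding sym_map_def sym_eval_sum sym_eval_mult sym_eval_prod sym_eval_power sym_eval_vec[OF assms]
  by (simp add: sym_eval_def[of "\<lambda>b. lam (w b)"])

lemma sym_map_vec_mult:
  assumes "linear w" "q \<in> sym_algebra"
  shows "sym_map w (sym_vec v * q) = sym_vec (w v) * sym_map w q"
proof (rule sym_algebra_eqI)
  fix \<xi> :: 'a
  have "linear (\<lambda>b. real_point \<xi> (w b))"
    using linear_compose[OF assms(1) linear_real_point] by (simp add: o_def)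
  then show "sym_eval (real_point \<xi>) (sym_map w (sym_vec v * q)) = sym_eval (real_point \<xi>) (sym_vec (w v) * sym_map w q)"
    by (simp add: sym_eval_map linear_real_point sym_eval_mult sym_eval_vec)
qed (auto intro: sym_algebra_intros sym_algebra_map assms)

lemma sym_map_add: "sym_map w (p + q) = sym_map w p + sym_map w q"
  by (rule sym_algebra_eqI)
    (auto intro: sym_algebra_intros sym_algebra_map simp: sym_eval_map linear_real_point sym_eval_add)

lemma sym_map_const: "sym_map w (sym_const c) = sym_const c"
  by (rule sym_algebra_eqI)
    (auto intro: sym_algebra_intros sym_algebra_map simp: sym_eval_map linear_real_point)


section \<open>Constant coefficient operators on an open set\<close>

abbreviation pd :: "'a::euclidean_space sympoly \<Rightarrow> ('a \<Rightarrow> complex) \<Rightarrow> 'a \<Rightarrow> complex" where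
  "pd \<equiv> sym_subst dir_deriv"

text \<open>With values outside U set to 0, equality on U becomes equality of functions. The same
  encoding represents functions on the regular set, see \<open>reg_restrict_cut\<close>.\<close>

definition cut :: "'a::euclidean_space set \<Rightarrow> ('a \<Rightarrow> complex) \<Rightarrow> 'a \<Rightarrow> complex" where
  "cut U f = (\<lambda>x. if x \<in> U then f x else 0)"

definition smooth_cut :: "'a::euclidean_space set \<Rightarrow> ('a \<Rightarrow> complex) set" where
  "smooth_cut U = {f. smooth_on U f \<and> (\<forall>x. x \<notin> U \<longrightarrow> f x = 0)}"

definition dd_cut :: "'a::euclidean_space set \<Rightarrow> 'a \<Rightarrow> ('a \<Rightarrow> complex) \<Rightarrow> 'a \<Rightarrow> complex" where
  "dd_cut U v f = cut U (dir_deriv v f)"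

lemma cut_in_smooth_cut: "open U \<Longrightarrow> smooth_on U f \<Longrightarrow> cut U f \<in> smooth_cut U"
  using smooth_on_cong[of U f "cut U f"] by (auto simp: smooth_cut_def cut_def)

lemma comm_ops_dd_cut:
  assumes U: "open U" shows "comm_ops (smooth_cut U) (dd_cut U)"
proof
  show "csubspace_fun (smooth_cut U)"
    unfolding csubspace_fun_def smooth_cut_def using U by (auto intro: smooth_on_add smooth_on_cmult)
  show "dd_cut U b f \<in> smooth_cut U" if "f \<in> smooth_cut U" for b f
    unfolding dd_cut_def by (rule cut_in_smooth_cut[OF U]) (use that in \<open>auto simp: smooth_cut_def smooth_onD\<close>)
  show "clinear_fun_on (smooth_cut U) (dd_cut U b)" for b
    unfolding clinear_fun_on_def dd_cut_def cut_def smooth_cut_def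
    by (auto simp: fun_eq_iff dir_deriv_add dir_deriv_cmult smooth_onD)
  show "dd_cut U b (dd_cut U c f) = dd_cut U c (dd_cut U b f)" if f: "f \<in> smooth_cut U" for b c f
  proof
    fix x
    have "dir_deriv b (dd_cut U c f) x = dir_deriv b (dir_deriv c f) x" if "x \<in> U" for b c
      by (rule dir_deriv_cong_open[OF U that]) (simp add: dd_cut_def cut_def)
    moreover have "dir_deriv b (dir_deriv c f) x = dir_deriv c (dir_deriv b f) x" if "x \<in> U"
      by (rule dir_deriv_commute[OF U _ that]) (use f in \<open>auto simp: smooth_cut_def smooth_onD\<close>)
    ultimately show "dd_cut U b (dd_cut U c f) x = dd_cut U c (dd_cut U b f) x"
      by (simp add: dd_cut_def[of U b "dd_cut U c f"] dd_cut_def[of U c "dd_cut U b f"] cut_def)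
  qed
qed

lemma funpow_dd_cut:
  assumes U: "open U" and fg: "\<And>x. x \<in> U \<Longrightarrow> f x = g x" and x: "x \<in> U"
  shows "(dir_deriv v ^^ n) f x = (dd_cut U v ^^ n) g x"
  using x
proof (induction n arbitrary: x)
  case (Suc n)
  show ?case
    using dir_deriv_cong_open[OF U Suc.prems Suc.IH] Suc.prems by (simp add: dd_cut_def cut_def)
qed (simp add: fg)

lemma pd_cut:
  assumes U: "open U" and fg: "\<And>x. x \<in> U \<Longrightarrow> f x = g x" and x: "x \<in> U"
  shows "pd p f x = sym_subst (dd_cut U) p g x"
proof -
  have "foldr (\<lambda>b g. (dir_deriv b ^^ Poly_Mapping.lookup m b) g) xs f x =
        foldr (\<lambda>b g. (dd_cut U b ^^ Poly_Mapping.lookup m b) g) xs g x" for m and xs :: "'a list"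
    using x
  proof (induction xs arbitrary: x)
    case (Cons b xs)
    show ?case using funpow_dd_cut[OF U Cons.IH Cons.prems] by simp
  qed (simp add: fg)
  then show ?thesis by (simp add: sym_subst_def)
qed

lemma pd_cong:
  assumes "open U" "\<And>x. x \<in> U \<Longrightarrow> f x = g x" "x \<in> U"
  shows "pd p f x = pd p g x"
  using pd_cut[OF assms] pd_cut[OF assms(1) _ assms(3), of g g] by simp

lemma cut_pd:
  assumes U: "open U" and f: "smooth_on U f"
  shows "cut U (pd p f) = sym_subst (dd_cut U) p (cut U f)"
proof -
  interpret comm_ops "smooth_cut U" "dd_cut U" by (rule comm_ops_dd_cut[OF U])
  have "sym_subst (dd_cut U) p (cut U f) \<in> smooth_cut U"
    by (intro subst_closed cut_in_smooth_cut U f)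
  then show ?thesis
    using pd_cut[OF U, of f "cut U f" _ p] by (auto simp: fun_eq_iff cut_def smooth_cut_def)
qed

lemma
  assumes U: "open U" and f: "smooth_on U f"
  shows smooth_on_pd: "smooth_on U (pd p f)"
    and pd_mult: "x \<in> U \<Longrightarrow> pd (p * q) f x = pd p (pd q f) x"
    and pd_vec: "x \<in> U \<Longrightarrow> pd (sym_vec v) f x = dir_deriv v f x"
    and pd_fun_scale: "x \<in> U \<Longrightarrow> pd p (\<lambda>x. c * f x) x = c * pd p f x"
    and pd_fun_add: "x \<in> U \<Longrightarrow> smooth_on U g \<Longrightarrow> pd p (\<lambda>x. f x + g x) x = pd p f x + pd p g x"
proof -
  interpret comm_ops "smooth_cut U" "dd_cut U" by (rule comm_ops_dd_cut[OF U])
  have cf: "cut U f \<in> smooth_cut U" by (rule cut_in_smooth_cut[OF U f])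
  have "smooth_on U (cut U (pd p f))"
    using subst_closed[OF cf, of p] unfolding cut_pd[OF U f] by (simp add: smooth_cut_def)
  then show "smooth_on U (pd p f)"
    by (subst smooth_on_cong[OF U, of _ "cut U (pd p f)"]) (auto simp: cut_def)
  have ev: "pd p h x = sym_subst (dd_cut U) p (cut U h) x" if "x \<in> U" for p h x
    by (rule pd_cut[OF U _ that]) (simp add: cut_def)
  show "x \<in> U \<Longrightarrow> pd (p * q) f x = pd p (pd q f) x"
    by (simp add: ev subst_mult[OF cf] cut_pd[OF U f])
  show "pd (sym_vec v) f x = dir_deriv v f x" if x: "x \<in> U"
  proof -
    have "dir_deriv b (cut U f) x = dir_deriv b f x" for b
      by (rule dir_deriv_cong_open[OF U x]) (simp add: cut_def)
    then have "dd_cut U b (cut U f) x = dir_deriv b f x" for b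
      using x by (simp add: dd_cut_def cut_def[of U "dir_deriv b (cut U f)"])
    then show ?thesis
      using x f by (simp add: ev subst_vec dir_deriv_expand[of f x v] smooth_onD)
  qed
  have "cut U (\<lambda>x. c * f x) = (\<lambda>x. c * cut U f x)" by (auto simp: cut_def)
  then show "x \<in> U \<Longrightarrow> pd p (\<lambda>x. c * f x) x = c * pd p f x"
    by (simp add: ev subst_fun_scale[OF cf])
  show "pd p (\<lambda>x. f x + g x) x = pd p f x + pd p g x" if "x \<in> U" "smooth_on U g"
  proof -
    have "cut U (\<lambda>x. f x + g x) = (\<lambda>x. cut U f x + cut U g x)" by (auto simp: cut_def)
    then show ?thesis using that by (simp add: ev subst_fun_add[OF cf cut_in_smooth_cut[OF U]])
  qed
qed

lemma pd_add: "pd (p + q) f x = pd p f x + pd q f x"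
  and pd_sum: "pd (\<Sum>i\<in>I. r i) f x = (\<Sum>i\<in>I. pd (r i) f x)"
  and pd_const: "pd (sym_const c) f x = c * f x"
  and pd_zero: "pd 0 f x = 0"
  and pd_one: "pd 1 f x = f x"
proof -
  \<comment> \<open>These rules hold for arbitrary f, without differentiability: they concern only
    the sum over the support of the polynomial. The zero space serves to reach them.\<close>
  interpret comm_ops "{\<lambda>x. 0}" dir_deriv
    by standard (auto simp: csubspace_fun_def clinear_fun_on_def)
  show "pd (p + q) f x = pd p f x + pd q f x" "pd (\<Sum>i\<in>I. r i) f x = (\<Sum>i\<in>I. pd (r i) f x)"
    "pd (sym_const c) f x = c * f x" "pd 0 f x = 0" "pd 1 f x = f x"
    by (simp_all add: subst_add subst_sum subst_const subst_zero subst_one)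
qed

lemma pd_vec_power:
  assumes U: "open U" and f: "smooth_on U f" and x: "x \<in> U"
  shows "pd (sym_vec v ^ n) f x = (dir_deriv v ^^ n) f x"
  using x
proof (induction n arbitrary: x)
  case (Suc n)
  have "pd (sym_vec v ^ Suc n) f x = dir_deriv v (pd (sym_vec v ^ n) f) x"
    using Suc.prems by (simp add: pd_mult[OF U f] pd_vec[OF U smooth_on_pd[OF U f]])
  also have "\<dots> = dir_deriv v ((dir_deriv v ^^ n) f) x"
    by (rule dir_deriv_cong_open[OF U Suc.prems Suc.IH])
  finally show ?case by simp
qed (simp add: pd_one)

lemma pd_fun_sum:
  assumes U: "open U" and f: "\<And>i. i \<in> I \<Longrightarrow> smooth_on U (f i)" and x: "x \<in> U"
  shows "pd p (\<lambda>x. \<Sum>i\<in>I. f i x) x = (\<Sum>i\<in>I. pd p (f i) x)"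
  using f
proof (induction I rule: infinite_finite_induct)
  case (insert i I)
  then show ?case
    by (simp add: pd_fun_add[OF U] smooth_on_sum U x)
qed (use pd_fun_scale[OF U smooth_on_const x, of p 0 0] in auto)

text \<open>The chain rule. For invariant p and L in the Weyl group it says that p(d) commutes with
  composition by the affine map, and so the eigenvalue equations are preserved by W.\<close>

lemma pd_affine:
  assumes U: "open U" and L: "bounded_linear L" and f: "smooth_on U f" and p: "p \<in> sym_algebra"
    and x: "L x + c \<in> U"
  shows "pd p (\<lambda>x. f (L x + c)) x = pd (sym_map L p) f (L x + c)"
  using p x
proof (induction arbitrary: x rule: sym_algebra_induct)
  case (const d)
  then show ?case by (simp add: sym_map_const pd_const)
next
  case (add p q)
  then show ?case by (simp add: sym_map_add pd_add)
next
  case (vec v q)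
  let ?V = "(\<lambda>x. L x + c) -` U"
  have V: "open ?V"
    by (intro open_vimage U continuous_intros bounded_linear.continuous_on[OF L])
  have fV: "smooth_on ?V (\<lambda>x. f (L x + c))" by (rule smooth_on_affine[OF U L f]) auto
  have sq: "smooth_on U (pd (sym_map L q) f)" by (rule smooth_on_pd[OF U f])
  have "pd (sym_vec v * q) (\<lambda>x. f (L x + c)) x = dir_deriv v (pd q (\<lambda>x. f (L x + c))) x"
    using vec.prems by (simp add: pd_mult[OF V fV] pd_vec[OF V smooth_on_pd[OF V fV]])
  also have "\<dots> = dir_deriv v (\<lambda>x. pd (sym_map L q) f (L x + c)) x"
    by (rule dir_deriv_cong_open[OF V]) (use vec in auto)
  also have "\<dots> = dir_deriv (L v) (pd (sym_map L q) f) (L x + c)"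
    by (rule dir_deriv_affine[OF L]) (use sq vec.prems smooth_onD in blast)
  also have "\<dots> = pd (sym_vec (L v) * sym_map L q) f (L x + c)"
    using vec.prems by (simp add: pd_mult[OF U f] pd_vec[OF U sq])
  finally show ?case
    using vec.hyps L by (simp add: sym_map_vec_mult bounded_linear.linear)
qed

section \<open>The finite Weyl group and the eigenvalue equations\<close>

lemma refl_linear: "linear (refl \<alpha>)"
  by (rule linearI) (auto simp: refl_def inner_add_right algebra_simps)

lemma refl_inner: "refl \<alpha> x \<bullet> refl \<alpha> y = x \<bullet> y"
proof (cases "\<alpha> = 0")
  case False
  then have "\<alpha> \<bullet> \<alpha> \<noteq> 0" by simp
  then show ?thesis
    by (simp add: refl_def coroot_def inner_diff_left inner_diff_right inner_commute[of x] inner_commute[of y \<alpha>])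
qed (simp add: refl_def)

lemma coroot_inner: "\<alpha> \<noteq> 0 \<Longrightarrow> \<alpha> \<bullet> coroot \<alpha> = 2"
  by (simp add: coroot_def)

lemma refl_refl [simp]: "refl \<alpha> (refl \<alpha> x) = x"
proof (cases "\<alpha> = 0")
  case True
  then show ?thesis by (simp add: refl_def)
next
  case False
  then have "\<alpha> \<bullet> (c *\<^sub>R coroot \<alpha>) = 2 * c" for c by (simp add: coroot_inner)
  then show ?thesis by (simp add: refl_def inner_diff_right algebra_simps flip: scaleR_left_distrib)
qed

lemma weyl_linear: "w \<in> weyl_group R \<Longrightarrow> linear w"
  by (induction rule: weyl_group.induct)
    (auto simp: id_def intro: linearI linear_compose[OF _ refl_linear, unfolded o_def])

lemma weyl_bounded_linear: "w \<in> weyl_group R \<Longrightarrow> bounded_linear w"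
  by (simp add: weyl_linear linear_conv_bounded_linear[symmetric])

lemma weyl_inner: "w \<in> weyl_group R \<Longrightarrow> w x \<bullet> w y = x \<bullet> y"
  by (induction rule: weyl_group.induct) (auto simp: refl_inner)

lemma weyl_comp: "w \<in> weyl_group R \<Longrightarrow> w' \<in> weyl_group R \<Longrightarrow> w \<circ> w' \<in> weyl_group R"
  by (induction rule: weyl_group.induct) (auto simp: o_assoc[symmetric] intro: weyl_group.intros)

lemma weyl_refl: "\<alpha> \<in> R \<Longrightarrow> refl \<alpha> \<in> weyl_group R"
  using weyl_group.intros(2)[OF _ weyl_group.intros(1)] by simp

lemma weyl_inverse: "w \<in> weyl_group R \<Longrightarrow> \<exists>w'\<in>weyl_group R. w \<circ> w' = id \<and> w' \<circ> w = id"
proof (induction rule: weyl_group.induct)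
  case 1
  then show ?case using weyl_group.intros(1) by (intro bexI[of _ id]) auto
next
  case (2 \<alpha> w)
  then obtain w' where w': "w' \<in> weyl_group R" "w \<circ> w' = id" "w' \<circ> w = id" by blast
  then show ?case
    by (intro bexI[of _ "w' \<circ> refl \<alpha>"] weyl_comp weyl_refl 2) (auto simp: fun_eq_iff)
qed

lemma weyl_root:
  assumes "\<forall>\<alpha>\<in>R. \<forall>\<beta>\<in>R. refl \<alpha> \<beta> \<in> R"
  shows "w \<in> weyl_group R \<Longrightarrow> \<alpha> \<in> R \<Longrightarrow> w \<alpha> \<in> R"
  by (induction rule: weyl_group.induct) (use assms in auto)

text \<open>R spans, so an element of the group is determined by the permutation of R that it
  induces.\<close>

lemma weyl_finite:
  assumes "\<forall>\<alpha>\<in>R. \<forall>\<beta>\<in>R. refl \<alpha> \<beta> \<in> R" "finite R" "span R = UNIV"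
  shows "finite (weyl_group R)"
proof -
  have "inj_on (\<lambda>w. restrict w R) (weyl_group R)"
  proof (rule inj_onI)
    fix w w' assume w: "w \<in> weyl_group R" "w' \<in> weyl_group R" "restrict w R = restrict w' R"
    have "w x = w' x" if "x \<in> R" for x using w(3) that by (metis restrict_apply')
    then have "w x = w' x" if "x \<in> span R" for x
      using linear_eq_on_span[OF weyl_linear[OF w(1)] weyl_linear[OF w(2)]] that by blast
    then show "w = w'" using assms(3) by auto
  qed
  moreover have "(\<lambda>w. restrict w R) ` weyl_group R \<subseteq> R \<rightarrow>\<^sub>E R"
    using weyl_root[OF assms(1)] by auto
  moreover have "finite (R \<rightarrow>\<^sub>E R)" by (intro finite_PiE assms(2))
  ultimately show ?thesis by (meson finite_imageD finite_subset)
qed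

text \<open>Invariance is defined through the action on points; it passes to \<open>sym_map\<close>
  because the transpose of an orthogonal map is its inverse.\<close>

lemma sym_map_invariant:
  assumes p: "p \<in> sym_algebra" "sym_invariant R p" and w: "w \<in> weyl_group R"
  shows "sym_map w p = p"
proof (rule sym_algebra_eqI[OF sym_algebra_map p(1)])
  fix \<xi> :: 'a
  obtain w' where w': "w' \<in> weyl_group R" "w \<circ> w' = id" "w' \<circ> w = id" using weyl_inverse[OF w] by blast
  have "\<xi> \<bullet> w b = w' \<xi> \<bullet> b" for b
    using weyl_inner[OF w, of "w' \<xi>" b] w'(2) by (simp add: fun_eq_iff)
  then have "(\<lambda>b. real_point \<xi> (w b)) = real_point (w' \<xi>)" by (auto simp: real_point_def)
  then show "sym_eval (real_point \<xi>) (sym_map w p) = sym_eval (real_point \<xi>) p"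
    using p(2) w'(1) by (simp add: sym_eval_map linear_real_point sym_invariant_def)
qed

section \<open>Local solutions of the eigenvalue equations\<close>

text \<open>A local form of E(lambda) with smoothness in place of analyticity; on the whole space
  both agree by \<open>E_space_eq\<close>.\<close>

definition sol :: "'a::euclidean_space set \<Rightarrow> ('a \<Rightarrow> complex) \<Rightarrow> 'a set \<Rightarrow> ('a \<Rightarrow> complex) set" where
  "sol R lam U = {f. smooth_on U f \<and> (\<forall>p\<in>sym_algebra. sym_invariant R p \<longrightarrow>
     (\<forall>x\<in>U. pd p f x = sym_eval lam p * f x))}"

lemma solD:
  assumes "f \<in> sol R lam U"
  shows "smooth_on U f" "p \<in> sym_algebra \<Longrightarrow> sym_invariant R p \<Longrightarrow> x \<in> U \<Longrightarrow> pd p f x = sym_eval lam p * f x"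
  using assms unfolding sol_def by auto

lemma solI:
  assumes "smooth_on U f"
    "\<And>p x. p \<in> sym_algebra \<Longrightarrow> sym_invariant R p \<Longrightarrow> x \<in> U \<Longrightarrow> pd p f x = sym_eval lam p * f x"
  shows "f \<in> sol R lam U"
  using assms unfolding sol_def by auto

lemma sol_subset: "f \<in> sol R lam U \<Longrightarrow> V \<subseteq> U \<Longrightarrow> f \<in> sol R lam V"
  unfolding sol_def using smooth_on_subset by blast

lemma sol_cong:
  assumes "open U" "\<And>x. x \<in> U \<Longrightarrow> f x = g x" "f \<in> sol R lam U"
  shows "g \<in> sol R lam U"
  using assms pd_cong[OF assms(1,2)] smooth_on_cong[OF assms(1,2)] unfolding sol_def by simp

lemma sol_csubspace:
  assumes "open U" shows "csubspace_fun (sol R lam U)"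
proof -
  have "pd p (\<lambda>x. 0) x = 0" if "x \<in> U" for p x
    using pd_fun_scale[OF assms smooth_on_const that, of p 0 0] by simp
  then show ?thesis
    unfolding csubspace_fun_def sol_def
    by (auto simp: pd_fun_add[OF assms] pd_fun_scale[OF assms] smooth_on_add[OF assms] smooth_on_cmult[OF assms] algebra_simps)
qed

lemma sol_pd:
  assumes U: "open U" and f: "f \<in> sol R lam U"
  shows "pd q f \<in> sol R lam U"
proof (rule solI)
  note sf = solD(1)[OF f]
  show "smooth_on U (pd q f)" by (rule smooth_on_pd[OF U sf])
  fix p :: "'a sympoly" and x assume p: "p \<in> sym_algebra" "sym_invariant R p" and x: "x \<in> U"
  have "pd p (pd q f) x = pd q (pd p f) x"
    using pd_mult[OF U sf x, of p q] pd_mult[OF U sf x, of q p] by (simp add: mult.commute)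
  also have "\<dots> = pd q (\<lambda>x. sym_eval lam p * f x) x"
    by (rule pd_cong[OF U solD(2)[OF f p] x])
  also have "\<dots> = sym_eval lam p * pd q f x" by (rule pd_fun_scale[OF U sf x])
  finally show "pd p (pd q f) x = sym_eval lam p * pd q f x" .
qed

lemma sol_dir_deriv:
  assumes U: "open U" and f: "f \<in> sol R lam U"
  shows "dir_deriv v f \<in> sol R lam U"
  by (rule sol_cong[OF U _ sol_pd[OF U f, of "sym_vec v"]]) (simp add: pd_vec[OF U solD(1)[OF f]])

lemma sol_affine:
  assumes U: "open U" and f: "f \<in> sol R lam U" and w: "w \<in> weyl_group R" and V: "\<And>x. x \<in> V \<Longrightarrow> w x + c \<in> U"
  shows "(\<lambda>x. f (w x + c)) \<in> sol R lam V"
  by (rule solI)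
    (use pd_affine[OF U weyl_bounded_linear[OF w] solD(1)[OF f]] solD(2)[OF f] sym_map_invariant[OF _ _ w]
        smooth_on_affine[OF U weyl_bounded_linear[OF w] solD(1)[OF f]] V in auto)

text \<open>The coefficients of \<open>\<Prod>\<^sub>w (X - w v)\<close> are invariant and the polynomial vanishes at \<open>X = v\<close>, so the
  eigenvalue equations imply an ordinary differential equation in every direction.\<close>

lemma sol_ode:
  assumes fin: "finite (weyl_group R)" and lam: "linear lam"
  shows "\<exists>c. c (card (weyl_group R)) = 1 \<and> (\<forall>U f x. open U \<longrightarrow> f \<in> sol R lam U \<longrightarrow> x \<in> U \<longrightarrow>
           (\<Sum>j\<le>card (weyl_group R). c j * (dir_deriv v ^^ j) f x) = 0)"
proof -
  let ?W = "weyl_group R"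
  define N where "N = card ?W"
  \<comment> \<open>The coefficient of X^j in the product of all X - w v; A is the set of factors
    from which X is taken.\<close>
  define e where "e j = (\<Sum>A | A \<in> Pow ?W \<and> card A = j. \<Prod>w\<in>?W - A. sym_vec (- w v))" for j
  have eR: "e j \<in> sym_algebra" for j
    unfolding e_def by (intro sym_algebra_intros)
  have e_inv: "sym_invariant R (e j)" for j
    unfolding sym_invariant_def
  proof (intro ballI allI)
    fix u \<xi> assume u: "u \<in> ?W"
    obtain u' where u': "u' \<in> ?W" "u \<circ> u' = id" "u' \<circ> u = id" using weyl_inverse[OF u] by blast
    have canc: "u \<circ> (u' \<circ> w) = w" "u' \<circ> (u \<circ> w) = w" for w :: "'a \<Rightarrow> 'a"
      using u' by (simp_all add: o_assoc)
    have ev: "sym_eval (real_point \<eta>) (e j) =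
        (\<Sum>A | A \<in> Pow ?W \<and> card A = j. \<Prod>w\<in>?W - A. complex_of_real (\<eta> \<bullet> - w v))" for \<eta>
      by (simp add: e_def sym_eval_sum sym_eval_prod sym_eval_vec[OF linear_real_point])
        (simp add: real_point_def)
    have inj: "inj_on ((\<circ>) u) X" "inj_on ((\<circ>) u') X" for X :: "('a \<Rightarrow> 'a) set"
      using canc by (metis inj_onI)+
    have img: "(\<circ>) u ` ?W = ?W" "(\<circ>) u' ` ?W = ?W"
    proof -
      have s: "(\<circ>) u ` ?W \<subseteq> ?W" "(\<circ>) u' ` ?W \<subseteq> ?W" using weyl_comp u u' by blast+
      have "w \<in> (\<circ>) u ` ?W" "w \<in> (\<circ>) u' ` ?W" if w: "w \<in> ?W" for w
        using image_eqI[where f="(\<circ>) u", OF canc(1)[of w, symmetric] weyl_comp[OF u'(1) w]]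
          image_eqI[where f="(\<circ>) u'", OF canc(2)[of w, symmetric] weyl_comp[OF u w]] by simp_all
      then show "(\<circ>) u ` ?W = ?W" "(\<circ>) u' ` ?W = ?W" using s by blast+
    qed
    \<comment> \<open>Left multiplication by u permutes the group, hence its subsets with j
      elements.\<close>
    have "(\<Sum>A | A \<in> Pow ?W \<and> card A = j. \<Prod>w\<in>?W - A. complex_of_real (u \<xi> \<bullet> - w v)) =
          (\<Sum>A | A \<in> Pow ?W \<and> card A = j. \<Prod>w\<in>?W - A. complex_of_real (\<xi> \<bullet> - w v))"
    proof (rule sum.reindex_bij_witness[where i="(`) ((\<circ>) u)" and j="(`) ((\<circ>) u')"])
      fix A assume A: "A \<in> {A. A \<in> Pow ?W \<and> card A = j}"
      show "(\<circ>) u ` (\<circ>) u' ` A = A" "(\<circ>) u' ` (\<circ>) u ` A = A" by (simp_all add: image_image canc)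
      show "(\<circ>) u' ` A \<in> {A. A \<in> Pow ?W \<and> card A = j}" "(\<circ>) u ` A \<in> {A. A \<in> Pow ?W \<and> card A = j}"
        using A weyl_comp u u' by (auto simp: card_image inj)
      have "?W - (\<circ>) u' ` A = (\<circ>) u' ` (?W - A)"
        using A img inj_on_image_set_diff[OF inj(2)[of ?W], of ?W A] by auto
      then have "(\<Prod>w\<in>?W - (\<circ>) u' ` A. complex_of_real (\<xi> \<bullet> - w v)) = (\<Prod>w\<in>?W - A. complex_of_real (\<xi> \<bullet> - (u' \<circ> w) v))"
        by (simp add: prod.reindex[OF inj(2)])
      moreover have "\<xi> \<bullet> u' x = u \<xi> \<bullet> x" for x
        using weyl_inner[OF u, of \<xi> "u' x"] u'(2) by (simp add: fun_eq_iff)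
      ultimately show "(\<Prod>w\<in>?W - (\<circ>) u' ` A. complex_of_real (\<xi> \<bullet> - w v)) = (\<Prod>w\<in>?W - A. complex_of_real (u \<xi> \<bullet> - w v))"
        by simp
    qed
    then show "sym_eval (real_point (u \<xi>)) (e j) = sym_eval (real_point \<xi>) (e j)"
      by (simp add: ev)
  qed
  have "0 = (\<Prod>w\<in>?W. sym_vec v + sym_vec (- w v))"
  proof (rule prod_zero[OF fin, symmetric])
    have "sym_vec v + sym_vec (- v) = 0"
      by (simp add: sym_vec_def flip: sum.distrib single_add)
    then show "\<exists>w\<in>?W. sym_vec v + sym_vec (- w v) = 0"
      using weyl_group.intros(1)[of R] by (intro bexI[of _ id]) auto
  qed
  also have "\<dots> = (\<Sum>A\<in>Pow ?W. sym_vec v ^ card A * (\<Prod>w\<in>?W - A. sym_vec (- w v)))"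
    by (simp add: prod_add[OF fin])
  also have "\<dots> = (\<Sum>j\<in>{..N}. \<Sum>A | A \<in> Pow ?W \<and> card A = j. sym_vec v ^ card A * (\<Prod>w\<in>?W - A. sym_vec (- w v)))"
    by (rule sum.group[symmetric]) (use fin in \<open>auto simp: N_def card_mono\<close>)
  also have "\<dots> = (\<Sum>j\<in>{..N}. sym_vec v ^ j * e j)"
    unfolding e_def sum_distrib_left by (auto intro!: sum.cong)
  finally have zero: "(\<Sum>j\<in>{..N}. sym_vec v ^ j * e j) = 0" by simp
  define c where "c j = sym_eval lam (e j)" for j
  have "{A. A \<in> Pow ?W \<and> card A = N} = {?W}"
    using card_subset_eq[OF fin] by (auto simp: N_def)
  then have "e N = 1" unfolding e_def by simp
  then have cN: "c N = 1" by (simp add: c_def)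
  have "(\<Sum>j\<le>N. c j * (dir_deriv v ^^ j) f x) = 0" if U: "open U" and f: "f \<in> sol R lam U" and x: "x \<in> U" for U f x
  proof -
    have sf: "smooth_on U f" by (rule solD(1)[OF f])
    have "(\<Sum>j\<le>N. c j * (dir_deriv v ^^ j) f x) = (\<Sum>j\<le>N. pd (sym_vec v ^ j * e j) f x)"
    proof (rule sum.cong[OF refl])
      fix j
      have "pd (sym_vec v ^ j * e j) f x = pd (sym_vec v ^ j) (pd (e j) f) x"
        by (rule pd_mult[OF U sf x])
      also have "\<dots> = pd (sym_vec v ^ j) (\<lambda>x. c j * f x) x"
        unfolding c_def by (rule pd_cong[OF U solD(2)[OF f eR e_inv] x])
      also have "\<dots> = c j * (dir_deriv v ^^ j) f x"
        by (simp add: pd_fun_scale[OF U sf x] pd_vec_power[OF U sf x])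
      finally show "c j * (dir_deriv v ^^ j) f x = pd (sym_vec v ^ j * e j) f x" by simp
    qed
    also have "\<dots> = pd (\<Sum>j\<le>N. sym_vec v ^ j * e j) f x" by (simp add: pd_sum)
    also have "\<dots> = 0" by (simp add: zero pd_zero)
    finally show ?thesis .
  qed
  with cN show ?thesis unfolding N_def by blast
qed

section \<open>Linear ordinary differential equations with constant coefficients\<close>

locale ode =
  fixes N :: nat and c :: "nat \<Rightarrow> complex"
  assumes cN: "c N = 1"
begin

text \<open>The solution of the recursion sum_l c l d(i + l) = 0 with initial values d i = 1 for i =
  j and 0 for the other i < N: these are the derivatives at 0 of the j-th fundamental
  solution.\<close>

function fund :: "nat \<Rightarrow> nat \<Rightarrow> complex" where
  "fund j i = (if i < N then (if i = j then 1 else 0) else - (\<Sum>l\<in>{..<N}. c l * fund j (i - N + l)))"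
  by pat_completeness auto
termination by (relation "inv_image less_than snd") auto

declare fund.simps [simp del]

lemma fund_init: "i < N \<Longrightarrow> fund j i = (if i = j then 1 else 0)"
  by (simp add: fund.simps)

lemma rec_solve:
  assumes "(\<Sum>l\<le>N. c l * d l) = (0::complex)" shows "d N = - (\<Sum>l<N. c l * d l)"
  using assms by (simp add: lessThan_Suc_atMost[symmetric] cN eq_neg_iff_add_eq_0 add.commute)

lemma fund_rec: "(\<Sum>l\<le>N. c l * fund j (i + l)) = 0"
  using fund.simps[of j "i + N"] by (simp add: lessThan_Suc_atMost[symmetric] cN)

lemma rec_expand:
  assumes d: "\<And>i. (\<Sum>l\<le>N. c l * d (i + l)) = 0"
  shows "d i = (\<Sum>j<N. d j * fund j i)"
proof (induction i rule: less_induct)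
  case (less i)
  show ?case
  proof (cases "i < N")
    case True
    then have "(\<Sum>j<N. d j * fund j i) = (\<Sum>j<N. if j = i then d i else 0)"
      by (intro sum.cong) (auto simp: fund_init)
    then show ?thesis using True by simp
  next
    case False
    define k where "k = i - N"
    have i: "i = k + N" using False by (simp add: k_def)
    have "d i = - (\<Sum>l<N. c l * d (k + l))"
      using rec_solve[of "\<lambda>l. d (k + l)"] d[of k] i by simp
    also have "\<dots> = - (\<Sum>l<N. \<Sum>j<N. d j * (c l * fund j (k + l)))"
      using less.IH i by (simp add: sum_distrib_left mult_ac)
    also have "\<dots> = (\<Sum>j<N. d j * (- (\<Sum>l<N. c l * fund j (k + l))))"
      by (subst sum.swap) (simp add: sum_distrib_left sum_negf)
    also have "\<dots> = (\<Sum>j<N. d j * fund j i)"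
      using rec_solve[of "\<lambda>l. fund _ (k + l)"] fund_rec i by simp
    finally show ?thesis .
  qed
qed

text \<open>A growth rate for the recursion: the new value is at most K - 1 times a bound for the N
  preceding ones. The summand 1 ensures K >= 1, so that the bounds M K^i increase with i.\<close>

definition K :: real where "K = 1 + (\<Sum>j<N. norm (c j))"

lemma K_ge_1: "K \<ge> 1" by (simp add: K_def sum_nonneg)

lemma rec_bound:
  assumes d: "\<And>i. (\<Sum>l\<le>N. c l * d (i + l)) = 0" and M: "M \<ge> 0" "\<And>i. i < N \<Longrightarrow> norm (d i) \<le> M"
  shows "norm (d i) \<le> M * K ^ i"
proof (induction i rule: less_induct)
  case (less i)
  show ?case
  proof (cases "i < N")
    case True
    then show ?thesis using M(2)[OF True] one_le_power[OF K_ge_1, of i] M(1)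
      by (meson mult_left_le mult_le_cancel_left1 order_trans linorder_not_less)
  next
    case False
    define k where "k = i - N"
    have i: "i = k + N" using False by (simp add: k_def)
    show ?thesis
    proof (cases "N = 0")
      case True
      then have "d i = 0" using d[of i] cN by simp
      then show ?thesis using M K_ge_1 by simp
    next
      case Npos: False
      have "norm (d i) = norm (\<Sum>l<N. c l * d (k + l))"
        using rec_solve[of "\<lambda>l. d (k + l)"] d[of k] i by simp
      also have "\<dots> \<le> (\<Sum>l<N. norm (c l) * (M * K ^ (i - 1)))"
      proof (rule order_trans[OF norm_sum], rule sum_mono)
        fix l assume l: "l \<in> {..<N}"
        have "norm (d (k + l)) \<le> M * K ^ (k + l)" using less.IH[of "k + l"] l i by simp
        also have "\<dots> \<le> M * K ^ (i - 1)"
          using l i M K_ge_1 by (intro mult_left_mono power_increasing) auto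
        finally show "norm (c l * d (k + l)) \<le> norm (c l) * (M * K ^ (i - 1))"
          by (simp add: norm_mult mult_left_mono)
      qed
      also have "\<dots> = (K - 1) * (M * K ^ (i - 1))" by (simp add: K_def sum_distrib_right)
      also have "\<dots> \<le> K * (M * K ^ (i - 1))"
        using M K_ge_1 by (intro mult_right_mono) auto
      also have "\<dots> = M * K ^ i" using i Npos by (simp add: mult.left_commute flip: power_Suc)
      finally show ?thesis .
    qed
  qed
qed

lemma fund_bound: "norm (fund j i) \<le> K ^ i"
  using rec_bound[of "fund j" 1 i] fund_rec[of j] by (auto simp: fund_init)

text \<open>The i-th derivative of the j-th fundamental solution \<open>E j 0\<close>, as an
  everywhere convergent power series.\<close>

definition E :: "nat \<Rightarrow> nat \<Rightarrow> complex \<Rightarrow> complex" where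
  "E j i z = suminf (\<lambda>l. fund j (l + i) / fact l * z ^ l)"

lemma E_abs_summable: "summable (\<lambda>l. norm (fund j (l + i) / fact l * z ^ l))"
proof (rule summable_comparison_test')
  show "summable (\<lambda>l. K ^ i * ((K * norm z) ^ l /\<^sub>R fact l))"
    by (intro summable_mult summable_exp_generic)
  fix l :: nat
  have "norm (fund j (l + i) / fact l * z ^ l) \<le> K ^ (l + i) / fact l * norm z ^ l"
    unfolding norm_mult norm_divide norm_power norm_fact
    by (intro mult_right_mono divide_right_mono fund_bound) simp_all
  also have "\<dots> = K ^ i * ((K * norm z) ^ l /\<^sub>R fact l)"
    by (simp only: power_add power_mult_distrib divide_inverse real_scaleR_def mult_ac)
  finally show "norm (norm (fund j (l + i) / fact l * z ^ l)) \<le> K ^ i * ((K * norm z) ^ l /\<^sub>R fact l)"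
    by (simp only: real_norm_def abs_norm_cancel)
qed

lemma E_sums: "(\<lambda>l. fund j (l + i) / fact l * z ^ l) sums E j i z"
  unfolding E_def by (rule summable_sums[OF summable_norm_cancel[OF E_abs_summable]])

lemma E_deriv: "(E j i has_field_derivative E j (Suc i) z) (at z)"
proof -
  have "diffs (\<lambda>l. fund j (l + i) / fact l) = (\<lambda>l. fund j (l + Suc i) / fact l)"
    by (rule ext) (simp add: diffs_def field_simps del: of_nat_Suc)
  moreover have "DERIV (\<lambda>z. suminf (\<lambda>l. fund j (l + i) / fact l * z ^ l)) z :>
      suminf (\<lambda>l. diffs (\<lambda>l. fund j (l + i) / fact l) l * z ^ l)"
    by (rule termdiffs_strong_converges_everywhere[OF summable_norm_cancel[OF E_abs_summable]])
  ultimately show ?thesis by (simp add: E_def[abs_def])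
qed

lemma E_ode: "(\<Sum>l\<le>N. c l * E j (i + l) z) = 0"
proof -
  have "(\<lambda>n. \<Sum>l\<le>N. c l * (fund j (n + (i + l)) / fact n * z ^ n)) sums (\<Sum>l\<le>N. c l * E j (i + l) z)"
    by (intro sums_sum sums_mult E_sums)
  moreover have "(\<Sum>l\<le>N. c l * (fund j (n + (i + l)) / fact n * z ^ n)) = 0" for n
    using fund_rec[of j "n + i"] by (simp add: add.assoc flip: sum_distrib_right sum_divide_distrib times_divide_eq_right mult.assoc)
  ultimately show ?thesis using sums_unique2 by (metis (no_types, lifting) sums_0 sums_cong)
qed

text \<open>The recursion bounds the i-th derivative by M K^i on the whole segment, so the Taylor
  remainder tends to 0, and the Taylor coefficients are combinations of those of the fundamental
  solutions. Only the segment from 0 to t is involved, because the lemma is applied to functions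
  known only on a box.\<close>

lemma ode_taylor:
  fixes D :: "nat \<Rightarrow> real \<Rightarrow> complex"
  assumes der: "\<And>i s. s \<in> {0..1} \<Longrightarrow> (D i has_vector_derivative D (Suc i) (s * t)) (at (s * t))"
    and rec: "\<And>i s. s \<in> {0..1} \<Longrightarrow> (\<Sum>l\<le>N. c l * D (i + l) (s * t)) = 0"
  shows "D 0 t = (\<Sum>j<N. D j 0 * E j 0 (complex_of_real t))"
proof -
  \<comment> \<open>The m-th derivative of s -> D 0 (s t); rescaling to the unit interval treats
    both signs of t at once.\<close>
  define h where "h m s = of_real t ^ m * D m (s * t)" for m s
  have hder: "(h m has_vector_derivative h (Suc m) s) (at s within {0..1})" if "s \<in> {0..1}" for m s
  proof -
    have "((\<lambda>s. D m (s * t)) has_vector_derivative t *\<^sub>R D (Suc m) (s * t)) (at s within {0..1})"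
    proof -
      have "((\<lambda>s. s * t) has_vector_derivative t) (at s within {0..1})"
        by (auto intro!: derivative_eq_intros simp flip: has_real_derivative_iff_has_vector_derivative)
      from vector_diff_chain_within[OF this has_vector_derivative_at_within[OF der[OF that]]]
      show ?thesis by (simp add: o_def)
    qed
    then have "((\<lambda>s. of_real t ^ m * D m (s * t)) has_vector_derivative of_real t ^ m * (t *\<^sub>R D (Suc m) (s * t))) (at s within {0..1})"
      by (rule has_vector_derivative_mult_right)
    then show ?thesis by (simp add: h_def[abs_def] scaleR_conv_of_real mult_ac)
  qed
  have cont: "continuous_on {0..1} (\<lambda>s. D m (s * t))" for m
  proof (rule continuous_at_imp_continuous_on, rule ballI)
    fix s :: real assume s: "s \<in> {0..1}"
    have "isCont (D m) (s * t)" by (rule has_vector_derivative_continuous[OF der[OF s]])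
    then show "isCont (\<lambda>s. D m (s * t)) s"
      using isCont_o2[of s "\<lambda>s. s * t" "D m"] by simp
  qed
  have "\<exists>M\<ge>0. \<forall>i<N. \<forall>s\<in>{0..1}. norm (D i (s * t)) \<le> M"
  proof -
    have "\<exists>M. \<forall>s\<in>{0..1}. norm (D i (s * t)) \<le> M" for i
      using compact_imp_bounded[OF compact_continuous_image[OF cont[of i] compact_Icc]]
      unfolding bounded_iff by auto
    then obtain m where m: "\<And>i s. s \<in> {0..1} \<Longrightarrow> norm (D i (s * t)) \<le> m i" by metis
    have "norm (D i (s * t)) \<le> (\<Sum>i<N. \<bar>m i\<bar>)" if "i < N" "s \<in> {0..1}" for i s
    proof -
      have "norm (D i (s * t)) \<le> \<bar>m i\<bar>" using m[OF that(2), of i] by simp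
      also have "\<dots> \<le> (\<Sum>i<N. \<bar>m i\<bar>)" by (rule member_le_sum) (use that in auto)
      finally show ?thesis .
    qed
    then show ?thesis by (intro exI[of _ "\<Sum>i<N. \<bar>m i\<bar>"]) (auto simp: sum_nonneg)
  qed
  then obtain M where M: "M \<ge> 0" "\<And>i s. i < N \<Longrightarrow> s \<in> {0..1} \<Longrightarrow> norm (D i (s * t)) \<le> M" by blast
  have bnd: "norm (D i (s * t)) \<le> M * K ^ i" if "s \<in> {0..1}" for i s
    by (rule rec_bound) (use M that rec[OF that] in auto)
  have "(\<lambda>i. D i 0 / fact i * of_real t ^ i) sums D 0 t"
    unfolding sums_def
  proof (rule Lim_transform_bound[where g="\<lambda>p. M * (K * \<bar>t\<bar>) * ((K * \<bar>t\<bar>) ^ (p - 1) / fact (p - 1))", THEN LIM_zero_cancel])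
    show "\<forall>\<^sub>F p in sequentially. norm ((\<Sum>i<p. D i 0 / fact i * of_real t ^ i) - D 0 t)
            \<le> norm (M * (K * \<bar>t\<bar>) * ((K * \<bar>t\<bar>) ^ (p - 1) / fact (p - 1)))"
      unfolding eventually_sequentially
    proof (intro exI allI impI)
      fix p :: nat assume p: "1 \<le> p"
      define i where "i s = ((1 - s) ^ (p - 1) / fact (p - 1)) *\<^sub>R h p s" for s
      have "(i has_integral h 0 1 - (\<Sum>i<p. ((1 - 0) ^ i / fact i) *\<^sub>R h i 0)) {0..1}"
        unfolding i_def by (rule Taylor_has_integral) (use p hder in auto)
      moreover have "norm (i s) \<le> M * (K * \<bar>t\<bar>) ^ p / fact (p - 1)" if s: "s \<in> {0..1}" for s
      proof -
        have "norm (i s) = (1 - s) ^ (p - 1) / fact (p - 1) * (\<bar>t\<bar> ^ p * norm (D p (s * t)))"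
          using s by (simp add: i_def h_def norm_mult norm_power)
        also have "\<dots> \<le> 1 / fact (p - 1) * (\<bar>t\<bar> ^ p * (M * K ^ p))"
          using s bnd[OF s, of p] by (intro mult_mono divide_right_mono power_le_one mult_left_mono) auto
        finally show ?thesis by (simp add: power_mult_distrib mult_ac)
      qed
      moreover have "0 \<le> M * (K * \<bar>t\<bar>) ^ p / fact (p - 1)" using M K_ge_1 by simp
      ultimately have "norm (h 0 1 - (\<Sum>i<p. ((1 - 0) ^ i / fact i) *\<^sub>R h i 0)) \<le> M * (K * \<bar>t\<bar>) ^ p / fact (p - 1) * measure lborel (cbox 0 (1::real))"
        by (intro has_integral_bound[of _ i]) auto
      moreover have "(\<Sum>i<p. ((1 - 0) ^ i / fact i) *\<^sub>R h i 0) = (\<Sum>i<p. D i 0 / fact i * of_real t ^ i)"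
        by (rule sum.cong) (auto simp: h_def scaleR_conv_of_real)
      moreover have "M * (K * \<bar>t\<bar>) ^ p / fact (p - 1) = M * (K * \<bar>t\<bar>) * ((K * \<bar>t\<bar>) ^ (p - 1) / fact (p - 1))"
        using p by (simp flip: power_Suc add: power_eq_if mult_ac)
      moreover have "measure lborel (cbox 0 (1::real)) = 1" "h 0 1 = D 0 t" by (simp_all add: h_def)
      ultimately have "norm (D 0 t - (\<Sum>i<p. D i 0 / fact i * of_real t ^ i)) \<le> M * (K * \<bar>t\<bar>) * ((K * \<bar>t\<bar>) ^ (p - 1) / fact (p - 1))"
        by (simp only: mult_1_right)
      then show "norm ((\<Sum>i<p. D i 0 / fact i * of_real t ^ i) - D 0 t)
            \<le> norm (M * (K * \<bar>t\<bar>) * ((K * \<bar>t\<bar>) ^ (p - 1) / fact (p - 1)))"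
        unfolding norm_minus_commute[of "D 0 t"] real_norm_def by (rule order_trans[OF _ abs_ge_self])
    qed
    have "(\<lambda>n. (K * \<bar>t\<bar>) ^ n /\<^sub>R fact n) \<longlonglongrightarrow> 0"
      by (rule summable_LIMSEQ_zero[OF summable_exp_generic])
    then have "(\<lambda>n. (K * \<bar>t\<bar>) ^ (n - 1) / fact (n - 1)) \<longlonglongrightarrow> 0"
      by (subst filterlim_sequentially_Suc[symmetric]) (simp add: field_simps)
    then show "(\<lambda>p. M * (K * \<bar>t\<bar>) * ((K * \<bar>t\<bar>) ^ (p - 1) / fact (p - 1))) \<longlonglongrightarrow> 0"
      by (rule tendsto_mult_right_zero)
  qed
  moreover have "(\<lambda>i. D i 0 / fact i * of_real t ^ i) sums (\<Sum>j<N. D j 0 * E j 0 (of_real t))"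
  proof -
    have eq: "D i 0 / fact i * of_real t ^ i = (\<Sum>j<N. D j 0 * (fund j (i + 0) / fact i * of_real t ^ i))" for i
    proof -
      have "D i 0 = (\<Sum>j<N. D j 0 * fund j i)"
        by (rule rec_expand) (use rec[of 0] in simp)
      then have "D i 0 / fact i * of_real t ^ i = (\<Sum>j<N. D j 0 * fund j i) / fact i * of_real t ^ i" by (rule arg_cong)
      then show ?thesis by (simp only: sum_distrib_right sum_divide_distrib times_divide_eq_right mult.assoc add_0_right times_divide_eq_left)
    qed
    show ?thesis by (subst sums_cong[OF eq]) (intro sums_sum sums_mult E_sums)
  qed
  ultimately show ?thesis by (rule sums_unique2)
qed

end


section \<open>Solutions of an equation in every coordinate direction\<close>

lemma has_sum_finite_sum:
  fixes f :: "'i \<Rightarrow> 'k \<Rightarrow> complex"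
  assumes "finite I" "\<And>i. i \<in> I \<Longrightarrow> (f i has_sum s i) A"
  shows "((\<lambda>k. \<Sum>i\<in>I. f i k) has_sum (\<Sum>i\<in>I. s i)) A"
  using assms by (induction I rule: finite_induct) (auto intro: has_sum_add)

text \<open>Replaces sums over multi-indices by sums over a product of copies of the natural
  numbers, where a product of absolutely convergent series can be multiplied out.\<close>

lemma bij_lookup:
  "bij_betw (\<lambda>m::'a::euclidean_space \<Rightarrow>\<^sub>0 nat. restrict (Poly_Mapping.lookup m) Basis) multi_indices (Basis \<rightarrow>\<^sub>E (UNIV :: nat set))"
proof (rule bij_betwI[where g="\<lambda>g. Abs_poly_mapping (\<lambda>b. if b \<in> Basis then g b else 0)"])
  have lk: "Poly_Mapping.lookup (Abs_poly_mapping (\<lambda>b::'a. if b \<in> Basis then g b else (0::nat))) = (\<lambda>b. if b \<in> Basis then g b else 0)" for g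
    by (rule Abs_poly_mapping_inverse) (auto intro: finite_subset[OF _ finite_Basis[where 'a='a]])
  show "(\<lambda>g. Abs_poly_mapping (\<lambda>b::'a. if b \<in> Basis then g b else 0)) \<in> (Basis \<rightarrow>\<^sub>E (UNIV :: nat set)) \<rightarrow> multi_indices"
    by (auto simp: multi_indices_def in_keys_iff lk split: if_splits)
  show "Abs_poly_mapping (\<lambda>b. if b \<in> Basis then restrict (Poly_Mapping.lookup m) Basis b else 0) = m"
    if "m \<in> multi_indices" for m :: "'a \<Rightarrow>\<^sub>0 nat"
    by (rule poly_mapping_eqI) (use that in \<open>auto simp: lk multi_indices_def in_keys_iff\<close>)
  show "restrict (Poly_Mapping.lookup (Abs_poly_mapping (\<lambda>b::'a. if b \<in> Basis then g b else (0::nat)))) Basis = g"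
    if "g \<in> Basis \<rightarrow>\<^sub>E (UNIV :: nat set)" for g
  proof
    fix b :: 'a
    show "restrict (Poly_Mapping.lookup (Abs_poly_mapping (\<lambda>b::'a. if b \<in> Basis then g b else (0::nat)))) Basis b = g b"
    proof (cases "b \<in> Basis")
      case False
      then show ?thesis using PiE_arb[OF that False] by simp
    qed (simp add: lk)
  qed
qed auto

locale odes =
  fixes N :: nat and c :: "'a::euclidean_space \<Rightarrow> nat \<Rightarrow> complex"
  assumes cN: "\<And>b. c b N = 1"
begin

lemma ode_c: "ode N (c b)" by standard (rule cN)

abbreviation EE :: "'a \<Rightarrow> nat \<Rightarrow> nat \<Rightarrow> complex \<Rightarrow> complex" where
  "EE b \<equiv> ode.E N (c b)"

definition P :: "'a \<Rightarrow> 'a sympoly" where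
  "P b = (\<Sum>l\<le>N. sym_const (c b l) * sym_vec b ^ l)"

text \<open>Only the equations in the coordinate directions are kept; these alone already bound the
  dimension and imply analyticity.\<close>

definition osol :: "'a set \<Rightarrow> ('a \<Rightarrow> complex) set" where
  "osol U = {f. smooth_on U f \<and> (\<forall>b\<in>Basis. \<forall>x\<in>U. pd (P b) f x = 0)}"

lemma pd_P:
  assumes U: "open U" and f: "smooth_on U f" and x: "x \<in> U"
  shows "pd (P b) f x = (\<Sum>l\<le>N. c b l * (dir_deriv b ^^ l) f x)"
  by (simp add: P_def pd_sum pd_mult[OF U f x] pd_const pd_vec_power[OF U f x])

lemma osol_pd:
  assumes U: "open U" and f: "f \<in> osol U"
  shows "pd q f \<in> osol U"
proof -
  have sf: "smooth_on U f" using f by (simp add: osol_def)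
  have "pd (P b) (pd q f) x = 0" if b: "b \<in> Basis" and x: "x \<in> U" for b x
  proof -
    have "pd (P b) (pd q f) x = pd q (pd (P b) f) x"
      using pd_mult[OF U sf x, of "P b" q] pd_mult[OF U sf x, of q "P b"] by (simp add: mult.commute)
    also have "\<dots> = pd q (\<lambda>x. 0 * f x) x"
      by (rule pd_cong[OF U _ x]) (use f b in \<open>auto simp: osol_def\<close>)
    also have "\<dots> = 0 * pd q f x" by (rule pd_fun_scale[OF U sf x])
    finally show ?thesis by simp
  qed
  then show ?thesis by (simp add: osol_def smooth_on_pd[OF U sf])
qed

lemma osol_lin:
  assumes U: "open U" and f: "\<And>i. i \<in> I \<Longrightarrow> f i \<in> osol U"
  shows "(\<lambda>x. \<Sum>i\<in>I. k i * f i x) \<in> osol U"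
proof -
  have sf: "\<And>i. i \<in> I \<Longrightarrow> smooth_on U (f i)" using f by (simp add: osol_def)
  have "pd (P b) (\<lambda>x. \<Sum>i\<in>I. k i * f i x) x = 0" if "b \<in> Basis" "x \<in> U" for b x
    using that f by (simp add: pd_fun_sum[OF U] smooth_on_cmult[OF U] sf pd_fun_scale[OF U] osol_def)
  then show ?thesis using sf by (simp add: osol_def smooth_on_sum[OF U] smooth_on_cmult[OF U])
qed

text \<open>From each point of U a single coordinate can be moved to that of y without leaving U.
  This is all that solving one coordinate after another requires, and it holds for boxes and for the
  whole space.\<close>

definition boxy :: "'a set \<Rightarrow> 'a \<Rightarrow> bool" where
  "boxy U y \<longleftrightarrow> y \<in> U \<and> (\<forall>x\<in>U. \<forall>b\<in>Basis. \<forall>s\<in>{0..1}. x + (s * ((y - x) \<bullet> b)) *\<^sub>R b \<in> U)"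

lemma rep_step:
  assumes U: "open U" and bx: "boxy U y" and f: "f \<in> osol U" and x: "x \<in> U" and b: "b \<in> Basis"
  shows "f x = (\<Sum>j<N. pd (sym_vec b ^ j) f (x + ((y - x) \<bullet> b) *\<^sub>R b) * EE b j 0 (complex_of_real ((x - y) \<bullet> b)))"
proof -
  interpret ode N "c b" by (rule ode_c)
  define z where "z = x + ((y - x) \<bullet> b) *\<^sub>R b"
  define t where "t = (x - y) \<bullet> b"
  have sf: "smooth_on U f" using f by (simp add: osol_def)
  have zt: "z + (s * t) *\<^sub>R b \<in> U" if s: "s \<in> {0..1}" for s
  proof -
    have "z + (s * t) *\<^sub>R b = x + ((1 - s) * ((y - x) \<bullet> b)) *\<^sub>R b"
      by (simp add: z_def t_def inner_diff_left algebra_simps)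
    then show ?thesis using bx x b s unfolding boxy_def by simp
  qed
  define D where "D i s = (dir_deriv b ^^ i) f (z + s *\<^sub>R b)" for i s
  have sm: "smooth_on U ((dir_deriv b ^^ i) f)" for i
    by (induction i) (simp_all add: sf smooth_onD)
  have "D 0 t = (\<Sum>j<N. D j 0 * E j 0 (complex_of_real t))"
  proof (rule ode_taylor)
    fix i and s :: real assume s: "s \<in> {0..1}"
    show "(D i has_vector_derivative D (Suc i) (s * t)) (at (s * t))"
      unfolding D_def[abs_def]
      using has_vector_derivative_dir_deriv[of "(dir_deriv b ^^ i) f" z "s * t" b] smooth_onD(1)[OF sm zt[OF s]] by simp
    have "pd (sym_vec b ^ l) (pd (sym_vec b ^ i) f) (z + (s * t) *\<^sub>R b) = D (i + l) (s * t)" for l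
      unfolding pd_mult[OF U sf zt[OF s], symmetric] power_add[symmetric] D_def
      by (simp add: pd_vec_power[OF U sf zt[OF s]] add.commute)
    then have "(\<Sum>l\<le>N. c b l * D (i + l) (s * t)) = pd (P b) (pd (sym_vec b ^ i) f) (z + (s * t) *\<^sub>R b)"
      using zt[OF s]
      by (simp add: P_def pd_sum pd_mult[OF U smooth_on_pd[OF U sf]] pd_const)
    also have "\<dots> = 0" using osol_pd[OF U f] b zt[OF s] by (simp add: osol_def)
    finally show "(\<Sum>l\<le>N. c b l * D (i + l) (s * t)) = 0" .
  qed
  moreover have "z + t *\<^sub>R b = x" by (simp add: z_def t_def inner_diff_left algebra_simps)
  moreover have "z \<in> U" using zt[of 0] by simp
  ultimately show ?thesis
    unfolding z_def[symmetric] t_def[symmetric] by (simp add: D_def pd_vec_power[OF U sf])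
qed

text \<open>Induction on the set S of coordinates in which x may differ from y. One application of
  \<open>rep_step\<close> removes a coordinate, and the hypothesis is used for the derivatives of f,
  which are solutions again.\<close>

lemma rep_partial:
  assumes U: "open U" and bx: "boxy U y"
  shows "finite S \<Longrightarrow> S \<subseteq> Basis \<Longrightarrow> f \<in> osol U \<Longrightarrow> x \<in> U \<Longrightarrow> (\<And>b. b \<in> Basis - S \<Longrightarrow> x \<bullet> b = y \<bullet> b) \<Longrightarrow>
     f x = (\<Sum>m\<in>S \<rightarrow>\<^sub>E {..<N}. pd (\<Prod>b\<in>S. sym_vec b ^ m b) f y * (\<Prod>b\<in>S. EE b (m b) 0 (complex_of_real ((x - y) \<bullet> b))))"
proof (induction S arbitrary: f x rule: finite_induct)
  case empty
  have "x = y" by (rule euclidean_eqI) (use empty in auto)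
  then show ?case by (simp add: pd_one)
next
  case (insert b S)
  have b: "b \<in> Basis" and S: "S \<subseteq> Basis" using insert.prems by auto
  have sf: "smooth_on U f" and y: "y \<in> U" using insert.prems bx by (auto simp: osol_def boxy_def)
  define z where "z = x + ((y - x) \<bullet> b) *\<^sub>R b"
  have z: "z \<in> U" using bx insert.prems(3) b unfolding boxy_def z_def by (metis atLeastAtMost_iff mult_1 order_refl zero_le_one)
  have zb: "z \<bullet> b' = (if b' = b then y \<bullet> b else x \<bullet> b')" if "b' \<in> Basis" for b'
    using that b by (simp add: z_def inner_add_left inner_diff_left inner_Basis)
  have s1: "f x = (\<Sum>j<N. pd (sym_vec b ^ j) f z * EE b j 0 (complex_of_real ((x - y) \<bullet> b)))" (is "_ = ?R1")
    unfolding z_def by (rule rep_step[OF U bx insert.prems(2,3) b])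
  have s2: "?R1 = (\<Sum>j<N. (\<Sum>m\<in>S \<rightarrow>\<^sub>E {..<N}. pd (\<Prod>b\<in>S. sym_vec b ^ m b) (pd (sym_vec b ^ j) f) y *
        (\<Prod>b'\<in>S. EE b' (m b') 0 (complex_of_real ((z - y) \<bullet> b')))) * EE b j 0 (complex_of_real ((x - y) \<bullet> b)))" (is "_ = ?R2")
  proof (intro sum.cong refl arg_cong2[where f=times])
    fix j
    show "pd (sym_vec b ^ j) f z = (\<Sum>m\<in>S \<rightarrow>\<^sub>E {..<N}. pd (\<Prod>b\<in>S. sym_vec b ^ m b) (pd (sym_vec b ^ j) f) y *
        (\<Prod>b'\<in>S. EE b' (m b') 0 (complex_of_real ((z - y) \<bullet> b'))))"
      by (rule insert.IH[OF S osol_pd[OF U insert.prems(2)] z]) (use insert.prems(4) zb in auto)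
  qed
  have s3: "?R2 = (\<Sum>(j, m)\<in>{..<N} \<times> (S \<rightarrow>\<^sub>E {..<N}). pd (\<Prod>b\<in>S. sym_vec b ^ m b) (pd (sym_vec b ^ j) f) y *
        (\<Prod>b'\<in>S. EE b' (m b') 0 (complex_of_real ((z - y) \<bullet> b'))) * EE b j 0 (complex_of_real ((x - y) \<bullet> b)))" (is "_ = ?R3")
    by (simp add: sum_distrib_right sum.cartesian_product)
  have s4: "?R3 = (\<Sum>(j, m)\<in>{..<N} \<times> (S \<rightarrow>\<^sub>E {..<N}). pd (\<Prod>b'\<in>insert b S. sym_vec b' ^ (m(b := j)) b') f y *
        (\<Prod>b'\<in>insert b S. EE b' ((m(b := j)) b') 0 (complex_of_real ((x - y) \<bullet> b'))))" (is "_ = ?R4")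
  proof (intro sum.cong refl, clarify)
    fix j m
    have e1: "(\<Prod>b'\<in>S. EE b' (m b') 0 (complex_of_real ((z - y) \<bullet> b'))) = (\<Prod>b'\<in>S. EE b' ((m(b := j)) b') 0 (complex_of_real ((x - y) \<bullet> b')))"
      using insert.hyps S zb by (intro prod.cong) (auto simp: inner_diff_left)
    have e2: "(\<Prod>b\<in>S. sym_vec b ^ m b) = (\<Prod>b'\<in>S. sym_vec b' ^ (m(b := j)) b')"
      using insert.hyps by (intro prod.cong) auto
    have e3: "pd p (pd q f) y = pd (q * p) f y" for p q
      unfolding mult.commute[of q p] by (rule pd_mult[OF U sf y, symmetric])
    show "pd (\<Prod>b\<in>S. sym_vec b ^ m b) (pd (sym_vec b ^ j) f) y *
        (\<Prod>b'\<in>S. EE b' (m b') 0 (complex_of_real ((z - y) \<bullet> b'))) * EE b j 0 (complex_of_real ((x - y) \<bullet> b)) =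
        pd (\<Prod>b'\<in>insert b S. sym_vec b' ^ (m(b := j)) b') f y *
        (\<Prod>b'\<in>insert b S. EE b' ((m(b := j)) b') 0 (complex_of_real ((x - y) \<bullet> b')))"
      unfolding e1 e2 e3 prod.insert[OF insert.hyps] fun_upd_same by (simp only: mult_ac)
  qed
  have s5: "?R4 = (\<Sum>m\<in>insert b S \<rightarrow>\<^sub>E {..<N}. pd (\<Prod>b\<in>insert b S. sym_vec b ^ m b) f y *
        (\<Prod>b\<in>insert b S. EE b (m b) 0 (complex_of_real ((x - y) \<bullet> b))))" (is "_ = ?R5")
  proof (rule sum.reindex_cong[symmetric, OF _ PiE_insert_eq])
    show "inj_on (\<lambda>(y, g). g(b := y)) ({..<N} \<times> (S \<rightarrow>\<^sub>E {..<N}))"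
      by (rule inj_combinator[OF insert.hyps(2), of "\<lambda>_. {..<N}"])
  qed auto
  show ?case by (rule trans[OF s1 trans[OF s2 trans[OF s3 trans[OF s4 s5]]]])
qed

definition index_set :: "('a \<Rightarrow> nat) set" where
  "index_set = Basis \<rightarrow>\<^sub>E {..<N}"

text \<open>Products of one-variable fundamental solutions centred at y. By
  \<open>representation\<close> they span the solutions, and the derivatives \<open>DD m\<close> at
  y are the coefficients.\<close>

definition GG :: "'a \<Rightarrow> ('a \<Rightarrow> nat) \<Rightarrow> 'a \<Rightarrow> complex" where
  "GG y m x = (\<Prod>b\<in>Basis. EE b (m b) 0 (complex_of_real ((x - y) \<bullet> b)))"

definition DD :: "('a \<Rightarrow> nat) \<Rightarrow> 'a sympoly" where
  "DD m = (\<Prod>b\<in>Basis. sym_vec b ^ m b)"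

lemma finite_index_set: "finite index_set" by (simp add: index_set_def finite_PiE)

lemma representation:
  assumes "open U" "boxy U y" "f \<in> osol U" "x \<in> U"
  shows "f x = (\<Sum>m\<in>index_set. pd (DD m) f y * GG y m x)"
  unfolding index_set_def DD_def GG_def using rep_partial[OF assms(1,2) finite_Basis order_refl assms(3,4)] by simp

lemma boxy_UNIV: "boxy UNIV y" by (simp add: boxy_def)

lemma osol_unique:
  assumes "f \<in> osol UNIV" "g \<in> osol UNIV" "\<And>m. m \<in> index_set \<Longrightarrow> pd (DD m) f y = pd (DD m) g y"
  shows "f = g"
proof
  fix x
  show "f x = g x"
    unfolding representation[OF open_UNIV boxy_UNIV assms(1) UNIV_I, of x y]
      representation[OF open_UNIV boxy_UNIV assms(2) UNIV_I, of x y]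
    by (rule sum.cong) (simp_all add: assms(3))
qed

lemma osol_eq_on_open:
  assumes "f \<in> osol UNIV" "g \<in> osol UNIV" "open V" "y \<in> V" "\<And>x. x \<in> V \<Longrightarrow> f x = g x"
  shows "f = g"
  by (rule osol_unique[OF assms(1,2)]) (rule pd_cong[OF assms(3,5,4)])

text \<open>A factor of \<open>GG\<close>, with the order i of the derivative as an additional
  index, so that the family is closed under differentiation up to constants.\<close>

definition FF :: "'a \<Rightarrow> 'a \<Rightarrow> nat \<Rightarrow> nat \<Rightarrow> 'a \<Rightarrow> complex" where
  "FF y b j i x = EE b j i (complex_of_real ((x - y) \<bullet> b))"

lemma FF_deriv: "(FF y b j i has_derivative (\<lambda>v. complex_of_real (v \<bullet> b) * FF y b j (Suc i) x)) (at x)"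
proof -
  have "((\<lambda>x. complex_of_real ((x - y) \<bullet> b)) has_derivative (\<lambda>v. complex_of_real (v \<bullet> b))) (at x)"
    by (auto intro!: derivative_eq_intros)
  from has_derivative_compose[OF this ode.E_deriv[OF ode_c, unfolded has_field_derivative_def]]
  show ?thesis by (simp add: FF_def[abs_def] mult.commute)
qed

lemma FF_differentiable: "FF y b j i differentiable (at x)"
  using FF_deriv unfolding differentiable_def by blast

lemma FF_dir_deriv: "dir_deriv v (FF y b j i) = (\<lambda>x. complex_of_real (v \<bullet> b) * FF y b j (Suc i) x)"
  by (rule ext) (rule dir_deriv_eq[OF FF_deriv])

lemma FF_smooth: "smooth_on UNIV (FF y b j i)"
proof -
  have "Ck_on n UNIV (FF y b j i)" for n
  proof (induction n arbitrary: i)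
    case 0
    then show ?case
      using FF_deriv by (auto intro!: has_derivative_continuous continuous_at_imp_continuous_on)
  next
    case (Suc n)
    then show ?case
      by (auto simp: FF_dir_deriv FF_differentiable intro!: Ck_on_mult)
  qed
  then show ?thesis by (simp add: smooth_on_def)
qed

lemma GG_FF: "GG y m = (\<lambda>x. \<Prod>b\<in>Basis. FF y b (m b) 0 x)"
  by (simp add: GG_def[abs_def] FF_def)

lemma GG_smooth: "smooth_on UNIV (GG y m)"
  unfolding GG_FF by (intro smooth_on_prod FF_smooth open_UNIV)

lemma GG_osol: "GG y m \<in> osol UNIV"
proof -
  have "pd (P b) (GG y m) x = 0" if b: "b \<in> Basis" for b x
  proof -
    \<comment> \<open>The remaining factors are constant in the direction b, so \<open>P b\<close>
      acts on the factor of index b alone.\<close>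
    define r where "r x = (\<Prod>b'\<in>Basis - {b}. FF y b' (m b') 0 x)" for x
    have rinv: "r (x + t *\<^sub>R b) = r x" for x t
      unfolding r_def using b
      by (intro prod.cong) (auto simp: FF_def inner_add_left inner_diff_left inner_Basis)
    have GG: "GG y m = (\<lambda>x. FF y b (m b) 0 x * r x)"
      unfolding GG_FF r_def using prod.remove[OF finite_Basis b] by blast
    have der: "dir_deriv b (\<lambda>x. FF y b j i x * r x) = (\<lambda>x. FF y b j (Suc i) x * r x)" for j i
    proof
      fix x
      have "((\<lambda>t. FF y b j i (x + t *\<^sub>R b)) has_vector_derivative dir_deriv b (FF y b j i) (x + 0 *\<^sub>R b)) (at 0)"
        by (rule has_vector_derivative_dir_deriv) (rule FF_differentiable)
      then have "((\<lambda>t. FF y b j i (x + t *\<^sub>R b) * r x) has_vector_derivative FF y b j (Suc i) x * r x) (at 0)"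
        using b by (intro has_vector_derivative_mult_left) (simp add: FF_dir_deriv)
      then show "dir_deriv b (\<lambda>x. FF y b j i x * r x) x = FF y b j (Suc i) x * r x"
        by (simp add: dir_deriv_def rinv vector_derivative_at)
    qed
    have pw: "(dir_deriv b ^^ l) (GG y m) = (\<lambda>x. FF y b (m b) l x * r x)" for l
      by (induction l) (simp_all add: GG der)
    have "(\<Sum>l\<le>N. c b l * (dir_deriv b ^^ l) (GG y m) x) = (\<Sum>l\<le>N. c b l * FF y b (m b) (0 + l) x) * r x"
      by (simp add: pw sum_distrib_right mult.assoc)
    also have "\<dots> = 0" unfolding FF_def using ode.E_ode[OF ode_c, of b "m b" 0] by simp
    finally show ?thesis by (simp add: pd_P[OF open_UNIV GG_smooth])
  qed
  then show ?thesis by (simp add: osol_def GG_smooth)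
qed

text \<open>The right-hand side of \<open>representation\<close> is defined on the whole
  space.\<close>

lemma osol_extension:
  assumes "open U" "boxy U y" "f \<in> osol U"
  shows "\<exists>g\<in>osol UNIV. \<forall>x\<in>U. f x = g x"
  by (rule bexI[of _ "\<lambda>x. \<Sum>m\<in>index_set. pd (DD m) f y * GG y m x"])
    (use representation[OF assms] osol_lin[OF open_UNIV GG_osol] in auto)

lemma GG_has_sum:
  "((\<lambda>k. (\<Prod>b\<in>Basis. ode.fund N (c b) (m b) (Poly_Mapping.lookup k b) / fact (Poly_Mapping.lookup k b)) *
      complex_of_real (\<Prod>b\<in>Basis. ((x - y) \<bullet> b) ^ Poly_Mapping.lookup k b)) has_sum GG y m x) multi_indices"
proof -
  define f where "f b l = ode.fund N (c b) (m b) l / fact l * complex_of_real ((x - y) \<bullet> b) ^ l" for b l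
  have sm: "summable (\<lambda>l. norm (f b l))" for b
    using ode.E_abs_summable[OF ode_c, of b "m b" 0 "complex_of_real ((x - y) \<bullet> b)"] by (simp add: f_def)
  have abs: "Infinite_Set_Sum.abs_summable_on (f b) UNIV" for b
    unfolding abs_summable_equivalent[symmetric]
    using norm_summable_imp_summable_on[of "\<lambda>l. norm (f b l)"] sm by simp
  have E: "infsum (f b) UNIV = EE b (m b) 0 (complex_of_real ((x - y) \<bullet> b))" for b
  proof -
    have "f b sums EE b (m b) 0 (complex_of_real ((x - y) \<bullet> b))"
      using ode.E_sums[OF ode_c, of b "m b" 0 "complex_of_real ((x - y) \<bullet> b)"] by (simp add: f_def[abs_def])
    from norm_summable_imp_has_sum[OF sm this] show ?thesis by (rule infsumI)
  qed
  have pabs: "Infinite_Set_Sum.abs_summable_on (\<lambda>g. \<Prod>b\<in>Basis. f b (g b)) (Basis \<rightarrow>\<^sub>E UNIV)"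
    by (rule abs_summable_on_prod_PiE) (use abs in auto)
  have "(\<lambda>g. \<Prod>b\<in>Basis. f b (g b)) summable_on (Basis \<rightarrow>\<^sub>E UNIV)"
    using pabs unfolding abs_summable_equivalent[symmetric] by (rule abs_summable_summable)
  moreover have "infsum (\<lambda>g. \<Prod>b\<in>Basis. f b (g b)) (Basis \<rightarrow>\<^sub>E UNIV) = GG y m x"
    using infsetsum_prod_PiE[OF finite_Basis, of "\<lambda>_. UNIV" f] abs pabs
    by (simp add: infsetsum_infsum E GG_def)
  ultimately have "((\<lambda>g. \<Prod>b\<in>Basis. f b (g b)) has_sum GG y m x) (Basis \<rightarrow>\<^sub>E UNIV)"
    using has_sum_infsum by fastforce
  then have "((\<lambda>k. \<Prod>b\<in>Basis. f b (restrict (Poly_Mapping.lookup k) Basis b)) has_sum GG y m x) multi_indices"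
    by (subst has_sum_reindex_bij_betw[OF bij_lookup])
  then show ?thesis
    by (simp add: f_def prod.distrib prod_dividef)
qed

lemma osol_real_analytic:
  assumes "f \<in> osol UNIV" shows "real_analytic f"
  unfolding real_analytic_def
proof
  fix x
  define C where "C k = (\<Sum>m\<in>index_set. pd (DD m) f x *
     (\<Prod>b\<in>Basis. ode.fund N (c b) (m b) (Poly_Mapping.lookup k b) / fact (Poly_Mapping.lookup k b)))" for k
  have "((\<lambda>k. C k * complex_of_real (\<Prod>b\<in>Basis. ((y - x) \<bullet> b) ^ Poly_Mapping.lookup k b)) has_sum f y) multi_indices" for y
  proof -
    have "((\<lambda>k. \<Sum>m\<in>index_set. pd (DD m) f x * ((\<Prod>b\<in>Basis. ode.fund N (c b) (m b) (Poly_Mapping.lookup k b) / fact (Poly_Mapping.lookup k b)) *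
      complex_of_real (\<Prod>b\<in>Basis. ((y - x) \<bullet> b) ^ Poly_Mapping.lookup k b))) has_sum (\<Sum>m\<in>index_set. pd (DD m) f x * GG x m y)) multi_indices"
      by (intro has_sum_finite_sum finite_index_set has_sum_cmult_right GG_has_sum)
    then show ?thesis
      using representation[OF open_UNIV boxy_UNIV assms, of y x]
      by (simp add: C_def sum_distrib_right mult.assoc)
  qed
  then show "\<exists>r>0. \<exists>c. \<forall>y\<in>ball x r. ((\<lambda>m. c m * complex_of_real (\<Prod>b\<in>Basis. ((y - x) \<bullet> b) ^ Poly_Mapping.lookup m b)) has_sum f y) multi_indices"
    by (intro exI[of _ "1::real"] conjI exI[of _ C]) auto
qed

end

section \<open>Real analytic functions are smooth\<close>

lemma real_analytic_add:
  assumes "real_analytic f" "real_analytic g" shows "real_analytic (\<lambda>x. f x + g x)"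
  unfolding real_analytic_def
proof
  fix x
  obtain r1 c1 where 1: "r1 > 0" "\<forall>y\<in>ball x r1. ((\<lambda>m. c1 m * complex_of_real (\<Prod>b\<in>Basis. ((y - x) \<bullet> b) ^ Poly_Mapping.lookup m b)) has_sum f y) multi_indices"
    using assms(1) unfolding real_analytic_def by blast
  obtain r2 c2 where 2: "r2 > 0" "\<forall>y\<in>ball x r2. ((\<lambda>m. c2 m * complex_of_real (\<Prod>b\<in>Basis. ((y - x) \<bullet> b) ^ Poly_Mapping.lookup m b)) has_sum g y) multi_indices"
    using assms(2) unfolding real_analytic_def by blast
  have "((\<lambda>m. (c1 m + c2 m) * complex_of_real (\<Prod>b\<in>Basis. ((y - x) \<bullet> b) ^ Poly_Mapping.lookup m b)) has_sum f y + g y) multi_indices"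
    if "y \<in> ball x (min r1 r2)" for y
    unfolding distrib_right by (rule has_sum_add) (use that 1 2 in auto)
  then show "\<exists>r>0. \<exists>c. \<forall>y\<in>ball x r. ((\<lambda>m. c m * complex_of_real (\<Prod>b\<in>Basis. ((y - x) \<bullet> b) ^ Poly_Mapping.lookup m b)) has_sum f y + g y) multi_indices"
    using 1 2 by (intro exI[of _ "min r1 r2"] conjI exI[of _ "\<lambda>m. c1 m + c2 m"]) auto
qed

lemma real_analytic_cmult:
  assumes "real_analytic f" shows "real_analytic (\<lambda>x. a * f x)"
  unfolding real_analytic_def
proof
  fix x
  obtain r1 c1 where 1: "r1 > 0" "\<forall>y\<in>ball x r1. ((\<lambda>m. c1 m * complex_of_real (\<Prod>b\<in>Basis. ((y - x) \<bullet> b) ^ Poly_Mapping.lookup m b)) has_sum f y) multi_indices"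
    using assms(1) unfolding real_analytic_def by blast
  have "((\<lambda>m. (a * c1 m) * complex_of_real (\<Prod>b\<in>Basis. ((y - x) \<bullet> b) ^ Poly_Mapping.lookup m b)) has_sum a * f y) multi_indices"
    if "y \<in> ball x r1" for y
    unfolding mult.assoc by (rule has_sum_cmult_right) (use that 1 in auto)
  then show "\<exists>r>0. \<exists>c. \<forall>y\<in>ball x r. ((\<lambda>m. c m * complex_of_real (\<Prod>b\<in>Basis. ((y - x) \<bullet> b) ^ Poly_Mapping.lookup m b)) has_sum a * f y) multi_indices"
    using 1 by (intro exI[of _ r1] conjI exI[of _ "\<lambda>m. a * c1 m"]) auto
qed

lemma real_analytic_zero: "real_analytic (\<lambda>x. 0)"
  unfolding real_analytic_def
proof
  fix x :: 'a
  show "\<exists>r>0. \<exists>c. \<forall>y\<in>ball x r. ((\<lambda>m. c m * complex_of_real (\<Prod>b\<in>Basis. ((y - x) \<bullet> b) ^ Poly_Mapping.lookup m b)) has_sum 0) multi_indices"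
    by (rule exI[of _ "1::real"], simp, rule exI[of _ "\<lambda>_. 0"]) simp
qed

lemma real_analytic_sum:
  "finite I \<Longrightarrow> (\<And>i. i \<in> I \<Longrightarrow> real_analytic (f i)) \<Longrightarrow> real_analytic (\<lambda>x. \<Sum>i\<in>I. f i x)"
  by (induction I rule: finite_induct) (auto intro: real_analytic_add real_analytic_zero)

text \<open>An enumeration turns unordered sums over multi-indices into series, which can be
  differentiated term by term.\<close>

lemma multi_indices_bij_nat: "\<exists>e. bij_betw e (UNIV :: nat set) (multi_indices :: ('a::euclidean_space \<Rightarrow>\<^sub>0 nat) set)"
proof -
  have "countable ((\<lambda>m::'a \<Rightarrow>\<^sub>0 nat. restrict (Poly_Mapping.lookup m) Basis) ` multi_indices)"
    unfolding bij_betw_imp_surj_on[OF bij_lookup] by (intro countable_PiE finite_Basis) auto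
  then have "countable (multi_indices :: ('a \<Rightarrow>\<^sub>0 nat) set)"
    using bij_lookup[where 'a='a] by (rule countable_image_inj_on[OF _ bij_betw_imp_inj_on])
  moreover have "infinite (multi_indices :: ('a \<Rightarrow>\<^sub>0 nat) set)"
  proof
    assume fin: "finite (multi_indices :: ('a \<Rightarrow>\<^sub>0 nat) set)"
    obtain b :: 'a where b: "b \<in> Basis" using nonempty_Basis by blast
    have "range (\<lambda>n. Poly_Mapping.single b n) \<subseteq> multi_indices" using multi_indices_single[OF b] by auto
    moreover have "inj (\<lambda>n::nat. Poly_Mapping.single b n)"
      by (rule injI) (metis lookup_single_eq)
    ultimately show False using fin finite_subset finite_imageD infinite_UNIV_nat by metis
  qed
  ultimately show ?thesis using countableE_infinite bij_betw_inv by metis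
qed

definition monf :: "'a::euclidean_space \<Rightarrow> ('a \<Rightarrow>\<^sub>0 nat) \<Rightarrow> 'a \<Rightarrow> real" where
  "monf x m y = (\<Prod>b\<in>Basis. ((y - x) \<bullet> b) ^ Poly_Mapping.lookup m b)"

text \<open>The partial derivative of \<open>monf x m\<close> in the direction b. For exponent 0 the
  truncated subtraction is harmless because the first factor vanishes.\<close>

definition dmonf :: "'a::euclidean_space \<Rightarrow> ('a \<Rightarrow>\<^sub>0 nat) \<Rightarrow> 'a \<Rightarrow> 'a \<Rightarrow> real" where
  "dmonf x m b y = real (Poly_Mapping.lookup m b) * ((y - x) \<bullet> b) ^ (Poly_Mapping.lookup m b - 1) *
     (\<Prod>b'\<in>Basis - {b}. ((y - x) \<bullet> b') ^ Poly_Mapping.lookup m b')"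

definition mdeg :: "('a::euclidean_space \<Rightarrow>\<^sub>0 nat) \<Rightarrow> nat" where
  "mdeg m = (\<Sum>b\<in>Basis. Poly_Mapping.lookup m b)"

lemma monf_deriv: "(monf x m has_derivative (\<lambda>h. \<Sum>b\<in>Basis. (h \<bullet> b) * dmonf x m b y)) (at y)"
proof -
  have "((\<lambda>y. ((y - x) \<bullet> b) ^ Poly_Mapping.lookup m b) has_derivative
     (\<lambda>h. real (Poly_Mapping.lookup m b) * (h \<bullet> b) * ((y - x) \<bullet> b) ^ (Poly_Mapping.lookup m b - 1))) (at y)" for b
    by (rule has_derivative_power) (auto intro!: derivative_eq_intros)
  from has_derivative_prod[of Basis, OF this]
  show ?thesis unfolding monf_def[abs_def] dmonf_def by (simp add: mult_ac)
qed

text \<open>Halving the radius absorbs the exponent that differentiation brings down: k + 1 <=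
  2^k.\<close>

lemma dmonf_bound:
  assumes \<rho>: "\<rho> > 0" and y: "norm (y - x) \<le> \<rho> / 2" and b: "b \<in> Basis"
  shows "\<bar>dmonf x m b y\<bar> \<le> \<rho> ^ mdeg m / \<rho>"
proof (cases "Poly_Mapping.lookup m b = 0")
  case True
  then show ?thesis using \<rho> by (simp add: dmonf_def)
next
  case False
  have le: "\<bar>(y - x) \<bullet> b'\<bar> \<le> \<rho> / 2" if "b' \<in> Basis" for b' using Basis_le_norm[OF that, of "y - x"] y by simp
  define k where "k = mdeg m - 1"
  have deg: "mdeg m = Poly_Mapping.lookup m b + (\<Sum>b'\<in>Basis - {b}. Poly_Mapping.lookup m b')"
    unfolding mdeg_def using b by (simp add: sum.remove)
  have k: "mdeg m = Suc k" "Poly_Mapping.lookup m b \<le> Suc k" using False deg by (auto simp: k_def)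
  have ksum: "Poly_Mapping.lookup m b - 1 + (\<Sum>b'\<in>Basis - {b}. Poly_Mapping.lookup m b') = k"
    using False deg by (auto simp: k_def)
  have "\<bar>dmonf x m b y\<bar> = real (Poly_Mapping.lookup m b) * (\<bar>(y - x) \<bullet> b\<bar> ^ (Poly_Mapping.lookup m b - 1) *
     (\<Prod>b'\<in>Basis - {b}. \<bar>(y - x) \<bullet> b'\<bar> ^ Poly_Mapping.lookup m b'))"
    by (simp add: dmonf_def abs_mult abs_prod power_abs)
  also have "\<dots> \<le> real (Suc k) * ((\<rho> / 2) ^ (Poly_Mapping.lookup m b - 1) * (\<Prod>b'\<in>Basis - {b}. (\<rho> / 2) ^ Poly_Mapping.lookup m b'))"
    using le b \<rho> k(2) by (intro mult_mono prod_mono conjI power_mono prod_nonneg mult_nonneg_nonneg ballI) auto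
  also have "\<dots> = real (Suc k) * (\<rho> / 2) ^ k"
    by (simp only: power_sum[symmetric] power_add[symmetric] ksum)
  also have "\<dots> \<le> 2 ^ k * (\<rho> / 2) ^ k"
  proof (rule mult_right_mono)
    have "Suc k \<le> 2 ^ k" by (simp add: Suc_leI less_exp)
    then show "real (Suc k) \<le> 2 ^ k" by (metis of_nat_le_iff of_nat_numeral of_nat_power)
  qed (use \<rho> in simp)
  also have "\<dots> = \<rho> ^ mdeg m / \<rho>" using \<rho> by (simp add: k power_divide)
  finally show ?thesis .
qed

lemma power_series_deriv:
  fixes c :: "('a::euclidean_space \<Rightarrow>\<^sub>0 nat) \<Rightarrow> complex"
  assumes r: "r > 0" and f: "\<And>y. y \<in> ball x r \<Longrightarrow> ((\<lambda>m. c m * complex_of_real (monf x m y)) has_sum f y) multi_indices"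
  shows "\<exists>s>0. \<forall>y\<in>ball x s. f differentiable (at y) \<and>
    (\<forall>b\<in>Basis. ((\<lambda>m. c m * complex_of_real (dmonf x m b y)) has_sum dir_deriv b f y) multi_indices)"
proof -
  define n where "n = real DIM('a)"
  have n: "n \<ge> 1" unfolding n_def using DIM_positive[where 'a='a] by linarith
  \<comment> \<open>The point z, displaced from x by \<rho> in every coordinate, is at distance at
    most r / 2. Summability there is absolute and gives the summability of |c m| \<rho>^|m|, which
    dominates the differentiated series on the ball of radius \<rho> / 2.\<close>
  define \<rho> where "\<rho> = r / (2 * n)"
  have \<rho>: "\<rho> > 0" using r n by (simp add: \<rho>_def)
  define z where "z = x + (\<Sum>b\<in>Basis. \<rho> *\<^sub>R b)"
  have "norm (z - x) \<le> (\<Sum>b\<in>(Basis :: 'a set). norm (\<rho> *\<^sub>R b))" unfolding z_def by (simp only: add_diff_cancel_left' norm_sum)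
  also have "\<dots> = n * \<rho>" using \<rho> by (simp add: n_def)
  also have "\<dots> < r" using r n by (simp add: \<rho>_def)
  finally have "z \<in> ball x r" by (simp add: dist_norm norm_minus_commute)
  from f[OF this] have "(\<lambda>m. c m * complex_of_real (monf x m z)) summable_on multi_indices"
    using summable_on_def by blast
  then have "(\<lambda>m. norm (c m * complex_of_real (monf x m z))) summable_on multi_indices"
    by (simp add: summable_on_iff_abs_summable_on_complex)
  moreover have "monf x m z = \<rho> ^ mdeg m" for m
    by (simp add: monf_def z_def mdeg_def inner_sum_left_Basis power_sum)
  ultimately have sm: "(\<lambda>m. norm (c m) * \<rho> ^ mdeg m) summable_on multi_indices"
    using \<rho> by (simp add: norm_mult norm_power)
  obtain e where e: "bij_betw e (UNIV :: nat set) (multi_indices :: ('a \<Rightarrow>\<^sub>0 nat) set)"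
    using multi_indices_bij_nat by blast
  define A where "A m = n * (norm (c m) * \<rho> ^ mdeg m / \<rho>)" for m
  have Asum: "A summable_on multi_indices"
    unfolding A_def divide_inverse by (intro summable_on_cmult_right summable_on_cmult_left sm)
  then have Ae: "summable (\<lambda>i. A (e i))"
    by (intro summable_on_imp_summable) (simp add: summable_on_reindex_bij_betw[OF e])
  have A0: "A m \<ge> 0" for m using n \<rho> by (simp add: A_def)
  define S where "S = ball x (\<rho> / 2)"
  define F where "F m y h = c m * complex_of_real (\<Sum>b\<in>Basis. (h \<bullet> b) * dmonf x m b y)" for m y h
  have Fb: "norm (F m y h) \<le> A m * norm h" if "y \<in> S" for m y h
  proof -
    have "\<bar>\<Sum>b\<in>Basis. (h \<bullet> b) * dmonf x m b y\<bar> \<le> (\<Sum>b\<in>(Basis::'a set). norm h * (\<rho> ^ mdeg m / \<rho>))"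
    proof (rule order_trans[OF sum_abs], rule sum_mono)
      fix b :: 'a assume b: "b \<in> Basis"
      show "\<bar>(h \<bullet> b) * dmonf x m b y\<bar> \<le> norm h * (\<rho> ^ mdeg m / \<rho>)"
        unfolding abs_mult
        by (intro mult_mono dmonf_bound Basis_le_norm \<rho> b) (use that in \<open>auto simp: S_def dist_norm norm_minus_commute\<close>)
    qed
    then have "norm (c m) * \<bar>\<Sum>b\<in>Basis. (h \<bullet> b) * dmonf x m b y\<bar> \<le> norm (c m) * (n * (norm h * (\<rho> ^ mdeg m / \<rho>)))"
      by (intro mult_left_mono) (simp_all add: n_def)
    then show ?thesis by (simp only: F_def A_def norm_mult norm_of_real real_norm_def mult_ac times_divide_eq_right)
  qed
  have Fsum: "(\<lambda>m. F m y h) summable_on multi_indices" if "y \<in> S" for y h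
  proof -
    have "(\<lambda>m. norm (F m y h)) summable_on multi_indices"
      by (rule summable_on_comparison_test[of "\<lambda>m. A m * norm h"])
        (use Fb[OF that] in \<open>auto intro!: summable_on_cmult_left Asum\<close>)
    then show ?thesis by (rule abs_summable_summable)
  qed
  define g' where "g' y h = infsum (\<lambda>m. F m y h) multi_indices" for y h
  have g': "((\<lambda>m. F m y h) has_sum g' y h) multi_indices" if "y \<in> S" for y h
    unfolding g'_def using Fsum[OF that] by simp
  have g's: "(\<lambda>i. F (e i) y h) sums g' y h" if "y \<in> S" for y h
    by (rule has_sum_imp_sums[OF has_sum_reindex_bij_betw[OF e, where f="\<lambda>m. F m y h", THEN iffD2, OF g'[OF that]]])
  have Sr: "S \<subseteq> ball x r"
  proof -
    have "\<rho> / 2 \<le> r" using r n by (simp add: \<rho>_def field_simps)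
    then show ?thesis unfolding S_def by (rule subset_ball)
  qed
  have fs: "(\<lambda>i. c (e i) * complex_of_real (monf x (e i) y)) sums f y" if "y \<in> S" for y
    by (rule has_sum_imp_sums[OF has_sum_reindex_bij_betw[OF e, where f="\<lambda>m. c m * complex_of_real (monf x m y)", THEN iffD2, OF f]])
      (use that Sr in blast)
  have xS: "x \<in> S" using \<rho> by (simp add: S_def)
  have "\<exists>g. \<forall>y\<in>S. (\<lambda>i. c (e i) * complex_of_real (monf x (e i) y)) sums g y \<and> (g has_derivative g' y) (at y within S)"
  proof (rule has_derivative_series[where f="\<lambda>i y. c (e i) * complex_of_real (monf x (e i) y)" and f'="\<lambda>i y h. F (e i) y h"
        and S=S and g'=g' and x=x and l="f x"])
    show "x \<in> S" by (rule xS)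
    show "(\<lambda>i. c (e i) * complex_of_real (monf x (e i) x)) sums f x" by (rule fs[OF xS])
    show "convex S" by (simp add: S_def)
    show "((\<lambda>y. c (e i) * complex_of_real (monf x (e i) y)) has_derivative F (e i) y) (at y within S)" for i y
      unfolding F_def
      by (intro has_derivative_mult_right has_derivative_of_real has_derivative_at_withinI[OF monf_deriv])
    fix \<epsilon> :: real assume \<epsilon>: "\<epsilon> > 0"
    obtain N where N: "\<And>n. n \<ge> N \<Longrightarrow> norm (suminf (\<lambda>i. A (e (i + n)))) < \<epsilon>"
      using suminf_exist_split[OF \<epsilon> Ae] by blast
    show "\<forall>\<^sub>F n in sequentially. \<forall>y\<in>S. \<forall>h. norm ((\<Sum>i<n. F (e i) y h) - g' y h) \<le> \<epsilon> * norm h"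
      unfolding eventually_sequentially
    proof (intro exI allI impI ballI)
      fix n y h assume n: "N \<le> n" and y: "y \<in> S"
      have s1: "summable (\<lambda>i. F (e i) y h)" using g's[OF y] sums_summable by blast
      have s2: "summable (\<lambda>i. A (e (i + n)) * norm h)" using Ae by (intro summable_mult2 summable_ignore_initial_segment)
      have s3: "summable (\<lambda>i. norm (F (e (i + n)) y h))"
        by (rule summable_comparison_test'[OF s2]) (use Fb[OF y] in auto)
      have "g' y h = suminf (\<lambda>i. F (e i) y h)" using g's[OF y] by (simp add: sums_iff)
      then have "(\<Sum>i<n. F (e i) y h) - g' y h = - suminf (\<lambda>i. F (e (i + n)) y h)"
        using suminf_split_initial_segment[OF s1, of n] by simp
      then have "norm ((\<Sum>i<n. F (e i) y h) - g' y h) = norm (suminf (\<lambda>i. F (e (i + n)) y h))" by simp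
      also have "\<dots> \<le> suminf (\<lambda>i. norm (F (e (i + n)) y h))" by (rule summable_norm[OF s3])
      also have "\<dots> \<le> suminf (\<lambda>i. A (e (i + n)) * norm h)" by (rule suminf_le[OF _ s3 s2]) (rule Fb[OF y])
      also have "\<dots> = suminf (\<lambda>i. A (e (i + n))) * norm h"
        by (rule suminf_mult2[symmetric]) (use Ae in \<open>rule summable_ignore_initial_segment\<close>)
      also have "\<dots> \<le> \<epsilon> * norm h"
        using N[OF n] by (intro mult_right_mono) auto
      finally show "norm ((\<Sum>i<n. F (e i) y h) - g' y h) \<le> \<epsilon> * norm h" .
    qed
  qed
  then obtain g where g0: "\<forall>y\<in>S. (\<lambda>i. c (e i) * complex_of_real (monf x (e i) y)) sums g y \<and> (g has_derivative g' y) (at y within S)" ..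
  have g: "(\<lambda>i. c (e i) * complex_of_real (monf x (e i) y)) sums g y" "(g has_derivative g' y) (at y within S)" if "y \<in> S" for y
    using bspec[OF g0 that] by simp_all
  have gf: "g y = f y" if "y \<in> S" for y by (rule sums_unique2[OF g(1)[OF that] fs[OF that]])
  have oS: "open S" by (simp add: S_def)
  have fd: "(f has_derivative g' y) (at y)" if y: "y \<in> S" for y
  proof -
    have "(g has_derivative g' y) (at y)" using g(2)[OF y] unfolding at_within_open[OF y oS] .
    then show ?thesis by (rule has_derivative_transform_within_open[OF _ oS y gf])
  qed
  have Fbs: "F m y b = c m * complex_of_real (dmonf x m b y)" if "b \<in> Basis" for m y b
  proof -
    have "(\<Sum>b'\<in>Basis. (b \<bullet> b') * dmonf x m b' y) = (\<Sum>b'\<in>Basis. if b' = b then dmonf x m b y else 0)"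
      by (rule sum.cong) (use that in \<open>auto simp: inner_Basis\<close>)
    then show ?thesis using that by (simp add: F_def)
  qed
  show ?thesis
  proof (intro exI[of _ "\<rho> / 2"] conjI ballI)
    show "\<rho> / 2 > 0" using \<rho> by simp
    fix y assume "y \<in> ball x (\<rho> / 2)"
    then have y: "y \<in> S" by (simp add: S_def)
    show "f differentiable (at y)" using fd[OF y] unfolding differentiable_def by blast
    fix b :: 'a assume b: "b \<in> Basis"
    show "((\<lambda>m. c m * complex_of_real (dmonf x m b y)) has_sum dir_deriv b f y) multi_indices"
      using g'[OF y, of b] by (simp add: Fbs[OF b] dir_deriv_eq[OF fd[OF y]])
  qed
qed

lemma real_analytic_deriv:
  assumes "real_analytic f"
  shows "f differentiable (at x)" "b \<in> Basis \<Longrightarrow> real_analytic (dir_deriv b f)"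
proof -
  have *: "\<exists>s>0. \<exists>c. \<forall>y\<in>ball x s. f differentiable (at y) \<and>
    (\<forall>b\<in>Basis. ((\<lambda>m. c m * complex_of_real (dmonf x m b y)) has_sum dir_deriv b f y) multi_indices)" for x
  proof -
    obtain r c where rc: "r > 0" "\<forall>y\<in>ball x r. ((\<lambda>m. c m * complex_of_real (monf x m y)) has_sum f y) multi_indices"
      using assms[unfolded real_analytic_def, rule_format, of x] unfolding monf_def by (elim exE conjE)
    have rc2: "((\<lambda>m. c m * complex_of_real (monf x m y)) has_sum f y) multi_indices" if "y \<in> ball x r" for y
      by (rule bspec[OF rc(2) that])
    have "\<exists>s>0. \<forall>y\<in>ball x s. f differentiable (at y) \<and>
      (\<forall>b\<in>Basis. ((\<lambda>m. c m * complex_of_real (dmonf x m b y)) has_sum dir_deriv b f y) multi_indices)"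
      by (rule power_series_deriv[OF rc(1)]) (rule rc2)
    then obtain s where "s > 0 \<and> (\<forall>y\<in>ball x s. f differentiable (at y) \<and>
      (\<forall>b\<in>Basis. ((\<lambda>m. c m * complex_of_real (dmonf x m b y)) has_sum dir_deriv b f y) multi_indices))" ..
    then show ?thesis by (intro exI[of _ s] conjI exI[of _ c]) simp_all
  qed
  show "f differentiable (at x)" using *[of x] by (metis centre_in_ball)
  show "real_analytic (dir_deriv b f)" if b: "b \<in> Basis"
    unfolding real_analytic_def
  proof
    fix x
    obtain s c where s: "s > 0" and c0: "\<forall>y\<in>ball x s. f differentiable (at y) \<and>
        (\<forall>b\<in>Basis. ((\<lambda>m. c m * complex_of_real (dmonf x m b y)) has_sum dir_deriv b f y) multi_indices)"
      using *[of x] by (elim exE conjE)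
    have c: "((\<lambda>m. c m * complex_of_real (dmonf x m b y)) has_sum dir_deriv b f y) multi_indices" if "y \<in> ball x s" for y
      using bspec[OF conjunct2[OF bspec[OF c0 that]] b] .
    \<comment> \<open>Differentiation lowers the exponent at b, so the new series is reindexed by
      raising it; the multi-indices missed by h have exponent 0 at b and contribute nothing.\<close>
    define h where "h m = m + Poly_Mapping.single b 1" for m :: "'a \<Rightarrow>\<^sub>0 nat"
    define C where "C m = c (h m) * of_nat (Suc (Poly_Mapping.lookup m b))" for m
    have inj: "inj_on h multi_indices" by (rule inj_onI) (simp add: h_def)
    have lkh: "Poly_Mapping.lookup (h m) b' = (if b' = b then Suc (Poly_Mapping.lookup m b') else Poly_Mapping.lookup m b')" for m b'
      by (simp add: h_def lookup_add lookup_single when_def)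
    have img: "m \<in> h ` multi_indices" if m: "m \<in> multi_indices" "Poly_Mapping.lookup m b \<noteq> 0" for m
    proof (rule image_eqI)
      show "m = h (m - Poly_Mapping.single b 1)"
        by (rule poly_mapping_eqI) (use m in \<open>auto simp: lkh lookup_minus lookup_single when_def\<close>)
      show "m - Poly_Mapping.single b 1 \<in> multi_indices"
        using m unfolding multi_indices_def by (auto simp: in_keys_iff lookup_minus subset_iff)
    qed
    have sub: "h ` multi_indices \<subseteq> multi_indices"
      unfolding h_def using multi_indices_add multi_indices_single[OF b] by blast
    have "((\<lambda>m. C m * complex_of_real (\<Prod>b\<in>Basis. ((y - x) \<bullet> b) ^ Poly_Mapping.lookup m b)) has_sum dir_deriv b f y) multi_indices"
      if y: "y \<in> ball x s" for y
    proof -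
      have "((\<lambda>m. c m * complex_of_real (dmonf x m b y)) has_sum dir_deriv b f y) (h ` multi_indices)"
        by (subst has_sum_cong_neutral[where T=multi_indices and g="\<lambda>m. c m * complex_of_real (dmonf x m b y)"])
          (use c[OF y] sub img in \<open>auto simp: dmonf_def\<close>)
      then have "((\<lambda>m. c (h m) * complex_of_real (dmonf x (h m) b y)) has_sum dir_deriv b f y) multi_indices"
        by (simp add: has_sum_reindex[OF inj] o_def)
      moreover have "c (h m) * complex_of_real (dmonf x (h m) b y) = C m * complex_of_real (\<Prod>b\<in>Basis. ((y - x) \<bullet> b) ^ Poly_Mapping.lookup m b)" for m
      proof -
        have "(\<Prod>b'\<in>Basis - {b}. ((y - x) \<bullet> b') ^ Poly_Mapping.lookup (h m) b') = (\<Prod>b'\<in>Basis - {b}. ((y - x) \<bullet> b') ^ Poly_Mapping.lookup m b')"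
          by (rule prod.cong) (auto simp: lkh)
        then have "dmonf x (h m) b y = real (Suc (Poly_Mapping.lookup m b)) * (\<Prod>b\<in>Basis. ((y - x) \<bullet> b) ^ Poly_Mapping.lookup m b)"
          unfolding prod.remove[OF finite_Basis b] dmonf_def by (simp add: lkh)
        then show ?thesis by (simp add: C_def)
      qed
      ultimately show ?thesis by simp
    qed
    then show "\<exists>r>0. \<exists>c. \<forall>y\<in>ball x r. ((\<lambda>m. c m * complex_of_real (\<Prod>b\<in>Basis. ((y - x) \<bullet> b) ^ Poly_Mapping.lookup m b)) has_sum dir_deriv b f y) multi_indices"
      using s by (intro exI[of _ s] conjI exI[of _ C]) auto
  qed
qed

lemma real_analytic_smooth:
  fixes f :: "'a::euclidean_space \<Rightarrow> complex"
  assumes "real_analytic f" shows "smooth_on UNIV f"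
proof -
  have "real_analytic f \<Longrightarrow> Ck_on n UNIV f" for n and f :: "'a \<Rightarrow> complex"
  proof (induction n arbitrary: f)
    case 0
    then show ?case
      using real_analytic_deriv(1) by (auto intro!: continuous_at_imp_continuous_on differentiable_imp_continuous_within)
  next
    case (Suc n)
    have dd: "dir_deriv v f = (\<lambda>x. \<Sum>b\<in>Basis. complex_of_real (v \<bullet> b) * dir_deriv b f x)" for v
      by (rule ext) (rule dir_deriv_expand[OF real_analytic_deriv(1)[OF Suc.prems]])
    have "real_analytic (dir_deriv v f)" for v
      by (subst dd) (intro real_analytic_sum real_analytic_cmult real_analytic_deriv(2)[OF Suc.prems] finite_Basis)
    then show ?case using real_analytic_deriv(1)[OF Suc.prems] Suc.IH by simp
  qed
  then show ?thesis using assms by (simp add: smooth_on_def)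
qed

section \<open>Eigenfunctions\<close>

locale eigen =
  fixes R :: "'a::euclidean_space set" and lam :: "'a \<Rightarrow> complex"
  assumes fin: "finite (weyl_group R)" and lam: "linear lam"
begin

text \<open>The coefficients depend only on v, R and lambda. Hence one family of fundamental
  solutions serves all open sets and all eigenfunctions.\<close>

definition cc :: "'a \<Rightarrow> nat \<Rightarrow> complex" where
  "cc v = (SOME c. c (card (weyl_group R)) = 1 \<and> (\<forall>U f x. open U \<longrightarrow> f \<in> sol R lam U \<longrightarrow> x \<in> U \<longrightarrow>
           (\<Sum>j\<le>card (weyl_group R). c j * (dir_deriv v ^^ j) f x) = 0))"

lemma cc: "cc v (card (weyl_group R)) = 1"
  "open U \<Longrightarrow> f \<in> sol R lam U \<Longrightarrow> x \<in> U \<Longrightarrow> (\<Sum>j\<le>card (weyl_group R). cc v j * (dir_deriv v ^^ j) f x) = 0"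
  using someI_ex[OF sol_ode[OF fin lam, of v]] unfolding cc_def[symmetric] by blast+

sublocale odes "card (weyl_group R)" cc
  by standard (rule cc(1))

lemma sol_osol: "open U \<Longrightarrow> f \<in> sol R lam U \<Longrightarrow> f \<in> osol U"
proof -
  assume U: "open U" and f: "f \<in> sol R lam U"
  have "pd (P b) f x = 0" if "x \<in> U" for b x
    unfolding pd_P[OF U solD(1)[OF f] that] by (rule cc(2)[OF U f that])
  then show ?thesis using solD(1)[OF f] by (simp add: osol_def)
qed

text \<open>A smooth solution satisfies the equations in the coordinate directions and is therefore
  analytic; the converse inclusion is the smoothness of convergent power series. Until the final
  theorem E(lambda) is used in the form \<open>sol R lam UNIV\<close>.\<close>

lemma E_space_eq: "E_space R lam = sol R lam UNIV"
proof
  show "E_space R lam \<subseteq> sol R lam UNIV"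
    unfolding E_space_def sol_def using real_analytic_smooth by (auto simp: fun_eq_iff)
  show "sol R lam UNIV \<subseteq> E_space R lam"
    using osol_real_analytic[OF sol_osol[OF open_UNIV]] by (auto simp: E_space_def sol_def fun_eq_iff)
qed

lemma sol_unique:
  assumes "f \<in> sol R lam UNIV" "g \<in> sol R lam UNIV" "\<And>q. q \<in> sym_algebra \<Longrightarrow> pd q f y = pd q g y"
  shows "f = g"
  by (rule osol_unique[where y=y, OF sol_osol sol_osol, OF open_UNIV assms(1) open_UNIV assms(2)])
    (auto intro!: assms(3) simp: DD_def intro: sym_algebra_intros)

lemma sol_eq_on_open:
  assumes "f \<in> sol R lam UNIV" "g \<in> sol R lam UNIV" "open V" "y \<in> V" "\<And>x. x \<in> V \<Longrightarrow> f x = g x"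
  shows "f = g"
  by (rule sol_unique[OF assms(1,2)]) (rule pd_cong[OF assms(3,5,4)])

lemma sol_extension:
  assumes U: "open U" and bx: "boxy U y" and f: "f \<in> sol R lam U"
  shows "\<exists>g\<in>sol R lam UNIV. \<forall>x\<in>U. f x = g x"
proof -
  obtain g where g: "g \<in> osol UNIV" "\<And>x. x \<in> U \<Longrightarrow> f x = g x"
    using osol_extension[OF U bx sol_osol[OF U f]] by blast
  have sg: "smooth_on UNIV g" using g by (simp add: osol_def)
  have "g \<in> sol R lam UNIV"
  proof (rule solI[OF sg])
    fix p :: "'a sympoly" and x assume p: "p \<in> sym_algebra" "sym_invariant R p"
    \<comment> \<open>The extension is known to satisfy only the coordinate equations. Both sides of
      the eigenvalue equation solve these and agree on U. The one-term sum brings the right-hand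
      side into the form of \<open>osol_lin\<close>.\<close>
    have "pd p g = (\<lambda>x. \<Sum>i\<in>{()}. sym_eval lam p * g x)"
    proof (rule osol_eq_on_open[OF osol_pd[OF open_UNIV g(1)] osol_lin[OF open_UNIV g(1)] U])
      show "y \<in> U" using bx by (simp add: boxy_def)
      fix x assume x: "x \<in> U"
      have "pd p g x = pd p f x" by (rule pd_cong[OF U _ x]) (simp add: g(2))
      then show "pd p g x = (\<Sum>i\<in>{()}. sym_eval lam p * g x)" using solD(2)[OF f p x] g(2)[OF x] by simp
    qed
    then show "pd p g x = sym_eval lam p * g x" by simp
  qed
  then show ?thesis using g(2) by blast
qed

end

section \<open>Geometry of the affine Weyl group\<close>

lemma nat_cone_zero: "0 \<in> nat_cone B"
  unfolding nat_cone_def by (rule CollectI, rule exI[of _ "\<lambda>_. 0"]) simp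

lemma nat_cone_add: "x \<in> nat_cone B \<Longrightarrow> y \<in> nat_cone B \<Longrightarrow> x + y \<in> nat_cone B"
proof -
  assume "x \<in> nat_cone B" "y \<in> nat_cone B"
  then obtain c d where "x = (\<Sum>b\<in>B. real (c b) *\<^sub>R b)" "y = (\<Sum>b\<in>B. real (d b) *\<^sub>R b)"
    unfolding nat_cone_def by blast
  then have "x + y = (\<Sum>b\<in>B. real (c b + d b) *\<^sub>R b)"
    by (simp add: scaleR_left_distrib sum.distrib)
  then show ?thesis unfolding nat_cone_def by (intro CollectI exI conjI TrueI)
qed

lemma nat_cone_scale: "x \<in> nat_cone B \<Longrightarrow> real n *\<^sub>R x \<in> nat_cone B"
  by (induction n) (auto simp: nat_cone_zero scaleR_left_distrib nat_cone_add)

lemma nat_cone_sum: "(\<And>i. i \<in> I \<Longrightarrow> x i \<in> nat_cone B) \<Longrightarrow> (\<Sum>i\<in>I. x i) \<in> nat_cone B"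
  by (induction I rule: infinite_finite_induct) (auto simp: nat_cone_zero nat_cone_add)

lemma nat_cone_mem:
  assumes "finite B" "b \<in> B" shows "b \<in> nat_cone B"
proof -
  have "(\<Sum>x\<in>B. real (if x = b then 1 else 0) *\<^sub>R x) = (\<Sum>x\<in>B. if x = b then b else 0)"
    by (rule sum.cong) auto
  then have "b = (\<Sum>x\<in>B. real (if x = b then 1 else 0) *\<^sub>R x)"
    using assms by simp
  then show ?thesis unfolding nat_cone_def by (intro CollectI exI conjI TrueI)
qed

lemma nat_coneE:
  assumes "x \<in> nat_cone B" obtains c where "x = (\<Sum>b\<in>B. real (c b) *\<^sub>R b)"
  using assms unfolding nat_cone_def by blast

lemma aeval_sum: "aeval (\<Sum>s\<in>S. c s *\<^sub>R s) v = (\<Sum>s\<in>S. c s * aeval s v)"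
  by (induction S rule: infinite_finite_induct) (auto simp: aeval_def inner_add_left algebra_simps)

lemma aeval_uminus: "aeval (- a) v = - aeval a v"
  by (simp add: aeval_def)

lemma aeval_inj: assumes "\<And>v. aeval a v = aeval b v" shows "a = b"
proof -
  have s: "snd a = snd b" using assms[of 0] by (simp add: aeval_def)
  then have "(fst a - fst b) \<bullet> v = 0" for v using assms[of v] by (simp add: aeval_def inner_diff_left)
  then have "fst a - fst b = 0" using inner_eq_zero_iff by blast
  then show ?thesis using s by (simp add: prod_eq_iff)
qed

lemma continuous_on_aeval [continuous_intros]: "continuous_on U (aeval a)"
  unfolding aeval_def by (intro continuous_intros)

lemma coroot_nonzero: "\<alpha> \<noteq> 0 \<Longrightarrow> coroot \<alpha> \<noteq> 0"
  by (simp add: coroot_def)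

lemma coroot_uminus: "coroot (- \<alpha>) = - coroot \<alpha>"
  by (simp add: coroot_def)

lemma coroot_weyl: "w \<in> weyl_group R \<Longrightarrow> coroot (w \<alpha>) = w (coroot \<alpha>)"
  by (simp add: coroot_def weyl_inner linear_scale[OF weyl_linear])

lemma refl_coroot: "\<beta> - (\<beta> \<bullet> coroot \<alpha>) *\<^sub>R \<alpha> = refl \<alpha> \<beta>"
  by (simp add: refl_def coroot_def inner_commute)

lemma arefl_refl: "arefl a v = refl (fst a) v + - snd a *\<^sub>R coroot (fst a)"
  by (simp add: arefl_def refl_def aeval_def algebra_simps)

lemma arefl_arefl [simp]: "fst a \<noteq> 0 \<Longrightarrow> arefl a (arefl a v) = v"
  by (simp add: arefl_def aeval_def inner_diff_right coroot_inner algebra_simps flip: scaleR_left_distrib)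

lemma aeval_arefl_self: "fst a \<noteq> 0 \<Longrightarrow> aeval a (arefl a v) = - aeval a v"
  by (simp add: arefl_def aeval_def inner_diff_right coroot_inner)

lemma arefl_uminus: "arefl (- a) = arefl a"
  by (simp add: arefl_def fun_eq_iff aeval_uminus coroot_uminus)

locale affine_weyl =
  fixes R B :: "'a::euclidean_space set" and \<phi> :: 'a
  assumes irr: "irreducible_root_system R" and bas: "root_basis R B" and hr: "highest_root R B \<phi>"
begin

abbreviation "Sig \<equiv> affine_roots R"
abbreviation "S \<equiv> affine_basis B \<phi>"
abbreviation "Pos \<equiv> pos_affine_roots R B \<phi>"
abbreviation "W \<equiv> affine_weyl_group R"
abbreviation "C \<equiv> fund_alcove B \<phi>"
abbreviation "reg \<equiv> regular_set R B \<phi>"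

text \<open>The closure of \<open>C\<close>, see \<open>closure_C\<close>, described by the
  inequalities that the arguments use.\<close>

definition Cb :: "'a set" where "Cb = {v. \<forall>s\<in>S. aeval s v \<ge> 0}"

lemma finite_R: "finite R" and span_R: "span R = UNIV" and zero_R: "0 \<notin> R"
  and refl_R: "\<forall>\<alpha>\<in>R. \<forall>\<beta>\<in>R. refl \<alpha> \<beta> \<in> R"
  and int_R: "\<alpha> \<in> R \<Longrightarrow> \<beta> \<in> R \<Longrightarrow> \<beta> \<bullet> coroot \<alpha> \<in> \<int>"
  and red_R: "\<alpha> \<in> R \<Longrightarrow> c *\<^sub>R \<alpha> \<in> R \<Longrightarrow> c = 1 \<or> c = - 1"
  using irr unfolding irreducible_root_system_def by auto

lemma finite_weyl: "finite (weyl_group R)"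
  by (rule weyl_finite[OF refl_R finite_R span_R])

lemma uminus_R: "\<alpha> \<in> R \<Longrightarrow> - \<alpha> \<in> R"
proof -
  assume a: "\<alpha> \<in> R"
  then have "\<alpha> \<noteq> 0" using zero_R by blast
  then have "refl \<alpha> \<alpha> = - \<alpha>" by (simp add: refl_def coroot_def scaleR_2)
  then show ?thesis using refl_R a by metis
qed

lemma B_R: "B \<subseteq> R" and indep_B: "independent B" and cone_R: "\<alpha> \<in> R \<Longrightarrow> \<alpha> \<in> nat_cone B \<or> - \<alpha> \<in> nat_cone B"
  using bas unfolding root_basis_def by auto

lemma finite_B: "finite B" using B_R finite_R finite_subset by blast

lemma phi_R: "\<phi> \<in> R" and phi_max: "\<alpha> \<in> R \<Longrightarrow> \<phi> - \<alpha> \<in> nat_cone B"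
  using hr unfolding highest_root_def by auto

lemma finite_S: "finite S" using finite_B by (simp add: affine_basis_def)

lemma S_Sig: "S \<subseteq> Sig"
  using B_R phi_R uminus_R by (auto simp: affine_basis_def affine_roots_def)

lemma Sig_fst: "a \<in> Sig \<Longrightarrow> fst a \<in> R" "a \<in> Sig \<Longrightarrow> snd a \<in> \<int>" "a \<in> Sig \<Longrightarrow> fst a \<noteq> 0"
  using zero_R by (auto simp: affine_roots_def)

lemma Sig_uminus: "a \<in> Sig \<Longrightarrow> - a \<in> Sig"
  using uminus_R by (auto simp: affine_roots_def)

section \<open>Points of the fundamental alcove and positivity of affine roots\<close>

text \<open>Independence of B gives a linear functional with the prescribed values, and the inner
  product represents it by a vector.\<close>

lemma basis_point: "\<exists>y. \<forall>b\<in>B. b \<bullet> y = h b"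
proof -
  obtain f :: "'a \<Rightarrow> real" where f: "linear f" "\<forall>b\<in>B. f b = h b"
    using linear_independent_extend[OF indep_B, of h] by blast
  interpret linear f by (rule f(1))
  have "v \<bullet> (\<Sum>i\<in>Basis. f i *\<^sub>R i) = f v" for v
  proof -
    have "v \<bullet> (\<Sum>i\<in>Basis. f i *\<^sub>R i) = (\<Sum>i\<in>Basis. f ((v \<bullet> i) *\<^sub>R i))"
      by (simp add: inner_sum_right scale mult.commute)
    also have "\<dots> = f v" by (simp flip: sum add: euclidean_representation)
    finally show ?thesis .
  qed
  then show ?thesis using f(2) by (intro exI[of _ "\<Sum>i\<in>Basis. f i *\<^sub>R i"]) simp
qed

lemma cone_nonneg: "x \<in> nat_cone B \<Longrightarrow> (\<And>b. b \<in> B \<Longrightarrow> b \<bullet> y \<ge> 0) \<Longrightarrow> x \<bullet> y \<ge> 0"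
  by (elim nat_coneE) (auto simp: inner_sum_left intro!: sum_nonneg)

lemma phi_bound:
  assumes "\<And>b. b \<in> B \<Longrightarrow> b \<bullet> y \<ge> 0" "\<alpha> \<in> R" shows "\<bar>\<alpha> \<bullet> y\<bar> \<le> \<phi> \<bullet> y"
  using cone_nonneg[OF phi_max[OF assms(2)] assms(1)] cone_nonneg[OF phi_max[OF uminus_R[OF assms(2)]] assms(1)]
  by (simp add: inner_diff_left inner_add_left abs_le_iff)

lemma phi_pos: assumes "\<And>b. b \<in> B \<Longrightarrow> b \<bullet> y \<ge> 0" "b \<in> B" "b \<bullet> y > 0" shows "\<phi> \<bullet> y > 0"
  using phi_bound[of y b] assms B_R by fastforce

lemma B_nonempty: "B \<noteq> {}"
proof
  assume "B = {}"
  then have "nat_cone B = {0}" by (auto simp: nat_cone_def)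
  then show False using cone_R[OF phi_R] phi_R zero_R by auto
qed

text \<open>A point in the relative interior of the facet belonging to s. For the affine simple root
  a point with positive simple roots is rescaled to the level where \<phi> is 1; for a finite simple
  root a point on its wall is shrunk by d until \<phi> is below 1.\<close>

lemma wall_point:
  assumes "s \<in> S" shows "\<exists>y. aeval s y = 0 \<and> (\<forall>t\<in>S - {s}. aeval t y > 0)"
proof (cases "s = (- \<phi>, 1)")
  case True
  obtain y where y: "\<forall>b\<in>B. b \<bullet> y = 1" using basis_point[of "\<lambda>_. 1"] by blast
  obtain b where "b \<in> B" using B_nonempty by blast
  then have p: "\<phi> \<bullet> y > 0" using phi_pos[of y b] y by simp
  show ?thesis
    by (rule exI[of _ "(1 / (\<phi> \<bullet> y)) *\<^sub>R y"]) (use True y p in \<open>auto simp: aeval_def affine_basis_def\<close>)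
next
  case False
  then obtain \<beta> where \<beta>: "\<beta> \<in> B" "s = (\<beta>, 0)" using assms by (auto simp: affine_basis_def)
  obtain y where y: "\<forall>b\<in>B. b \<bullet> y = (if b = \<beta> then 0 else 1)" using basis_point[of "\<lambda>b. if b = \<beta> then 0 else 1"] by blast
  define d where "d = 1 / (1 + \<bar>\<phi> \<bullet> y\<bar>)"
  have d: "d > 0" "d * (\<phi> \<bullet> y) < 1" unfolding d_def by (auto simp: field_simps abs_if)
  show ?thesis
    by (rule exI[of _ "d *\<^sub>R y"]) (use \<beta> y d in \<open>auto simp: aeval_def affine_basis_def split: if_splits\<close>)
qed

lemma C_nonempty: "C \<noteq> {}"
proof -
  obtain y where y: "\<forall>b\<in>B. b \<bullet> y = 1" using basis_point[of "\<lambda>_. 1"] by blast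
  define d where "d = 1 / (1 + \<bar>\<phi> \<bullet> y\<bar>)"
  have d: "d > 0" "d * (\<phi> \<bullet> y) < 1" unfolding d_def by (auto simp: field_simps abs_if)
  have "d *\<^sub>R y \<in> C" using y d by (auto simp: fund_alcove_def aeval_def affine_basis_def)
  then show ?thesis by blast
qed

lemma C_Cb: "C \<subseteq> Cb" by (auto simp: fund_alcove_def Cb_def intro: less_imp_le)

lemma Pos_Sig: "a \<in> Pos \<Longrightarrow> a \<in> Sig" by (simp add: pos_affine_roots_def)

lemma PosE:
  assumes "a \<in> Pos" obtains c where "a = (\<Sum>s\<in>S. real (c s) *\<^sub>R s)" "\<exists>s\<in>S. c s > 0"
proof -
  obtain c where c: "a = (\<Sum>s\<in>S. real (c s) *\<^sub>R s)" using assms unfolding pos_affine_roots_def by (auto elim: nat_coneE)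
  have "fst a \<noteq> 0" using Sig_fst(3)[OF Pos_Sig[OF assms]] .
  then have "a \<noteq> 0" by auto
  then have "\<exists>s\<in>S. c s > 0" using c by (metis (no_types, lifting) gr0I of_nat_0 scaleR_zero_left sum.neutral)
  then show ?thesis using that c by blast
qed

lemma Pos_nonneg: assumes "a \<in> Pos" "v \<in> Cb" shows "aeval a v \<ge> 0"
proof -
  obtain c where c: "a = (\<Sum>s\<in>S. real (c s) *\<^sub>R s)" using PosE[OF assms(1)] by metis
  then show ?thesis using assms(2) unfolding c aeval_sum by (auto simp: Cb_def intro!: sum_nonneg)
qed

lemma Pos_pos: assumes "a \<in> Pos" "v \<in> C" shows "aeval a v > 0"
proof -
  obtain c where c: "a = (\<Sum>s\<in>S. real (c s) *\<^sub>R s)" "\<exists>s\<in>S. c s > 0" using PosE[OF assms(1)] by metis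
  obtain s where s: "s \<in> S" "c s > 0" using c(2) by blast
  show ?thesis unfolding c(1) aeval_sum
    by (rule sum_pos2[OF finite_S s(1)]) (use assms(2) s in \<open>auto simp: fund_alcove_def less_imp_le\<close>)
qed

lemma nat_cone_lift: "x \<in> nat_cone B \<Longrightarrow> (x, 0) \<in> nat_cone S"
proof (elim nat_coneE)
  fix c assume x: "x = (\<Sum>b\<in>B. real (c b) *\<^sub>R b)"
  have "(x, 0) = (\<Sum>b\<in>B. real (c b) *\<^sub>R (b, 0::real))"
    by (simp add: prod_eq_iff fst_sum snd_sum x)
  also have "\<dots> \<in> nat_cone S"
    by (intro nat_cone_sum nat_cone_scale nat_cone_mem finite_S) (simp add: affine_basis_def)
  finally show ?thesis .
qed

text \<open>For a positive constant term, (\<alpha>, n + 1) = (n + 1) (-\<phi>, 1) + (n \<phi> +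
  (\<phi> + \<alpha>), 0), and \<phi> + \<alpha> lies in the cone because \<phi> is the highest
  root. Constant term 0 is the case of the finite basis, and negative ones follow by a change of
  sign.\<close>

lemma Pos_cases: assumes "a \<in> Sig" shows "a \<in> Pos \<or> - a \<in> Pos"
proof -
  have pos1: "(\<alpha>, real (Suc n)) \<in> nat_cone S" if "\<alpha> \<in> R" for \<alpha> n
  proof -
    have phi: "\<phi> \<in> nat_cone B"
    proof -
      have "\<phi> \<bullet> y \<ge> 0" if "\<And>b. b \<in> B \<Longrightarrow> b \<bullet> y \<ge> 0" for y using phi_bound[OF that phi_R] by linarith
      obtain y where y: "\<forall>b\<in>B. b \<bullet> y = 1" using basis_point[of "\<lambda>_. 1"] by blast
      obtain b where "b \<in> B" using B_nonempty by blast
      then have p: "\<phi> \<bullet> y > 0" using phi_pos[of y b] y by simp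
      have "- \<phi> \<notin> nat_cone B" using cone_nonneg[of "- \<phi>" y] y p by auto
      then show ?thesis using cone_R[OF phi_R] by blast
    qed
    have cone: "real n *\<^sub>R \<phi> + (\<phi> - (- \<alpha>)) \<in> nat_cone B"
      by (intro nat_cone_add nat_cone_scale phi phi_max uminus_R that)
    have "(- \<phi>, 1::real) \<in> S" by (simp add: affine_basis_def)
    from nat_cone_add[OF nat_cone_scale[OF nat_cone_mem[OF finite_S this], of "Suc n"] nat_cone_lift[OF cone]]
    have "real (Suc n) *\<^sub>R (- \<phi>, 1::real) + (real n *\<^sub>R \<phi> + (\<phi> - (- \<alpha>)), 0) \<in> nat_cone S" .
    then show ?thesis by (simp add: algebra_simps)
  qed
  obtain \<alpha> n where a: "a = (\<alpha>, real_of_int n)" "\<alpha> \<in> R"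
    using assms by (auto simp: affine_roots_def Ints_def)
  consider "n = 0" | m where "n = int (Suc m)" | m where "n = - int (Suc m)"
    by (cases n rule: int_cases3) (metis Suc_pred neq0_conv)+
  then have "a \<in> nat_cone S \<or> - a \<in> nat_cone S"
  proof cases
    case 1
    then show ?thesis using cone_R[OF a(2)] nat_cone_lift[of \<alpha>] nat_cone_lift[of "- \<alpha>"] by (auto simp: a)
  next
    case 2
    then show ?thesis using pos1[OF a(2)] by (simp add: a)
  next
    case 3
    then have "real_of_int n = - real (Suc m)" by simp
    then have "- a = (- \<alpha>, real (Suc m))" by (simp add: a)
    then show ?thesis using pos1[OF uminus_R[OF a(2)], of m] by simp
  qed
  then show ?thesis using assms Sig_uminus by (auto simp: pos_affine_roots_def)
qed

lemma Pos_not_uminus: "a \<in> Pos \<Longrightarrow> - a \<notin> Pos"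
proof -
  assume a: "a \<in> Pos"
  obtain y where y: "y \<in> C" using C_nonempty by blast
  show ?thesis using Pos_pos[OF a y] Pos_pos[OF _ y, of "- a"] by (auto simp: aeval_uminus)
qed

lemma S_Pos: "S \<subseteq> Pos"
  using S_Sig nat_cone_mem[OF finite_S] by (auto simp: pos_affine_roots_def)

text \<open>Because the root system is reduced, a positive root other than s involves a second
  simple root, and that one is positive at y.\<close>

lemma Pos_wall_pos:
  assumes a: "a \<in> Pos" and s: "s \<in> S" "a \<noteq> s" and y: "aeval s y = 0" "\<forall>t\<in>S - {s}. aeval t y > 0"
  shows "aeval a y > 0"
proof -
  obtain c where c: "a = (\<Sum>s\<in>S. real (c s) *\<^sub>R s)" "\<exists>s\<in>S. c s > 0" using PosE[OF a] by metis
  have "\<exists>t\<in>S - {s}. c t > 0"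
  proof (rule ccontr)
    assume "\<not> ?thesis"
    then have "(\<Sum>t\<in>S - {s}. real (c t) *\<^sub>R t) = 0" by (intro sum.neutral) auto
    then have as: "a = real (c s) *\<^sub>R s" using c(1) by (simp add: sum.remove[OF finite_S s(1)])
    then have "real (c s) *\<^sub>R fst s \<in> R" "fst s \<in> R" using Sig_fst(1)[OF Pos_Sig[OF a]] Sig_fst(1)[of s] S_Sig s(1) by auto
    then have "real (c s) = 1" using red_R[of "fst s" "real (c s)"] by auto
    then show False using as s(2) by simp
  qed
  then obtain t where t: "t \<in> S" "t \<noteq> s" "c t > 0" by blast
  have nn: "aeval t y \<ge> 0" if "t \<in> S" for t using y that by (cases "t = s") (auto intro: less_imp_le)
  show ?thesis unfolding c(1) aeval_sum
    by (rule sum_pos2[OF finite_S t(1)]) (use t y nn in auto)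
qed

subsection \<open>The action on affine roots\<close>

lemma W_affine: "w \<in> W \<Longrightarrow> \<exists>L\<in>weyl_group R. \<exists>c. \<forall>v. w v = L v + c"
proof (induction rule: affine_weyl_group.induct)
  case 1
  then show ?case using weyl_group.intros(1) by (intro bexI[of _ id] exI[of _ 0]) auto
next
  case (2 a w)
  then obtain L c where L: "L \<in> weyl_group R" "\<forall>v. w v = L v + c" by blast
  have "(arefl a \<circ> w) v = (refl (fst a) \<circ> L) v + (refl (fst a) c + - snd a *\<^sub>R coroot (fst a))" for v
    using L(2) by (simp add: arefl_refl linear_add[OF refl_linear])
  moreover have "refl (fst a) \<circ> L \<in> weyl_group R"
    using 2 L Sig_fst(1) by (intro weyl_group.intros)
  ultimately show ?case by blast
qed

definition lin :: "('a \<Rightarrow> 'a) \<Rightarrow> 'a \<Rightarrow> 'a" where "lin w = (\<lambda>v. w v - w 0)"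

lemma lin: assumes "w \<in> W" shows "lin w \<in> weyl_group R" "w v = lin w v + w 0"
proof -
  obtain L c where L: "L \<in> weyl_group R" "\<forall>v. w v = L v + c" using W_affine[OF assms] by blast
  have "L 0 = 0" using weyl_linear[OF L(1)] by (rule linear_0)
  then have "lin w = L" using L(2) by (auto simp: lin_def)
  then show "lin w \<in> weyl_group R" using L by simp
qed (simp add: lin_def)

lemma W_comp: "w \<in> W \<Longrightarrow> w' \<in> W \<Longrightarrow> w \<circ> w' \<in> W"
  by (induction rule: affine_weyl_group.induct) (auto simp: o_assoc[symmetric] intro: affine_weyl_group.intros)

lemma W_id: "id \<in> W" by (rule affine_weyl_group.intros)

lemma W_arefl: "a \<in> Sig \<Longrightarrow> arefl a \<in> W"
  using affine_weyl_group.intros(2)[OF _ W_id] by simp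

lemma arefl_comp: "a \<in> Sig \<Longrightarrow> arefl a \<circ> arefl a = id"
  using Sig_fst(3) by (auto simp: fun_eq_iff)

lemma W_inverse: "w \<in> W \<Longrightarrow> \<exists>w'\<in>W. w \<circ> w' = id \<and> w' \<circ> w = id"
proof (induction rule: affine_weyl_group.induct)
  case 1
  then show ?case using W_id by (intro bexI[of _ id]) auto
next
  case (2 a w)
  then obtain w' where w': "w' \<in> W" "w \<circ> w' = id" "w' \<circ> w = id" by blast
  then show ?case
    using 2 Sig_fst(3) by (intro bexI[of _ "w' \<circ> arefl a"] W_comp W_arefl) (auto simp: fun_eq_iff)
qed

lemma W_bij: "w \<in> W \<Longrightarrow> bij w" using W_inverse o_bij by blast

lemma W_inv: "w \<in> W \<Longrightarrow> inv w \<in> W"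
  using W_inverse[of w] by (metis inv_unique_comp)

lemma W_inv_simps [simp]: "w \<in> W \<Longrightarrow> w (inv w x) = x" "w \<in> W \<Longrightarrow> inv w (w x) = x"
  using W_bij by (auto simp: bij_is_surj surj_f_inv_f bij_is_inj inv_f_f)

lemma W_inv_comp: "w \<in> W \<Longrightarrow> w' \<in> W \<Longrightarrow> inv (w \<circ> w') = inv w' \<circ> inv w"
  using W_bij by (intro o_inv_distrib) auto

lemma inv_arefl: "a \<in> Sig \<Longrightarrow> inv (arefl a) = arefl a"
  using arefl_comp by (intro inv_unique_comp)

text \<open>The action (w a)(v) = a(w^-1 v) in coordinates; \<open>aeval_act\<close> is the form in
  which it is used.\<close>

definition act :: "('a \<Rightarrow> 'a) \<Rightarrow> 'a affine_functional \<Rightarrow> 'a affine_functional" where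
  "act w a = (lin w (fst a), snd a - lin w (fst a) \<bullet> w 0)"

lemma aeval_act: "w \<in> W \<Longrightarrow> aeval (act w a) (w v) = aeval a v"
  using weyl_inner[OF lin(1), of w "fst a" v]
  by (subst lin(2)) (simp_all add: act_def aeval_def inner_add_right)

lemma aeval_act_inv: "w \<in> W \<Longrightarrow> aeval (act w a) v = aeval a (inv w v)"
  using aeval_act[of w a "inv w v"] by simp

lemma act_eqI: assumes "w \<in> W" "\<And>v. aeval b (w v) = aeval a v" shows "act w a = b"
  by (rule aeval_inj) (metis W_inv_simps(1) aeval_act assms)

lemma act_comp: "w \<in> W \<Longrightarrow> w' \<in> W \<Longrightarrow> act (w \<circ> w') a = act w (act w' a)"
  by (rule act_eqI) (auto simp: W_comp aeval_act)

lemma act_id [simp]: "act id a = a" by (rule act_eqI) (auto simp: W_id)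

lemma act_inv [simp]: "w \<in> W \<Longrightarrow> act w (act (inv w) a) = a" "w \<in> W \<Longrightarrow> act (inv w) (act w a) = a"
proof -
  have "w \<circ> inv w = id" "inv w \<circ> w = id" if "w \<in> W" using that by (auto simp: fun_eq_iff)
  then show "w \<in> W \<Longrightarrow> act w (act (inv w) a) = a" "w \<in> W \<Longrightarrow> act (inv w) (act w a) = a"
    using act_comp[of w "inv w" a] act_comp[of "inv w" w a] W_inv[of w] by (metis act_id)+
qed

lemma act_uminus: "w \<in> W \<Longrightarrow> act w (- a) = - act w a"
  by (rule act_eqI) (auto simp: aeval_uminus aeval_act)

lemma act_arefl: assumes s: "s \<in> Sig" shows "act (arefl s) a = a - (fst a \<bullet> coroot (fst s)) *\<^sub>R s"
proof (rule act_eqI[OF W_arefl[OF s]])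
  fix v
  have "aeval (a - c *\<^sub>R s) v = aeval a v - c * aeval s v" for c v
    by (simp add: aeval_def inner_diff_left algebra_simps)
  moreover have "aeval a (arefl s v) = aeval a v - aeval s v * (fst a \<bullet> coroot (fst s))"
    by (simp add: aeval_def[of a] arefl_def inner_diff_right)
  ultimately show "aeval (a - (fst a \<bullet> coroot (fst s)) *\<^sub>R s) (arefl s v) = aeval a v"
    using Sig_fst(3)[OF s] by (simp add: aeval_arefl_self)
qed

text \<open>The constant term stays integral because the root system is crystallographic.\<close>

lemma act_Sig: "w \<in> W \<Longrightarrow> a \<in> Sig \<Longrightarrow> act w a \<in> Sig"
proof (induction arbitrary: a rule: affine_weyl_group.induct)
  case (2 s w)
  have a': "act w a \<in> Sig" using 2 by blast
  have "act (arefl s) (act w a) \<in> Sig"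
  proof -
    have "fst (act (arefl s) (act w a)) = refl (fst s) (fst (act w a))"
      by (simp add: act_arefl[OF 2(1)] refl_coroot)
    moreover have "snd (act (arefl s) (act w a)) \<in> \<int>"
      unfolding act_arefl[OF 2(1)] using 2(1) a' by (auto intro!: Ints_diff Ints_mult int_R Sig_fst)
    ultimately show ?thesis
      using refl_R Sig_fst(1)[OF a'] Sig_fst(1)[OF 2(1)] by (simp add: affine_roots_def mem_Times_iff)
  qed
  then show ?case by (simp only: act_comp[OF W_arefl[OF 2(1)] 2(2)])
qed simp

lemma act_self: "s \<in> Sig \<Longrightarrow> act (arefl s) s = - s"
  using Sig_fst(3) by (simp add: act_arefl coroot_inner scaleR_2)

lemma arefl_act: assumes "w \<in> W" "a \<in> Sig" shows "arefl (act w a) (w v) = w (arefl a v)"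
proof -
  have "w (v - c *\<^sub>R x) = w v - c *\<^sub>R lin w x" for c x
    using lin(2)[OF assms(1), of "v - c *\<^sub>R x"] lin(2)[OF assms(1), of v] weyl_linear[OF lin(1)[OF assms(1)]]
    by (simp add: linear_diff linear_scale)
  then show ?thesis
    by (simp add: arefl_def aeval_act[OF assms(1)]) (simp add: act_def coroot_weyl[OF lin(1)[OF assms(1)]])
qed

text \<open>At a point inside the wall of s every positive root other than s is positive, and s
  fixes this point. So the image of a is positive there and cannot be a negative root.\<close>

lemma act_simple_pos:
  assumes "s \<in> S" "a \<in> Pos" "a \<noteq> s" shows "act (arefl s) a \<in> Pos"
proof (rule ccontr)
  assume n: "act (arefl s) a \<notin> Pos"
  have sS: "s \<in> Sig" using S_Sig assms(1) by blast
  obtain y where y: "aeval s y = 0" "\<forall>t\<in>S - {s}. aeval t y > 0" using wall_point[OF assms(1)] by blast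
  have yC: "y \<in> Cb" using y by (auto simp: Cb_def) (metis Diff_iff less_imp_le order_refl singletonD)
  have "- act (arefl s) a \<in> Pos" using n Pos_cases[OF act_Sig[OF W_arefl[OF sS] Pos_Sig[OF assms(2)]]] by blast
  from Pos_nonneg[OF this yC] have "aeval (act (arefl s) a) (arefl s y) \<le> 0"
    using y by (simp add: aeval_uminus arefl_def)
  then have "aeval a y \<le> 0" by (simp add: aeval_act W_arefl[OF sS])
  then show False using Pos_wall_pos[OF assms(2,1,3) y] by linarith
qed

text \<open>The inversions of w: the positive roots whose hyperplanes separate \<open>C\<close> from
  w^-1 \<open>C\<close>. Their number is the Coxeter length of w.\<close>

definition Inv :: "('a \<Rightarrow> 'a) \<Rightarrow> 'a affine_functional set" where
  "Inv w = {a \<in> Pos. - act w a \<in> Pos}"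

text \<open>Passing from w to s w crosses a single hyperplane, that of w^-1 s, because s permutes
  the positive roots other than s.\<close>

lemma Inv_arefl:
  assumes s: "s \<in> S" and w: "w \<in> W"
  shows "act (inv w) s \<in> Pos \<Longrightarrow> Inv (arefl s \<circ> w) = insert (act (inv w) s) (Inv w) \<and> act (inv w) s \<notin> Inv w"
    and "act (inv w) s \<notin> Pos \<Longrightarrow> Inv (arefl s \<circ> w) = Inv w - {- act (inv w) s} \<and> - act (inv w) s \<in> Inv w"
proof -
  have sS: "s \<in> Sig" and sP: "s \<in> Pos" using S_Sig S_Pos s by auto
  note Ws = W_arefl[OF sS]
  have mem: "a \<in> Inv (arefl s \<circ> w) \<longleftrightarrow> a \<in> Inv w" if "a \<in> Pos" "a \<noteq> act (inv w) s" "a \<noteq> - act (inv w) s" for a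
  proof -
    have ne: "act w a \<noteq> s" "act w a \<noteq> - s"
      using that act_inv(2)[OF w, of a] act_uminus[OF W_inv[OF w], of s] by metis+
    have "- act (arefl s) (act w a) \<in> Pos \<longleftrightarrow> - act w a \<in> Pos"
    proof
      assume "- act w a \<in> Pos"
      then have "act (arefl s) (- act w a) \<in> Pos" using ne by (intro act_simple_pos s) (auto simp: minus_equation_iff)
      then show "- act (arefl s) (act w a) \<in> Pos" by (simp add: act_uminus Ws)
    next
      assume n: "- act (arefl s) (act w a) \<in> Pos"
      show "- act w a \<in> Pos"
      proof (rule ccontr)
        assume "- act w a \<notin> Pos"
        then have "act w a \<in> Pos" using Pos_cases[OF act_Sig[OF w Pos_Sig[OF that(1)]]] by blast
        from act_simple_pos[OF s this ne(1)] show False using n Pos_not_uminus by blast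
      qed
    qed
    then show ?thesis using that by (simp add: Inv_def act_comp Ws w)
  qed
  have c: "act w (act (inv w) s) = s" by (simp add: w)
  have cs: "act (arefl s \<circ> w) (act (inv w) s) = - s" by (simp add: act_comp Ws w act_self sS)
  have mc: "act w (- act (inv w) s) = - s" by (simp add: act_uminus w)
  have mcs: "act (arefl s \<circ> w) (- act (inv w) s) = s" by (simp add: act_uminus W_comp Ws w cs)
  show "Inv (arefl s \<circ> w) = insert (act (inv w) s) (Inv w) \<and> act (inv w) s \<notin> Inv w" if p: "act (inv w) s \<in> Pos"
  proof -
    have "act (inv w) s \<in> Inv (arefl s \<circ> w)" "act (inv w) s \<notin> Inv w"
      using p sP cs c Pos_not_uminus by (auto simp: Inv_def)
    moreover have "- act (inv w) s \<notin> Pos" using p Pos_not_uminus by blast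
    ultimately show ?thesis using mem unfolding Inv_def by blast
  qed
  show "Inv (arefl s \<circ> w) = Inv w - {- act (inv w) s} \<and> - act (inv w) s \<in> Inv w" if p: "act (inv w) s \<notin> Pos"
  proof -
    have np: "- act (inv w) s \<in> Pos" using p Pos_cases[OF act_Sig[OF W_inv[OF w] sS]] by blast
    have "- act (inv w) s \<in> Inv w" "- act (inv w) s \<notin> Inv (arefl s \<circ> w)"
      using np sP mc mcs Pos_not_uminus by (auto simp: Inv_def)
    then show ?thesis using mem p unfolding Inv_def by blast
  qed
qed

lemma Inv_id: "Inv id = {}" using Pos_not_uminus by (auto simp: Inv_def)

subsection \<open>Words in the simple reflections\<close>

definition wmap :: "'a affine_functional list \<Rightarrow> 'a \<Rightarrow> 'a" where
  "wmap ws = foldr (\<circ>) (map arefl ws) id"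

lemma wmap_simps [simp]: "wmap [] = id" "wmap (s # ws) = arefl s \<circ> wmap ws"
  by (simp_all add: wmap_def)

lemma wmap_append: "wmap (us @ vs) = wmap us \<circ> wmap vs"
  by (induction us) (auto simp: o_assoc)

lemma wmap_W: "set ws \<subseteq> S \<Longrightarrow> wmap ws \<in> W"
  using S_Sig by (induction ws) (auto simp: W_id intro!: W_comp W_arefl)

text \<open>Each letter changes the number of inversions by exactly one. The parity statement shows
  later that relations have even length.\<close>

lemma finite_Inv_wmap: "set ws \<subseteq> S \<Longrightarrow> finite (Inv (wmap ws)) \<and> card (Inv (wmap ws)) \<le> length ws \<and>
    even (card (Inv (wmap ws)) + length ws)"
proof (induction ws)
  case (Cons s ws)
  then have IH: "finite (Inv (wmap ws))" "card (Inv (wmap ws)) \<le> length ws" "even (card (Inv (wmap ws)) + length ws)"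
    and s: "s \<in> S" and w: "wmap ws \<in> W" using wmap_W by auto
  show ?case
  proof (cases "act (inv (wmap ws)) s \<in> Pos")
    case True
    note I = Inv_arefl(1)[OF s w True, folded wmap_simps(2)]
    have "card (Inv (wmap (s # ws))) = Suc (card (Inv (wmap ws)))" "finite (Inv (wmap (s # ws)))"
      using I IH(1) by (simp_all del: wmap_simps)
    then show ?thesis using IH(2,3) by (simp del: wmap_simps)
  next
    case False
    note I = Inv_arefl(2)[OF s w False, folded wmap_simps(2)]
    have "card (Inv (wmap ws)) = Suc (card (Inv (wmap (s # ws))))"
      using I card_Suc_Diff1[OF IH(1), of "- act (inv (wmap ws)) s"] by (simp del: wmap_simps)
    moreover have "finite (Inv (wmap (s # ws)))" using I IH(1) by (simp del: wmap_simps)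
    ultimately show ?thesis using IH(2,3) by (simp del: wmap_simps)
  qed
qed (simp add: Inv_id)

text \<open>Induction on the value of a at a fixed point y of the alcove, in steps of d, the least
  value of a simple root at y. As fst a has positive square, some simple s has positive inner
  product with a; the integer m is then at least 1, so s lowers the value by at least d, and the
  reflection in a is conjugate by s to the one in s a.\<close>

lemma W_word_pos: "a \<in> Pos \<Longrightarrow> \<exists>ws. set ws \<subseteq> S \<and> arefl a = wmap ws"
proof -
  obtain y where y: "y \<in> C" using C_nonempty by blast
  define d where "d = Min ((\<lambda>s. aeval s y) ` S)"
  have Sne: "S \<noteq> {}" by (simp add: affine_basis_def)
  have d: "d > 0" unfolding d_def using finite_S Sne y by (subst Min_gr_iff) (auto simp: fund_alcove_def)
  have dle: "d \<le> aeval s y" if "s \<in> S" for s unfolding d_def using finite_S that by auto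
  have "a \<in> Pos \<Longrightarrow> aeval a y < real n * d \<Longrightarrow> \<exists>ws. set ws \<subseteq> S \<and> arefl a = wmap ws" for n a
  proof (induction n arbitrary: a)
    case 0
    then show ?case using Pos_pos[OF 0(1) y] by simp
  next
    case (Suc n)
    note aS = Pos_Sig[OF Suc.prems(1)]
    show ?case
    proof (cases "a \<in> S")
      case True
      then show ?thesis by (intro exI[of _ "[a]"]) simp
    next
      case False
      obtain c where c: "a = (\<Sum>s\<in>S. real (c s) *\<^sub>R s)" using PosE[OF Suc.prems(1)] by metis
      have "fst a \<bullet> fst a = (\<Sum>s\<in>S. real (c s) * (fst s \<bullet> fst a))"
        by (subst (1) c) (simp add: fst_sum inner_sum_left)
      moreover have "fst a \<bullet> fst a > 0" using Sig_fst(3)[OF aS] by simp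
      ultimately have "\<exists>s\<in>S. real (c s) * (fst s \<bullet> fst a) > 0"
        by (metis (no_types, lifting) not_le sum_nonpos)
      then obtain s where s: "s \<in> S" "fst s \<bullet> fst a > 0"
        by (metis mult_nonneg_nonpos not_le of_nat_0_le_iff)
      have sS: "s \<in> Sig" using s S_Sig by blast
      define m where "m = fst a \<bullet> coroot (fst s)"
      have "m > 0" using s(2) Sig_fst(3)[OF sS] by (simp add: m_def coroot_def inner_commute)
      moreover have "m \<in> \<int>" unfolding m_def by (rule int_R[OF Sig_fst(1)[OF sS] Sig_fst(1)[OF aS]])
      ultimately have m: "m \<ge> 1" by (auto elim!: Ints_cases)
      define a' where "a' = act (arefl s) a"
      have a': "a' \<in> Pos" unfolding a'_def using False s by (intro act_simple_pos Suc.prems) auto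
      have "aeval a' y = aeval a y - m * aeval s y"
        unfolding a'_def act_arefl[OF sS] m_def[symmetric] by (simp add: aeval_def inner_diff_left algebra_simps)
      moreover have "d \<le> m * aeval s y" using dle[OF s(1)] m d by (metis mult_1 mult_mono order.strict_implies_order order_trans zero_le_one)
      ultimately have "aeval a' y < real n * d" using Suc.prems(2) by (simp add: algebra_simps)
      from Suc.IH[OF a' this] obtain ws where ws: "set ws \<subseteq> S" "arefl a' = wmap ws" by blast
      have "arefl a = arefl s \<circ> arefl a' \<circ> arefl s"
        using arefl_act[OF W_arefl[OF sS] aS] Sig_fst(3)[OF sS] by (auto simp: fun_eq_iff a'_def)
      then have "arefl a = wmap (s # ws @ [s])" using ws by (simp add: wmap_append o_assoc)
      then show ?thesis using ws s by (intro exI[of _ "s # ws @ [s]"]) auto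
    qed
  qed
  moreover obtain n where "aeval a y < real n * d" using d reals_Archimedean3 by blast
  ultimately show "a \<in> Pos \<Longrightarrow> ?thesis" by blast
qed

lemma W_word: "w \<in> W \<Longrightarrow> \<exists>ws. set ws \<subseteq> S \<and> w = wmap ws"
proof (induction rule: affine_weyl_group.induct)
  case 1
  then show ?case by (intro exI[of _ "[]"]) simp
next
  case (2 a w)
  then obtain ws where ws: "set ws \<subseteq> S" "w = wmap ws" by blast
  obtain us where "set us \<subseteq> S" "arefl a = wmap us"
    using Pos_cases[OF 2(1)] W_word_pos[of a] W_word_pos[of "- a"] by (auto simp: arefl_uminus)
  then show ?case using ws by (intro exI[of _ "us @ ws"]) (auto simp: wmap_append)
qed

lemma finite_Inv: "w \<in> W \<Longrightarrow> finite (Inv w)" using W_word finite_Inv_wmap by blast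

text \<open>The letters carry the positive root a step by step to a negative one. By
  \<open>act_simple_pos\<close> the sign can change only at a letter t to which a has just been
  carried.\<close>

lemma exchange:
  "set vs \<subseteq> S \<Longrightarrow> a \<in> Pos \<Longrightarrow> act (inv (wmap vs)) a \<notin> Pos \<Longrightarrow>
    \<exists>xs t ys. vs = xs @ t # ys \<and> act (inv (wmap xs)) a = t"
proof (induction vs arbitrary: a)
  case (Cons t vs)
  have t: "t \<in> S" "t \<in> Sig" and vs: "set vs \<subseteq> S" using Cons.prems S_Sig by auto
  show ?case
  proof (cases "a = t")
    case True
    have "act (inv (wmap [])) a = t" unfolding wmap_simps inv_id act_id by (rule True)
    with append_Nil[symmetric] show ?thesis by blast
  next
    case False
    have *: "act (inv (wmap (t # xs))) a = act (inv (wmap xs)) (act (arefl t) a)" if "set xs \<subseteq> S" for xs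
      using wmap_W[OF that] t by (simp add: W_inv_comp W_arefl inv_arefl act_comp W_inv)
    have p: "act (arefl t) a \<in> Pos" by (rule act_simple_pos[OF t(1) Cons.prems(2) False])
    have "act (inv (wmap vs)) (act (arefl t) a) \<notin> Pos" using Cons.prems(3) unfolding *[OF vs] .
    from Cons.IH[OF vs p this]
    obtain xs t' ys where x: "vs = xs @ t' # ys" "act (inv (wmap xs)) (act (arefl t) a) = t'" by blast
    have xs: "set xs \<subseteq> S" using x vs by auto
    have "t # vs = (t # xs) @ t' # ys" using x(1) by simp
    moreover have "act (inv (wmap (t # xs))) a = t'" unfolding *[OF xs] by (rule x(2))
    ultimately show ?thesis by blast
  qed
qed (simp add: inv_id)

text \<open>The conclusion is kept as the relation s xs = xs t, rather than as a shortened word,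
  because the relation has to be tested on the operators Q as well.\<close>

lemma deletion:
  "set ws \<subseteq> S \<Longrightarrow> card (Inv (wmap ws)) < length ws \<Longrightarrow>
    \<exists>us s xs t ys. ws = us @ s # xs @ t # ys \<and> wmap (s # xs) = wmap (xs @ [t])"
proof (induction ws)
  case (Cons s ws)
  have s: "s \<in> S" "s \<in> Sig" and ws: "set ws \<subseteq> S" using Cons.prems S_Sig by auto
  show ?case
  proof (cases "act (inv (wmap ws)) s \<in> Pos")
    case True
    then have "card (Inv (wmap (s # ws))) = Suc (card (Inv (wmap ws)))"
      using Inv_arefl(1)[OF s(1) wmap_W[OF ws] True, folded wmap_simps(2)] finite_Inv_wmap[OF ws] by (simp del: wmap_simps)
    then have "card (Inv (wmap ws)) < length ws" using Cons.prems by (simp del: wmap_simps)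
    from Cons.IH[OF ws this] obtain us s' xs t ys where x: "ws = us @ s' # xs @ t # ys" "wmap (s' # xs) = wmap (xs @ [t])" by blast
    have "s # ws = (s # us) @ s' # xs @ t # ys" using x(1) by simp
    then show ?thesis using x(2) by blast
  next
    case False
    obtain xs t ys where x: "ws = xs @ t # ys" "act (inv (wmap xs)) s = t"
      using exchange[OF ws _ False] S_Pos s by blast
    have xs: "set xs \<subseteq> S" using x ws by auto
    note xW = wmap_W[OF xs]
    have st: "act (wmap xs) t = s" using x(2) act_inv(1)[OF xW] by blast
    have "t \<in> Sig" using x ws S_Sig by auto
    then have "arefl s (wmap xs v) = wmap xs (arefl t v)" for v using arefl_act[OF xW, of t v] st by simp
    then have "wmap (s # xs) = wmap (xs @ [t])" by (auto simp: wmap_append fun_eq_iff)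
    moreover have "s # ws = [] @ s # xs @ t # ys" using x by simp
    ultimately show ?thesis by blast
  qed
qed simp

text \<open>A shortest word for w is empty, since otherwise \<open>deletion\<close> would remove two
  of its letters.\<close>

lemma Inv_empty: assumes "w \<in> W" "Inv w = {}" shows "w = id"
proof -
  define Q where "Q ws \<longleftrightarrow> set ws \<subseteq> S \<and> w = wmap ws" for ws
  obtain ws0 where "Q ws0" using W_word[OF assms(1)] unfolding Q_def by blast
  from ex_has_least_nat[of Q ws0 length, OF this]
  obtain ws where Q: "Q ws" and least: "\<And>vs. Q vs \<Longrightarrow> length ws \<le> length vs" by blast
  have ws: "set ws \<subseteq> S" "w = wmap ws" using Q by (auto simp: Q_def)
  have "ws = []"
  proof (rule ccontr)
    assume "ws \<noteq> []"
    then have "card (Inv (wmap ws)) < length ws" using assms(2) ws(2) by simp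
    from deletion[OF ws(1) this] obtain us s xs t ys where x: "ws = us @ s # xs @ t # ys" "wmap (s # xs) = wmap (xs @ [t])" by blast
    have "t \<in> Sig" using x ws(1) S_Sig by auto
    moreover have "arefl s (wmap xs v) = wmap xs (arefl t v)" for v using fun_cong[OF x(2), of v] by (simp add: wmap_append)
    ultimately have "wmap (s # xs @ t # ys) = wmap (xs @ ys)"
      using Sig_fst(3)[of t] by (simp add: wmap_append fun_eq_iff)
    then have "w = wmap (us @ xs @ ys)" using ws(2) x(1) by (simp add: wmap_append)
    then have "Q (us @ xs @ ys)" using ws(1) x(1) unfolding Q_def by auto
    then show False using least x(1) by fastforce
  qed
  then show ?thesis using ws by simp
qed

text \<open>Otherwise all simple roots, and with them -w a, are non-negative at w y for y in
  \<open>C\<close>; but -w a takes there the value -a(y) < 0.\<close>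

lemma exists_descent: assumes w: "w \<in> W" "Inv w \<noteq> {}" shows "\<exists>s\<in>S. act (inv w) s \<notin> Pos"
proof (rule ccontr)
  assume n: "\<not> ?thesis"
  obtain a where a: "a \<in> Pos" "- act w a \<in> Pos" using w(2) by (auto simp: Inv_def)
  obtain y where y: "y \<in> C" using C_nonempty by blast
  obtain c where c: "- act w a = (\<Sum>s\<in>S. real (c s) *\<^sub>R s)" using PosE[OF a(2)] by metis
  have "- aeval a y = aeval (- act w a) (w y)" by (simp add: aeval_uminus aeval_act w)
  also have "\<dots> = (\<Sum>s\<in>S. real (c s) * aeval s (w y))" unfolding c aeval_sum ..
  also have "\<dots> \<ge> 0"
  proof (intro sum_nonneg mult_nonneg_nonneg)
    fix s assume "s \<in> S"
    then have "aeval (act (inv w) s) y > 0" using n Pos_pos[OF _ y] by blast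
    then show "aeval s (w y) \<ge> 0" using aeval_act[OF W_inv[OF w(1)], of s "w y"] w by simp
  qed simp
  finally show False using Pos_pos[OF a(1) y] by simp
qed

text \<open>The closed alcove is a strict fundamental domain, and the stabilizer of a point is
  generated by the walls through it. Induction on the number of inversions: for a descent s the
  negative root w^-1 s is at most 0 at v, while s is at least 0 at w v; so w v is on the wall of s,
  and s can be stripped off.\<close>

lemma stabilizer:
  assumes "w \<in> W" "v \<in> Cb" "w v \<in> Cb"
  shows "w v = v \<and> (\<exists>ws. set ws \<subseteq> {s\<in>S. aeval s v = 0} \<and> w = wmap ws)"
  using assms
proof (induction "card (Inv w)" arbitrary: w)
  case 0
  then have w: "w = wmap []" using Inv_empty finite_Inv unfolding wmap_simps by auto
  then have "w v = v" by simp
  then show ?case using w by (intro conjI exI[of _ "[]"]) simp_all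
next
  case (Suc n)
  then have "Inv w \<noteq> {}" by force
  then obtain s where s: "s \<in> S" "act (inv w) s \<notin> Pos" using exists_descent Suc by blast
  have sS: "s \<in> Sig" using s S_Sig by blast
  have "- act (inv w) s \<in> Pos" using s Pos_cases[OF act_Sig[OF W_inv[OF Suc.prems(1)] sS]] by blast
  from Pos_nonneg[OF this Suc.prems(2)] have "aeval s (w v) \<le> 0"
    using aeval_act[OF W_inv[OF Suc.prems(1)], of s "w v"] Suc.prems(1) by (simp add: aeval_uminus)
  moreover have "aeval s (w v) \<ge> 0" using Suc.prems(3) s by (auto simp: Cb_def)
  ultimately have z: "aeval s (w v) = 0" by simp
  then have fixv: "arefl s (w v) = w v" by (simp add: arefl_def)
  have I: "Inv (arefl s \<circ> w) = Inv w - {- act (inv w) s}" "- act (inv w) s \<in> Inv w"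
    using Inv_arefl(2)[OF s(1) Suc.prems(1) s(2)] by auto
  have "n = card (Inv (arefl s \<circ> w))"
    using I finite_Inv[OF Suc.prems(1)] Suc.hyps(2) by simp
  from Suc.hyps(1)[OF this W_comp[OF W_arefl[OF sS] Suc.prems(1)] Suc.prems(2)] fixv Suc.prems(3)
  obtain ws where ws: "w v = v" "set ws \<subseteq> {s\<in>S. aeval s v = 0}" "arefl s \<circ> w = wmap ws" by auto
  have "w = wmap (s # ws)" using ws(3)[symmetric] arefl_comp[OF sS] by (simp add: o_assoc)
  then show ?case using ws s z by (intro conjI exI[of _ "s # ws"]) auto
qed

section \<open>Finiteness properties and the reduction to the fundamental alcove\<close>

text \<open>Positive affine roots have non-negative constant terms; these are bounded in terms of x
  and K, and there are finitely many gradients.\<close>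

lemma finite_Neg: "finite {a \<in> Pos. aeval a x \<le> K}"
proof -
  have "{a \<in> Pos. aeval a x \<le> K} \<subseteq> R \<times> (real ` {n. n \<le> nat \<lceil>\<bar>K\<bar> + (\<Sum>\<alpha>\<in>R. \<bar>\<alpha> \<bullet> x\<bar>)\<rceil>})"
  proof
    fix a assume a: "a \<in> {a \<in> Pos. aeval a x \<le> K}"
    then have aP: "a \<in> Pos" and le: "aeval a x \<le> K" by auto
    note aS = Pos_Sig[OF aP]
    obtain c where c: "a = (\<Sum>s\<in>S. real (c s) *\<^sub>R s)" using PosE[OF aP] by metis
    have "snd a = (\<Sum>s\<in>S. real (c s) * snd s)" by (subst c) (simp add: snd_sum)
    also have "\<dots> \<ge> 0" by (intro sum_nonneg mult_nonneg_nonneg) (auto simp: affine_basis_def)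
    finally have nn: "snd a \<ge> 0" .
    then obtain n where n: "snd a = real n" using Sig_fst(2)[OF aS] by (auto elim!: Ints_cases intro: zero_le_imp_eq_int)
        (metis of_nat_nat of_int_0_le_iff of_int_of_nat_eq)
    have "\<bar>fst a \<bullet> x\<bar> \<le> (\<Sum>\<alpha>\<in>R. \<bar>\<alpha> \<bullet> x\<bar>)" using Sig_fst(1)[OF aS] finite_R by (intro member_le_sum) auto
    then have "real n \<le> \<bar>K\<bar> + (\<Sum>\<alpha>\<in>R. \<bar>\<alpha> \<bullet> x\<bar>)" using le n by (simp add: aeval_def)
    then have "n \<le> nat \<lceil>\<bar>K\<bar> + (\<Sum>\<alpha>\<in>R. \<bar>\<alpha> \<bullet> x\<bar>)\<rceil>" by linarith
    then show "a \<in> R \<times> (real ` {n. n \<le> nat \<lceil>\<bar>K\<bar> + (\<Sum>\<alpha>\<in>R. \<bar>\<alpha> \<bullet> x\<bar>)\<rceil>})"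
      using Sig_fst(1)[OF aS] n by (simp add: mem_Times_iff)
  qed
  then show ?thesis using finite_R by (rule finite_subset[OF _ finite_cartesian_product]) simp
qed

text \<open>A simple reflection s with s(x) < 0 lowers the number of positive roots negative at x:
  it permutes the positive roots other than s and drops s from the list.\<close>

lemma to_chamber: "\<exists>w\<in>W. w x \<in> Cb"
proof (induction "card {a \<in> Pos. aeval a x < 0}" arbitrary: x rule: less_induct)
  case less
  have fin: "finite {a \<in> Pos. aeval a x < 0}" for x
    by (rule finite_subset[OF _ finite_Neg[of x 0]]) auto
  show ?case
  proof (cases "x \<in> Cb")
    case True
    then show ?thesis using W_id by (intro bexI[of _ id]) auto
  next
    case False
    then obtain s where s: "s \<in> S" "aeval s x < 0" by (auto simp: Cb_def not_le)
    have sS: "s \<in> Sig" and sP: "s \<in> Pos" using s S_Sig S_Pos by auto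
    note Ws = W_arefl[OF sS]
    have "act (arefl s) ` {a \<in> Pos. aeval a (arefl s x) < 0} \<subseteq> {a \<in> Pos. aeval a x < 0} - {s}"
    proof (rule image_subsetI)
      fix a assume "a \<in> {a \<in> Pos. aeval a (arefl s x) < 0}"
      then have a: "a \<in> Pos" "aeval a (arefl s x) < 0" by auto
      have ne: "a \<noteq> s" using a s Sig_fst(3)[OF sS] by (auto simp: aeval_arefl_self)
      have p: "act (arefl s) a \<in> Pos" by (rule act_simple_pos[OF s(1) a(1) ne])
      have "act (arefl s) a \<noteq> s"
      proof
        assume "act (arefl s) a = s"
        then have "act (arefl s) (act (arefl s) a) = act (arefl s) s" by simp
        then have "a = - s" using act_comp[OF Ws Ws, of a] by (simp add: arefl_comp[OF sS] act_self[OF sS])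
        then show False using a(1) sP Pos_not_uminus by blast
      qed
      moreover have "aeval (act (arefl s) a) x < 0"
        using a(2) aeval_act_inv[OF Ws, of a x] by (simp add: inv_arefl[OF sS])
      ultimately show "act (arefl s) a \<in> {a \<in> Pos. aeval a x < 0} - {s}" using p by simp
    qed
    moreover have "inj_on (act (arefl s)) {a \<in> Pos. aeval a (arefl s x) < 0}"
      by (rule inj_onI) (metis act_inv(2) Ws)
    ultimately have "card {a \<in> Pos. aeval a (arefl s x) < 0} \<le> card ({a \<in> Pos. aeval a x < 0} - {s})"
      using fin by (intro card_inj_on_le) auto
    also have "\<dots> < card {a \<in> Pos. aeval a x < 0}"
      using fin sP s by (intro card_Diff1_less) auto
    finally obtain w where "w \<in> W" "w (arefl s x) \<in> Cb" using less by blast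
    then show ?thesis using Ws by (intro bexI[of _ "w \<circ> arefl s"] W_comp) auto
  qed
qed

subsection \<open>Alcoves\<close>

lemma reg_W: "w \<in> W \<Longrightarrow> w x \<in> reg \<longleftrightarrow> x \<in> reg"
proof -
  have *: "w x \<in> reg" if "w \<in> W" "x \<in> reg" for w x
    unfolding regular_set_def
  proof (rule CollectI, rule ballI)
    fix a assume a: "a \<in> Pos"
    have "act (inv w) a \<in> Sig" using act_Sig[OF W_inv[OF that(1)] Pos_Sig[OF a]] .
    then have "aeval (act (inv w) a) x \<noteq> 0"
      using Pos_cases that(2) by (fastforce simp: regular_set_def aeval_uminus)
    then show "aeval a (w x) \<noteq> 0" using aeval_act[OF W_inv[OF that(1)], of a "w x"] that(1) by simp
  qed
  assume w: "w \<in> W"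
  show ?thesis using *[OF w] *[OF W_inv[OF w], of "w x"] w by auto
qed

lemma C_reg: "C \<subseteq> reg" using Pos_pos by (force simp: regular_set_def)

lemma Cb_reg: "v \<in> Cb \<Longrightarrow> v \<in> reg \<Longrightarrow> v \<in> C"
  using S_Pos by (force simp: Cb_def regular_set_def fund_alcove_def)

lemma open_C: "open C"
proof -
  have "C = (\<Inter>s\<in>S. {v. 0 < aeval s v})" by (auto simp: fund_alcove_def)
  moreover have "open {v. 0 < aeval s v}" for s by (intro open_Collect_less continuous_intros)
  ultimately show ?thesis using open_INT[OF finite_S, of "\<lambda>s. {v. 0 < aeval s v}"] by metis
qed

lemma closed_Cb: "closed Cb"
proof -
  have "Cb = (\<Inter>s\<in>S. {v. 0 \<le> aeval s v})" by (auto simp: Cb_def)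
  moreover have "closed {v. 0 \<le> aeval s v}" for s by (intro closed_Collect_le continuous_intros)
  ultimately show ?thesis using closed_INT[of S "\<lambda>s. {v. 0 \<le> aeval s v}"] by metis
qed

lemma convex_C: "convex C"
proof (rule convexI)
  fix x y and u v :: real assume *: "x \<in> C" "y \<in> C" "0 \<le> u" "0 \<le> v" "u + v = 1"
  have "aeval s (u *\<^sub>R x + v *\<^sub>R y) = u * aeval s x + v * aeval s y" for s :: "'a affine_functional"
  proof -
    have "snd s = (u + v) * snd s" using * by simp
    then show ?thesis by (simp add: aeval_def inner_add_right algebra_simps)
  qed
  moreover have "u * p + v * q > 0" if "p > 0" "q > 0" for p q
  proof (cases "u = 0")
    case False
    then show ?thesis using * that by (intro add_pos_nonneg mult_pos_pos mult_nonneg_nonneg) auto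
  qed (use * that in auto)
  ultimately show "u *\<^sub>R x + v *\<^sub>R y \<in> C"
    using * by (simp add: fund_alcove_def)
qed

lemma closure_C: "closure C = Cb"
proof
  show "closure C \<subseteq> Cb" by (rule closure_minimal[OF C_Cb closed_Cb])
  show "Cb \<subseteq> closure C"
  proof
    fix v assume v: "v \<in> Cb"
    obtain y where y: "y \<in> C" using C_nonempty by blast
    define f where "f n = v + (1 / real (Suc n)) *\<^sub>R (y - v)" for n
    have "f n \<in> C" for n
    proof -
      define t where "t = 1 / real (Suc n)"
      have t: "0 < t" "t \<le> 1" by (auto simp: t_def)
      have "aeval s (v + t *\<^sub>R (y - v)) > 0" if "s \<in> S" for s
      proof -
        have "aeval s (v + t *\<^sub>R (y - v)) = (1 - t) * aeval s v + t * aeval s y"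
          by (simp add: aeval_def inner_add_right inner_diff_right algebra_simps)
        moreover have "(1 - t) * aeval s v \<ge> 0" "t * aeval s y > 0"
          using v y t that by (auto simp: Cb_def fund_alcove_def)
        ultimately show ?thesis by linarith
      qed
      then show ?thesis by (auto simp: f_def t_def fund_alcove_def)
    qed
    moreover have "f \<longlonglongrightarrow> v + 0 *\<^sub>R (y - v)"
      unfolding f_def by (intro tendsto_intros LIMSEQ_Suc[OF lim_1_over_n])
    ultimately show "v \<in> closure C" unfolding closure_sequential by (intro exI[of _ f]) auto
  qed
qed

lemma W_continuous: "w \<in> W \<Longrightarrow> continuous_on A w"
proof -
  assume w: "w \<in> W"
  have "continuous_on A (\<lambda>v. lin w v + w 0)"
    by (intro continuous_intros bounded_linear.continuous_on[OF weyl_bounded_linear[OF lin(1)[OF w]]])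
  then show ?thesis using lin(2)[OF w] by (metis continuous_on_cong)
qed

lemma W_image: "w \<in> W \<Longrightarrow> w ` A = inv w -` A"
  by (auto simp: image_iff) (metis W_inv_simps(1))

lemma open_W: "w \<in> W \<Longrightarrow> open A \<Longrightarrow> open (w ` A)"
  unfolding W_image by (rule open_vimage[OF _ W_continuous[OF W_inv]])

lemma reg_union: "reg = (\<Union>w\<in>W. w ` C)"
proof
  show "reg \<subseteq> (\<Union>w\<in>W. w ` C)"
  proof
    fix x assume x: "x \<in> reg"
    obtain w where w: "w \<in> W" "w x \<in> Cb" using to_chamber by blast
    then have "w x \<in> C" using Cb_reg reg_W x by blast
    then show "x \<in> (\<Union>w\<in>W. w ` C)" using w W_inv by (intro UN_I[of "inv w"]) (auto intro: image_eqI[of _ _ "w x"])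
  qed
qed (use C_reg reg_W in auto)

lemma open_reg: "open reg"
  unfolding reg_union by (intro open_UN ballI open_W open_C)

text \<open>A point of the open alcove lies on no wall, so the word provided by
  \<open>stabilizer\<close> is empty.\<close>

lemma alcove_disjoint:
  assumes "w \<in> W" "w' \<in> W" "y \<in> C" "y' \<in> C" "w y = w' y'" shows "w = w'" "y = y'"
proof -
  define u where "u = inv w' \<circ> w"
  have u: "u \<in> W" "u y = y'" using assms W_comp W_inv by (auto simp: u_def)
  obtain ws where ws: "u y = y" "set ws \<subseteq> {s\<in>S. aeval s y = 0}" "u = wmap ws"
    using stabilizer[OF u(1), of y] u assms C_Cb by blast
  show "y = y'" using u ws by simp
  have "ws = []" using ws(2) assms(3) by (cases ws) (auto simp: fund_alcove_def)
  then have "inv w' (w v) = v" for v using ws(3) by (simp add: u_def fun_eq_iff)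
  then show "w = w'" using assms(2) W_inv_simps(1) by (metis ext)
qed

text \<open>The translates of \<open>C\<close> are connected, open and pairwise disjoint and cover
  the regular set, hence they are its components.\<close>

lemma alcoves_eq: "alcoves R B \<phi> = (\<lambda>w. w ` C) ` W"
proof
  have con: "connected (w ` C)" if "w \<in> W" for w
    by (intro connected_continuous_image W_continuous that convex_connected convex_C)
  have alc: "w ` C \<in> components reg" if w: "w \<in> W" for w
    unfolding in_components_maximal
  proof (intro conjI allI impI)
    show "w ` C \<noteq> {}" using C_nonempty by simp
    show "w ` C \<subseteq> reg" using reg_union w by blast
    show "connected (w ` C)" by (rule con[OF w])
    fix D assume D: "D \<noteq> {} \<and> w ` C \<subseteq> D \<and> D \<subseteq> reg \<and> connected D"
    define V where "V = (\<Union>w'\<in>W - {w}. w' ` C)"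
    have oV: "open V" unfolding V_def by (intro open_UN ballI open_W open_C) simp
    have cov: "D \<subseteq> w ` C \<union> V"
    proof
      fix x assume "x \<in> D"
      then have "x \<in> reg" using D by auto
      then obtain w' where w': "w' \<in> W" "x \<in> w' ` C" unfolding reg_union by (elim UN_E)
      show "x \<in> w ` C \<union> V"
      proof (cases "w' = w")
        case False
        then have "x \<in> V" unfolding V_def using w' by (intro UN_I[of w']) simp_all
        then show ?thesis by simp
      qed (use w' in simp)
    qed
    have dis: "w ` C \<inter> V = {}"
    proof (rule ccontr)
      assume "w ` C \<inter> V \<noteq> {}"
      then obtain y y' w' where "y \<in> C" "y' \<in> C" "w' \<in> W" "w' \<noteq> w" "w y = w' y'" by (auto simp: V_def)
      then show False using alcove_disjoint(1)[OF w, of w' y y'] by blast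
    qed
    have ne: "w ` C \<inter> D \<noteq> {}" using D C_nonempty by auto
    have "V \<inter> D = {}"
    proof (rule ccontr)
      assume n: "V \<inter> D \<noteq> {}"
      have "connected D" using D by blast
      from connectedD[OF this open_W[OF w open_C] oV _ cov] ne n dis show False by blast
    qed
    then show "D = w ` C" using cov D by blast
  qed
  then show "(\<lambda>w. w ` C) ` W \<subseteq> alcoves R B \<phi>" by (auto simp: alcoves_def)
  show "alcoves R B \<phi> \<subseteq> (\<lambda>w. w ` C) ` W"
  proof
    fix D assume "D \<in> alcoves R B \<phi>"
    then have D: "D \<in> components reg" by (simp only: alcoves_def)
    obtain x where x: "x \<in> D" using in_components_nonempty[OF D] by blast
    then have "x \<in> reg" using in_components_subset[OF D] by auto
    then obtain w where w: "w \<in> W" "x \<in> w ` C" unfolding reg_union by (elim UN_E)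
    have "D \<inter> w ` C \<noteq> {}" using x w by blast
    then have "D = w ` C" using components_nonoverlap[OF D alc[OF w(1)]] by blast
    then show "D \<in> (\<lambda>w. w ` C) ` W" using w by blast
  qed
qed

text \<open>One radius serves all roots at once: only finitely many nonzero values at x are at most
  M, and roots with larger values cannot vanish within distance 1 because their gradients are
  shorter than M.\<close>

lemma local_finite: "\<exists>r>0. \<forall>a\<in>Sig. aeval a x \<noteq> 0 \<longrightarrow> (\<forall>y\<in>ball x r. aeval a x * aeval a y > 0)"
proof -
  define M where "M = Max (norm ` R) + 1"
  have M: "norm \<alpha> < M" if "\<alpha> \<in> R" for \<alpha>
  proof -
    have "norm \<alpha> \<le> Max (norm ` R)" using finite_R that by simp
    then show ?thesis by (simp add: M_def)
  qed
  have Mpos: "M > 0" using M[OF phi_R] norm_ge_zero[of \<phi>] by linarith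
  define F where "F = {a \<in> Sig. \<bar>aeval a x\<bar> \<le> M \<and> aeval a x \<noteq> 0}"
  have "F \<subseteq> {a \<in> Pos. aeval a x \<le> M} \<union> uminus ` {a \<in> Pos. aeval a x \<le> M}"
  proof
    fix a assume a: "a \<in> F"
    show "a \<in> {a \<in> Pos. aeval a x \<le> M} \<union> uminus ` {a \<in> Pos. aeval a x \<le> M}"
    proof (cases "a \<in> Pos")
      case False
      then have "- a \<in> {a \<in> Pos. aeval a x \<le> M}" using a Pos_cases[of a] by (auto simp: F_def aeval_uminus)
      then have "- (- a) \<in> uminus ` {a \<in> Pos. aeval a x \<le> M}" by (rule imageI)
      then show ?thesis by simp
    qed (use a in \<open>auto simp: F_def\<close>)
  qed
  then have finF: "finite F" using finite_Neg[of x M] by (meson finite_UnI finite_imageI finite_subset)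
  define r where "r = Min (insert 1 ((\<lambda>a. \<bar>aeval a x\<bar> / M) ` F))"
  have r: "r > 0" unfolding r_def using finF Mpos by (auto simp: F_def)
  have r1: "r \<le> 1" "\<And>a. a \<in> F \<Longrightarrow> r \<le> \<bar>aeval a x\<bar> / M" unfolding r_def using finF by (auto intro!: Min_le)
  have "aeval a x * aeval a y > 0" if a: "a \<in> Sig" "aeval a x \<noteq> 0" and y: "y \<in> ball x r" for a y
  proof -
    have "r \<le> \<bar>aeval a x\<bar> / M"
    proof (cases "a \<in> F")
      case False
      then have "M \<le> \<bar>aeval a x\<bar>" using a by (auto simp: F_def)
      then have "1 \<le> \<bar>aeval a x\<bar> / M" using Mpos by simp
      then show ?thesis using r1 by linarith
    qed (use r1 in blast)
    then have rM: "r * M \<le> \<bar>aeval a x\<bar>" using Mpos by (simp add: field_simps)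
    have "\<bar>aeval a y - aeval a x\<bar> = \<bar>fst a \<bullet> (y - x)\<bar>" by (simp add: aeval_def inner_diff_right)
    also have "\<dots> \<le> norm (fst a) * norm (y - x)" by (rule Cauchy_Schwarz_ineq2)
    also have "\<dots> \<le> M * norm (y - x)" using M[OF Sig_fst(1)[OF a(1)]] by (intro mult_right_mono) auto
    also have "\<dots> < M * r" using y Mpos by (simp add: dist_norm norm_minus_commute)
    finally have "\<bar>aeval a y - aeval a x\<bar> < \<bar>aeval a x\<bar>" using rM by (simp add: mult.commute)
    then show ?thesis by (auto simp: zero_less_mult_iff abs_if split: if_splits)
  qed
  then show ?thesis using r by blast
qed

text \<open>Near x only closed alcoves that contain x are met; this gives the continuity of T f
  across the walls.\<close>

lemma local_chambers:
  "\<exists>r>0. \<forall>y\<in>ball x r. \<forall>w\<in>W. w y \<in> Cb \<longrightarrow> w x \<in> Cb"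
proof -
  obtain r where r: "r > 0" "\<And>a y. a \<in> Sig \<Longrightarrow> aeval a x \<noteq> 0 \<Longrightarrow> y \<in> ball x r \<Longrightarrow> aeval a x * aeval a y > 0"
    using local_finite[of x] by blast
  have "w x \<in> Cb" if y: "y \<in> ball x r" and w: "w \<in> W" "w y \<in> Cb" for y w
    unfolding Cb_def
  proof (rule CollectI, rule ballI, rule ccontr)
    fix s assume s: "s \<in> S" "\<not> aeval s (w x) \<ge> 0"
    have ev: "aeval (act (inv w) s) z = aeval s (w z)" for z
      using aeval_act[OF W_inv[OF w(1)], of s "w z"] w(1) by simp
    have "act (inv w) s \<in> Sig" using act_Sig[OF W_inv[OF w(1)]] S_Sig s by blast
    from r(2)[OF this _ y] have "aeval s (w x) * aeval s (w y) > 0" using s by (simp add: ev)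
    moreover have "aeval s (w y) \<ge> 0" using w s by (auto simp: Cb_def)
    ultimately show False using s(2) by (simp add: zero_less_mult_iff)
  qed
  then show ?thesis using r(1) by blast
qed

lemma chamber_unique: "w \<in> W \<Longrightarrow> w' \<in> W \<Longrightarrow> w x \<in> Cb \<Longrightarrow> w' x \<in> Cb \<Longrightarrow> w x = w' x"
  using stabilizer[of "w' \<circ> inv w" "w x"] by (auto simp: W_comp W_inv)

text \<open>Two such elements agree at x, so they are equal once their linear parts are equal, and
  there are finitely many linear parts.\<close>

lemma finite_chambers: "finite {w \<in> W. w x \<in> Cb}"
proof -
  have "inj_on lin {w \<in> W. w x \<in> Cb}"
  proof (rule inj_onI)
    fix w w' assume w: "w \<in> {w \<in> W. w x \<in> Cb}" "w' \<in> {w \<in> W. w x \<in> Cb}" and l: "lin w = lin w'"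
    then have "w x = w' x" using chamber_unique by blast
    then have "w 0 = w' 0" using fun_cong[OF l, of x] by (simp add: lin_def)
    moreover have "w \<in> W" "w' \<in> W" using w by auto
    ultimately have "w v = w' v" for v using lin(2)[of w v] lin(2)[of w' v] l by simp
    then show "w = w'" by (rule ext)
  qed
  moreover have "lin ` {w \<in> W. w x \<in> Cb} \<subseteq> weyl_group R" using lin(1) by auto
  ultimately show ?thesis using finite_subset[OF _ finite_weyl] finite_imageD by blast
qed

end

section \<open>Integrals depending on a parameter\<close>

text \<open>The Leibniz rule in a form where the derivative is an ordinary function and its
  continuity has to be checked only in the basis directions.\<close>

lemma integral_param_deriv:
  fixes F :: "'a::euclidean_space \<Rightarrow> 'b::euclidean_space \<Rightarrow> complex"
  assumes d: "\<And>x t. t \<in> cbox a b \<Longrightarrow> ((\<lambda>x. F x t) has_derivative F' x t) (at x)"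
    and c: "\<And>i. i \<in> Basis \<Longrightarrow> continuous_on (UNIV \<times> cbox a b) (\<lambda>p. F' (fst p) (snd p) i)"
    and cF: "\<And>x. continuous_on (cbox a b) (F x)"
  shows "((\<lambda>x. integral (cbox a b) (F x)) has_derivative (\<lambda>u. integral (cbox a b) (\<lambda>t. F' x t u))) (at x)"
proof -
  define fx where "fx x t = Blinfun (F' x t)" for x t
  have app: "blinfun_apply (fx x t) = F' x t" if "t \<in> cbox a b" for x t
    unfolding fx_def using has_derivative_bounded_linear[OF d[OF that]] by (rule bounded_linear_Blinfun_apply)
  have cont: "continuous_on (UNIV \<times> cbox a b) (\<lambda>(x, t). fx x t)"
  proof (rule continuous_on_blinfun_componentwise)
    fix i :: 'a assume i: "i \<in> Basis"
    show "continuous_on (UNIV \<times> cbox a b) (\<lambda>p. blinfun_apply (case p of (x, t) \<Rightarrow> fx x t) i)"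
      using c[OF i] by (rule continuous_on_eq) (auto simp: app)
  qed
  have "((\<lambda>x. integral (cbox a b) (F x)) has_derivative blinfun_apply (integral (cbox a b) (fx x))) (at x within UNIV)"
    by (rule leibniz_rule[OF _ _ cont]) (auto simp: app d intro!: integrable_continuous cF)
  moreover have "blinfun_apply (integral (cbox a b) (fx x)) = (\<lambda>u. integral (cbox a b) (\<lambda>t. F' x t u))"
  proof (rule ext)
    fix u
    have "continuous_on (cbox a b) (Pair x)" by (intro continuous_intros)
    from continuous_on_compose2[OF cont this] have "continuous_on (cbox a b) (fx x)" by auto
    then have "fx x integrable_on cbox a b" by (rule integrable_continuous)
    from blinfun_apply_integral[OF this]
    have "blinfun_apply (integral (cbox a b) (fx x)) u = integral (cbox a b) (\<lambda>t. blinfun_apply (fx x t) u)" .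
    also have "\<dots> = integral (cbox a b) (\<lambda>t. F' x t u)" by (rule integral_cong) (simp add: app)
    finally show "blinfun_apply (integral (cbox a b) (fx x)) u = integral (cbox a b) (\<lambda>t. F' x t u)" .
  qed
  ultimately show ?thesis by simp
qed

section \<open>Antiderivatives in a fixed direction\<close>

context
  fixes d :: "'a::euclidean_space" assumes d: "d \<noteq> 0"
begin

definition ell :: "'a \<Rightarrow> real" where "ell v = (v \<bullet> d) / (d \<bullet> d)"

text \<open>Moments of f along the segment from v, parallel to d, to the hyperplane
  \<open>ell\<close> = 0. The chain rule produces a factor s, and the powers of s close the family
  under differentiation.\<close>

definition JJ :: "nat \<Rightarrow> ('a \<Rightarrow> complex) \<Rightarrow> 'a \<Rightarrow> complex" where
  "JJ n f v = integral (cbox 0 1) (\<lambda>s::real. complex_of_real (s ^ n) * f (v - (s * ell v) *\<^sub>R d))"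

lemma ell_d: "ell d = 1" using d by (simp add: ell_def)

lemma ell_linear: "linear ell"
  by (rule linearI) (auto simp: ell_def inner_add_left add_divide_distrib)

lemma JJ_deriv:
  assumes f: "smooth_on UNIV f"
  shows "(JJ n f has_derivative (\<lambda>u. JJ n (dir_deriv u f) v - complex_of_real (ell u) * JJ (Suc n) (dir_deriv d f) v)) (at v)"
proof -
  have lin: "dir_deriv (u - c *\<^sub>R d) f x = dir_deriv u f x - complex_of_real c * dir_deriv d f x" for u c x
    by (simp only: linear_diff[OF dir_deriv_linear[OF smooth_onD(1)[OF f UNIV_I]]]
        linear_scale[OF dir_deriv_linear[OF smooth_onD(1)[OF f UNIV_I]]] scaleR_conv_of_real)
  have cont: "continuous_on UNIV g" if "smooth_on UNIV g" for g :: "'a \<Rightarrow> complex" using smooth_onD(3)[OF that] .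
  have path: "continuous_on T (\<lambda>p. fst p - (snd p * ell (fst p)) *\<^sub>R d)" for T :: "('a \<times> real) set"
    unfolding ell_def by (intro continuous_intros) (use d in auto)
  have path1: "continuous_on T (\<lambda>s. v - (s * ell v) *\<^sub>R d)" for v and T :: "real set"
    by (intro continuous_intros)
  have int: "(\<lambda>s. complex_of_real (s ^ n) * g (v - (s * ell v) *\<^sub>R d)) integrable_on cbox 0 1"
    if "smooth_on UNIV g" for g :: "'a \<Rightarrow> complex" and n v
    by (intro integrable_continuous continuous_intros continuous_on_compose2[OF cont[OF that] path1]) auto
  define F' where "F' v s u = complex_of_real (s ^ n) * dir_deriv (u - (s * ell u) *\<^sub>R d) f (v - (s * ell v) *\<^sub>R d)" for v s u
  have F': "F' v s u = complex_of_real (s ^ n) * dir_deriv u f (v - (s * ell v) *\<^sub>R d)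
      - complex_of_real (ell u) * (complex_of_real (s ^ Suc n) * dir_deriv d f (v - (s * ell v) *\<^sub>R d))" for v s u
    by (simp add: F'_def lin algebra_simps)
  have "((\<lambda>v. integral (cbox 0 1) (\<lambda>s::real. complex_of_real (s ^ n) * f (v - (s * ell v) *\<^sub>R d))) has_derivative
     (\<lambda>u. integral (cbox 0 1) (\<lambda>s. F' v s u))) (at v)"
  proof (rule integral_param_deriv)
    fix x and s :: real
    have bl: "bounded_linear (\<lambda>u. u - (s * ell u) *\<^sub>R d)"
      by (intro bounded_linear_sub bounded_linear_ident bounded_linear_scaleR_const bounded_linear_const_mult)
        (simp add: ell_linear linear_conv_bounded_linear[symmetric])
    have "((\<lambda>x. f (x - (s * ell x) *\<^sub>R d)) has_derivative (\<lambda>u. dir_deriv (u - (s * ell u) *\<^sub>R d) f (x - (s * ell x) *\<^sub>R d))) (at x)"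
      by (rule has_derivative_compose[OF bounded_linear_imp_has_derivative[OF bl] has_derivative_dir_deriv])
        (rule smooth_onD(1)[OF f UNIV_I])
    then show "((\<lambda>v. complex_of_real (s ^ n) * f (v - (s * ell v) *\<^sub>R d)) has_derivative F' x s) (at x)"
      unfolding F'_def by (rule has_derivative_mult_right)
  next
    fix i :: 'a
    show "continuous_on (UNIV \<times> cbox 0 1) (\<lambda>p. F' (fst p) (snd p) i)"
      unfolding F'
      by (intro continuous_intros continuous_on_compose2[OF cont[OF smooth_onD(2)[OF f]] path]) auto
    show "continuous_on (cbox 0 1) (\<lambda>s. complex_of_real (s ^ n) * f (x - (s * ell x) *\<^sub>R d))" for x
      by (intro continuous_intros continuous_on_compose2[OF cont[OF f] path1]) auto
  qed
  moreover have "integral (cbox 0 1) (\<lambda>s. F' v s u) = JJ n (dir_deriv u f) v - complex_of_real (ell u) * JJ (Suc n) (dir_deriv d f) v" for u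
    unfolding F' JJ_def
    by (subst integral_diff) (intro int smooth_onD(2)[OF f] integrable_on_mult_right, intro integrable_on_mult_right int smooth_onD(2)[OF f], simp only: integral_mult_right)
  ultimately show ?thesis unfolding JJ_def[abs_def] by simp
qed

lemma JJ_smooth: assumes "smooth_on UNIV f" shows "smooth_on UNIV (JJ n f)"
proof -
  have "smooth_on UNIV f \<Longrightarrow> Ck_on m UNIV (JJ n f)" for m n f
  proof (induction m arbitrary: n f)
    case 0
    then show ?case
      using has_derivative_continuous[OF JJ_deriv[OF 0]] by (auto intro!: continuous_at_imp_continuous_on)
  next
    case (Suc m)
    have dd: "dir_deriv u (JJ n f) = (\<lambda>v. JJ n (dir_deriv u f) v + (- complex_of_real (ell u)) * JJ (Suc n) (dir_deriv d f) v)" for u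
      by (rule ext) (simp add: dir_deriv_eq[OF JJ_deriv[OF Suc.prems]])
    have "Ck_on m UNIV (dir_deriv u (JJ n f))" for u
      unfolding dd by (intro Ck_on_add Ck_on_mult Ck_on_const Suc.IH smooth_onD(2)[OF Suc.prems] open_UNIV)
    moreover have "JJ n f differentiable (at x)" for x
      using JJ_deriv[OF Suc.prems] unfolding differentiable_def by blast
    ultimately show ?case by simp
  qed
  then show ?thesis using assms unfolding smooth_on_def by simp
qed

text \<open>The function is \<open>ell v\<close> times \<open>JJ 0 f v\<close>, the line integral of
  f from the hyperplane \<open>ell\<close> = 0 to v. Its rescaling to a fixed interval reduces
  smoothness to differentiation under the integral sign. The derivative is found by applying the
  fundamental theorem to s -> -(1 - s) f(v - s \<open>ell v\<close> d).\<close>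

lemma antiderivative:
  assumes f: "smooth_on UNIV f"
  shows "\<exists>\<Phi>. smooth_on UNIV \<Phi> \<and> dir_deriv d \<Phi> = f"
proof (intro exI conjI ext)
  define e where "e v = complex_of_real (ell v)" for v
  have e: "(e has_derivative e) (at v)" for v
    unfolding e_def[abs_def]
    by (intro bounded_linear_imp_has_derivative bounded_linear_compose[OF bounded_linear_of_real])
      (simp add: ell_linear linear_conv_bounded_linear[symmetric])
  have es: "smooth_on UNIV e"
    unfolding e_def[abs_def]
    by (intro smooth_on_linear bounded_linear_compose[OF bounded_linear_of_real])
      (simp add: ell_linear linear_conv_bounded_linear[symmetric])
  show "smooth_on UNIV (\<lambda>v. e v * JJ 0 f v)" by (intro smooth_on_mult es JJ_smooth f open_UNIV)
  fix v
  define g where "g s = dir_deriv d f (v - (s * ell v) *\<^sub>R d)" for s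
  have aux: "- (c * ((- l) *\<^sub>R G) + (- 1) * F) = complex_of_real l * (c * G) + F" for c G F :: complex and l
    by (simp add: scaleR_conv_of_real)
  have cont: "continuous_on T (\<lambda>s. h (v - (s * ell v) *\<^sub>R d))" if "smooth_on UNIV h" for h :: "'a \<Rightarrow> complex" and T
    by (rule continuous_on_compose2[OF smooth_onD(3)[OF that]]) (auto intro!: continuous_intros)
  have "dir_deriv d (\<lambda>v. e v * JJ 0 f v) v = e v * (JJ 0 (dir_deriv d f) v - JJ (Suc 0) (dir_deriv d f) v) + JJ 0 f v"
    using dir_deriv_eq[OF has_derivative_mult[OF e JJ_deriv[OF f]], of d 0 v] by (simp add: ell_d e_def)
  also have "JJ 0 (dir_deriv d f) v - JJ (Suc 0) (dir_deriv d f) v = integral {0..1} (\<lambda>s. complex_of_real (1 - s) * g s)"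
    unfolding JJ_def g_def
    by (subst integral_diff[symmetric])
      (auto simp: algebra_simps intro!: integrable_continuous_interval continuous_intros cont smooth_onD(2)[OF f])
  also have "e v * integral {0..1} (\<lambda>s. complex_of_real (1 - s) * g s) = integral {0..1} (\<lambda>s. e v * (complex_of_real (1 - s) * g s))"
    by simp
  also have "\<dots> + JJ 0 f v = integral {0..1} (\<lambda>s. e v * (complex_of_real (1 - s) * g s) + f (v - (s * ell v) *\<^sub>R d))"
    unfolding JJ_def g_def
    by (subst integral_add)
      (auto intro!: integrable_continuous_interval continuous_intros cont smooth_onD(2)[OF f] f)
  also have "\<dots> = - (complex_of_real (1 - 1) * f (v - (1 * ell v) *\<^sub>R d)) - (- (complex_of_real (1 - 0) * f (v - (0 * ell v) *\<^sub>R d)))"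
  proof (rule integral_unique, rule fundamental_theorem_of_calculus)
    fix s :: real
    have "((\<lambda>t. f (v + t *\<^sub>R d)) has_vector_derivative g s) (at (- (s * ell v)))"
      using has_vector_derivative_dir_deriv[where x=v and t="- (s * ell v)" and v=d, OF smooth_onD(1)[OF f UNIV_I]] by (simp add: g_def)
    moreover have "((\<lambda>s. - (s * ell v)) has_vector_derivative - ell v) (at s)"
      by (auto intro!: derivative_eq_intros simp flip: has_real_derivative_iff_has_vector_derivative)
    ultimately have "((\<lambda>s. f (v - (s * ell v) *\<^sub>R d)) has_vector_derivative (- ell v) *\<^sub>R g s) (at s)"
      using vector_diff_chain_at[of "\<lambda>s. - (s * ell v)" "- ell v" s "\<lambda>t. f (v + t *\<^sub>R d)" "g s"] by (simp add: o_def)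
    moreover have "((\<lambda>s. complex_of_real (1 - s)) has_vector_derivative - 1) (at s)"
      using has_vector_derivative_of_real[of "\<lambda>s. 1 - s" "-1" "at s"] by (auto intro!: derivative_eq_intros)
    ultimately have "((\<lambda>s. - (complex_of_real (1 - s) * f (v - (s * ell v) *\<^sub>R d))) has_vector_derivative
       - (complex_of_real (1 - s) * ((- ell v) *\<^sub>R g s) + (- 1) * f (v - (s * ell v) *\<^sub>R d))) (at s)"
      by (intro has_vector_derivative_minus has_vector_derivative_mult)
    then show "((\<lambda>s. - (complex_of_real (1 - s) * f (v - (s * ell v) *\<^sub>R d))) has_vector_derivative
       e v * (complex_of_real (1 - s) * g s) + f (v - (s * ell v) *\<^sub>R d)) (at s within {0..1})"
      unfolding aux e_def by (rule has_vector_derivative_at_within)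
  qed simp
  finally show "dir_deriv d (\<lambda>v. e v * JJ 0 f v) v = f v" by simp
qed

end

section \<open>The operators \<open>Q\<close>\<close>

locale hecke_setup = affine_weyl R B \<phi> for R B :: "'a::euclidean_space set" and \<phi> +
  fixes k :: "'a affine_functional \<Rightarrow> real" and mul :: "'a hecke \<Rightarrow> 'a hecke \<Rightarrow> 'a hecke" and lam :: "'a \<Rightarrow> complex"
  assumes mf: "multiplicity_function R k" and hm: "hecke_mult R B \<phi> k mul" and lam0: "linear lam"
begin

sublocale eigen R lam
  by (intro eigen.intro finite_weyl lam0)

abbreviation "EV \<equiv> sol R lam UNIV"
abbreviation "Q \<equiv> Q_gen k"

lemma EV_smooth: "f \<in> EV \<Longrightarrow> smooth_on UNIV f" by (rule solD(1))

lemma EV_csub: "csubspace_fun EV" by (rule sol_csubspace[OF open_UNIV])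

lemma EV_add: "f \<in> EV \<Longrightarrow> g \<in> EV \<Longrightarrow> (\<lambda>x. f x + g x) \<in> EV"
  and EV_scale: "f \<in> EV \<Longrightarrow> (\<lambda>x. c * f x) \<in> EV" and EV_zero: "(\<lambda>x. 0) \<in> EV"
  using EV_csub unfolding csubspace_fun_def by auto

lemma EV_pd: "f \<in> EV \<Longrightarrow> pd p f \<in> EV" by (rule sol_pd[OF open_UNIV])

lemma EV_dir_deriv: "f \<in> EV \<Longrightarrow> dir_deriv v f \<in> EV" by (rule sol_dir_deriv[OF open_UNIV])

lemma EV_W: assumes "f \<in> EV" "w \<in> W" shows "(\<lambda>x. f (w x)) \<in> EV"
  using sol_affine[OF open_UNIV assms(1) lin(1)[OF assms(2)] UNIV_I, where V=UNIV and c="w 0"]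
  by (simp only: lin(2)[OF assms(2), symmetric])

lemma dir_deriv_W:
  assumes "smooth_on UNIV f" "w \<in> W"
  shows "dir_deriv v (\<lambda>x. f (w x)) x = dir_deriv (lin w v) f (w x)"
  using dir_deriv_affine[OF weyl_bounded_linear[OF lin(1)[OF assms(2)]] smooth_onD(1)[OF assms(1) UNIV_I], where x=x and c="w 0" and v=v]
  by (simp only: lin(2)[OF assms(2), symmetric])

lemma lin_arefl: "lin (arefl a) = refl (fst a)"
  by (simp add: lin_def fun_eq_iff arefl_def refl_def aeval_def algebra_simps)

lemma coroot_Sig: "a \<in> Sig \<Longrightarrow> coroot (fst a) \<noteq> 0"
  using Sig_fst(3) coroot_nonzero by blast

lemma Q_antiderivative:
  assumes \<Phi>: "smooth_on UNIV \<Phi>" and f: "dir_deriv (coroot (fst a)) \<Phi> = f"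
  shows "Q a f v = f (arefl a v) + complex_of_real (k a) * (\<Phi> v - \<Phi> (arefl a v))"
proof -
  let ?d = "coroot (fst a)"
  have "(LBINT t=ereal 0..ereal (aeval a v). f (v - t *\<^sub>R ?d)) = - \<Phi> (v - aeval a v *\<^sub>R ?d) - (- \<Phi> (v - 0 *\<^sub>R ?d))"
  proof (rule interval_integral_FTC_finite)
    have sf: "smooth_on UNIV f" using smooth_onD(2)[OF \<Phi>, of ?d] unfolding f .
    show "continuous_on {min 0 (aeval a v)..max 0 (aeval a v)} (\<lambda>t. f (v - t *\<^sub>R ?d))"
      by (rule continuous_on_compose2[OF smooth_onD(3)[OF sf]]) (auto intro!: continuous_intros)
    fix t
    have "((\<lambda>s. \<Phi> (v + s *\<^sub>R ?d)) has_vector_derivative f (v - t *\<^sub>R ?d)) (at (- t))"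
      using has_vector_derivative_dir_deriv[where x=v and t="- t" and v="?d", OF smooth_onD(1)[OF \<Phi> UNIV_I]] f by simp
    moreover have "((\<lambda>s::real. - s) has_vector_derivative - 1) (at t)"
      by (auto intro!: derivative_eq_intros simp flip: has_real_derivative_iff_has_vector_derivative)
    ultimately have "((\<lambda>s. \<Phi> (v - s *\<^sub>R ?d)) has_vector_derivative (- 1) *\<^sub>R f (v - t *\<^sub>R ?d)) (at t)"
      using vector_diff_chain_at[of "\<lambda>s. - s" "- 1" t "\<lambda>s. \<Phi> (v + s *\<^sub>R ?d)" "f (v - t *\<^sub>R ?d)"] by (simp add: o_def)
    then have "((\<lambda>s. - \<Phi> (v - s *\<^sub>R ?d)) has_vector_derivative - ((- 1) *\<^sub>R f (v - t *\<^sub>R ?d))) (at t)"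
      by (rule has_vector_derivative_minus)
    then have "((\<lambda>s. - \<Phi> (v - s *\<^sub>R ?d)) has_vector_derivative f (v - t *\<^sub>R ?d)) (at t)" by simp
    then show "((\<lambda>s. - \<Phi> (v - s *\<^sub>R ?d)) has_vector_derivative f (v - t *\<^sub>R ?d)) (at t within {min 0 (aeval a v)..max 0 (aeval a v)})"
      by (rule has_vector_derivative_at_within)
  qed
  then show ?thesis by (simp add: Q_gen_def arefl_def)
qed

lemma Q_add:
  assumes "smooth_on UNIV f" "smooth_on UNIV g" "a \<in> Sig"
  shows "Q a (\<lambda>x. f x + g x) = (\<lambda>x. Q a f x + Q a g x)"
proof -
  obtain F where F: "smooth_on UNIV F" "dir_deriv (coroot (fst a)) F = f" using antiderivative[OF coroot_Sig[OF assms(3)] assms(1)] by blast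
  obtain G where G: "smooth_on UNIV G" "dir_deriv (coroot (fst a)) G = g" using antiderivative[OF coroot_Sig[OF assms(3)] assms(2)] by blast
  have "dir_deriv (coroot (fst a)) (\<lambda>x. F x + G x) = (\<lambda>x. f x + g x)"
    using F G by (auto simp: fun_eq_iff dir_deriv_add smooth_onD)
  note e = Q_antiderivative[OF smooth_on_add[OF open_UNIV F(1) G(1)] this]
  show ?thesis
    by (rule ext) (simp only: e Q_antiderivative[OF F] Q_antiderivative[OF G], simp add: algebra_simps)
qed

lemma Q_scale:
  assumes "smooth_on UNIV f" "a \<in> Sig"
  shows "Q a (\<lambda>x. c * f x) = (\<lambda>x. c * Q a f x)"
proof -
  obtain F where F: "smooth_on UNIV F" "dir_deriv (coroot (fst a)) F = f" using antiderivative[OF coroot_Sig[OF assms(2)] assms(1)] by blast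
  have "dir_deriv (coroot (fst a)) (\<lambda>x. c * F x) = (\<lambda>x. c * f x)"
    using F by (auto simp: fun_eq_iff dir_deriv_cmult smooth_onD)
  note e = Q_antiderivative[OF smooth_on_cmult[OF open_UNIV F(1)] this]
  show ?thesis by (rule ext) (simp only: e Q_antiderivative[OF F], simp add: algebra_simps)
qed

lemma Q_wall: "aeval a v = 0 \<Longrightarrow> Q a f v = f v"
  by (simp add: Q_gen_def arefl_def)

lemma
  assumes f: "smooth_on UNIV f" and a: "a \<in> Sig"
  shows Q_smooth: "smooth_on UNIV (Q a f)"
    and Q_dir_deriv: "dir_deriv u (Q a f) v = Q a (dir_deriv (refl (fst a) u) f) v + complex_of_real (k a * (fst a \<bullet> u)) * f v"
    and Q_invariant: "p \<in> sym_algebra \<Longrightarrow> sym_invariant R p \<Longrightarrow> pd p (Q a f) v = Q a (pd p f) v"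
proof -
  let ?d = "coroot (fst a)"
  note Wa = W_arefl[OF a]
  obtain \<Phi> where \<Phi>: "smooth_on UNIV \<Phi>" "dir_deriv ?d \<Phi> = f" using antiderivative[OF coroot_Sig[OF a] f] by blast
  have Qf: "Q a f = (\<lambda>v. f (arefl a v) + complex_of_real (k a) * (\<Phi> v - \<Phi> (arefl a v)))"
    using Q_antiderivative[OF \<Phi>] by blast
  have ar: "(\<lambda>v. g (arefl a v)) = (\<lambda>v. g (refl (fst a) v + - snd a *\<^sub>R ?d))" for g :: "'a \<Rightarrow> complex"
    by (simp add: arefl_refl)
  have rW: "refl (fst a) \<in> weyl_group R" using weyl_refl Sig_fst(1)[OF a] by blast
  have bl: "bounded_linear (refl (fst a))" by (rule weyl_bounded_linear[OF rW])
  have sm: "smooth_on UNIV (\<lambda>v. g (arefl a v))" if "smooth_on UNIV g" for g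
    unfolding ar by (rule smooth_on_affine[OF open_UNIV bl that]) simp
  show sQ: "smooth_on UNIV (Q a f)"
    unfolding Qf by (intro smooth_on_add smooth_on_cmult smooth_on_diff open_UNIV sm f \<Phi>)
  have dar: "dir_deriv u (\<lambda>v. g (arefl a v)) v = dir_deriv (refl (fst a) u) g (arefl a v)" if "smooth_on UNIV g" for g u v
    using dir_deriv_W[OF that Wa] by (simp add: lin_arefl)
  have dQ: "dir_deriv u (Q a f) v = dir_deriv (refl (fst a) u) f (arefl a v) +
      complex_of_real (k a) * (dir_deriv u \<Phi> v - dir_deriv (refl (fst a) u) \<Phi> (arefl a v))"
  proof -
    have e: "(\<lambda>v. f (arefl a v) + complex_of_real (k a) * (\<Phi> v - \<Phi> (arefl a v))) =
       (\<lambda>v. f (arefl a v) + complex_of_real (k a) * (\<Phi> v + (- 1) * \<Phi> (arefl a v)))" by simp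
    have df: "g differentiable (at v)" if "smooth_on UNIV g" for g :: "'a \<Rightarrow> complex" using smooth_onD(1)[OF that UNIV_I] .
    have "dir_deriv u (Q a f) v = dir_deriv u (\<lambda>v. f (arefl a v)) v + complex_of_real (k a) * (dir_deriv u \<Phi> v + (- 1) * dir_deriv u (\<lambda>v. \<Phi> (arefl a v)) v)"
      unfolding Qf e
      by (subst dir_deriv_add dir_deriv_cmult | intro df smooth_on_add smooth_on_cmult sm f \<Phi>(1) open_UNIV)+ (rule refl)
    then show ?thesis by (simp add: dar f \<Phi>)
  qed
  let ?ru = "refl (fst a) u"
  \<comment> \<open>Derivatives commute, so the derivative of \<Phi> is an antiderivative of the
    derivative of f, and \<open>Q_antiderivative\<close> applies to it.\<close>
  have "dir_deriv ?d (dir_deriv ?ru \<Phi>) = dir_deriv ?ru f"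
    using dir_deriv_commute[OF open_UNIV smooth_onD(4)[OF \<Phi>(1)] UNIV_I, of ?d ?ru] \<Phi>(2) by (simp add: fun_eq_iff)
  then have Q2: "Q a (dir_deriv ?ru f) v = dir_deriv ?ru f (arefl a v) + complex_of_real (k a) * (dir_deriv ?ru \<Phi> v - dir_deriv ?ru \<Phi> (arefl a v))"
    by (rule Q_antiderivative[OF smooth_onD(2)[OF \<Phi>(1)]])
  have "dir_deriv ?ru \<Phi> v = dir_deriv u \<Phi> v - complex_of_real (fst a \<bullet> u) * f v"
    by (simp only: refl_def linear_diff[OF dir_deriv_linear[OF smooth_onD(1)[OF \<Phi>(1) UNIV_I]]]
        linear_scale[OF dir_deriv_linear[OF smooth_onD(1)[OF \<Phi>(1) UNIV_I]]] scaleR_conv_of_real \<Phi>(2))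
  then have e: "dir_deriv u \<Phi> v = dir_deriv ?ru \<Phi> v + complex_of_real (fst a \<bullet> u) * f v" by simp
  show "dir_deriv u (Q a f) v = Q a (dir_deriv ?ru f) v + complex_of_real (k a * (fst a \<bullet> u)) * f v"
    unfolding dQ Q2 e by (simp add: algebra_simps)
  show "pd p (Q a f) v = Q a (pd p f) v" if p: "p \<in> sym_algebra" "sym_invariant R p"
  proof -
    have par: "pd p (\<lambda>v. g (arefl a v)) v = pd p g (arefl a v)" if "smooth_on UNIV g" for g v
      unfolding ar using pd_affine[OF open_UNIV bl that p(1) UNIV_I, where x=v and c="- snd a *\<^sub>R ?d"]
      by (simp only: sym_map_invariant[OF p rW] arefl_refl)
    \<comment> \<open>The same for an invariant p: p(d)\<Phi> is an antiderivative of p(d)f, and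
      p(d) commutes with the reflection.\<close>
    have pA: "dir_deriv ?d (pd p \<Phi>) = pd p f"
    proof
      fix v
      have "dir_deriv ?d (pd p \<Phi>) v = pd (sym_vec ?d * p) \<Phi> v"
        by (simp add: pd_mult[OF open_UNIV \<Phi>(1)] pd_vec[OF open_UNIV smooth_on_pd[OF open_UNIV \<Phi>(1)]])
      also have "\<dots> = pd p (pd (sym_vec ?d) \<Phi>) v" by (simp add: pd_mult[OF open_UNIV \<Phi>(1), symmetric] mult.commute)
      also have "\<dots> = pd p f v"
        by (rule pd_cong[OF open_UNIV]) (simp_all add: pd_vec[OF open_UNIV \<Phi>(1)] \<Phi>(2))
      finally show "dir_deriv ?d (pd p \<Phi>) v = pd p f v" .
    qed
    have "pd p (Q a f) v = pd p (\<lambda>v. f (arefl a v)) v + complex_of_real (k a) * (pd p \<Phi> v + (- 1) * pd p (\<lambda>v. \<Phi> (arefl a v)) v)"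
    proof -
      have e: "Q a f = (\<lambda>v. f (arefl a v) + complex_of_real (k a) * (\<Phi> v + (- 1) * \<Phi> (arefl a v)))" by (simp add: Qf)
      have s1: "smooth_on UNIV (\<lambda>v. (- 1) * \<Phi> (arefl a v))" by (intro smooth_on_cmult sm \<Phi> open_UNIV)
      have s2: "smooth_on UNIV (\<lambda>v. \<Phi> v + (- 1) * \<Phi> (arefl a v))" by (intro smooth_on_add s1 \<Phi> open_UNIV)
      show ?thesis unfolding e
        by (simp only: pd_fun_add[OF open_UNIV sm[OF f] UNIV_I smooth_on_cmult[OF open_UNIV s2]] pd_fun_scale[OF open_UNIV s2 UNIV_I]
            pd_fun_add[OF open_UNIV \<Phi>(1) UNIV_I s1] pd_fun_scale[OF open_UNIV sm[OF \<Phi>(1)] UNIV_I])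
    qed
    also have "\<dots> = pd p f (arefl a v) + complex_of_real (k a) * (pd p \<Phi> v - pd p \<Phi> (arefl a v))"
      by (simp add: par f \<Phi>)
    also have "\<dots> = Q a (pd p f) v"
      by (rule Q_antiderivative[OF smooth_on_pd[OF open_UNIV \<Phi>(1)] pA, symmetric])
    finally show ?thesis .
  qed
qed

lemma Q_EV: assumes "f \<in> EV" "a \<in> Sig" shows "Q a f \<in> EV"
proof (rule solI[OF Q_smooth[OF EV_smooth[OF assms(1)] assms(2)]])
  fix p :: "'a sympoly" and x assume p: "p \<in> sym_algebra" "sym_invariant R p"
  have "pd p f = (\<lambda>x. sym_eval lam p * f x)" using solD(2)[OF assms(1) p] by auto
  then show "pd p (Q a f) x = sym_eval lam p * Q a f x"
    by (simp add: Q_invariant[OF EV_smooth[OF assms(1)] assms(2) p] Q_scale[OF EV_smooth[OF assms(1)] assms(2)])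
qed

end

section \<open>Relations between the operators \<open>Q\<close>\<close>

context hecke_setup
begin

abbreviation "HC \<equiv> hecke_carrier R"
abbreviation "SA \<equiv> (sym_algebra :: 'a sympoly set)"

lemma
  shows mul_closed: "x \<in> HC \<Longrightarrow> y \<in> HC \<Longrightarrow> mul x y \<in> HC"
    and mul_add_left: "x \<in> HC \<Longrightarrow> y \<in> HC \<Longrightarrow> z \<in> HC \<Longrightarrow> mul (x + y) z = mul x z + mul y z"
    and mul_add_right: "x \<in> HC \<Longrightarrow> y \<in> HC \<Longrightarrow> z \<in> HC \<Longrightarrow> mul x (y + z) = mul x y + mul x z"
    and mul_assoc: "x \<in> HC \<Longrightarrow> y \<in> HC \<Longrightarrow> z \<in> HC \<Longrightarrow> mul (mul x y) z = mul x (mul y z)"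
    and mul_scale_right: "x \<in> HC \<Longrightarrow> y \<in> HC \<Longrightarrow> mul x (hecke_scale c y) = hecke_scale c (mul x y)"
    and mul_one_left: "x \<in> HC \<Longrightarrow> mul (hecke_tensor 1 id) x = x"
    and mul_one_right: "x \<in> HC \<Longrightarrow> mul x (hecke_tensor 1 id) = x"
    and mul_sym: "p \<in> SA \<Longrightarrow> q \<in> SA \<Longrightarrow> mul (hecke_tensor p id) (hecke_tensor q id) = hecke_tensor (p * q) id"
    and mul_grp: "w \<in> W \<Longrightarrow> w' \<in> W \<Longrightarrow> mul (hecke_tensor 1 w) (hecke_tensor 1 w') = hecke_tensor 1 (w \<circ> w')"
    and mul_tensor: "p \<in> SA \<Longrightarrow> w \<in> W \<Longrightarrow> mul (hecke_tensor p id) (hecke_tensor 1 w) = hecke_tensor p w"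
    and mul_cross: "a \<in> S \<Longrightarrow> mul (hecke_tensor 1 (arefl a)) (hecke_tensor (sym_vec v) id) -
        mul (hecke_tensor (sym_vec (refl (fst a) v)) id) (hecke_tensor 1 (arefl a)) =
        hecke_tensor (sym_const (complex_of_real (k a * (fst a \<bullet> v)))) id"
  using hm unfolding hecke_mult_def by simp_all

lemma HC_tensor: "p \<in> SA \<Longrightarrow> w \<in> W \<Longrightarrow> hecke_tensor p w \<in> HC"
  by (auto simp: hecke_carrier_def lookup_single when_def sym_algebra_zero)

lemma HC_add: "x \<in> HC \<Longrightarrow> y \<in> HC \<Longrightarrow> x + y \<in> HC"
  using keys_add[of x y] by (auto simp: hecke_carrier_def lookup_add sym_algebra_add)

lemma HC_zero: "0 \<in> HC" by (simp add: hecke_carrier_def sym_algebra_zero)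

lemma HC_sum: "(\<And>i. i \<in> I \<Longrightarrow> x i \<in> HC) \<Longrightarrow> (\<Sum>i\<in>I. x i) \<in> HC"
  by (induction I rule: infinite_finite_induct) (auto simp: HC_add HC_zero)

lemma HC_lookup: "x \<in> HC \<Longrightarrow> Poly_Mapping.lookup x w \<in> SA" and HC_keys: "x \<in> HC \<Longrightarrow> Poly_Mapping.keys x \<subseteq> W"
  by (auto simp: hecke_carrier_def)

lemma scale_tensor: "hecke_scale c (hecke_tensor p w) = hecke_tensor (sym_const c * p) w"
  by (rule poly_mapping_eqI) (simp add: hecke_scale_def Poly_Mapping.map.rep_eq lookup_single when_def)

lemma lookup_scale: "Poly_Mapping.lookup (hecke_scale c x) w = sym_const c * Poly_Mapping.lookup x w"
  by (simp add: hecke_scale_def Poly_Mapping.map.rep_eq when_def)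

lemma HC_scale: "x \<in> HC \<Longrightarrow> hecke_scale c x \<in> HC"
proof -
  assume x: "x \<in> HC"
  have "Poly_Mapping.keys (hecke_scale c x) \<subseteq> Poly_Mapping.keys x" by (auto simp: in_keys_iff lookup_scale)
  then show ?thesis using x by (auto simp: hecke_carrier_def lookup_scale intro!: sym_algebra_mult sym_algebra_const)
qed

lemma HC_induct [consumes 1, case_names tensor add]:
  assumes x: "x \<in> HC" and t: "\<And>p w. p \<in> SA \<Longrightarrow> w \<in> W \<Longrightarrow> Pr (hecke_tensor p w)"
    and a: "\<And>x y. x \<in> HC \<Longrightarrow> y \<in> HC \<Longrightarrow> Pr x \<Longrightarrow> Pr y \<Longrightarrow> Pr (x + y)"
  shows "Pr x"
proof -
  have P0: "Pr 0" using t[OF sym_algebra_zero W_id] by simp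
  have "K \<subseteq> Poly_Mapping.keys x \<Longrightarrow> Pr (\<Sum>w\<in>K. hecke_tensor (Poly_Mapping.lookup x w) w)" if "finite K" for K
    using that
  proof (induction K)
    case (insert w K)
    have W': "\<And>u. u \<in> insert w K \<Longrightarrow> u \<in> W" using insert.prems HC_keys[OF x] by auto
    show ?case unfolding sum.insert[OF insert.hyps]
      by (intro a HC_sum HC_tensor HC_lookup x W' t insert.IH) (use insert in auto)
  qed (simp add: P0)
  then show ?thesis using poly_mapping_eq_sum[of x] by (metis finite_keys order_refl)
qed

section \<open>The module induced from the trivial representation\<close>

text \<open>The projection of H_k onto S(V), regarded as the module induced from the trivial
  representation of W.\<close>

definition aug :: "'a hecke \<Rightarrow> 'a sympoly" where
  "aug x = (\<Sum>w\<in>Poly_Mapping.keys x. Poly_Mapping.lookup x w)"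

lemma aug_superset: "finite A \<Longrightarrow> Poly_Mapping.keys x \<subseteq> A \<Longrightarrow> aug x = (\<Sum>w\<in>A. Poly_Mapping.lookup x w)"
  unfolding aug_def by (rule sum.mono_neutral_left) (auto simp: in_keys_iff)

lemma aug_add: "aug (x + y) = aug x + aug y"
proof -
  let ?A = "Poly_Mapping.keys x \<union> Poly_Mapping.keys y"
  have "Poly_Mapping.keys (x + y) \<subseteq> ?A" by (rule keys_add)
  then show ?thesis
    by (subst (1 2 3) aug_superset[of ?A]) (simp_all add: lookup_add sum.distrib)
qed

lemma aug_tensor [simp]: "aug (hecke_tensor p w) = p"
  by (simp add: aug_def)

lemma aug_SA: "x \<in> HC \<Longrightarrow> aug x \<in> SA"
  unfolding aug_def by (intro sym_algebra_sum HC_lookup)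

lemma aug_mult_grp: assumes "y \<in> HC" "w \<in> W" shows "aug (mul y (hecke_tensor 1 w)) = aug y"
  using assms(1)
proof (induction rule: HC_induct)
  case (tensor p u)
  have "mul (hecke_tensor p u) (hecke_tensor 1 w) = mul (mul (hecke_tensor p id) (hecke_tensor 1 u)) (hecke_tensor 1 w)"
    by (simp add: mul_tensor tensor)
  also have "\<dots> = mul (hecke_tensor p id) (mul (hecke_tensor 1 u) (hecke_tensor 1 w))"
    by (intro mul_assoc HC_tensor tensor sym_algebra_one W_id assms)
  also have "\<dots> = hecke_tensor p (u \<circ> w)"
    unfolding mul_grp[OF tensor(2) assms(2)] by (intro mul_tensor W_comp tensor assms)
  finally show ?case by simp
next
  case (add x y)
  then show ?case by (simp add: mul_add_left[OF add(1,2) HC_tensor[OF sym_algebra_one assms(2)]] aug_add)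
qed

text \<open>The kernel of the augmentation is the left ideal generated by the elements \<open>w - 1\<close>.\<close>

lemma aug_mult: assumes "x \<in> HC" "y \<in> HC" shows "aug (mul x y) = aug (mul x (hecke_tensor (aug y) id))"
  using assms(2)
proof (induction rule: HC_induct)
  case (tensor p w)
  have "mul x (hecke_tensor p w) = mul (mul x (hecke_tensor p id)) (hecke_tensor 1 w)"
    using mul_assoc[OF assms(1) HC_tensor[OF tensor(1) W_id] HC_tensor[OF sym_algebra_one tensor(2)]]
    by (simp add: mul_tensor tensor)
  then show ?case
    using aug_mult_grp[OF mul_closed[OF assms(1) HC_tensor[OF tensor(1) W_id]] tensor(2)] by (simp only: aug_tensor)
next
  case (add y z)
  have e: "mul x (hecke_tensor (aug y + aug z) id) = mul x (hecke_tensor (aug y) id) + mul x (hecke_tensor (aug z) id)"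
    unfolding single_add by (intro mul_add_right assms HC_tensor aug_SA add W_id)
  show ?case by (simp only: mul_add_right[OF assms(1) add(1,2)] aug_add add(3,4) e)
qed

lemma aug_sym_mult: assumes "p \<in> SA" "y \<in> HC" shows "aug (mul (hecke_tensor p id) y) = p * aug y"
  using aug_mult[OF HC_tensor[OF assms(1) W_id] assms(2)] by (simp add: mul_sym assms aug_SA)

lemma S_nz: "s \<in> S \<Longrightarrow> fst s \<noteq> 0"
  using S_Sig Sig_fst(3) by blast

lemma S_HC: "s \<in> S \<Longrightarrow> hecke_tensor 1 (arefl s) \<in> HC"
  using S_Sig by (intro HC_tensor sym_algebra_one W_arefl) auto

lemma mul_cross':
  assumes s: "s \<in> S" and q: "q \<in> SA"
  shows "mul (hecke_tensor 1 (arefl s)) (hecke_tensor (sym_vec v * q) id) =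
    mul (hecke_tensor (sym_vec (refl (fst s) v)) id) (mul (hecke_tensor 1 (arefl s)) (hecke_tensor q id)) +
    hecke_tensor (sym_const (complex_of_real (k s * (fst s \<bullet> v))) * q) id"
proof -
  let ?s = "hecke_tensor 1 (arefl s)" and ?v = "hecke_tensor (sym_vec v) id" and ?q = "hecke_tensor q id"
  let ?v' = "hecke_tensor (sym_vec (refl (fst s) v)) id"
  let ?c = "hecke_tensor (sym_const (complex_of_real (k s * (fst s \<bullet> v)))) id"
  note h = S_HC[OF s] HC_tensor[OF sym_algebra_vec W_id] HC_tensor[OF q W_id] HC_tensor[OF sym_algebra_const W_id]
  have "mul ?s ?v = mul ?v' ?s + ?c" using mul_cross[OF s, of v] by (simp add: algebra_simps)
  moreover have "mul ?s (hecke_tensor (sym_vec v * q) id) = mul (mul ?s ?v) ?q"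
    by (simp add: mul_sym[OF sym_algebra_vec q, symmetric] mul_assoc h)
  ultimately have "mul ?s (hecke_tensor (sym_vec v * q) id) = mul (mul ?v' ?s) ?q + mul ?c ?q"
    using mul_add_left[OF mul_closed[OF h(2,1)] h(4,3)] by simp
  then show ?thesis by (simp add: mul_assoc h mul_sym[OF sym_algebra_const q])
qed

text \<open>The action of s on the induced module, a degenerate Demazure-Lusztig operator.\<close>

definition DL :: "'a affine_functional \<Rightarrow> 'a sympoly \<Rightarrow> 'a sympoly" where
  "DL s p = aug (mul (hecke_tensor 1 (arefl s)) (hecke_tensor p id))"

lemma DL_SA: "s \<in> S \<Longrightarrow> p \<in> SA \<Longrightarrow> DL s p \<in> SA"
  unfolding DL_def by (intro aug_SA mul_closed S_HC HC_tensor W_id)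

text \<open>Pairing a polynomial \<open>p\<close> with a function \<open>f\<close> by \<open>p(\<partial>)f(y)\<close> for a point \<open>y\<close> on the wall of \<open>s\<close>, the
  operator \<open>Q\<^sub>s\<close> is the transpose of the action of \<open>s\<close> on the induced module \<open>S(V)\<close>.\<close>

lemma pairing:
  assumes s: "s \<in> S" and y: "aeval s y = 0" and p: "p \<in> SA" and f: "f \<in> EV"
  shows "pd p (Q s f) y = pd (DL s p) f y"
  using p f
proof (induction arbitrary: f rule: sym_algebra_induct)
  case (const c)
  have e: "hecke_tensor (sym_const c) id = hecke_scale c (hecke_tensor 1 id)" unfolding scale_tensor mult_1_right ..
  have "mul (hecke_tensor 1 (arefl s)) (hecke_tensor (sym_const c) id) = hecke_scale c (mul (hecke_tensor 1 (arefl s)) (hecke_tensor 1 id))"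
    unfolding e by (rule mul_scale_right[OF S_HC[OF s] HC_tensor[OF sym_algebra_one W_id]])
  then have "DL s (sym_const c) = sym_const c"
    unfolding DL_def by (simp only: mul_one_right[OF S_HC[OF s]] scale_tensor aug_tensor mult_1_right)
  then show ?case by (simp add: pd_const Q_wall[OF y])
next
  case (vec v q)
  have sS: "s \<in> Sig" using s S_Sig by blast
  note sf = EV_smooth[OF vec.prems] and sQ = Q_smooth[OF EV_smooth[OF vec.prems] sS]
  let ?v = "refl (fst s) v" and ?c = "complex_of_real (k s * (fst s \<bullet> v))"
  have "DL s (sym_vec v * q) = sym_vec ?v * DL s q + sym_const ?c * q"
    unfolding DL_def mul_cross'[OF s vec.hyps] aug_add
    by (simp add: aug_sym_mult sym_algebra_vec mul_closed S_HC[OF s] HC_tensor vec.hyps W_id)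
  then have "pd (DL s (sym_vec v * q)) f y = pd (DL s q) (pd (sym_vec ?v) f) y + ?c * pd q f y"
    by (simp add: pd_add pd_mult[OF open_UNIV sf] pd_const mult.commute[of "sym_vec ?v"])
  also have "pd (DL s q) (pd (sym_vec ?v) f) y = pd (DL s q) (dir_deriv ?v f) y"
    by (rule pd_cong[OF open_UNIV]) (simp_all add: pd_vec[OF open_UNIV sf])
  also have "\<dots> = pd q (Q s (dir_deriv ?v f)) y" by (rule vec.IH[OF EV_dir_deriv[OF vec.prems], symmetric])
  also have "\<dots> + ?c * pd q f y = pd q (\<lambda>x. Q s (dir_deriv ?v f) x + ?c * f x) y"
    by (simp add: pd_fun_add[OF open_UNIV Q_smooth[OF smooth_onD(2)[OF sf] sS] UNIV_I smooth_on_cmult[OF open_UNIV sf]]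
        pd_fun_scale[OF open_UNIV sf])
  also have "\<dots> = pd q (dir_deriv v (Q s f)) y"
    by (rule pd_cong[OF open_UNIV]) (simp_all add: Q_dir_deriv[OF sf sS])
  also have "\<dots> = pd q (pd (sym_vec v) (Q s f)) y"
    by (rule pd_cong[OF open_UNIV]) (simp_all add: pd_vec[OF open_UNIV sQ])
  also have "\<dots> = pd (sym_vec v * q) (Q s f) y"
    by (simp add: pd_mult[OF open_UNIV sQ] mult.commute[of "sym_vec v"])
  finally show ?case by simp
next
  case (add p q)
  have "mul (hecke_tensor 1 (arefl s)) (hecke_tensor (p + q) id) =
      mul (hecke_tensor 1 (arefl s)) (hecke_tensor p id) + mul (hecke_tensor 1 (arefl s)) (hecke_tensor q id)"
    unfolding single_add by (intro mul_add_right S_HC s HC_tensor add W_id)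
  then show ?case using add by (simp add: DL_def aug_add pd_add)
qed

section \<open>Words in the operators Q and their relations\<close>

definition Qw :: "'a affine_functional list \<Rightarrow> ('a \<Rightarrow> complex) \<Rightarrow> 'a \<Rightarrow> complex" where
  "Qw ws f = foldr Q ws f"

lemma Qw_Nil: "Qw [] f = f" and Qw_Cons: "Qw (s # ws) f = Q s (Qw ws f)"
  and Qw_append: "Qw (us @ vs) f = Qw us (Qw vs f)"
  by (simp_all add: Qw_def)

lemma Qw_EV: "set ws \<subseteq> S \<Longrightarrow> f \<in> EV \<Longrightarrow> Qw ws f \<in> EV"
  using S_Sig by (induction ws) (auto simp: Qw_Nil Qw_Cons intro!: Q_EV)

text \<open>Transposition reverses the order, hence \<open>rev ws\<close>. The walls of all letters
  contain the same y, because \<open>pairing\<close> moves one letter after another across the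
  evaluation at y.\<close>

lemma pairing_word:
  assumes "set ws \<subseteq> {s \<in> S. aeval s y = 0}" "p \<in> SA" "f \<in> EV"
  shows "pd p (Qw ws f) y = pd (aug (mul (hecke_tensor 1 (wmap (rev ws))) (hecke_tensor p id))) f y"
  using assms(1,2)
proof (induction ws arbitrary: p)
  case Nil
  then show ?case by (simp only: Qw_Nil rev.simps wmap_simps mul_one_left[OF HC_tensor[OF _ W_id]] aug_tensor)
next
  case (Cons s ws)
  have s: "s \<in> S" "aeval s y = 0" and ws: "set ws \<subseteq> {s \<in> S. aeval s y = 0}" "set ws \<subseteq> S" "set (rev ws) \<subseteq> S"
    using Cons.prems by auto
  let ?x = "hecke_tensor 1 (wmap (rev ws))"
  have x: "?x \<in> HC" by (intro HC_tensor sym_algebra_one wmap_W ws)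
  have sp: "mul (hecke_tensor 1 (arefl s)) (hecke_tensor p id) \<in> HC"
    by (intro mul_closed S_HC s HC_tensor Cons.prems W_id)
  have "pd p (Qw (s # ws) f) y = pd (DL s p) (Qw ws f) y"
    unfolding Qw_Cons by (rule pairing[OF s Cons.prems(2) Qw_EV[OF ws(2) assms(3)]])
  also have "\<dots> = pd (aug (mul ?x (hecke_tensor (DL s p) id))) f y"
    by (rule Cons.IH[OF ws(1) DL_SA[OF s(1) Cons.prems(2)]])
  also have "aug (mul ?x (hecke_tensor (DL s p) id)) = aug (mul ?x (mul (hecke_tensor 1 (arefl s)) (hecke_tensor p id)))"
    unfolding DL_def by (rule aug_mult[OF x sp, symmetric])
  also have "mul ?x (mul (hecke_tensor 1 (arefl s)) (hecke_tensor p id)) = mul (mul ?x (hecke_tensor 1 (arefl s))) (hecke_tensor p id)"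
    by (intro mul_assoc[symmetric] x S_HC s HC_tensor Cons.prems W_id)
  also have "mul ?x (hecke_tensor 1 (arefl s)) = hecke_tensor 1 (wmap (rev ws) \<circ> arefl s)"
    using s S_Sig by (intro mul_grp wmap_W ws W_arefl) auto
  also have "wmap (rev ws) \<circ> arefl s = wmap (rev (s # ws))"
    by (simp add: wmap_append)
  finally show ?case .
qed

lemma wmap_rev: "set ws \<subseteq> S \<Longrightarrow> wmap (rev ws) = inv (wmap ws)"
proof (induction ws)
  case (Cons s ws)
  then have "inv (arefl s \<circ> wmap ws) = inv (wmap ws) \<circ> arefl s"
    using S_Sig by (subst W_inv_comp) (auto intro!: W_arefl wmap_W simp: inv_arefl)
  then show ?case using Cons by (simp only: rev.simps wmap_append wmap_simps) (simp add: fun_eq_iff)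
qed (simp add: inv_id[unfolded id_def])

definition triv :: "'a affine_functional list \<Rightarrow> bool" where
  "triv ws \<longleftrightarrow> (\<forall>f\<in>EV. Qw ws f = f)"

definition is_rel :: "'a affine_functional list \<Rightarrow> bool" where
  "is_rel ws \<longleftrightarrow> set ws \<subseteq> S \<and> wmap ws = id"

text \<open>The pairings at y see only the group element of the reversed word, which is the
  identity, and by \<open>sol_unique\<close> they determine a solution.\<close>

lemma triv_wall:
  assumes r: "is_rel ws" and y: "\<And>s. s \<in> set ws \<Longrightarrow> aeval s y = 0" shows "triv ws"
  unfolding triv_def
proof
  fix f assume f: "f \<in> EV"
  have ws: "set ws \<subseteq> {s \<in> S. aeval s y = 0}" "set ws \<subseteq> S" using r y by (auto simp: is_rel_def)
  have "wmap (rev ws) = id" using wmap_rev[OF ws(2)] r by (simp only: is_rel_def inv_id)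
  then have "pd p (Qw ws f) y = pd p f y" if "p \<in> SA" for p
    using pairing_word[OF ws(1) that f] mul_one_left[OF HC_tensor[OF that W_id]] by (simp only: aug_tensor)
  then show "Qw ws f = f" by (rule sol_unique[OF Qw_EV[OF ws(2) f] f])
qed

lemma Q_Q: "s \<in> S \<Longrightarrow> f \<in> EV \<Longrightarrow> Q s (Q s f) = f"
proof -
  assume s: "s \<in> S" and f: "f \<in> EV"
  obtain y where y: "aeval s y = 0" using wall_point[OF s] by blast
  have "is_rel [s, s]" using s S_Sig arefl_comp[of s] by (auto simp: is_rel_def fun_eq_iff)
  then have "triv [s, s]" by (rule triv_wall) (use y in auto)
  then show ?thesis using f by (simp add: triv_def Qw_Cons Qw_Nil)
qed

lemma Qw_rev: "set ws \<subseteq> S \<Longrightarrow> f \<in> EV \<Longrightarrow> Qw (rev ws) (Qw ws f) = f"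
proof (induction ws arbitrary: f)
  case (Cons s ws)
  then show ?case by (simp add: Qw_append Qw_Cons Qw_Nil Q_Q Qw_EV)
qed (simp add: Qw_Nil)

lemma rel_rotate: "is_rel (us @ vs) \<Longrightarrow> is_rel (vs @ us)"
proof -
  assume r: "is_rel (us @ vs)"
  then have s: "set us \<subseteq> S" "set vs \<subseteq> S" and e: "wmap us \<circ> wmap vs = id" by (auto simp: is_rel_def wmap_append)
  have "bij (wmap us)" by (rule W_bij[OF wmap_W[OF s(1)]])
  then have "wmap vs \<circ> wmap us = id" using e
    by (metis bij_betw_imp_inj_on bij_is_surj comp_id fun.map_id0 inv_unique_comp inv_o_cancel left_right_inverse_eq surj_iff)
  then show ?thesis using s by (simp only: is_rel_def wmap_append set_append Un_subset_iff)
qed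

lemma triv_rotate: assumes "set us \<subseteq> S" "set vs \<subseteq> S" "triv (us @ vs)" shows "triv (vs @ us)"
  unfolding triv_def
proof
  fix f assume f: "f \<in> EV"
  have "Qw us (Qw vs (Qw us f)) = Qw us f"
    using assms(3) Qw_EV[OF assms(1) f] by (simp add: triv_def Qw_append)
  then have "Qw (rev us) (Qw us (Qw vs (Qw us f))) = Qw (rev us) (Qw us f)" by simp
  then show "Qw (vs @ us) f = f"
    by (simp add: Qw_append Qw_rev assms f Qw_EV)
qed

lemma Qw_eq_of_triv:
  assumes "set us \<subseteq> S" "set vs \<subseteq> S" "triv (us @ rev vs)" "f \<in> EV" shows "Qw us f = Qw vs f"
proof -
  have "Qw (us @ rev vs) (Qw vs f) = Qw vs f" using assms Qw_EV by (simp add: triv_def)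
  then show ?thesis by (simp add: Qw_append Qw_rev assms)
qed

lemma rel_of_eq: "set us \<subseteq> S \<Longrightarrow> set vs \<subseteq> S \<Longrightarrow> wmap us = wmap vs \<Longrightarrow> is_rel (us @ rev vs)"
proof -
  assume s: "set us \<subseteq> S" "set vs \<subseteq> S" and e: "wmap us = wmap vs"
  have "wmap (us @ rev vs) = wmap vs \<circ> inv (wmap vs)" by (simp only: wmap_append wmap_rev[OF s(2)] e)
  also have "\<dots> = id" using W_inv_simps(1)[OF wmap_W[OF s(2)]] by (intro ext) (simp only: comp_apply id_apply)
  finally show ?thesis using s by (simp add: is_rel_def)
qed

lemma eq_of_rel: "is_rel (us @ vs) \<Longrightarrow> wmap us = wmap (rev vs)"
proof -
  assume r: "is_rel (us @ vs)"
  then have s: "set us \<subseteq> S" "set vs \<subseteq> S" and e: "wmap us \<circ> wmap vs = id" by (auto simp: is_rel_def wmap_append)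
  note v = wmap_W[OF s(2)]
  show ?thesis
  proof
    fix x
    have "wmap us (wmap vs (inv (wmap vs) x)) = inv (wmap vs) x" using fun_cong[OF e] by (simp only: comp_apply id_apply)
    then show "wmap us x = wmap (rev vs) x" by (simp only: wmap_rev[OF s(2)] W_inv_simps[OF v])
  qed
qed

text \<open>The following three lemmas are Tits' argument for the Coxeter presentation, applied to the operators
  \<open>Q\<close>: a relation either follows from shorter ones or it is a relation in two generators.\<close>

lemma rel_step:
  assumes IH: "\<And>vs. is_rel vs \<Longrightarrow> length vs < 2 * q \<Longrightarrow> triv vs"
    and r: "is_rel ws" and len: "length ws = 2 * q" and q: "q \<ge> 1"
  shows "triv ws \<or> wmap (take q (drop 1 ws)) = wmap (take q ws)"
proof -
  \<comment> \<open>As a group element u equals the reversed remainder, which has only q - 1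
    letters; so u is not reduced and \<open>deletion\<close> applies to it.\<close>
  define u v where "u = take (q + 1) ws" and "v = drop (q + 1) ws"
  have uv: "ws = u @ v" by (simp add: u_def v_def)
  have ws: "set ws \<subseteq> S" using r by (simp add: is_rel_def)
  then have su: "set u \<subseteq> S" "set v \<subseteq> S" by (simp_all add: uv)
  have lu: "length u = q + 1" "length v = q - 1" using len q by (simp_all add: u_def v_def)
  have "wmap u = wmap (rev v)" using eq_of_rel r uv by simp
  then have "card (Inv (wmap u)) \<le> length (rev v)" using finite_Inv_wmap[of "rev v"] su by simp
  then have "card (Inv (wmap u)) < length u" using lu by simp
  from deletion[OF su(1) this] obtain us s xs t ys where x: "u = us @ s # xs @ t # ys" "wmap (s # xs) = wmap (xs @ [t])" by blast
  have sets: "set us \<subseteq> S" "s \<in> S" "set xs \<subseteq> S" "t \<in> S" "set ys \<subseteq> S" using su x by auto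
  show ?thesis
  \<comment> \<open>If the relation s xs = xs t uses all of u, it has the full length 2 q and is the
    second alternative of the claim.\<close>
  proof (cases "us = [] \<and> ys = []")
    case True
    then have u: "u = s # xs @ [t]" using x by simp
    then have lx: "length xs + 1 = q" using lu by simp
    have "take q ws = s # xs" "take q (drop 1 ws) = xs @ [t]" using uv u lx by auto
    then show ?thesis using x(2) by simp
  next
    \<comment> \<open>Now s xs = xs t is a relation of length below 2 q, so it also holds for the
      operators. It cancels s and t in ws, and what remains is a shorter relation.\<close>
    case False
    then have lx: "length xs + 1 < q" using lu x by (cases us; cases ys) auto
    have "is_rel ((s # xs) @ rev (xs @ [t]))" by (rule rel_of_eq[OF _ _ x(2)]) (use sets in auto)
    then have tr: "triv ((s # xs) @ rev (xs @ [t]))" by (rule IH) (use lx in simp)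
    have e1: "Qw (s # xs) f = Qw (xs @ [t]) f" if "f \<in> EV" for f
      by (rule Qw_eq_of_triv[OF _ _ tr that]) (use sets in auto)
    have e2: "Qw (s # xs @ [t]) f = Qw xs f" if "f \<in> EV" for f
    proof -
      have "Qw (s # xs @ [t]) f = Qw (s # xs) (Qw [t] f)" using Qw_append[of "s # xs" "[t]" f] by simp
      also have "\<dots> = Qw (xs @ [t]) (Qw [t] f)" by (rule e1) (use sets that in \<open>auto intro: Qw_EV\<close>)
      also have "\<dots> = Qw xs f" using sets that by (simp add: Qw_append Qw_Cons Qw_Nil Q_Q)
      finally show ?thesis .
    qed
    have e3: "wmap (s # xs @ [t]) = wmap xs"
    proof
      fix z
      have "wmap (s # xs) (arefl t z) = wmap (xs @ [t]) (arefl t z)" using x(2) by simp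
      moreover have "arefl t (arefl t z) = z" using sets by (intro arefl_arefl S_nz)
      ultimately show "wmap (s # xs @ [t]) z = wmap xs z" by (simp add: wmap_append)
    qed
    let ?ws = "us @ xs @ ys @ v"
    have ws': "ws = us @ (s # xs @ [t]) @ ys @ v" using x uv by simp
    have "wmap ?ws = wmap ws" unfolding ws' wmap_append e3 ..
    then have "is_rel ?ws" using r sets su by (simp add: is_rel_def del: wmap_simps)
    then have "triv ?ws" by (rule IH) (use lu x len uv in simp)
    moreover have "Qw ws f = Qw ?ws f" if "f \<in> EV" for f
      unfolding ws' Qw_append[of us] Qw_append[of "s # xs @ [t]"] Qw_append[of xs]
      using e2[OF Qw_EV[of "ys @ v" f]] sets su that by simp
    ultimately show ?thesis by (simp add: triv_def)
  qed
qed

lemma arefl_simple_inj: assumes "s \<in> S" "t \<in> S" "arefl s = arefl t" shows "s = t"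
proof (rule ccontr)
  assume "s \<noteq> t"
  then have "act (arefl t) s \<in> Pos" using act_simple_pos[OF assms(2)] assms(1) S_Pos by blast
  moreover have "act (arefl t) s = - s" using act_self[of s] assms S_Sig by auto
  ultimately have "- s \<in> Pos" by simp
  then show False using Pos_not_uminus[of s] assms(1) S_Pos by (meson subsetD)
qed

lemma rel_third:
  assumes IH: "\<And>vs. is_rel vs \<Longrightarrow> length vs < 2 * q \<Longrightarrow> triv vs"
    and r: "is_rel ws" and len: "length ws = 2 * q" and q: "q \<ge> 2" and nt: "\<not> triv ws"
  shows "ws ! 0 = ws ! 2"
proof -
  have "Suc (Suc (Suc 0)) \<le> length ws" using len q by linarith
  then obtain s1 s2 s3 zs where ws: "ws = s1 # s2 # s3 # zs"
    unfolding Suc_le_length_iff by blast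
  have sets: "s1 \<in> S" "s2 \<in> S" "s3 \<in> S" "set zs \<subseteq> S" using r ws by (auto simp: is_rel_def)
  define m where "m = take (q - 2) zs"
  define t where "t = zs ! (q - 2)"
  define z where "z = drop (q - 1) zs"
  have lz: "length zs = 2 * q - 3" using len ws by simp
  have zs: "zs = m @ t # z"
  proof -
    have "zs = take (q - 2) zs @ zs ! (q - 2) # drop (Suc (q - 2)) zs"
      using lz q by (intro id_take_nth_drop) simp
    then show ?thesis using q by (simp add: m_def t_def z_def Suc_diff_Suc numeral_2_eq_2)
  qed
  have lm: "length m = q - 2" using lz q by (simp add: m_def)
  have sm: "set m \<subseteq> S" "t \<in> S" "set z \<subseteq> S" using sets zs by auto
  \<comment> \<open>As ws and its rotation are not trivial, \<open>rel_step\<close> gives s2 s3 m =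
    s1 s2 ... for ws and, in E2, s3 m t = s2 s3 m for the word rotated by one letter.\<close>
  have E1: "wmap (s2 # s3 # m) = wmap (s1 # s2 # take (q - 2) (s3 # m))"
  proof -
    have "wmap (take q (drop 1 ws)) = wmap (take q ws)" using rel_step[OF IH r len] nt q by auto
    moreover have "take q (drop 1 ws) = s2 # s3 # m" using lm q by (cases q; cases "q - 1") (auto simp: ws zs)
    moreover have "take q ws = s1 # s2 # take (q - 2) (s3 # m)"
      using lm q take_append[of "q - 2" "s3 # m" "t # z"] by (cases q; cases "q - 1") (auto simp: ws zs)
    ultimately show ?thesis by simp
  qed
  let ?ws1 = "s2 # s3 # zs @ [s1]"
  have r1: "is_rel ?ws1" using rel_rotate[of "[s1]" "s2 # s3 # zs"] r ws by simp
  have nt1: "\<not> triv ?ws1" using triv_rotate[of "s2 # s3 # zs" "[s1]"] nt ws sets by auto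
  have E2: "wmap (s3 # m @ [t]) = wmap (s2 # s3 # m)"
  proof -
    have "wmap (take q (drop 1 ?ws1)) = wmap (take q ?ws1)" using rel_step[OF IH r1] len ws nt1 q by auto
    moreover have "take q (drop 1 ?ws1) = s3 # m @ [t]" using lm q by (cases q; cases "q - 1") (auto simp: zs)
    moreover have "take q ?ws1 = s2 # s3 # m" using lm q by (cases q; cases "q - 1") (auto simp: zs)
    ultimately show ?thesis by simp
  qed
  \<comment> \<open>Multiplying E2 by s3 gives s3 s2 s3 m = m t, again a relation of length 2 q,
    which now begins with s3 s2.\<close>
  let ?A = "s3 # s2 # s3 # m" and ?B = "m @ [t]"
  have a3: "arefl s3 (arefl s3 x) = x" for x using sets by (intro arefl_arefl S_nz)
  have E3: "wmap ?A = wmap ?B"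
  proof
    fix x
    have "wmap ?A x = arefl s3 (wmap (s2 # s3 # m) x)" by simp
    also have "\<dots> = arefl s3 (wmap (s3 # m @ [t]) x)" by (simp only: E2)
    also have "\<dots> = wmap ?B x" by (simp add: a3)
    finally show "wmap ?A x = wmap ?B x" .
  qed
  let ?ws2 = "?A @ rev ?B"
  have r2: "is_rel ?ws2" by (rule rel_of_eq[OF _ _ E3]) (use sets sm in auto)
  have l2: "length ?ws2 = 2 * q" using lm q by simp
  \<comment> \<open>Were it trivial, s2 s3 m could be replaced by s3 m t inside ws on the level of
    operators; two adjacent letters t would cancel and leave a shorter relation.\<close>
  have nt2: "\<not> triv ?ws2"
  proof
    assume t2: "triv ?ws2"
    have e: "Qw ?A f = Qw ?B f" if "f \<in> EV" for f
      by (rule Qw_eq_of_triv[OF _ _ t2 that]) (use sets sm in auto)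
    have e': "Qw (s2 # s3 # m) f = Qw (s3 # m @ [t]) f" if f: "f \<in> EV" for f
    proof -
      have "Q s3 (Qw ?A f) = Q s3 (Qw ?B f)" using e[OF f] by simp
      moreover have "Qw (s2 # s3 # m) f \<in> EV" using sets sm f by (intro Qw_EV) auto
      ultimately show ?thesis using sets by (simp add: Qw_Cons[of s3] Q_Q)
    qed
    let ?v = "s1 # s3 # m @ z"
    have wv: "ws = [s1] @ (s2 # s3 # m) @ t # z" "?v = [s1] @ (s3 # m) @ z" by (simp_all add: ws zs)
    have "Qw ws f = Qw ?v f" if f: "f \<in> EV" for f
    proof -
      have z: "Qw z f \<in> EV" "Qw (t # z) f \<in> EV" using sm f by (auto intro!: Qw_EV)
      have "Qw ws f = Q s1 (Qw (s2 # s3 # m) (Qw (t # z) f))" unfolding wv(1) Qw_append by (simp add: Qw_Cons Qw_Nil)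
      also have "\<dots> = Q s1 (Qw (s3 # m @ [t]) (Qw (t # z) f))" using e'[OF z(2)] by simp
      also have "\<dots> = Q s1 (Qw (s3 # m) (Qw z f))" using Q_Q[OF sm(2) z(1)] by (simp add: Qw_Cons Qw_append Qw_Nil)
      also have "\<dots> = Qw ?v f" unfolding wv(2) Qw_append by (simp add: Qw_Cons Qw_Nil)
      finally show ?thesis .
    qed
    moreover have "triv ?v"
    proof (rule IH)
      have "wmap ?v x = wmap ws x" for x
      proof -
        have "arefl t (arefl t y) = y" for y using sm by (intro arefl_arefl S_nz)
        then have "wmap ?v x = arefl s1 (wmap (s3 # m @ [t]) (arefl t (wmap z x)))" by (simp add: wmap_append)
        also have "\<dots> = arefl s1 (wmap (s2 # s3 # m) (arefl t (wmap z x)))" by (simp only: E2)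
        also have "\<dots> = wmap ws x" by (simp add: ws zs wmap_append)
        finally show ?thesis .
      qed
      then have "wmap ?v = wmap ws" by (rule ext)
      then show "is_rel ?v" using r sets sm by (simp add: is_rel_def del: wmap_simps)
      show "length ?v < 2 * q" using len by (simp add: ws zs)
    qed
    ultimately show False using nt by (simp add: triv_def)
  qed
  \<comment> \<open>Comparing \<open>rel_step\<close> for the new relation with E1 gives s1 x = s3 x
    with the same word x, hence s1 = s3.\<close>
  have "wmap (take q (drop 1 ?ws2)) = wmap (take q ?ws2)" using rel_step[OF IH r2 l2] nt2 q by auto
  moreover have "take q (drop 1 ?ws2) = s2 # s3 # m" using lm q by (cases q; cases "q - 1") auto
  moreover have "take q ?ws2 = s3 # s2 # take (q - 2) (s3 # m)"
    using lm q take_append[of "q - 2" "s3 # m" "t # rev m"] by (cases q; cases "q - 1") auto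
  ultimately have "wmap (s1 # s2 # take (q - 2) (s3 # m)) = wmap (s3 # s2 # take (q - 2) (s3 # m))"
    using E1 by simp
  then have eq: "arefl s1 (wmap (s2 # take (q - 2) (s3 # m)) x) = arefl s3 (wmap (s2 # take (q - 2) (s3 # m)) x)" for x
    by (metis comp_apply wmap_simps(2))
  have sub: "set (s2 # take (q - 2) (s3 # m)) \<subseteq> S"
    using sets sm set_take_subset[of "q - 2" "s3 # m"] by auto
  have "arefl s1 x = arefl s3 x" for x
    using eq[of "inv (wmap (s2 # take (q - 2) (s3 # m))) x"] by (simp only: W_inv_simps[OF wmap_W[OF sub]])
  then have "arefl s1 = arefl s3" by (rule ext)
  then have "s1 = s3" by (rule arefl_simple_inj[OF sets(1,3)])
  then show ?thesis by (simp add: ws)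
qed

lemma alternating_fixed_point:
  assumes r: "is_rel ws" and len: "length ws = 2 * q" and q: "q \<ge> 1"
    and alt: "\<And>j. j < 2 * q \<Longrightarrow> ws ! j = (if even j then s else t)"
  shows "\<exists>y. aeval s y = 0 \<and> aeval t y = 0"
proof -
  have ws: "set ws \<subseteq> S" using r by (simp add: is_rel_def)
  define x where "x j = wmap (drop j ws) 0" for j
  have xend: "x (2 * q) = x 0" using len r by (simp add: x_def is_rel_def)
  have st: "s \<in> S" "t \<in> S" using alt[of 0] alt[of 1] ws len q nth_mem[of 0 ws] nth_mem[of 1 ws] by auto
  have nz: "fst s \<noteq> 0" "fst t \<noteq> 0" using st S_nz by auto
  have step: "x j = arefl (ws ! j) (x (Suc j))" if "j < 2 * q" for j
    using that len by (simp add: x_def Cons_nth_drop_Suc[symmetric])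
  \<comment> \<open>The barycentre of the points visited by the word. The reflection s exchanges x
    (2 i) and x (2 i + 1), while t exchanges x (2 i + 1) and x (2 i + 2), with x (2 q) = x 0; so
    both functionals have mean value 0 over the points.\<close>
  define y where "y = (1 / real (2 * q)) *\<^sub>R (\<Sum>j<2 * q. x j)"
  have bary: "aeval a y = (1 / real (2 * q)) * (\<Sum>j<2 * q. aeval a (x j))" for a :: "'a affine_functional"
    using q by (simp add: aeval_def y_def inner_sum_right sum.distrib algebra_simps)
  have split: "(\<Sum>j<2 * q. g j) = (\<Sum>i<q. g (2 * i) + g (Suc (2 * i)))" for g :: "nat \<Rightarrow> real"
    by (induction q) auto
  have "(\<Sum>j<2 * q. aeval s (x j)) = 0"
    unfolding split
    by (rule sum.neutral) (use step alt nz in \<open>auto simp: aeval_arefl_self\<close>)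
  moreover have "(\<Sum>j<2 * q. aeval t (x j)) = (\<Sum>j<2 * q. aeval t (x (Suc j)))"
    using sum.lessThan_Suc_shift[of "\<lambda>j. aeval t (x j)" "2 * q"] xend by simp
  moreover have "(\<Sum>j<2 * q. aeval t (x (Suc j))) = 0"
    unfolding split
  proof (rule sum.neutral, rule ballI)
    fix i assume "i \<in> {..<q}"
    then have "x (Suc (2 * i)) = arefl t (x (Suc (Suc (2 * i))))" using step[of "Suc (2 * i)"] alt[of "Suc (2 * i)"] by simp
    then show "aeval t (x (Suc (2 * i))) + aeval t (x (Suc (Suc (2 * i)))) = 0" using nz by (simp add: aeval_arefl_self)
  qed
  ultimately show ?thesis using bary by (intro exI[of _ y]) simp
qed

theorem relations: "is_rel ws \<Longrightarrow> triv ws"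
proof (induction "length ws" arbitrary: ws rule: less_induct)
  case less
  have ws: "set ws \<subseteq> S" and id: "wmap ws = id" using less.prems by (auto simp: is_rel_def)
  have "even (length ws)" using finite_Inv_wmap[OF ws] unfolding id Inv_id by simp
  then obtain q where len: "length ws = 2 * q" by (elim evenE)
  show ?case
  proof (rule ccontr)
    assume nt: "\<not> triv ws"
    have q: "q \<ge> 1" using nt len by (cases q) (auto simp: triv_def Qw_Nil)
    have IH: "\<And>vs. is_rel vs \<Longrightarrow> length vs < 2 * q \<Longrightarrow> triv vs" using less.hyps len by simp
    \<comment> \<open>Rotation brings position j to the front and preserves both being a relation
      and not being trivial.\<close>
    have third: "ws ! j = ws ! (j + 2)" if "j + 2 < 2 * q" for j
    proof -
      let ?u = "take j ws" and ?v = "drop j ws"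
      have s: "set ?u \<subseteq> S" "set ?v \<subseteq> S" using ws set_take_subset[of j ws] set_drop_subset[of j ws] by auto
      have r: "is_rel (?v @ ?u)" using rel_rotate[of ?u ?v] less.prems by simp
      have n: "\<not> triv (?v @ ?u)" using triv_rotate[OF s(2,1)] nt by auto
      have "(?v @ ?u) ! 0 = (?v @ ?u) ! 2"
        by (rule rel_third[OF IH r _ _ n]) (use len that in auto)
      moreover have "2 < 2 * q - j" using that by linarith
      ultimately show ?thesis using len that by (simp add: nth_append)
    qed
    have alt: "ws ! j = (if even j then ws ! 0 else ws ! 1)" if "j < 2 * q" for j
      using that
    proof (induction j rule: less_induct)
      case (less j)
      show ?case
      proof (cases "j < 2")
        case True
        then have "j = 0 \<or> j = 1" by linarith
        then show ?thesis by auto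
      next
        case False
        then obtain i where i: "j = i + 2" by (metis add.commute le_add_diff_inverse not_less)
        then show ?thesis using third[of i] less.IH[of i] less.prems by simp
      qed
    qed
    obtain y where y: "aeval (ws ! 0) y = 0" "aeval (ws ! 1) y = 0"
      using alternating_fixed_point[OF less.prems len q alt] by blast
    have "triv ws"
    proof (rule triv_wall[OF less.prems])
      fix s assume "s \<in> set ws"
      then obtain j where "j < length ws" "s = ws ! j" by (auto simp: in_set_conv_nth)
      then show "aeval s y = 0" using alt[of j] y len by (cases "even j") auto
    qed
    then show False using nt by simp
  qed
qed

section \<open>The action of the affine Weyl group by Q\<close>

abbreviation QW :: "('a \<Rightarrow> 'a) \<Rightarrow> ('a \<Rightarrow> complex) \<Rightarrow> 'a \<Rightarrow> complex" where
  "QW w f \<equiv> Q_weyl B \<phi> k w f"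

text \<open>The word chosen in \<open>simple_word\<close> may be replaced by any other word for the
  same element; all later statements about \<open>QW\<close> start from here.\<close>

lemma QW_word: assumes "set ws \<subseteq> S" "f \<in> EV" shows "QW (wmap ws) f = Qw ws f"
proof -
  let ?us = "simple_word B \<phi> (wmap ws)"
  have "\<exists>as. set as \<subseteq> S \<and> foldr (\<circ>) (map arefl as) id = wmap ws"
    using assms(1) by (auto simp: wmap_def)
  from someI_ex[OF this] have us: "set ?us \<subseteq> S" "wmap ?us = wmap ws"
    unfolding simple_word_def wmap_def by auto
  have "Qw ?us f = Qw ws f"
    by (rule Qw_eq_of_triv[OF us(1) assms(1) relations[OF rel_of_eq[OF us(1) assms(1) us(2)]] assms(2)])
  then show ?thesis by (simp add: Q_weyl_def Qw_def)
qed

lemma QW_EV: "w \<in> W \<Longrightarrow> f \<in> EV \<Longrightarrow> QW w f \<in> EV"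
  using W_word[of w] QW_word Qw_EV by metis

lemma QW_comp: "u \<in> W \<Longrightarrow> w \<in> W \<Longrightarrow> f \<in> EV \<Longrightarrow> QW (u \<circ> w) f = QW u (QW w f)"
proof -
  assume u: "u \<in> W" and w: "w \<in> W" and f: "f \<in> EV"
  obtain us ws where s: "set us \<subseteq> S" "u = wmap us" "set ws \<subseteq> S" "w = wmap ws" using W_word u w by metis
  have "QW (wmap (us @ ws)) f = Qw (us @ ws) f" by (rule QW_word) (use s f in auto)
  then show ?thesis by (simp only: s wmap_append Qw_append QW_word[OF s(3) f] QW_word[OF s(1) Qw_EV[OF s(3) f]])
qed

lemma QW_id: "f \<in> EV \<Longrightarrow> QW id f = f"
  using QW_word[of "[]" f] by (simp only: wmap_simps Qw_Nil list.set empty_subsetI)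

lemma QW_arefl: "s \<in> S \<Longrightarrow> f \<in> EV \<Longrightarrow> QW (arefl s) f = Q s f"
  using QW_word[of "[s]" f] by (simp only: wmap_simps Qw_Nil Qw_Cons list.set comp_id empty_subsetI insert_subset)

lemma QW_lin:
  assumes w: "w \<in> W" and f: "f \<in> EV" and g: "g \<in> EV"
  shows "QW w (\<lambda>x. f x + g x) = (\<lambda>x. QW w f x + QW w g x)" "QW w (\<lambda>x. c * f x) = (\<lambda>x. c * QW w f x)"
proof -
  obtain ws where ws: "set ws \<subseteq> S" "w = wmap ws" using W_word w by metis
  have "Qw ws (\<lambda>x. f x + g x) = (\<lambda>x. Qw ws f x + Qw ws g x) \<and> Qw ws (\<lambda>x. c * f x) = (\<lambda>x. c * Qw ws f x)"
    using ws(1)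
  proof (induction ws)
    case (Cons s ws)
    have s: "s \<in> Sig" and ws: "set ws \<subseteq> S" using Cons.prems S_Sig by auto
    have sm: "smooth_on UNIV (Qw ws f)" "smooth_on UNIV (Qw ws g)" using EV_smooth Qw_EV[OF ws] f g by auto
    show ?case using Cons.IH[OF ws] by (simp add: Qw_Cons Q_add[OF sm s] Q_scale[OF sm(1) s])
  qed (simp add: Qw_Nil)
  then show "QW w (\<lambda>x. f x + g x) = (\<lambda>x. QW w f x + QW w g x)" "QW w (\<lambda>x. c * f x) = (\<lambda>x. c * QW w f x)"
    unfolding ws(2) by (simp_all only: QW_word[OF ws(1)] f g EV_add EV_scale)
qed

end

context hecke_setup
begin

section \<open>The module structure given by \<open>Q\<close>\<close>

abbreviation QR :: "'a hecke \<Rightarrow> ('a \<Rightarrow> complex) \<Rightarrow> 'a \<Rightarrow> complex" where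
  "QR \<equiv> Q_rep B \<phi> k"

lemma QR_superset:
  "finite A \<Longrightarrow> Poly_Mapping.keys h \<subseteq> A \<Longrightarrow> QR h f x = (\<Sum>w\<in>A. pd (Poly_Mapping.lookup h w) (QW w f) x)"
  unfolding Q_rep_def by (rule sum.mono_neutral_left) (auto simp: in_keys_iff pd_zero)

lemma QR_add: "QR (h + h') f = (\<lambda>x. QR h f x + QR h' f x)"
proof
  fix x
  let ?A = "Poly_Mapping.keys h \<union> Poly_Mapping.keys h'"
  have "Poly_Mapping.keys (h + h') \<subseteq> ?A" by (rule keys_add)
  then show "QR (h + h') f x = QR h f x + QR h' f x"
    by (subst (1 2 3) QR_superset[of ?A]) (simp_all add: lookup_add pd_add sum.distrib)
qed

lemma QR_tensor: "QR (hecke_tensor p w) f = pd p (QW w f)"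
  using QR_superset[of "{w}" "hecke_tensor p w" f] by (auto simp: fun_eq_iff)

lemma EV_sum: "(\<And>i. i \<in> I \<Longrightarrow> f i \<in> EV) \<Longrightarrow> (\<lambda>x. \<Sum>i\<in>I. f i x) \<in> EV"
  by (induction I rule: infinite_finite_induct) (auto intro: EV_add EV_zero)

lemma pd_lin:
  assumes "f \<in> EV" "g \<in> EV"
  shows "pd p (\<lambda>x. f x + g x) = (\<lambda>x. pd p f x + pd p g x)" "pd p (\<lambda>x. c * f x) = (\<lambda>x. c * pd p f x)"
  using pd_fun_add[OF open_UNIV EV_smooth[OF assms(1)] UNIV_I EV_smooth[OF assms(2)]]
    pd_fun_scale[OF open_UNIV EV_smooth[OF assms(1)] UNIV_I] by auto

lemma pd_comp: "f \<in> EV \<Longrightarrow> pd (p * q) f = pd p (pd q f)"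
  using pd_mult[OF open_UNIV EV_smooth UNIV_I] by auto

lemma QR_EV: "h \<in> HC \<Longrightarrow> f \<in> EV \<Longrightarrow> QR h f \<in> EV"
proof (induction rule: HC_induct)
  case (tensor p w)
  then show ?case by (simp only: QR_tensor EV_pd QW_EV)
next
  case (add x y)
  then show ?case by (simp only: QR_add EV_add)
qed

lemma QR_lin:
  assumes "h \<in> HC" "f \<in> EV" "g \<in> EV"
  shows "QR h (\<lambda>x. f x + g x) = (\<lambda>x. QR h f x + QR h g x)" "QR h (\<lambda>x. c * f x) = (\<lambda>x. c * QR h f x)"
proof -
  have "QR h (\<lambda>x. f x + g x) = (\<lambda>x. QR h f x + QR h g x) \<and> QR h (\<lambda>x. c * f x) = (\<lambda>x. c * QR h f x)"
    using assms(1)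
  proof (induction rule: HC_induct)
    case (tensor p w)
    then show ?case
      by (simp only: QR_tensor QW_lin[OF tensor(2) assms(2,3)] pd_lin[OF QW_EV[OF tensor(2) assms(2)] QW_EV[OF tensor(2) assms(3)]])
  next
    case (add x y)
    then show ?case by (simp add: QR_add distrib_left add_ac)
  qed
  then show "QR h (\<lambda>x. f x + g x) = (\<lambda>x. QR h f x + QR h g x)" "QR h (\<lambda>x. c * f x) = (\<lambda>x. c * QR h f x)" by blast+
qed

lemma QR_scale: assumes "h \<in> HC" "f \<in> EV" shows "QR (hecke_scale c h) f = (\<lambda>x. c * QR h f x)"
proof -
  have "Poly_Mapping.keys (hecke_scale c h) \<subseteq> Poly_Mapping.keys h" by (auto simp: in_keys_iff lookup_scale)
  then have "QR (hecke_scale c h) f x = (\<Sum>w\<in>Poly_Mapping.keys h. pd (sym_const c * Poly_Mapping.lookup h w) (QW w f) x)" for x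
    by (subst QR_superset[of "Poly_Mapping.keys h"]) (simp_all add: lookup_scale)
  also have "(\<Sum>w\<in>Poly_Mapping.keys h. pd (sym_const c * Poly_Mapping.lookup h w) (QW w f) x) = c * QR h f x" for x
    unfolding Q_rep_def sum_distrib_left
  proof (rule sum.cong[OF refl])
    fix w assume "w \<in> Poly_Mapping.keys h"
    then have "QW w f \<in> EV" using HC_keys[OF assms(1)] assms(2) QW_EV by blast
    then show "pd (sym_const c * Poly_Mapping.lookup h w) (QW w f) x = c * pd (Poly_Mapping.lookup h w) (QW w f) x"
      by (simp add: pd_comp pd_const)
  qed
  finally show ?thesis by (rule ext)
qed

lemma QR_grp_right: "z \<in> HC \<Longrightarrow> w \<in> W \<Longrightarrow> f \<in> EV \<Longrightarrow> QR (mul z (hecke_tensor 1 w)) f = QR z (QW w f)"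
proof (induction rule: HC_induct)
  case (tensor p u)
  have "mul (hecke_tensor p u) (hecke_tensor 1 w) = mul (mul (hecke_tensor p id) (hecke_tensor 1 u)) (hecke_tensor 1 w)"
    by (simp only: mul_tensor tensor)
  also have "\<dots> = mul (hecke_tensor p id) (mul (hecke_tensor 1 u) (hecke_tensor 1 w))"
    by (intro mul_assoc HC_tensor tensor sym_algebra_one W_id)
  also have "\<dots> = hecke_tensor p (u \<circ> w)"
    unfolding mul_grp[OF tensor(2,3)] by (intro mul_tensor W_comp tensor)
  finally show ?case by (simp only: QR_tensor QW_comp[OF tensor(2,3,4)])
next
  case (add x y)
  then show ?case by (simp only: mul_add_left[OF add(1,2) HC_tensor[OF sym_algebra_one add(5)]] QR_add)
qed

text \<open>The elements whose left multiplications are respected by \<open>QR\<close>. They are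
  closed under sums and products and include the polynomials and the simple reflections, so they
  exhaust H_k.\<close>

definition acts_mult :: "'a hecke \<Rightarrow> bool" where
  "acts_mult x \<longleftrightarrow> x \<in> HC \<and> (\<forall>y\<in>HC. \<forall>f\<in>EV. QR (mul x y) f = QR x (QR y f))"

lemma acts_mult_sym: assumes p: "p \<in> SA" shows "acts_mult (hecke_tensor p id)"
  unfolding acts_mult_def
proof (intro conjI ballI)
  show x: "hecke_tensor p id \<in> HC" by (rule HC_tensor[OF p W_id])
  fix y f assume y: "y \<in> HC" and f: "f \<in> EV"
  show "QR (mul (hecke_tensor p id) y) f = QR (hecke_tensor p id) (QR y f)"
    using y
  proof (induction rule: HC_induct)
    case (tensor q w)
    have "mul (hecke_tensor p id) (hecke_tensor q w) = mul (mul (hecke_tensor p id) (hecke_tensor q id)) (hecke_tensor 1 w)"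
      using mul_assoc[OF x HC_tensor[OF tensor(1) W_id] HC_tensor[OF sym_algebra_one tensor(2)]]
      by (simp only: mul_tensor[OF tensor])
    also have "\<dots> = hecke_tensor (p * q) w"
      unfolding mul_sym[OF p tensor(1)] by (rule mul_tensor[OF sym_algebra_mult[OF p tensor(1)] tensor(2)])
    finally show ?case
      by (simp only: QR_tensor pd_comp[OF QW_EV[OF tensor(2) f]] QW_id[OF EV_pd[OF QW_EV[OF tensor(2) f]]])
  next
    case (add y z)
    then show ?case
      by (simp only: mul_add_right[OF x] QR_add QR_lin(1)[OF x QR_EV[OF add(1) f] QR_EV[OF add(2) f]])
  qed
qed

text \<open>Both sides obey the cross relation: the left one in H_k, the right one by
  \<open>Q_dir_deriv\<close> applied to the reflected vector, which changes the sign of the scalar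
  term.\<close>

lemma QR_simple_sym:
  assumes s: "s \<in> S" and q: "q \<in> SA" and g: "g \<in> EV"
  shows "QR (mul (hecke_tensor 1 (arefl s)) (hecke_tensor q id)) g = Q s (pd q g)"
  using q
proof (induction rule: sym_algebra_induct)
  case (const c)
  have sS: "s \<in> Sig" using s S_Sig by blast
  have e: "hecke_tensor (sym_const c) id = hecke_scale c (hecke_tensor 1 id)" unfolding scale_tensor mult_1_right ..
  have "mul (hecke_tensor 1 (arefl s)) (hecke_tensor (sym_const c) id) = hecke_scale c (mul (hecke_tensor 1 (arefl s)) (hecke_tensor 1 id))"
    unfolding e by (rule mul_scale_right[OF S_HC[OF s] HC_tensor[OF sym_algebra_one W_id]])
  then have "QR (mul (hecke_tensor 1 (arefl s)) (hecke_tensor (sym_const c) id)) g = (\<lambda>x. c * QR (hecke_tensor 1 (arefl s)) g x)"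
    by (simp only: mul_one_right[OF S_HC[OF s]] QR_scale[OF S_HC[OF s] g])
  also have "\<dots> = Q s (\<lambda>x. c * g x)"
    by (simp add: QR_tensor pd_one QW_arefl[OF s g] Q_scale[OF EV_smooth[OF g] sS])
  also have "(\<lambda>x. c * g x) = pd (sym_const c) g" by (rule ext) (simp add: pd_const)
  finally show ?case .
next
  case (vec v q)
  have sS: "s \<in> Sig" using s S_Sig by blast
  let ?h = "pd q g" and ?v = "refl (fst s) v" and ?c = "complex_of_real (k s * (fst s \<bullet> v))"
  have h: "?h \<in> EV" by (rule EV_pd[OF g])
  have mem: "mul (hecke_tensor 1 (arefl s)) (hecke_tensor q id) \<in> HC" by (intro mul_closed S_HC s HC_tensor vec W_id)
  have Qh: "Q s ?h \<in> EV" by (rule Q_EV[OF h sS])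
  have "QR (mul (hecke_tensor 1 (arefl s)) (hecke_tensor (sym_vec v * q) id)) g =
     (\<lambda>x. QR (hecke_tensor (sym_vec ?v) id) (Q s ?h) x + QR (hecke_tensor (sym_const ?c * q) id) g x)"
    using acts_mult_sym[OF sym_algebra_vec, of ?v] mem g
    by (simp only: mul_cross'[OF s vec.hyps] QR_add acts_mult_def vec.IH)
  also have "\<dots> = (\<lambda>x. dir_deriv ?v (Q s ?h) x + ?c * ?h x)"
    by (simp only: QR_tensor QW_id[OF Qh] QW_id[OF g] pd_vec[OF open_UNIV EV_smooth[OF Qh] UNIV_I] pd_comp[OF g] pd_const)
  also have "\<dots> = Q s (dir_deriv v ?h)"
  proof
    fix x
    have "fst s \<bullet> ?v = - (fst s \<bullet> v)" using S_nz[OF s] by (simp add: refl_def inner_diff_right coroot_inner)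
    then show "dir_deriv ?v (Q s ?h) x + ?c * ?h x = Q s (dir_deriv v ?h) x"
      unfolding Q_dir_deriv[OF EV_smooth[OF h] sS] refl_refl by simp
  qed
  also have "dir_deriv v ?h = pd (sym_vec v * q) g"
    by (rule ext) (simp only: pd_comp[OF g] pd_vec[OF open_UNIV EV_smooth[OF h] UNIV_I])
  finally show ?case .
next
  case (add p q)
  have sS: "s \<in> Sig" using s S_Sig by blast
  have "mul (hecke_tensor 1 (arefl s)) (hecke_tensor (p + q) id) =
      mul (hecke_tensor 1 (arefl s)) (hecke_tensor p id) + mul (hecke_tensor 1 (arefl s)) (hecke_tensor q id)"
    unfolding single_add by (intro mul_add_right S_HC s HC_tensor add W_id)
  moreover have "pd (p + q) g = (\<lambda>x. pd p g x + pd q g x)" by (rule ext) (rule pd_add)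
  ultimately show ?case using add
    by (simp only: QR_add Q_add[OF EV_smooth[OF EV_pd[OF g]] EV_smooth[OF EV_pd[OF g]] sS])
qed

lemma acts_mult_simple: assumes s: "s \<in> S" shows "acts_mult (hecke_tensor 1 (arefl s))"
  unfolding acts_mult_def
proof (intro conjI ballI)
  show x: "hecke_tensor 1 (arefl s) \<in> HC" by (rule S_HC[OF s])
  have one: "pd 1 g = g" for g :: "'a \<Rightarrow> complex" by (rule ext) (rule pd_one)
  fix y f assume y: "y \<in> HC" and f: "f \<in> EV"
  show "QR (mul (hecke_tensor 1 (arefl s)) y) f = QR (hecke_tensor 1 (arefl s)) (QR y f)"
    using y
  proof (induction rule: HC_induct)
    case (tensor q w)
    note g = QW_EV[OF tensor(2) f]
    have "mul (hecke_tensor 1 (arefl s)) (hecke_tensor q w) = mul (mul (hecke_tensor 1 (arefl s)) (hecke_tensor q id)) (hecke_tensor 1 w)"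
      using mul_assoc[OF x HC_tensor[OF tensor(1) W_id] HC_tensor[OF sym_algebra_one tensor(2)]]
      by (simp only: mul_tensor[OF tensor])
    then have "QR (mul (hecke_tensor 1 (arefl s)) (hecke_tensor q w)) f = Q s (pd q (QW w f))"
      by (simp only: QR_grp_right[OF mul_closed[OF x HC_tensor[OF tensor(1) W_id]] tensor(2) f] QR_simple_sym[OF s tensor(1) g])
    then show ?case by (simp only: QR_tensor QW_arefl[OF s EV_pd[OF g]] one)
  next
    case (add y z)
    then show ?case
      by (simp only: mul_add_right[OF x] QR_add QR_lin(1)[OF x QR_EV[OF add(1) f] QR_EV[OF add(2) f]])
  qed
qed

lemma acts_mult_mult: assumes "acts_mult x" "acts_mult y" shows "acts_mult (mul x y)"
  unfolding acts_mult_def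
proof (intro conjI ballI)
  have xy: "x \<in> HC" "y \<in> HC" using assms by (simp_all add: acts_mult_def)
  show "mul x y \<in> HC" by (rule mul_closed[OF xy])
  fix z f assume z: "z \<in> HC" "f \<in> EV"
  have "QR (mul (mul x y) z) f = QR (mul x (mul y z)) f" by (simp only: mul_assoc[OF xy z(1)])
  also have "\<dots> = QR x (QR (mul y z) f)" using assms(1) mul_closed[OF xy(2) z(1)] z(2) by (simp only: acts_mult_def)
  also have "\<dots> = QR x (QR y (QR z f))" using assms(2) z by (simp only: acts_mult_def)
  also have "\<dots> = QR (mul x y) (QR z f)" using assms(1) xy(2) QR_EV[OF z] by (simp only: acts_mult_def)
  finally show "QR (mul (mul x y) z) f = QR (mul x y) (QR z f)" .
qed

lemma acts_mult_all: "x \<in> HC \<Longrightarrow> acts_mult x"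
proof (induction rule: HC_induct)
  case (tensor p w)
  obtain ws where ws: "set ws \<subseteq> S" "w = wmap ws" using W_word tensor by metis
  have "acts_mult (hecke_tensor 1 (wmap ws))" using ws(1)
  proof (induction ws)
    case Nil
    then show ?case using acts_mult_sym[OF sym_algebra_one] by (simp only: wmap_simps)
  next
    case (Cons s ws)
    then have s: "s \<in> S" "s \<in> Sig" "set ws \<subseteq> S" using S_Sig by auto
    have "hecke_tensor 1 (wmap (s # ws)) = mul (hecke_tensor 1 (arefl s)) (hecke_tensor 1 (wmap ws))"
      by (simp only: wmap_simps mul_grp[OF W_arefl[OF s(2)] wmap_W[OF s(3)]])
    then show ?case using acts_mult_mult[OF acts_mult_simple[OF s(1)] Cons.IH[OF s(3)]] by (simp only:)
  qed
  from acts_mult_mult[OF acts_mult_sym[OF tensor(1)] this] show ?case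
    unfolding ws(2) mul_tensor[OF tensor, unfolded ws(2)] .
next
  case (add x y)
  show ?case
    unfolding acts_mult_def
  proof (intro conjI ballI)
    show "x + y \<in> HC" by (rule HC_add[OF add(1,2)])
    fix z f assume z: "z \<in> HC" "f \<in> EV"
    show "QR (mul (x + y) z) f = QR (x + y) (QR z f)"
      using add(3,4) z by (simp only: mul_add_left[OF add(1,2) z(1)] QR_add acts_mult_def)
  qed
qed

theorem Q_module: "hecke_module R mul EV QR"
  unfolding hecke_module_def
proof (intro conjI ballI allI)
  show "csubspace_fun EV" by (rule EV_csub)
  fix h assume h: "h \<in> HC"
  show "clinear_fun_on EV (QR h)" unfolding clinear_fun_on_def using QR_lin[OF h] by blast
  show "\<And>f. f \<in> EV \<Longrightarrow> QR h f \<in> EV" by (rule QR_EV[OF h])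
  fix f assume f: "f \<in> EV"
  show "\<And>h'. h' \<in> HC \<Longrightarrow> QR (h + h') f = (\<lambda>x. QR h f x + QR h' f x)" by (rule QR_add)
  show "\<And>h'. h' \<in> HC \<Longrightarrow> QR (mul h h') f = QR h (QR h' f)" using acts_mult_all[OF h] f by (simp only: acts_mult_def)
  show "\<And>c. QR (hecke_scale c h) f = (\<lambda>x. c * QR h f x)" by (rule QR_scale[OF h f])
next
  fix f assume f: "f \<in> EV"
  show "QR (hecke_tensor 1 id) f = f" unfolding QR_tensor QW_id[OF f] by (rule ext) (rule pd_one)
qed

section \<open>The propagation operator\<close>

abbreviation T :: "('a \<Rightarrow> complex) \<Rightarrow> 'a \<Rightarrow> complex" where "T \<equiv> T_op R B \<phi> k"

lemma Qw_fix: "set ws \<subseteq> {s \<in> S. aeval s v = 0} \<Longrightarrow> Qw ws g v = g v"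
  by (induction ws) (auto simp: Qw_Nil Qw_Cons Q_wall)

text \<open>By \<open>stabilizer\<close> the two choices differ by a product of reflections whose
  walls contain v, and the corresponding operators Q leave values at v unchanged.\<close>

lemma T_well_defined:
  assumes f: "f \<in> EV" and w: "w \<in> W" "w' \<in> W" and v: "v \<in> Cb" "v' \<in> Cb" and eq: "inv w v = inv w' v'"
  shows "QW w f v = QW w' f v'"
proof -
  define u where "u = w' \<circ> inv w"
  have u: "u \<in> W" unfolding u_def by (intro W_comp w W_inv)
  have uv: "u v = v'" using eq w by (simp add: u_def)
  obtain ws where ws: "u v = v" "set ws \<subseteq> {s\<in>S. aeval s v = 0}" "u = wmap ws"
    using stabilizer[OF u v(1)] uv v(2) by blast
  have "u (w x) = w' x" for x using w by (simp add: u_def)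
  then have "w' = u \<circ> w" by (intro ext) (simp only: comp_apply)
  then have "QW w' f v' = QW u (QW w f) v" using QW_comp[OF u w(1) f] uv ws(1) by (simp only:)
  also have "\<dots> = Qw ws (QW w f) v"
    unfolding ws(3) by (subst QW_word) (use ws(2) QW_EV[OF w(1) f] in auto)
  also have "\<dots> = QW w f v" by (rule Qw_fix[OF ws(2)])
  finally show ?thesis by simp
qed

lemma T_eval: assumes f: "f \<in> EV" and w: "w \<in> W" and x: "w x \<in> Cb" shows "T f x = QW w f (w x)"
  unfolding T_op_def closure_C
proof (rule the_equality)
  show "\<exists>u\<in>W. \<exists>v\<in>Cb. x = inv u v \<and> QW w f (w x) = QW u f v"
    using w x by (intro bexI[of _ w] bexI[of _ "w x"]) auto
  fix y assume "\<exists>u\<in>W. \<exists>v\<in>Cb. x = inv u v \<and> y = QW u f v"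
  then obtain u v where u: "u \<in> W" "v \<in> Cb" "x = inv u v" "y = QW u f v" by blast
  show "y = QW w f (w x)" unfolding u(4) by (rule T_well_defined[OF f u(1) w u(2) x]) (use u(3) w in simp)
qed

lemma T_add: "f \<in> EV \<Longrightarrow> g \<in> EV \<Longrightarrow> T (\<lambda>x. f x + g x) = (\<lambda>x. T f x + T g x)"
  and T_scale: "f \<in> EV \<Longrightarrow> T (\<lambda>x. c * f x) = (\<lambda>x. c * T f x)"
proof -
  assume f: "f \<in> EV"
  show "T (\<lambda>x. c * f x) = (\<lambda>x. c * T f x)"
  proof
    fix x
    obtain w where w: "w \<in> W" "w x \<in> Cb" using to_chamber by blast
    show "T (\<lambda>x. c * f x) x = c * T f x"
      by (simp only: T_eval[OF EV_scale[OF f] w] T_eval[OF f w] QW_lin(2)[OF w(1) f f])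
  qed
  assume g: "g \<in> EV"
  show "T (\<lambda>x. f x + g x) = (\<lambda>x. T f x + T g x)"
  proof
    fix x
    obtain w where w: "w \<in> W" "w x \<in> Cb" using to_chamber by blast
    show "T (\<lambda>x. f x + g x) x = T f x + T g x"
      by (simp only: T_eval[OF EV_add[OF f g] w] T_eval[OF f w] T_eval[OF g w] QW_lin(1)[OF w(1) f g])
  qed
qed

lemma T_QW: assumes f: "f \<in> EV" and u: "u \<in> W" shows "T (QW u f) x = T f (inv u x)"
proof -
  obtain w where w: "w \<in> W" "w x \<in> Cb" using to_chamber by blast
  have "(w \<circ> u) (inv u x) = w x" using u by simp
  then have "T f (inv u x) = QW (w \<circ> u) f (w x)" using T_eval[OF f W_comp[OF w(1) u], of "inv u x"] w by (simp only:)
  then show ?thesis by (simp only: T_eval[OF QW_EV[OF u f] w] QW_comp[OF w(1) u f])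
qed

text \<open>On \<open>C\<close> the function T f is f itself, and a solution is determined by its
  values on an open set.\<close>

lemma T_inj: assumes f: "f \<in> EV" and g: "g \<in> EV" and eq: "\<And>x. x \<in> C \<Longrightarrow> T f x = T g x" shows "f = g"
proof -
  obtain y where y: "y \<in> C" using C_nonempty by blast
  have T: "T h x = h x" if "h \<in> EV" "x \<in> C" for h x
    using T_eval[OF that(1) W_id, of x] that(2) C_Cb QW_id[OF that(1)] by auto
  show ?thesis
    by (rule sol_eq_on_open[OF f g open_C y]) (use eq T f g in metis)
qed

section \<open>Derivatives of propagated functions and Dunkl operators\<close>

lemma k_act: "w \<in> W \<Longrightarrow> a \<in> Sig \<Longrightarrow> k (act w a) = k a"
  using mf act_Sig[of w a] unfolding multiplicity_function_def by (metis aeval_act_inv)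

lemma k_uminus: assumes "a \<in> Sig" shows "k (- a) = k a"
  using k_act[OF W_arefl[OF assms] assms] act_self[OF assms] by simp

lemma lin_arefl_comp: assumes "w \<in> W" shows "lin (arefl s \<circ> w) v = refl (fst s) (lin w v)"
  by (simp add: lin_def arefl_def refl_def aeval_def algebra_simps)

lemma Q_sum:
  assumes "s \<in> Sig" "\<And>i. i \<in> I \<Longrightarrow> f i \<in> EV"
  shows "Q s (\<lambda>x. \<Sum>i\<in>I. c i * f i x) = (\<lambda>x. \<Sum>i\<in>I. c i * Q s (f i) x)"
  using assms(2)
proof (induction I rule: infinite_finite_induct)
  case (insert i I)
  have e: "(\<lambda>x. c i * f i x) \<in> EV" "(\<lambda>x. \<Sum>i\<in>I. c i * f i x) \<in> EV"
    using insert.prems by (auto intro!: EV_scale EV_sum)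
  show ?case
    using insert by (simp add: Q_add[OF EV_smooth[OF e(1)] EV_smooth[OF e(2)] assms(1)] Q_scale[OF EV_smooth assms(1)])
qed (use Q_scale[OF smooth_on_const assms(1), of 0 0] in simp_all)

lemma QW_dir_deriv:
  assumes ws: "set ws \<subseteq> S" and f: "f \<in> EV"
  shows "QW (wmap ws) (dir_deriv v f) x = dir_deriv (lin (wmap ws) v) (QW (wmap ws) f) x +
    (\<Sum>a\<in>Inv (wmap ws). complex_of_real (k a * (fst a \<bullet> v)) * QW (wmap ws \<circ> arefl a) f x)"
  using ws
proof (induction ws arbitrary: x)
  case Nil
  have l: "lin (wmap []) v = v" by (simp add: lin_def)
  show ?case
    unfolding l unfolding wmap_simps(1) Inv_id QW_id[OF EV_dir_deriv[OF f]] QW_id[OF f] by simp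
next
  case (Cons s ws)
  have s: "s \<in> S" "s \<in> Sig" and ws: "set ws \<subseteq> S" using Cons.prems S_Sig by auto
  define w where "w = wmap ws"
  have w: "w \<in> W" unfolding w_def by (rule wmap_W[OF ws])
  define g where "g = QW w f"
  have g: "g \<in> EV" unfolding g_def by (rule QW_EV[OF w f])
  note sW = W_arefl[OF s(2)]
  have swW: "arefl s \<circ> w \<in> W" by (rule W_comp[OF sW w])
  have Inv_Sig: "a \<in> Sig" if "a \<in> Inv w" for a using that Pos_Sig by (auto simp: Inv_def)
  define h where "h a = QW (w \<circ> arefl a) f" for a
  have h: "h a \<in> EV" if "a \<in> Sig" for a unfolding h_def by (intro QW_EV W_comp w W_arefl that f)
  have sh: "Q s (h a) = QW ((arefl s \<circ> w) \<circ> arefl a) f" if "a \<in> Sig" for a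
  proof -
    have "QW (arefl s \<circ> (w \<circ> arefl a)) f = QW (arefl s) (QW (w \<circ> arefl a) f)" by (rule QW_comp[OF sW W_comp[OF w W_arefl[OF that]] f])
    also have "\<dots> = Q s (h a)" unfolding h_def by (rule QW_arefl[OF s(1) h[OF that, unfolded h_def]])
    finally show ?thesis by (simp only: o_assoc)
  qed
  define \<kappa> where "\<kappa> a = complex_of_real (k a * (fst a \<bullet> v))" for a
  \<comment> \<open>The inversion sets of w and s w differ exactly by c or -c. Since s w s_c = w,
    the scalar multiple of g that arises when s passes the derivative is the summand belonging to
    c.\<close>
  define c where "c = act (inv w) s"
  have cS: "c \<in> Sig" unfolding c_def by (rule act_Sig[OF W_inv[OF w] s(2)])
  have wc: "act w c = s" unfolding c_def by (rule act_inv(1)[OF w])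
  have swc: "(arefl s \<circ> w) \<circ> arefl c = w"
  proof
    fix z
    have "w (arefl c z) = arefl s (w z)" using arefl_act[OF w cS, of z] wc by simp
    then show "((arefl s \<circ> w) \<circ> arefl c) z = w z" using S_nz[OF s(1)] by simp
  qed
  have kc: "complex_of_real (k s * (fst s \<bullet> lin w v)) = \<kappa> c"
  proof -
    have "fst s = lin w (fst c)" using wc by (auto simp: act_def)
    then have "fst s \<bullet> lin w v = fst c \<bullet> v" using weyl_inner[OF lin(1)[OF w]] by simp
    moreover have "k s = k c" using k_act[OF w cS] wc by simp
    ultimately show ?thesis by (simp add: \<kappa>_def)
  qed
  have IH: "QW w (dir_deriv v f) = (\<lambda>x. dir_deriv (lin w v) g x + (\<Sum>a\<in>Inv w. \<kappa> a * h a x))"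
    using Cons.IH[OF ws] unfolding w_def g_def h_def \<kappa>_def by blast
  have sumEV: "(\<lambda>x. \<Sum>a\<in>Inv w. \<kappa> a * h a x) \<in> EV" by (intro EV_sum EV_scale h Inv_Sig)
  have "QW (arefl s \<circ> w) (dir_deriv v f) = Q s (QW w (dir_deriv v f))"
    by (simp only: QW_comp[OF sW w EV_dir_deriv[OF f]] QW_arefl[OF s(1) QW_EV[OF w EV_dir_deriv[OF f]]])
  also have "\<dots> = (\<lambda>x. Q s (dir_deriv (lin w v) g) x + (\<Sum>a\<in>Inv w. \<kappa> a * Q s (h a) x))"
    unfolding IH Q_add[OF EV_smooth[OF EV_dir_deriv[OF g]] EV_smooth[OF sumEV] s(2)]
    by (simp only: Q_sum[OF s(2) h[OF Inv_Sig]])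
  finally have 1: "QW (arefl s \<circ> w) (dir_deriv v f) x = Q s (dir_deriv (lin w v) g) x + (\<Sum>a\<in>Inv w. \<kappa> a * Q s (h a) x)" by simp
  have 2: "Q s (dir_deriv (lin w v) g) x = dir_deriv (refl (fst s) (lin w v)) (Q s g) x + \<kappa> c * g x"
  proof -
    have "fst s \<bullet> refl (fst s) (lin w v) = - (fst s \<bullet> lin w v)" using S_nz[OF s(1)] by (simp add: refl_def inner_diff_right coroot_inner)
    then have "dir_deriv (refl (fst s) (lin w v)) (Q s g) x = Q s (dir_deriv (lin w v) g) x - complex_of_real (k s * (fst s \<bullet> lin w v)) * g x"
      unfolding Q_dir_deriv[OF EV_smooth[OF g] s(2)] refl_refl by simp
    then show ?thesis unfolding kc by simp
  qed
  have 3: "Q s g = QW (arefl s \<circ> w) f" unfolding g_def by (simp only: QW_comp[OF sW w f] QW_arefl[OF s(1) QW_EV[OF w f]])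
  have 4: "(\<Sum>a\<in>Inv w. \<kappa> a * Q s (h a) x) + \<kappa> c * g x = (\<Sum>a\<in>Inv (arefl s \<circ> w). \<kappa> a * QW ((arefl s \<circ> w) \<circ> arefl a) f x)"
  proof -
    have e: "(\<Sum>a\<in>Inv w. \<kappa> a * Q s (h a) x) = (\<Sum>a\<in>Inv w. \<kappa> a * QW ((arefl s \<circ> w) \<circ> arefl a) f x)"
      by (rule sum.cong[OF refl]) (simp only: sh[OF Inv_Sig])
    have gc: "g x = QW ((arefl s \<circ> w) \<circ> arefl c) f x" unfolding swc g_def ..
    show ?thesis
    proof (cases "c \<in> Pos")
      case True
      then have I: "Inv (arefl s \<circ> w) = insert c (Inv w)" "c \<notin> Inv w" using Inv_arefl(1)[OF s(1) w] unfolding c_def by auto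
      show ?thesis unfolding I(1) sum.insert[OF finite_Inv[OF w] I(2)] e gc by (rule add.commute)
    next
      case False
      then have I: "Inv (arefl s \<circ> w) = Inv w - {- c}" "- c \<in> Inv w" using Inv_arefl(2)[OF s(1) w] unfolding c_def by auto
      \<comment> \<open>Here -c is an inversion of w and not of s w; its summand is cancelled
        because the coefficient is odd in the root while the reflection is even.\<close>
      have "\<kappa> (- c) = - \<kappa> c" by (simp add: \<kappa>_def k_uminus[OF cS])
      then have "\<kappa> (- c) * QW ((arefl s \<circ> w) \<circ> arefl (- c)) f x = - (\<kappa> c * g x)"
        unfolding arefl_uminus gc by simp
      then show ?thesis unfolding I(1) e sum.remove[OF finite_Inv[OF w] I(2)] by simp
    qed
  qed
  show ?case
    unfolding wmap_simps w_def[symmetric] lin_arefl_comp[OF w] \<kappa>_def[symmetric] 1 2 3 4[symmetric] by (simp only: ac_simps)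
qed

lemma reg_restrict_cut: "reg_restrict R B \<phi> f = cut reg f"
  by (simp add: reg_restrict_def cut_def)

lemma T_local: assumes f: "f \<in> EV" and w: "w \<in> W" and x: "w x \<in> C" shows "T f x = QW w f (w x)"
  using T_eval[OF f w] x C_Cb by blast

lemma open_preC: "w \<in> W \<Longrightarrow> open (w -` C)"
  by (rule open_vimage[OF open_C W_continuous])

text \<open>Stated for any g that agrees with T f on the regular set, because
  \<open>dunkl_op\<close> is applied to an extension by zero.\<close>

lemma dir_deriv_T:
  assumes f: "f \<in> EV" and w: "w \<in> W" and x: "w x \<in> C" and g: "\<And>y. y \<in> reg \<Longrightarrow> g y = T f y"
  shows "dir_deriv v g x = dir_deriv (lin w v) (QW w f) (w x)"
proof -
  have "g y = QW w f (w y)" if "y \<in> w -` C" for y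
    using g[of y] T_local[OF f w, of y] that C_reg reg_W[OF w, of y] by auto
  then have "dir_deriv v g x = dir_deriv v (\<lambda>y. QW w f (w y)) x"
    by (intro dir_deriv_cong_open[OF open_preC[OF w]]) (use x in auto)
  also have "\<dots> = dir_deriv (lin w v) (QW w f) (w x)" by (rule dir_deriv_W[OF EV_smooth[OF QW_EV[OF w f]] w])
  finally show ?thesis .
qed

lemma dunkl_T: assumes f: "f \<in> EV" shows "dunkl_op R B \<phi> k v (cut reg (T f)) = cut reg (T (dir_deriv v f))"
proof
  fix x
  show "dunkl_op R B \<phi> k v (cut reg (T f)) x = cut reg (T (dir_deriv v f)) x"
  proof (cases "x \<in> reg")
    case False
    then show ?thesis by (simp add: dunkl_op_def reg_restrict_def cut_def)
  next
    case True
    obtain w where w: "w \<in> W" "w x \<in> Cb" using to_chamber by blast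
    have wC: "w x \<in> C" using Cb_reg[OF w(2)] reg_W[OF w(1)] True by blast
    \<comment> \<open>The positive roots with \<chi> = 1 at x are the inversions of the element w
      that carries x into \<open>C\<close>; this matches the Dunkl sum with
      \<open>QW_dir_deriv\<close>.\<close>
    have neg: "aeval a x < 0 \<longleftrightarrow> - act w a \<in> Pos" if "a \<in> Pos" for a
    proof -
      have "aeval a x = aeval (act w a) (w x)" by (simp add: aeval_act[OF w(1)])
      then show ?thesis using Pos_pos[OF _ wC, of "act w a"] Pos_pos[OF _ wC, of "- act w a"]
          Pos_cases[OF act_Sig[OF w(1) Pos_Sig[OF that]]] by (auto simp: aeval_uminus)
    qed
    have I: "{a \<in> Pos. chi a x \<noteq> 0} = Inv w" using neg by (auto simp: chi_def Inv_def)
    have "(\<Sum>a\<in>Inv w. complex_of_real (k a * (fst a \<bullet> v)) * chi a x * weyl_act (arefl a) (cut reg (T f)) x) =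
       (\<Sum>a\<in>Inv w. complex_of_real (k a * (fst a \<bullet> v)) * QW (w \<circ> arefl a) f (w x))"
    proof (rule sum.cong[OF refl])
      fix a assume a: "a \<in> Inv w"
      have aS: "a \<in> Sig" using a Pos_Sig by (auto simp: Inv_def)
      have "chi a x = 1" using a neg[of a] by (auto simp: Inv_def chi_def)
      moreover have "weyl_act (arefl a) (cut reg (T f)) x = T f (arefl a x)"
        using True reg_W[OF W_arefl[OF aS], of x] by (simp add: weyl_act_def inv_arefl[OF aS] cut_def)
      moreover have "T f (arefl a x) = QW (w \<circ> arefl a) f (w x)"
        using T_local[OF f W_comp[OF w(1) W_arefl[OF aS]], of "arefl a x"] wC arefl_arefl[of a x] Sig_fst[OF aS] by simp
      ultimately show "complex_of_real (k a * (fst a \<bullet> v)) * chi a x * weyl_act (arefl a) (cut reg (T f)) x =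
          complex_of_real (k a * (fst a \<bullet> v)) * QW (w \<circ> arefl a) f (w x)" by (simp only: mult_1_right)
    qed
    moreover have "dir_deriv v (cut reg (T f)) x = dir_deriv (lin w v) (QW w f) (w x)"
      by (rule dir_deriv_T[OF f w(1) wC]) (simp add: cut_def)
    moreover have "T (dir_deriv v f) x = QW w (dir_deriv v f) (w x)" by (rule T_local[OF EV_dir_deriv[OF f] w(1) wC])
    moreover obtain ws where "set ws \<subseteq> S" "w = wmap ws" using W_word[OF w(1)] by blast
    ultimately show ?thesis
      using QW_dir_deriv[of ws f v "w x"] f True by (simp only: dunkl_op_def reg_restrict_def cut_def[of reg "T (dir_deriv v f)"] if_True I)
  qed
qed

lemma subst_dunkl_T: assumes f: "f \<in> EV" shows "sym_subst (dunkl_op R B \<phi> k) p (cut reg (T f)) = cut reg (T (pd p f))"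
proof -
  have pw: "((dunkl_op R B \<phi> k b ^^ n) (cut reg (T g)) = cut reg (T ((dir_deriv b ^^ n) g))) \<and> (dir_deriv b ^^ n) g \<in> EV"
    if "g \<in> EV" for b n g
    using that by (induction n) (simp_all add: dunkl_T EV_dir_deriv)
  have fold: "foldr (\<lambda>b g. (dunkl_op R B \<phi> k b ^^ Poly_Mapping.lookup m b) g) xs (cut reg (T f)) =
       cut reg (T (foldr (\<lambda>b g. (dir_deriv b ^^ Poly_Mapping.lookup m b) g) xs f)) \<and>
       foldr (\<lambda>b g. (dir_deriv b ^^ Poly_Mapping.lookup m b) g) xs f \<in> EV" for m and xs :: "'a list"
    by (induction xs) (use pw f in auto)
  define M where "M m = foldr (\<lambda>b g. (dir_deriv b ^^ Poly_Mapping.lookup m b) g) basis_list f" for m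
  have M: "M m \<in> EV" for m unfolding M_def using fold by blast
  have sumT: "T (\<lambda>x. \<Sum>m\<in>K. c m * M m x) = (\<lambda>x. \<Sum>m\<in>K. c m * T (M m) x)" for K c
  proof (induction K rule: infinite_finite_induct)
    case (insert m K)
    have "(\<lambda>x. \<Sum>m\<in>K. c m * M m x) \<in> EV" by (intro EV_sum EV_scale M)
    then show ?case using insert by (simp add: T_add[OF EV_scale[OF M]] T_scale[OF M])
  qed (use T_scale[OF EV_zero, of 0] in simp_all)
  have "pd p f = (\<lambda>x. \<Sum>m\<in>Poly_Mapping.keys p. Poly_Mapping.lookup p m * M m x)"
    by (simp add: sym_subst_def M_def)
  then have "T (pd p f) = (\<lambda>x. \<Sum>m\<in>Poly_Mapping.keys p. Poly_Mapping.lookup p m * T (M m) x)" by (simp only: sumT)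
  then show ?thesis
    using fold[of _ basis_list] by (auto simp: sym_subst_def M_def[symmetric] fun_eq_iff cut_def intro!: sum.neutral)
qed

lemma weyl_act_T: assumes f: "f \<in> EV" and w: "w \<in> W" shows "weyl_act w (cut reg (T f)) = cut reg (T (QW w f))"
  by (rule ext) (simp add: weyl_act_def cut_def reg_W[OF W_inv[OF w]] T_QW[OF f w])

lemma pi_T: assumes f: "f \<in> EV" and h: "h \<in> HC" shows "pi_rep R B \<phi> k h (cut reg (T f)) = cut reg (T (QR h f))"
proof -
  have w: "w \<in> W" if "w \<in> Poly_Mapping.keys h" for w using HC_keys[OF h] that by blast
  have sumT: "T (\<lambda>x. \<Sum>i\<in>I. g i x) = (\<lambda>x. \<Sum>i\<in>I. T (g i) x)" if "\<And>i. i \<in> I \<Longrightarrow> g i \<in> EV"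
    for I and g :: "('a \<Rightarrow> 'a) \<Rightarrow> 'a \<Rightarrow> complex"
    using that
  proof (induction I rule: infinite_finite_induct)
    case (insert m K)
    then have "(\<lambda>x. \<Sum>i\<in>K. g i x) \<in> EV" "g m \<in> EV" by (auto intro!: EV_sum)
    then show ?case using insert by (simp add: T_add)
  qed (use T_scale[OF EV_zero, of 0] in simp_all)
  have "pi_rep R B \<phi> k h (cut reg (T f)) = (\<lambda>x. \<Sum>w\<in>Poly_Mapping.keys h. cut reg (T (pd (Poly_Mapping.lookup h w) (QW w f))) x)"
    unfolding pi_rep_def
    by (rule ext, rule sum.cong) (simp_all only: weyl_act_T[OF f w] subst_dunkl_T[OF QW_EV[OF w f]])
  also have "\<dots> = cut reg (\<lambda>x. \<Sum>w\<in>Poly_Mapping.keys h. T (pd (Poly_Mapping.lookup h w) (QW w f)) x)"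
    by (auto simp: cut_def fun_eq_iff)
  also have "\<dots> = cut reg (T (QR h f))"
    unfolding Q_rep_def by (subst sumT) (auto intro!: EV_pd QW_EV w f)
  finally show ?thesis .
qed

end

section \<open>Integration by parts\<close>

lemma Ck_on_local: "(\<And>x. x \<in> U \<Longrightarrow> \<exists>V. open V \<and> x \<in> V \<and> Ck_on n V f) \<Longrightarrow> Ck_on n U f"
proof (induction n arbitrary: f)
  case 0
  have "isCont f x" if x: "x \<in> U" for x
  proof -
    obtain V where "open V" "x \<in> V" "continuous_on V f" using 0[OF x] by auto
    then show ?thesis by (simp add: continuous_on_eq_continuous_at)
  qed
  then show ?case by (simp add: continuous_at_imp_continuous_on)
next
  case (Suc n)
  have "f differentiable (at x)" if x: "x \<in> U" for x using Suc.prems[OF x] by auto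
  moreover have "Ck_on n U (dir_deriv v f)" for v
  proof (rule Suc.IH)
    fix x assume "x \<in> U"
    from Suc.prems[OF this] obtain V where V: "open V" "x \<in> V" "Ck_on (Suc n) V f" by blast
    then show "\<exists>V. open V \<and> x \<in> V \<and> Ck_on n V (dir_deriv v f)" by auto
  qed
  ultimately show ?case by simp
qed

lemma smooth_on_local:
  assumes "\<And>x. x \<in> U \<Longrightarrow> \<exists>V. open V \<and> x \<in> V \<and> smooth_on V f" shows "smooth_on U f"
  unfolding smooth_on_def using Ck_on_local assms smooth_onD(4) by metis

lemma sol_local:
  assumes "\<And>x. x \<in> U \<Longrightarrow> \<exists>V. open V \<and> x \<in> V \<and> f \<in> sol R lam V" shows "f \<in> sol R lam U"
proof (rule solI)
  show "smooth_on U f" by (rule smooth_on_local) (use assms solD(1) in metis)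
  show "\<And>p x. p \<in> sym_algebra \<Longrightarrow> sym_invariant R p \<Longrightarrow> x \<in> U \<Longrightarrow> pd p f x = sym_eval lam p * f x"
    using assms solD(2) by metis
qed

lemma lborel_integral_cbox:
  fixes g :: "'a::euclidean_space \<Rightarrow> complex"
  assumes g: "continuous_on (cbox a b) g" and z: "\<And>x. x \<notin> cbox a b \<Longrightarrow> g x = 0"
  shows "integrable lborel g" "(LINT x|lborel. g x) = integral (cbox a b) g"
proof -
  have e: "(\<lambda>x. indicator (cbox a b) x *\<^sub>R g x) = g" using z by (auto simp: indicator_def fun_eq_iff)
  have i: "set_integrable lborel (cbox a b) g"
    unfolding set_integrable_def by (rule borel_integrable_compact[OF compact_cbox g])
  then show "integrable lborel g" unfolding set_integrable_def e .
  show "(LINT x|lborel. g x) = integral (cbox a b) g"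
    using set_borel_integral_eq_integral(2)[OF i] unfolding set_lebesgue_integral_def e .
qed

lemma lborel_integral_translate:
  fixes h :: "'a::euclidean_space \<Rightarrow> complex"
  assumes "h \<in> borel_measurable borel"
  shows "(LINT x|lborel. h (x + c)) = (LINT x|lborel. h x)"
proof -
  have "(LINT x|lborel. h x) = (LINT x|distr lborel borel ((+) c). h x)" by (simp only: lborel_distr_plus)
  also have "\<dots> = (LINT x|lborel. h (c + x))" by (rule integral_distr) (use assms in simp_all)
  finally show ?thesis by (simp add: add.commute)
qed

text \<open>By translation invariance the integral of h(x + t v) is constant in t, and its
  derivative at t = 0 is the integral in question.\<close>

lemma integral_dir_deriv_zero:
  fixes h :: "'a::euclidean_space \<Rightarrow> complex"
  assumes h: "smooth_on UNIV h" and K: "compact K" and z: "\<And>x. x \<notin> K \<Longrightarrow> h x = 0"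
  shows "(LINT x|lborel. dir_deriv v h x) = 0"
proof -
  obtain M where M: "\<And>x. x \<in> K \<Longrightarrow> norm x \<le> M" using compact_imp_bounded[OF K] by (auto simp: bounded_iff)
  \<comment> \<open>The box contains the supports of all translates with |t| <= 1, so the domain of
    integration does not depend on t near 0.\<close>
  obtain a :: 'a where a: "cball 0 (M + norm v) \<subseteq> cbox (- a) a" using bounded_subset_cbox_symmetric[OF bounded_cball] by blast
  have ch: "continuous_on A h" for A using smooth_onD(3)[OF h] continuous_on_subset by blast
  have cd: "continuous_on A (dir_deriv v h)" for A using smooth_onD(3)[OF smooth_onD(2)[OF h]] continuous_on_subset by blast
  have z': "h (x + t *\<^sub>R v) = 0" if x: "x \<notin> cbox (- a) a" and t: "\<bar>t\<bar> \<le> 1" for x :: 'a and t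
  proof (rule z, rule notI)
    assume "x + t *\<^sub>R v \<in> K"
    then have "norm (x + t *\<^sub>R v) \<le> M" by (rule M)
    moreover have "norm x \<le> norm (x + t *\<^sub>R v) + norm (t *\<^sub>R v)" using norm_triangle_ineq4[of "x + t *\<^sub>R v" "t *\<^sub>R v"] by simp
    moreover have "norm (t *\<^sub>R v) \<le> norm v" using t by (simp add: mult_left_le_one_le)
    ultimately have "norm x \<le> M + norm v" by linarith
    then show False using a x by auto
  qed
  have dz: "dir_deriv v h x = 0" if x: "x \<notin> cbox (- a) a" for x
  proof -
    have "dir_deriv v h x = dir_deriv v (\<lambda>x. 0) x"
      by (rule dir_deriv_cong_open[of "- cbox (- a) a"]) (use x z'[of _ 0] in \<open>auto simp: open_Compl closed_cbox\<close>)
    then show ?thesis by simp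
  qed
  define \<Phi> where "\<Phi> t = integral (cbox (- a) a) (\<lambda>x. h (x + t *\<^sub>R v))" for t :: real
  have "(\<Phi> has_vector_derivative integral (cbox (- a) a) (\<lambda>x. dir_deriv v h (x + 0 *\<^sub>R v))) (at 0 within UNIV)"
    unfolding \<Phi>_def[abs_def]
  proof (rule leibniz_rule_vector_derivative)
    show "((\<lambda>t. h (x + t *\<^sub>R v)) has_vector_derivative dir_deriv v h (x + t *\<^sub>R v)) (at t within UNIV)" for t x
      using has_vector_derivative_dir_deriv[where x=x and t=t and v=v, OF smooth_onD(1)[OF h UNIV_I]] by simp
    show "(\<lambda>x. h (x + t *\<^sub>R v)) integrable_on cbox (- a) a" for t
      by (intro integrable_continuous continuous_on_compose2[OF ch[of UNIV]] continuous_intros) simp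
    show "continuous_on (UNIV \<times> cbox (- a) a) (\<lambda>(t, x). dir_deriv v h (x + t *\<^sub>R v))"
      unfolding case_prod_beta by (intro continuous_on_compose2[OF cd[of UNIV]] continuous_intros) simp
  qed simp_all
  then have D: "(\<Phi> has_vector_derivative (LINT x|lborel. dir_deriv v h x)) (at 0)"
    using lborel_integral_cbox(2)[OF cd dz] by simp
  have \<Phi>: "\<Phi> t = (LINT x|lborel. h x)" if "\<bar>t\<bar> \<le> 1" for t
  proof -
    have "continuous_on (cbox (- a) a) (\<lambda>x. h (x + t *\<^sub>R v))"
      by (intro continuous_on_compose2[OF ch[of UNIV]] continuous_intros) simp
    then have "(LINT x|lborel. h (x + t *\<^sub>R v)) = \<Phi> t"
      unfolding \<Phi>_def by (rule lborel_integral_cbox(2)) (rule z'[OF _ that])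
    then show ?thesis using lborel_integral_translate[OF borel_measurable_continuous_onI[OF ch]] by simp
  qed
  have "(\<Phi> has_vector_derivative 0) (at 0)"
    by (rule has_vector_derivative_transform_within_open[OF has_vector_derivative_const, of "{-1<..<1}"]) (use \<Phi> in auto)
  then show ?thesis using D vector_derivative_unique_at by blast
qed

lemma test_function_csub: "csubspace_fun {\<psi>. test_function U \<psi>}"
  unfolding csubspace_fun_def
proof (intro conjI ballI allI)
  show "(\<lambda>x. 0) \<in> {\<psi>. test_function U \<psi>}" by (auto simp: test_function_def)
  fix f assume f: "f \<in> {\<psi>. test_function U \<psi>}"
  then obtain K where K: "compact K" "K \<subseteq> U" "\<And>x. x \<notin> K \<Longrightarrow> f x = 0" by (auto simp: test_function_def)
  show "\<And>c. (\<lambda>x. c * f x) \<in> {\<psi>. test_function U \<psi>}" using f by (auto simp: test_function_def intro: smooth_on_cmult)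
  fix g assume g: "g \<in> {\<psi>. test_function U \<psi>}"
  then obtain K' where K': "compact K'" "K' \<subseteq> U" "\<And>x. x \<notin> K' \<Longrightarrow> g x = 0" by (auto simp: test_function_def)
  have "\<exists>K. compact K \<and> K \<subseteq> U \<and> (\<forall>x. x \<notin> K \<longrightarrow> f x + g x = 0)"
    by (rule exI[of _ "K \<union> K'"]) (use K K' compact_Un in auto)
  then show "(\<lambda>x. f x + g x) \<in> {\<psi>. test_function U \<psi>}" using f g by (simp add: test_function_def smooth_on_add)
qed

abbreviation "npd \<equiv> sym_subst (\<lambda>v g y. - dir_deriv v g y)"

lemma test_function_dir_deriv:
  assumes "test_function U \<psi>" shows "test_function U (\<lambda>x. - dir_deriv v \<psi> x)"
proof -
  obtain K where K: "compact K" "K \<subseteq> U" "\<And>x. x \<notin> K \<Longrightarrow> \<psi> x = 0" and s: "smooth_on UNIV \<psi>"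
    using assms by (auto simp: test_function_def)
  have "- dir_deriv v \<psi> x = 0" if "x \<notin> K" for x
    using dir_deriv_cong_open[of "- K" x \<psi> "\<lambda>x. 0" v] K that by (auto simp: open_Compl compact_imp_closed)
  then show ?thesis unfolding test_function_def using K smooth_on_uminus[OF open_UNIV smooth_onD(2)[OF s]] by blast
qed

lemma comm_ops_test: "comm_ops {\<psi>. test_function U \<psi>} (\<lambda>v g y. - dir_deriv v g y)"
proof
  have s: "smooth_on UNIV f" if "f \<in> {\<psi>. test_function U \<psi>}" for f using that by (simp add: test_function_def)
  show "csubspace_fun {\<psi>. test_function U \<psi>}" by (rule test_function_csub)
  show "\<And>b f. f \<in> {\<psi>. test_function U \<psi>} \<Longrightarrow> (\<lambda>y. - dir_deriv b f y) \<in> {\<psi>. test_function U \<psi>}"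
    by (simp add: test_function_dir_deriv)
  show "clinear_fun_on {\<psi>. test_function U \<psi>} (\<lambda>g y. - dir_deriv b g y)" for b
    unfolding clinear_fun_on_def using smooth_onD(1)[OF s UNIV_I] by (auto simp: fun_eq_iff dir_deriv_add dir_deriv_cmult)
  fix b c f assume f: "f \<in> {\<psi>. test_function U \<psi>}"
  have "dir_deriv v (\<lambda>y. - dir_deriv u f y) y = - dir_deriv v (dir_deriv u f) y" for u v y
    using dir_deriv_cmult[OF smooth_onD(1)[OF smooth_onD(2)[OF s[OF f]] UNIV_I], of v "-1" u y] by simp
  then show "(\<lambda>y. - dir_deriv b (\<lambda>y. - dir_deriv c f y) y) = (\<lambda>y. - dir_deriv c (\<lambda>y. - dir_deriv b f y) y)"
    using dir_deriv_commute[OF open_UNIV smooth_onD(4)[OF s[OF f]] UNIV_I] by simp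
qed

lemma test_integrable:
  assumes F: "continuous_on U F" and \<psi>: "test_function U \<psi>"
  shows "set_integrable lborel U (\<lambda>x. F x * \<psi> x)"
proof -
  obtain K where K: "compact K" "K \<subseteq> U" "\<And>x. x \<notin> K \<Longrightarrow> \<psi> x = 0" and s: "smooth_on UNIV \<psi>"
    using \<psi> by (auto simp: test_function_def)
  have "(\<lambda>x. indicator U x *\<^sub>R (F x * \<psi> x)) = (\<lambda>x. indicator K x *\<^sub>R (F x * \<psi> x))"
    using K by (auto simp: indicator_def fun_eq_iff)
  moreover have "continuous_on K (\<lambda>x. F x * \<psi> x)"
    using continuous_on_subset[OF F K(2)] continuous_on_subset[OF smooth_onD(3)[OF s], of K] by (intro continuous_intros) auto
  ultimately show ?thesis
    unfolding set_integrable_def using borel_integrable_compact[OF K(1)] by metis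
qed

lemma integration_by_parts_dir:
  assumes U: "open U" and F: "smooth_on U F" and \<psi>: "test_function U \<psi>"
  shows "(LINT x:U|lborel. F x * - dir_deriv v \<psi> x) = (LINT x:U|lborel. dir_deriv v F x * \<psi> x)"
proof -
  obtain K where K: "compact K" "K \<subseteq> U" "\<And>x. x \<notin> K \<Longrightarrow> \<psi> x = 0" and s: "smooth_on UNIV \<psi>"
    using \<psi> by (auto simp: test_function_def)
  \<comment> \<open>F is smooth on U only; the product extends smoothly by zero because \<psi> has
    compact support in U.\<close>
  define h where "h = cut U (\<lambda>x. F x * \<psi> x)"
  have hz: "h x = 0" if "x \<notin> K" for x using that K by (simp add: h_def cut_def)
  have oK: "open (- K)" using K(1) by (simp add: open_Compl compact_imp_closed)
  have hU: "smooth_on U h"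
    using smooth_on_cong[OF U, of h "\<lambda>x. F x * \<psi> x"] smooth_on_mult[OF U F smooth_on_subset[OF s subset_UNIV]]
    by (simp add: h_def cut_def)
  have hK: "smooth_on (- K) h" using smooth_on_cong[OF oK, of h "\<lambda>x. 0"] hz by simp
  have h: "smooth_on UNIV h"
    by (rule smooth_on_local) (use hU hK U oK K(2) in blast)
  have d: "dir_deriv v h x = indicator U x *\<^sub>R (F x * dir_deriv v \<psi> x) + indicator U x *\<^sub>R (dir_deriv v F x * \<psi> x)" for x
  proof (cases "x \<in> U")
    case True
    have "dir_deriv v h x = dir_deriv v (\<lambda>x. F x * \<psi> x) x"
      by (rule dir_deriv_cong_open[OF U True]) (simp add: h_def cut_def)
    then show ?thesis using True dir_deriv_mult[OF smooth_onD(1)[OF F True] smooth_onD(1)[OF s UNIV_I]] by simp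
  next
    case False
    have "dir_deriv v h x = dir_deriv v (\<lambda>x. 0) x"
      by (rule dir_deriv_cong_open[OF oK]) (use False K(2) hz in auto)
    then show ?thesis using False by simp
  qed
  have i: "set_integrable lborel U (\<lambda>x. F x * - dir_deriv v \<psi> x)" "set_integrable lborel U (\<lambda>x. dir_deriv v F x * \<psi> x)"
    by (intro test_integrable smooth_onD(3)[OF F] smooth_onD(3)[OF smooth_onD(2)[OF F]] test_function_dir_deriv \<psi>)+
  have i1: "set_integrable lborel U (\<lambda>x. F x * dir_deriv v \<psi> x)"
    using i(1) by (simp add: set_integrable_def)
  have "0 = (LINT x|lborel. dir_deriv v h x)" using integral_dir_deriv_zero[OF h K(1) hz] by simp
  also have "\<dots> = (LINT x:U|lborel. F x * dir_deriv v \<psi> x) + (LINT x:U|lborel. dir_deriv v F x * \<psi> x)"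
    unfolding d set_lebesgue_integral_def
    by (rule Bochner_Integration.integral_add) (use i1 i(2) in \<open>simp_all add: set_integrable_def\<close>)
  finally show ?thesis by (simp add: set_lebesgue_integral_def add_eq_0_iff)
qed

lemma integration_by_parts:
  assumes U: "open U" and F: "smooth_on U F" and \<psi>: "test_function U \<psi>" and p: "p \<in> sym_algebra"
  shows "(LINT x:U|lborel. F x * npd p \<psi> x) = (LINT x:U|lborel. pd p F x * \<psi> x)"
  using p F
proof (induction arbitrary: F rule: sym_algebra_induct)
  interpret comm_ops "{\<psi>. test_function U \<psi>}" "\<lambda>v g y. - dir_deriv v g y" by (rule comm_ops_test)
  have \<psi>': "\<psi> \<in> {\<psi>. test_function U \<psi>}" using \<psi> by simp
  {
    case (const c)
    show ?case by (simp add: subst_const pd_const mult_ac)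
  next
    case (vec v q)
    have t: "npd q \<psi> \<in> {\<psi>. test_function U \<psi>}" by (rule subst_closed[OF \<psi>'])
    then have t': "test_function U (npd q \<psi>)" "smooth_on UNIV (npd q \<psi>)" by (simp_all add: test_function_def)
    have "npd (sym_vec v * q) \<psi> x = - dir_deriv v (npd q \<psi>) x" for x
      unfolding subst_mult[OF \<psi>'] subst_vec dir_deriv_expand[OF smooth_onD(1)[OF t'(2) UNIV_I], of v]
      by (simp add: sum_negf)
    then have "(LINT x:U|lborel. F x * npd (sym_vec v * q) \<psi> x) = (LINT x:U|lborel. dir_deriv v F x * npd q \<psi> x)"
      using integration_by_parts_dir[OF U vec.prems t'(1), of v] by simp
    also have "\<dots> = (LINT x:U|lborel. pd q (dir_deriv v F) x * \<psi> x)" by (rule vec.IH[OF smooth_onD(2)[OF vec.prems]])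
    also have "\<dots> = (LINT x:U|lborel. pd (sym_vec v * q) F x * \<psi> x)"
    proof (rule set_lebesgue_integral_cong)
      show "U \<in> sets lborel" using U by simp
      show "\<forall>x. x \<in> U \<longrightarrow> pd q (dir_deriv v F) x * \<psi> x = pd (sym_vec v * q) F x * \<psi> x"
      proof (intro allI impI)
        fix x assume x: "x \<in> U"
        have "pd (sym_vec v * q) F x = pd q (pd (sym_vec v) F) x"
          unfolding mult.commute[of "sym_vec v"] by (rule pd_mult[OF U vec.prems x])
        also have "\<dots> = pd q (dir_deriv v F) x" by (rule pd_cong[OF U _ x]) (rule pd_vec[OF U vec.prems])
        finally show "pd q (dir_deriv v F) x * \<psi> x = pd (sym_vec v * q) F x * \<psi> x" by simp
      qed
    qed
    finally show ?case .
  next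
    case (add p q)
    have t: "test_function U (npd r \<psi>)" for r using subst_closed[OF \<psi>', of r] by simp
    have "(LINT x:U|lborel. F x * npd (p + q) \<psi> x) = (LINT x:U|lborel. F x * npd p \<psi> x) + (LINT x:U|lborel. F x * npd q \<psi> x)"
      unfolding subst_add distrib_left
      by (intro set_integral_add test_integrable smooth_onD(3)[OF add.prems] t)
    also have "\<dots> = (LINT x:U|lborel. pd p F x * \<psi> x) + (LINT x:U|lborel. pd q F x * \<psi> x)"
      using add by simp
    also have "\<dots> = (LINT x:U|lborel. pd (p + q) F x * \<psi> x)"
      unfolding pd_add distrib_right
      by (intro set_integral_add(2)[symmetric] test_integrable smooth_onD(3)[OF smooth_on_pd[OF U add.prems]] \<psi>)
    finally show ?case .
  }
qed

section \<open>Propagated eigenfunctions solve the boundary value problem\<close>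

context hecke_setup
begin

lemma T_sol: assumes f: "f \<in> EV" shows "T f \<in> sol R lam reg"
proof (rule sol_local)
  fix x assume x: "x \<in> reg"
  obtain w where w: "w \<in> W" "w x \<in> Cb" using to_chamber by blast
  then have wC: "w x \<in> C" using Cb_reg reg_W[OF w(1)] x by blast
  have "T f \<in> sol R lam (w -` C)"
    by (rule sol_cong[OF open_preC[OF w(1)] _ sol_subset[OF EV_W[OF QW_EV[OF w(1) f] w(1)] subset_UNIV]])
      (simp add: T_local[OF f w(1)])
  then show "\<exists>V. open V \<and> x \<in> V \<and> T f \<in> sol R lam V" using open_preC[OF w(1)] wC by blast
qed

lemma T_distributional:
  assumes f: "f \<in> EV" and p: "p \<in> sym_algebra" "sym_invariant R p"
  shows "distributional_eigen reg p (sym_eval lam p) (T f)"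
  unfolding distributional_eigen_def
proof (intro allI impI)
  fix \<psi> assume \<psi>: "test_function reg \<psi>"
  have "(LINT x:reg|lborel. T f x * npd p \<psi> x) = (LINT x:reg|lborel. pd p (T f) x * \<psi> x)"
    by (rule integration_by_parts[OF open_reg solD(1)[OF T_sol[OF f]] \<psi> p(1)])
  also have "\<dots> = (LINT x:reg|lborel. sym_eval lam p * (T f x * \<psi> x))"
    by (rule set_lebesgue_integral_cong) (use open_reg solD(2)[OF T_sol[OF f] p] in simp_all)
  finally show "(LINT x:reg|lborel. T f x * npd p \<psi> x) = sym_eval lam p * (LINT x:reg|lborel. T f x * \<psi> x)" by simp
qed

text \<open>Near x the values of T f come from finitely many continuous functions, one for each
  closed alcove through x, and all of these take the value T f x at x.\<close>

lemma T_continuous: assumes f: "f \<in> EV" shows "continuous_on UNIV (T f)"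
  unfolding continuous_on_def
proof
  fix x :: 'a
  define F where "F = {w \<in> W. w x \<in> Cb}"
  have F: "finite F" unfolding F_def by (rule finite_chambers)
  obtain r where r: "r > 0" "\<forall>y\<in>ball x r. \<forall>w\<in>W. w y \<in> Cb \<longrightarrow> w x \<in> Cb" using local_chambers by blast
  show "(T f \<longlongrightarrow> T f x) (at x within UNIV)"
  proof (rule tendstoI)
    fix e :: real assume e: "e > 0"
    have "\<forall>w\<in>F. \<forall>\<^sub>F y in at x. dist (QW w f (w y)) (T f x) < e"
    proof
      fix w assume w: "w \<in> F"
      then have wW: "w \<in> W" "w x \<in> Cb" by (auto simp: F_def)
      have "isCont (\<lambda>y. QW w f (w y)) x"
        using smooth_onD(3)[OF EV_smooth[OF EV_W[OF QW_EV[OF wW(1) f] wW(1)]]] by (simp add: continuous_on_eq_continuous_at)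
      then have "((\<lambda>y. QW w f (w y)) \<longlongrightarrow> T f x) (at x)" unfolding T_eval[OF f wW] isCont_def .
      then show "\<forall>\<^sub>F y in at x. dist (QW w f (w y)) (T f x) < e" using e by (rule tendstoD)
    qed
    then have "\<forall>\<^sub>F y in at x. \<forall>w\<in>F. dist (QW w f (w y)) (T f x) < e" using F by (simp add: eventually_ball_finite)
    moreover have "\<forall>\<^sub>F y in at x. y \<in> ball x r" using r(1) by (intro eventually_at_in_open') auto
    ultimately show "\<forall>\<^sub>F y in at x within UNIV. dist (T f y) (T f x) < e"
    proof eventually_elim
      case (elim y)
      obtain w where w: "w \<in> W" "w y \<in> Cb" using to_chamber by blast
      then have "w \<in> F" using elim(2) r(2) by (auto simp: F_def)
      then show ?case using elim(1) T_eval[OF f w] by simp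
    qed
  qed
qed

lemma T_CB1: assumes f: "f \<in> EV" shows "T f \<in> CB1 R B \<phi>"
  unfolding CB1_def
proof (intro CollectI conjI ballI)
  show "continuous_on UNIV (T f)" by (rule T_continuous[OF f])
  fix A assume "A \<in> alcoves R B \<phi>"
  then obtain w where w': "A = w ` C" "w \<in> W" unfolding alcoves_eq by (rule imageE)
  note w = w'(2,1)
  define g where "g x = QW (inv w) f (inv w x)" for x
  have g: "g \<in> EV" unfolding g_def[abs_def] by (rule EV_W[OF QW_EV[OF W_inv[OF w(1)] f] W_inv[OF w(1)]])
  have "g x = T f x" if "x \<in> A" for x
    unfolding g_def by (rule T_local[symmetric, OF f W_inv[OF w(1)]]) (use that w in auto)
  then show "\<exists>U g. open U \<and> closure A \<subseteq> U \<and> Ck_on 1 U g \<and> (\<forall>x\<in>A. g x = T f x)"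
    by (intro exI[of _ UNIV] exI[of _ g]) (use smooth_onD(4)[OF EV_smooth[OF g]] in auto)
qed

text \<open>A sub-regular point is moved into the closed alcove, where only one simple root
  vanishes. That root is the image of a up to sign, and one more reflection in it corrects the sign
  without moving the point.\<close>

lemma subregular_wall:
  assumes a: "a \<in> Pos" and v: "subregular R B \<phi> a v"
  obtains w s where "w \<in> W" "s \<in> S" "act w a = s" "aeval s (w v) = 0" "\<And>t. t \<in> S \<Longrightarrow> t \<noteq> s \<Longrightarrow> aeval t (w v) > 0"
proof -
  obtain u where u: "u \<in> W" "u v \<in> Cb" using to_chamber by blast
  have root: "act (inv u) t = a \<or> act (inv u) t = - a" if "t \<in> Sig" "aeval t (u v) = 0" for t
  proof -
    let ?b = "act (inv u) t"
    have b: "?b \<in> Sig" by (rule act_Sig[OF W_inv[OF u(1)] that(1)])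
    have "aeval ?b v = 0" using aeval_act_inv[OF W_inv[OF u(1)], of t v] that(2) u(1) by (simp add: inv_inv_eq W_bij)
    then show ?thesis using Pos_cases[OF b] v unfolding subregular_def
      by (metis aeval_uminus minus_minus neg_equal_0_iff_equal)
  qed
  have ua: "act u a \<in> Sig" "aeval (act u a) (u v) = 0"
    using act_Sig[OF u(1) Pos_Sig[OF a]] aeval_act[OF u(1)] v by (auto simp: subregular_def)
  obtain c where c: "c \<in> Pos" "c = act u a \<or> c = - act u a" using Pos_cases[OF ua(1)] by blast
  have c0: "aeval c (u v) = 0" using c(2) ua(2) by (auto simp: aeval_uminus)
  have "\<exists>s\<in>S. aeval s (u v) = 0"
  proof (rule ccontr)
    assume "\<not> (\<exists>s\<in>S. aeval s (u v) = 0)"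
    then have "u v \<in> C" using u(2) by (force simp: Cb_def fund_alcove_def)
    then show False using Pos_pos[OF c(1)] c0 by fastforce
  qed
  then obtain s where s: "s \<in> S" "aeval s (u v) = 0" by blast
  have sS: "s \<in> Sig" using s(1) S_Sig by blast
  have uniq: "t = s" if t: "t \<in> S" "aeval t (u v) = 0" for t
  proof -
    have tS: "t \<in> Sig" using t(1) S_Sig by blast
    have "act (inv u) t = act (inv u) s \<or> act (inv u) t = - act (inv u) s"
      using root[OF tS t(2)] root[OF sS s(2)] by auto
    then have "t = s \<or> t = - s" using act_uminus[OF W_inv[OF u(1)], of s] act_inv(1)[OF u(1)] by metis
    then show ?thesis using Pos_not_uminus S_Pos t(1) s(1) by blast
  qed
  have pos: "aeval t (u v) > 0" if "t \<in> S" "t \<noteq> s" for t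
  proof -
    have "aeval t (u v) \<ge> 0" using u(2) that(1) by (simp add: Cb_def)
    then show ?thesis using uniq[OF that(1)] that(2) by fastforce
  qed
  consider "act u a = s" | "act u a = - s"
    using root[OF sS s(2)] act_inv(1)[OF u(1)] act_uminus[OF u(1)] by (metis minus_minus)
  then show ?thesis
  proof cases
    case 1
    then show ?thesis using that[OF u(1) s(1)] s(2) pos by blast
  next
    case 2
    have "act (arefl s \<circ> u) a = s"
      using act_comp[OF W_arefl[OF sS] u(1), of a] 2 act_uminus[OF W_arefl[OF sS]] act_self[OF sS] by simp
    moreover have "(arefl s \<circ> u) v = u v" using s(2) by (simp add: arefl_def)
    ultimately show ?thesis using that[OF W_comp[OF W_arefl[OF sS] u(1)] s(1)] s(2) pos by metis
  qed
qed

lemma T_jump: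
  assumes f: "f \<in> EV" and a: "a \<in> Pos" and v: "subregular R B \<phi> a v"
  shows "jump_condition k a (T f) v"
proof -
  obtain w s where w: "w \<in> W" and s: "s \<in> S" and was: "act w a = s" and s0: "aeval s (w v) = 0"
    and pos: "\<And>t. t \<in> S \<Longrightarrow> t \<noteq> s \<Longrightarrow> aeval t (w v) > 0"
    using subregular_wall[OF a v] by metis
  have sS: "s \<in> Sig" using s S_Sig by blast
  have snz: "fst s \<noteq> 0" by (rule S_nz[OF s])
  define g where "g = QW w f"
  have g: "g \<in> EV" unfolding g_def by (rule QW_EV[OF w f])
  define d where "d = coroot (fst a)"
  define d' where "d' = coroot (fst s)"
  have wd: "lin w d = d'" unfolding d_def d'_def was[symmetric] act_def by (simp add: coroot_weyl[OF lin(1)[OF w]])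
  have ad: "inner (fst a) d = 2" using Sig_fst(3)[OF Pos_Sig[OF a]] by (simp add: d_def coroot_inner)
  have a0: "aeval a v = 0" using v by (simp add: subregular_def)
  have aval: "aeval a (v + t *\<^sub>R d) = 2 * t" for t using a0 ad by (simp add: aeval_def inner_add_right algebra_simps)
  have sw: "aeval s (w y) = aeval a y" for y using aeval_act[OF w, of a y] was by simp
  let ?sw = "arefl s \<circ> w"
  have swW: "?sw \<in> W" by (rule W_comp[OF W_arefl[OF sS] w])
  have Qsg: "QW ?sw f = Q s g" unfolding g_def by (simp only: QW_comp[OF W_arefl[OF sS] w f] QW_arefl[OF s QW_EV[OF w f]])
  \<comment> \<open>A neighbourhood of v in which only the wall of a matters: the sign of a at y
    decides whether w y or s w y is in the closed alcove, so each side has its own formula for T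
    f.\<close>
  define N where "N = {y. \<forall>t\<in>S - {s}. aeval t (w y) > 0 \<and> aeval t (arefl s (w y)) > 0}"
  have cont: "continuous_on UNIV (\<lambda>y. aeval t (u y))" if "u \<in> W" for t u
    unfolding aeval_def by (intro continuous_intros W_continuous[OF that])
  have oN: "open N"
  proof -
    have "N = (\<Inter>t\<in>S - {s}. {y. 0 < aeval t (w y)} \<inter> {y. 0 < aeval t (?sw y)})" by (auto simp: N_def)
    also have "open \<dots>"
      by (intro open_INT finite_Diff finite_S ballI open_Int open_Collect_less continuous_on_const cont w swW)
    finally show ?thesis .
  qed
  have fixv: "arefl s (w v) = w v" using s0 by (simp add: arefl_def)
  have vN: "v \<in> N" unfolding N_def using pos fixv by simp
  have Tv: "T f v = g (w v)" unfolding g_def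
    by (rule T_eval[OF f w]) (use pos s0 in \<open>force simp: Cb_def\<close>)
  define P1 where "P1 = N \<inter> {y. 0 < aeval a y}"
  define P2 where "P2 = N \<inter> {y. aeval a y < 0}"
  have oP: "open P1" "open P2" unfolding P1_def P2_def aeval_def
    by (intro open_Int oN open_Collect_less continuous_intros)+
  have T1: "T f y = g (w y)" if "y \<in> P1" for y unfolding g_def
    by (rule T_eval[OF f w]) (use that sw in \<open>auto simp: P1_def N_def Cb_def intro: less_imp_le\<close>)
  have T2: "T f y = Q s g (?sw y)" if y: "y \<in> P2" for y unfolding Qsg[symmetric]
  proof (rule T_eval[OF f swW])
    have "aeval s (arefl s (w y)) > 0" using y sw aeval_arefl_self[OF snz] by (simp add: P2_def)
    then show "?sw y \<in> Cb" using y by (auto simp: P2_def N_def Cb_def intro: less_imp_le)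
  qed
  have D1: "dir_deriv d (T f) y = dir_deriv d' g (w y)" if "y \<in> P1" for y
    using dir_deriv_cong_open[OF oP(1) that T1, where v=d] dir_deriv_W[OF EV_smooth[OF g] w] wd by simp
  have D2: "dir_deriv d (T f) y = Q s (dir_deriv d' g) (?sw y) - 2 * complex_of_real (k s) * g (?sw y)" if y: "y \<in> P2" for y
  proof -
    have "dir_deriv d (T f) y = dir_deriv d (\<lambda>y. Q s g (?sw y)) y" by (rule dir_deriv_cong_open[OF oP(2) y T2])
    also have "\<dots> = dir_deriv (lin ?sw d) (Q s g) (?sw y)" by (rule dir_deriv_W[OF EV_smooth[OF Q_EV[OF g sS]] swW])
    also have "lin ?sw d = refl (fst s) d'" unfolding lin_arefl_comp[OF w] wd ..
    also have "dir_deriv (refl (fst s) d') (Q s g) (?sw y) = Q s (dir_deriv d' g) (?sw y) - 2 * complex_of_real (k s) * g (?sw y)"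
    proof -
      have "fst s \<bullet> refl (fst s) d' = - 2" using snz by (simp add: d'_def refl_def inner_diff_right coroot_inner)
      then show ?thesis unfolding Q_dir_deriv[OF EV_smooth[OF g] sS] refl_refl by (simp add: mult_ac)
    qed
    finally show ?thesis .
  qed
  have lim: "((\<lambda>t. h (u (v + (c * t) *\<^sub>R d))) \<longlongrightarrow> h (u v)) (at_right 0)" if "h \<in> EV" "u \<in> W" for h u and c :: real
  proof -
    have "isCont (\<lambda>t. h (u (v + (c * t) *\<^sub>R d))) 0"
      by (rule continuous_on_interior[of UNIV])
        (intro continuous_on_compose2[OF smooth_onD(3)[OF EV_smooth[OF EV_W[OF that]]]] continuous_intros, simp_all)
    then show ?thesis by (simp add: isCont_def filterlim_at_split)
  qed
  have near: "\<forall>\<^sub>F t in at_right 0. v + (c * t) *\<^sub>R d \<in> N" for c :: real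
  proof -
    have "((\<lambda>t. v + (c * t) *\<^sub>R d) \<longlongrightarrow> v + (c * 0) *\<^sub>R d) (at_right 0)" by (intro tendsto_intros)
    then show ?thesis using topological_tendstoD[OF _ oN] vN by fastforce
  qed
  have pos0: "\<forall>\<^sub>F t::real in at_right 0. t > 0" by (simp add: eventually_at_right_less)
  have dg: "dir_deriv d' g \<in> EV" by (rule EV_dir_deriv[OF g])
  have L1: "((\<lambda>t. dir_deriv d (T f) (v + t *\<^sub>R d)) \<longlongrightarrow> dir_deriv d' g (w v)) (at_right 0)"
  proof (rule tendsto_cong[THEN iffD2])
    show "\<forall>\<^sub>F t in at_right 0. dir_deriv d (T f) (v + t *\<^sub>R d) = dir_deriv d' g (w (v + (1 * t) *\<^sub>R d))"
      using near[of 1] pos0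
    proof eventually_elim
      case (elim t)
      then show ?case using D1[of "v + t *\<^sub>R d"] aval[of t] by (simp add: P1_def)
    qed
    show "((\<lambda>t. dir_deriv d' g (w (v + (1 * t) *\<^sub>R d))) \<longlongrightarrow> dir_deriv d' g (w v)) (at_right 0)" by (rule lim[OF dg w])
  qed
  have L2: "((\<lambda>t. dir_deriv d (T f) (v - t *\<^sub>R d)) \<longlongrightarrow> dir_deriv d' g (w v) - 2 * complex_of_real (k s) * g (w v)) (at_right 0)"
  proof (rule tendsto_cong[THEN iffD2])
    show "\<forall>\<^sub>F t in at_right 0. dir_deriv d (T f) (v - t *\<^sub>R d) =
        Q s (dir_deriv d' g) (?sw (v + (- 1 * t) *\<^sub>R d)) - 2 * complex_of_real (k s) * g (?sw (v + (- 1 * t) *\<^sub>R d))"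
      using near[of "-1"] pos0
    proof eventually_elim
      case (elim t)
      then show ?case using D2[of "v - t *\<^sub>R d"] aval[of "- t"] by (simp add: P2_def)
    qed
    have "?sw v = w v" using fixv by simp
    moreover have "Q s (dir_deriv d' g) (w v) = dir_deriv d' g (w v)" by (rule Q_wall[OF s0])
    ultimately show "((\<lambda>t. Q s (dir_deriv d' g) (?sw (v + (- 1 * t) *\<^sub>R d)) - 2 * complex_of_real (k s) * g (?sw (v + (- 1 * t) *\<^sub>R d)))
        \<longlongrightarrow> dir_deriv d' g (w v) - 2 * complex_of_real (k s) * g (w v)) (at_right 0)"
      using tendsto_diff[OF lim[OF Q_EV[OF dg sS] swW, of "- 1"] tendsto_mult_left[OF lim[OF g swW, of "- 1"], of "2 * complex_of_real (k s)"]]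
      by simp
  qed
  have "k s = k a" using k_act[OF w Pos_Sig[OF a]] was by simp
  then show ?thesis
    unfolding jump_condition_def Let_def d_def[symmetric] Tv using L1 L2 by (intro exI conjI) auto
qed

theorem T_BVP: assumes f: "f \<in> EV" shows "T f \<in> BVP R B \<phi> k lam"
  unfolding BVP_def using T_CB1[OF f] T_jump[OF f] T_distributional[OF f]
  by (auto simp: real_sym_algebra_def)

end

section \<open>Regularity of weak solutions\<close>

text \<open>The functions t^-m exp(-1/t), extended by 0. Their derivatives are combinations of
  members of the same family, which gives smoothness of \<open>bump\<close> by induction.\<close>

definition flat :: "nat \<Rightarrow> real \<Rightarrow> real" where
  "flat m t = (if t > 0 then inverse t ^ m * exp (- inverse t) else 0)"

lemma flat_tendsto: "(flat m \<longlongrightarrow> 0) (at 0)"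
  unfolding filterlim_at_split
proof
  have "\<forall>\<^sub>F t::real in at_left 0. t < 0" by (auto simp: eventually_at_left_field intro: exI[of _ "-1"])
  then show "(flat m \<longlongrightarrow> 0) (at_left 0)" by (intro tendsto_eventually) (auto simp: flat_def elim!: eventually_mono)
  have "((\<lambda>t. inverse t ^ m / exp (inverse t)) \<longlongrightarrow> (0::real)) (at_right 0)"
    by (rule filterlim_compose[OF tendsto_power_div_exp_0 filterlim_inverse_at_top_right])
  moreover have "\<forall>\<^sub>F t in at_right 0. inverse t ^ m / exp (inverse t) = flat m t"
    using eventually_at_right_less[of "0::real"] by eventually_elim (simp add: flat_def exp_minus divide_inverse)
  ultimately show "(flat m \<longlongrightarrow> 0) (at_right 0)" by (rule Lim_transform_eventually)
qed

lemma flat_deriv: "(flat m has_real_derivative flat (m + 2) t - real m * flat (m + 1) t) (at t)"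
proof -
  consider "t > 0" | "t < 0" | "t = 0" by linarith
  then show ?thesis
  proof cases
    case 1
    have i: "(inverse has_real_derivative - (inverse t ^ 2)) (at t)"
      using DERIV_inverse[of t] 1 by (simp add: numeral_2_eq_2)
    have "((\<lambda>t. inverse t ^ m * exp (- inverse t)) has_real_derivative
        inverse t ^ m * (exp (- inverse t) * - (- (inverse t ^ 2))) + real m * (- (inverse t ^ 2) * inverse t ^ (m - Suc 0)) * exp (- inverse t)) (at t)"
      by (rule DERIV_mult'[OF DERIV_power[OF i] DERIV_fun_exp[OF DERIV_minus[OF i]]])
    also have "inverse t ^ m * (exp (- inverse t) * - (- (inverse t ^ 2))) + real m * (- (inverse t ^ 2) * inverse t ^ (m - Suc 0)) * exp (- inverse t) =
        flat (m + 2) t - real m * flat (m + 1) t"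
      using 1 by (cases m) (simp_all add: flat_def power_add power2_eq_square algebra_simps)
    finally have "((\<lambda>t. inverse t ^ m * exp (- inverse t)) has_real_derivative flat (m + 2) t - real m * flat (m + 1) t) (at t)" .
    then show ?thesis
      by (rule has_field_derivative_transform_within_open[of _ _ _ "{0<..}"]) (use 1 in \<open>auto simp: flat_def\<close>)
  next
    case 2
    have "((\<lambda>t. 0) has_real_derivative flat (m + 2) t - real m * flat (m + 1) t) (at t)"
      using 2 by (simp add: flat_def)
    then show ?thesis
      by (rule has_field_derivative_transform_within_open[of _ _ _ "{..<0}"]) (use 2 in \<open>auto simp: flat_def\<close>)
  next
    case 3
    have "\<forall>\<^sub>F h in at 0. flat (m + 1) h = (flat m (0 + h) - flat m 0) / h"
      by (rule eventually_at_filter[THEN iffD2]) (auto simp: flat_def divide_inverse)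
    then have "((\<lambda>h. (flat m (0 + h) - flat m 0) / h) \<longlongrightarrow> 0) (at 0)"
      by (rule Lim_transform_eventually[OF flat_tendsto])
    then show ?thesis using 3 by (simp add: DERIV_def flat_def)
  qed
qed

text \<open>For c > 0 the function vanishes outside the ball of radius 1 / sqrt c; the choice c =
  n^2 gives a kernel of radius 1 / n.\<close>

definition bump :: "nat \<Rightarrow> real \<Rightarrow> 'a::euclidean_space \<Rightarrow> complex" where
  "bump m c x = complex_of_real (flat m (1 - c * (x \<bullet> x)))"

lemma bump_derivative:
  "(bump m c has_derivative (\<lambda>v. (bump (m + 2) c x + complex_of_real (- real m) * bump (m + 1) c x) * complex_of_real (- 2 * c * (x \<bullet> v)))) (at x)"
proof -
  have q: "((\<lambda>x. 1 - c * (x \<bullet> x)) has_derivative (\<lambda>v. - 2 * c * (x \<bullet> v))) (at x)"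
    by (auto intro!: derivative_eq_intros simp: inner_commute algebra_simps)
  have "((\<lambda>x. flat m (1 - c * (x \<bullet> x))) has_derivative
      (\<lambda>v. (flat (m + 2) (1 - c * (x \<bullet> x)) - real m * flat (m + 1) (1 - c * (x \<bullet> x))) * (- 2 * c * (x \<bullet> v)))) (at x)"
    by (rule has_derivative_compose[OF q flat_deriv[unfolded has_field_derivative_def]])
  from has_derivative_of_real[OF this, where 'a=complex] show ?thesis
    unfolding bump_def[abs_def] by (rule has_derivative_eq_rhs) (simp add: fun_eq_iff)
qed

lemma bump_smooth: "smooth_on UNIV (bump m c :: 'a::euclidean_space \<Rightarrow> complex)"
  unfolding smooth_on_def
proof
  fix n show "Ck_on n UNIV (bump m c :: 'a \<Rightarrow> complex)"
  proof (induction n arbitrary: m)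
    case (0 m)
    have "isCont (bump m c) x" for x :: 'a using bump_derivative by (rule has_derivative_continuous)
    then show ?case by (auto intro: continuous_at_imp_continuous_on)
  next
    case (Suc n m)
    have "dir_deriv v (bump m c) = (\<lambda>x. (bump (m + 2) c x + complex_of_real (- real m) * bump (m + 1) c x) * complex_of_real (- 2 * c * (x \<bullet> v)))" for v :: 'a
      using dir_deriv_eq[OF bump_derivative] by blast
    moreover have "smooth_on UNIV (\<lambda>x. complex_of_real (- 2 * c * (x \<bullet> v)))" for v :: 'a
      by (intro smooth_on_linear bounded_linear_compose[OF bounded_linear_of_real] bounded_linear_const_mult bounded_linear_inner_left)
    then have "Ck_on n UNIV (\<lambda>x. complex_of_real (- 2 * c * (x \<bullet> v)))" for v :: 'a by (rule smooth_onD(4))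
    ultimately have "Ck_on n UNIV (dir_deriv v (bump m c))" for v :: 'a
      using Suc by (simp only:) (intro Ck_on_mult Ck_on_add Ck_on_const open_UNIV)
    moreover have "bump m c differentiable (at x)" for x :: 'a
      unfolding differentiable_def by (rule exI, rule bump_derivative)
    ultimately show ?case by simp
  qed
qed

section \<open>Mollification by bump functions\<close>

text \<open>The convolution extends over a fixed box only, so continuity of F suffices; at the
  points of interest the kernel is supported inside the box. All derivatives fall on the
  kernel.\<close>

lemma mollify_smooth:
  fixes F \<beta> :: "'a::euclidean_space \<Rightarrow> complex"
  assumes F: "continuous_on (cbox a b) F" and \<beta>: "smooth_on UNIV \<beta>"
  shows "smooth_on UNIV (\<lambda>x. integral (cbox a b) (\<lambda>y. F y * \<beta> (x - y)))"
    and "dir_deriv v (\<lambda>x. integral (cbox a b) (\<lambda>y. F y * \<beta> (x - y))) = (\<lambda>x. integral (cbox a b) (\<lambda>y. F y * dir_deriv v \<beta> (x - y)))"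
proof -
  have D: "((\<lambda>x. integral (cbox a b) (\<lambda>y. F y * \<beta> (x - y))) has_derivative
      (\<lambda>u. integral (cbox a b) (\<lambda>y. F y * dir_deriv u \<beta> (x - y)))) (at x)" if \<beta>: "smooth_on UNIV \<beta>" for x and \<beta> :: "'a \<Rightarrow> complex"
  proof (rule integral_param_deriv)
    fix x y
    have "((\<lambda>x. \<beta> (x - y)) has_derivative (\<lambda>u. dir_deriv u \<beta> (x - y))) (at x)"
      by (rule has_derivative_compose[OF _ has_derivative_dir_deriv[OF smooth_onD(1)[OF \<beta> UNIV_I]], where f="\<lambda>x. x - y"])
        (auto intro!: derivative_eq_intros)
    then show "((\<lambda>x. F y * \<beta> (x - y)) has_derivative (\<lambda>u. F y * dir_deriv u \<beta> (x - y))) (at x)"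
      by (rule has_derivative_mult_right)
  next
    fix i :: 'a
    have "continuous_on (UNIV \<times> cbox a b) (\<lambda>p. F (snd p))"
      by (rule continuous_on_compose2[OF F]) (auto intro!: continuous_intros)
    moreover have "continuous_on (UNIV \<times> cbox a b) (\<lambda>p. dir_deriv i \<beta> (fst p - snd p))"
      by (rule continuous_on_compose2[OF smooth_onD(3)[OF smooth_onD(2)[OF \<beta>]]]) (auto intro!: continuous_intros)
    ultimately show "continuous_on (UNIV \<times> cbox a b) (\<lambda>p. F (snd p) * dir_deriv i \<beta> (fst p - snd p))"
      by (rule continuous_on_mult)
  next
    fix x
    show "continuous_on (cbox a b) (\<lambda>y. F y * \<beta> (x - y))"
      by (intro continuous_on_mult F continuous_on_compose2[OF smooth_onD(3)[OF \<beta>]] continuous_intros) simp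
  qed
  have dd: "dir_deriv v (\<lambda>x. integral (cbox a b) (\<lambda>y. F y * \<beta> (x - y))) = (\<lambda>x. integral (cbox a b) (\<lambda>y. F y * dir_deriv v \<beta> (x - y)))"
    if "smooth_on UNIV \<beta>" for v and \<beta> :: "'a \<Rightarrow> complex" by (rule ext) (rule dir_deriv_eq[OF D[OF that]])
  have df: "(\<lambda>x. integral (cbox a b) (\<lambda>y. F y * \<beta> (x - y))) differentiable (at x)" if "smooth_on UNIV \<beta>" for x and \<beta> :: "'a \<Rightarrow> complex"
    using D[OF that] by (auto simp: differentiable_def)
  have "Ck_on n UNIV (\<lambda>x. integral (cbox a b) (\<lambda>y. F y * \<beta> (x - y)))" for n
    using \<beta>
  proof (induction n arbitrary: \<beta>)
    case 0
    then show ?case using differentiable_imp_continuous_within[OF df] by (simp add: continuous_at_imp_continuous_on)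
  next
    case (Suc n)
    then show ?case by (simp add: dd df smooth_onD(2))
  qed
  then show "smooth_on UNIV (\<lambda>x. integral (cbox a b) (\<lambda>y. F y * \<beta> (x - y)))" by (simp add: smooth_on_def)
  show "dir_deriv v (\<lambda>x. integral (cbox a b) (\<lambda>y. F y * \<beta> (x - y))) = (\<lambda>x. integral (cbox a b) (\<lambda>y. F y * dir_deriv v \<beta> (x - y)))"
    by (rule dd[OF \<beta>])
qed

lemma pd_mollify:
  fixes F \<beta> :: "'a::euclidean_space \<Rightarrow> complex"
  assumes F: "continuous_on (cbox a b) F" and \<beta>: "smooth_on UNIV \<beta>" and p: "p \<in> sym_algebra"
  shows "pd p (\<lambda>x. integral (cbox a b) (\<lambda>y. F y * \<beta> (x - y))) x = integral (cbox a b) (\<lambda>y. F y * pd p \<beta> (x - y))"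
  using p
proof (induction arbitrary: x rule: sym_algebra_induct)
  case (const c)
  have "(\<lambda>y. F y * (c * \<beta> (x - y))) = (\<lambda>y. c * (F y * \<beta> (x - y)))" by (simp add: mult_ac)
  then show ?case by (simp add: pd_const)
next
  case (vec v q)
  let ?M = "\<lambda>\<beta> x. integral (cbox a b) (\<lambda>y. F y * \<beta> (x - y))"
  have q: "smooth_on UNIV (pd q \<beta>)" by (rule smooth_on_pd[OF open_UNIV \<beta>])
  have "pd q (?M \<beta>) = ?M (pd q \<beta>)" using vec.IH by blast
  then have "pd (sym_vec v * q) (?M \<beta>) x = dir_deriv v (?M (pd q \<beta>)) x"
    using pd_mult[OF open_UNIV mollify_smooth(1)[OF F \<beta>] UNIV_I, of "sym_vec v" q x]
      pd_vec[OF open_UNIV mollify_smooth(1)[OF F q] UNIV_I, of v x] by simp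
  moreover have "pd (sym_vec v * q) \<beta> = dir_deriv v (pd q \<beta>)"
    by (rule ext) (simp add: pd_mult[OF open_UNIV \<beta> UNIV_I] pd_vec[OF open_UNIV q UNIV_I])
  ultimately show ?case by (simp add: mollify_smooth(2)[OF F q])
next
  case (add p q)
  have c: "continuous_on (cbox a b) (\<lambda>y. F y * pd r \<beta> (x - y))" for r
    by (intro continuous_on_mult F continuous_on_compose2[OF smooth_onD(3)[OF smooth_on_pd[OF open_UNIV \<beta>]]] continuous_intros) simp
  show ?case
    by (simp add: pd_add add distrib_left integral_add[OF integrable_continuous[OF c] integrable_continuous[OF c]])
qed

text \<open>The sign from transposing a derivative cancels the sign from the reflection y -> x - y.
  So testing against a reflected kernel computes p(d) of the mollified function.\<close>

lemma npd_reflect: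
  assumes "smooth_on UNIV \<beta>"
  shows "npd p (\<lambda>y. \<beta> (x - y)) y = pd p \<beta> (x - y)"
proof -
  let ?r = "\<lambda>g y. g (x - y)"
  have D: "(\<lambda>y. - dir_deriv b (?r g) y) = ?r (dir_deriv b g) \<and> smooth_on UNIV (dir_deriv b g)"
    if g: "smooth_on UNIV g" for b and g :: "'a \<Rightarrow> complex"
  proof
    have "dir_deriv b (?r g) y = dir_deriv (- b) g (x - y)" for y
      using dir_deriv_affine[where L=uminus and c=x and x=y and v=b, OF _ smooth_onD(1)[OF g UNIV_I]]
      by (simp add: bounded_linear_minus)
    moreover have "dir_deriv (- b) g y = - dir_deriv b g y" for y
      by (rule linear_neg[OF dir_deriv_linear[OF smooth_onD(1)[OF g UNIV_I]]])
    ultimately show "(\<lambda>y. - dir_deriv b (?r g) y) = ?r (dir_deriv b g)" by simp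
  qed (rule smooth_onD(2)[OF g])
  have pw: "((\<lambda>g y. - dir_deriv b g y) ^^ n) (?r g) = ?r ((dir_deriv b ^^ n) g) \<and> smooth_on UNIV ((dir_deriv b ^^ n) g)"
    if "smooth_on UNIV g" for b n and g :: "'a \<Rightarrow> complex"
    by (induction n) (use that D in auto)
  have "foldr (\<lambda>b g. ((\<lambda>g y. - dir_deriv b g y) ^^ Poly_Mapping.lookup m b) g) xs (?r \<beta>) =
      ?r (foldr (\<lambda>b g. (dir_deriv b ^^ Poly_Mapping.lookup m b) g) xs \<beta>) \<and>
      smooth_on UNIV (foldr (\<lambda>b g. (dir_deriv b ^^ Poly_Mapping.lookup m b) g) xs \<beta>)" for m and xs :: "'a list"
    by (induction xs) (use assms pw in auto)
  then show ?thesis by (simp add: sym_subst_def)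
qed

lemma bump_zero: assumes "n > 0" "norm z \<ge> 1 / real n" shows "bump m ((real n)\<^sup>2) z = 0"
proof -
  have "1 \<le> real n * norm z" using assms by (simp add: field_simps)
  then have "1 \<le> (real n * norm z)\<^sup>2" by (simp add: one_le_power)
  then show ?thesis by (simp add: bump_def flat_def power_mult_distrib dot_square_norm)
qed

lemma bump_mass:
  assumes n: "n > 0"
  shows "\<exists>e>0. (LINT y|lborel. bump 0 ((real n)\<^sup>2) (y::'a::euclidean_space)) = complex_of_real e"
proof -
  let ?f = "\<lambda>y::'a. flat 0 (1 - (real n)\<^sup>2 * (y \<bullet> y))"
  define K :: "'a set" where "K = cbox (- One) One"
  have zero: "bump 0 ((real n)\<^sup>2) y = 0" if "y \<notin> K" for y :: 'a
  proof (rule bump_zero[OF n])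
    show "1 / real n \<le> norm y"
    proof (rule ccontr)
      assume "\<not> 1 / real n \<le> norm y"
      moreover have "1 / real n \<le> 1" using n by simp
      ultimately have y: "norm y \<le> 1" by linarith
      have "\<bar>y \<bullet> b\<bar> \<le> 1" if "b \<in> Basis" for b using Basis_le_norm[OF that, of y] y by linarith
      then have "y \<in> K" unfolding K_def mem_box by (auto simp: abs_le_iff)
      with that show False by simp
    qed
  qed
  have cb: "continuous_on A (bump 0 ((real n)\<^sup>2))" for A :: "'a set"
    using smooth_onD(3)[OF bump_smooth] continuous_on_subset by blast
  have cf: "continuous_on K ?f"
    using continuous_on_Re[OF cb[of K]] by (simp add: bump_def)
  have f0: "?f y \<ge> 0" for y :: 'a by (simp add: flat_def)
  have "integral K ?f \<noteq> 0"
  proof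
    assume "integral K ?f = 0"
    then have "(?f has_integral 0) (cbox (- One) One)"
      using integrable_integral[OF integrable_continuous[OF cf[unfolded K_def]]] by (simp add: K_def)
    then have "?f 0 = 0"
      by (rule has_integral_0_cbox_imp_0[OF cf[unfolded K_def] f0]) (auto simp: mem_box box_ne_empty)
    then show False by (simp add: flat_def)
  qed
  moreover have "integral K ?f \<ge> 0" by (rule integral_nonneg) (use cf f0 integrable_continuous K_def in auto)
  moreover have "(LINT y|lborel. bump 0 ((real n)\<^sup>2) (y::'a)) = complex_of_real (integral K ?f)"
  proof -
    have "((\<lambda>y. complex_of_real (?f y)) has_integral complex_of_real (integral K ?f)) K"
      by (rule has_integral_of_real[OF integrable_integral]) (use cf integrable_continuous K_def in auto)
    then have "integral K (bump 0 ((real n)\<^sup>2) :: 'a \<Rightarrow> complex) = complex_of_real (integral K ?f)"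
      unfolding bump_def[abs_def] by (rule integral_unique)
    then show ?thesis
      using lborel_integral_cbox(2)[OF cb[of "cbox (- One) One"] zero[unfolded K_def]] by (simp add: K_def)
  qed
  ultimately show ?thesis by (intro exI[of _ "integral K ?f"]) auto
qed

text \<open>The kernels \<^term>\<open>bump 0 ((real n)\<^sup>2)\<close> are not normalised; dividing by their total mass gives an
  approximate identity.\<close>

lemma mollify_tendsto:
  fixes F :: "'a::euclidean_space \<Rightarrow> complex"
  assumes F: "continuous_on UNIV F" and \<delta>: "\<delta> > 0" "ball x \<delta> \<subseteq> cbox a b"
  shows "(\<lambda>n. integral (cbox a b) (\<lambda>y. F y * bump 0 ((real n)\<^sup>2) (x - y)) / (LINT y|lborel. bump 0 ((real n)\<^sup>2) (y::'a))) \<longlonglongrightarrow> F x"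
proof (rule LIMSEQ_I)
  fix \<epsilon> :: real assume \<epsilon>: "\<epsilon> > 0"
  have "isCont F x" using F by (simp add: continuous_on_eq_continuous_at)
  then obtain d where d: "d > 0" "\<And>y. dist y x < d \<Longrightarrow> dist (F y) (F x) < \<epsilon> / 2"
    using \<epsilon> unfolding continuous_at_eps_delta by (metis half_gt_zero)
  obtain N :: nat where N: "1 / min d \<delta> < real N" using reals_Archimedean2 by blast
  show "\<exists>N. \<forall>n\<ge>N. norm (integral (cbox a b) (\<lambda>y. F y * bump 0 ((real n)\<^sup>2) (x - y)) / (LINT y|lborel. bump 0 ((real n)\<^sup>2) (y::'a)) - F x) < \<epsilon>"
  proof (intro exI allI impI)
    fix n assume n: "N \<le> n"
    define m where "m = min d \<delta>"
    have m: "m > 0" using d \<delta> by (simp add: m_def)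
    have "0 < 1 / m" using m by simp
    then have nN: "1 / m < real n" "n > 0" using N n unfolding m_def[symmetric] by linarith+
    have inv: "1 / real n < m" using nN m by (simp add: field_simps)
    let ?\<beta> = "bump 0 ((real n)\<^sup>2) :: 'a \<Rightarrow> complex" and ?K = "cbox a b"
    obtain e where e: "e > 0" "(LINT y|lborel. ?\<beta> y) = complex_of_real e" using bump_mass[OF nN(2)] by blast
    have z: "?\<beta> (x - y) = 0" if "\<not> dist y x < m" for y
      by (rule bump_zero[OF nN(2)]) (use that inv in \<open>simp add: dist_norm norm_minus_commute\<close>)
    have zK: "?\<beta> (x - y) = 0" if "y \<notin> ?K" for y
    proof (rule z, rule notI)
      assume "dist y x < m"
      then have "y \<in> ball x \<delta>" by (simp add: m_def dist_commute)
      then show False using \<delta>(2) that by blast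
    qed
    have c\<beta>: "continuous_on A ?\<beta>" for A using smooth_onD(3)[OF bump_smooth] continuous_on_subset by blast
    have c: "continuous_on ?K (\<lambda>y. ?\<beta> (x - y))" by (intro continuous_on_compose2[OF c\<beta>[of UNIV]] continuous_intros) simp
    have cF: "continuous_on ?K F" using F continuous_on_subset by blast
    have "integral ?K (\<lambda>y. ?\<beta> (x - y)) = (LINT y|lborel. ?\<beta> (x - y))"
      by (rule lborel_integral_cbox(2)[symmetric, OF c zK])
    also have "\<dots> = (LINT y|lborel. ?\<beta> (y + - x))"
      by (simp add: bump_def inner_diff_left inner_diff_right inner_commute fun_eq_iff add.commute)
    also have "\<dots> = complex_of_real e"
      unfolding e(2)[symmetric] by (rule lborel_integral_translate[OF borel_measurable_continuous_onI[OF c\<beta>]])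
    finally have mass: "integral ?K (\<lambda>y. ?\<beta> (x - y)) = complex_of_real e" .
    have i: "(\<lambda>y. F y * ?\<beta> (x - y)) integrable_on ?K" "(\<lambda>y. F x * ?\<beta> (x - y)) integrable_on ?K"
      by (intro integrable_continuous continuous_on_mult cF c continuous_on_const)+
    have "norm (integral ?K (\<lambda>y. F y * ?\<beta> (x - y) - F x * ?\<beta> (x - y))) \<le> integral ?K (\<lambda>y. \<epsilon> / 2 * Re (?\<beta> (x - y)))"
    proof (rule integral_norm_bound_integral)
      show "(\<lambda>y. F y * ?\<beta> (x - y) - F x * ?\<beta> (x - y)) integrable_on ?K" by (rule integrable_diff[OF i])
      show "(\<lambda>y. \<epsilon> / 2 * Re (?\<beta> (x - y))) integrable_on ?K"
        by (intro integrable_continuous continuous_on_mult continuous_on_const continuous_on_Re c)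
      fix y
      show "norm (F y * ?\<beta> (x - y) - F x * ?\<beta> (x - y)) \<le> \<epsilon> / 2 * Re (?\<beta> (x - y))"
      proof (cases "dist y x < m")
        case True
        then have "norm (F y - F x) \<le> \<epsilon> / 2" using d(2)[of y] by (simp add: m_def dist_norm)
        moreover have "norm (?\<beta> (x - y)) = Re (?\<beta> (x - y))" by (simp add: bump_def flat_def)
        ultimately show ?thesis
          unfolding left_diff_distrib[symmetric] norm_mult by (metis mult_right_mono norm_ge_zero)
      qed (simp add: z)
    qed
    also have "integral ?K (\<lambda>y. \<epsilon> / 2 * Re (?\<beta> (x - y))) = \<epsilon> / 2 * e"
      using integral_linear[OF integrable_continuous[OF c] bounded_linear_Re] mass by (simp add: o_def)
    finally have b: "norm (integral ?K (\<lambda>y. F y * ?\<beta> (x - y)) - F x * complex_of_real e) \<le> \<epsilon> / 2 * e"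
      by (simp add: integral_diff[OF i] mass)
    have "integral ?K (\<lambda>y. F y * ?\<beta> (x - y)) / complex_of_real e - F x =
        (integral ?K (\<lambda>y. F y * ?\<beta> (x - y)) - F x * complex_of_real e) / complex_of_real e"
      using e(1) by (simp add: field_simps)
    then have "norm (integral ?K (\<lambda>y. F y * ?\<beta> (x - y)) / complex_of_real e - F x) \<le> \<epsilon> / 2"
      using b e(1) by (simp add: norm_divide field_simps)
    then show "norm (integral ?K (\<lambda>y. F y * ?\<beta> (x - y)) / (LINT y|lborel. ?\<beta> y) - F x) < \<epsilon>"
      unfolding e(2) using \<epsilon> by linarith
  qed
qed

text \<open>A finite-dimensional function space is determined by the values at finitely many points, so it is
  closed under pointwise limits.\<close>

lemma interpolation:
  fixes M :: "('a \<Rightarrow> complex) set"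
  assumes "finite I" "csubspace_fun M" "\<And>f. f \<in> M \<Longrightarrow> \<exists>c. \<forall>x\<in>U. f x = (\<Sum>i\<in>I. c i * g i x)"
  shows "\<exists>n p h. (\<forall>j<n. p j \<in> U \<and> h j \<in> M) \<and> (\<forall>f\<in>M. \<forall>x\<in>U. f x = (\<Sum>j<(n::nat). f (p j) * h j x))"
  using assms
proof (induction "card I" arbitrary: I M g)
  case 0
  then have "I = {}" by simp
  then have "f x = 0" if "f \<in> M" "x \<in> U" for f x using 0(4)[OF that(1)] that(2) by simp
  then show ?case by (intro exI[of _ 0]) auto
next
  case (Suc m)
  have add: "(\<lambda>x. f x + g x) \<in> M" if "f \<in> M" "g \<in> M" for f g using Suc.prems(2) that by (auto simp: csubspace_fun_def)
  have scale: "(\<lambda>x. c * f x) \<in> M" if "f \<in> M" for f c using Suc.prems(2) that by (auto simp: csubspace_fun_def)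
  have zero: "(\<lambda>x. 0) \<in> M" using Suc.prems(2) by (auto simp: csubspace_fun_def)
  have diff: "(\<lambda>x. f x - g x) \<in> M" if "f \<in> M" "g \<in> M" for f g using add[OF that(1) scale[OF that(2), of "-1"]] by simp
  have sum: "(\<lambda>x. \<Sum>j<n. c j * h j x) \<in> M" if "\<And>j. j < n \<Longrightarrow> h j \<in> M" for n :: nat and c h
    using that
  proof (induction n)
    case (Suc n)
    then show ?case using add[OF Suc.IH scale[OF Suc.prems[of n], of "c n"]] by simp
  qed (simp add: zero)
  show ?case
  proof (cases "\<forall>f\<in>M. \<forall>x\<in>U. f x = 0")
    case True
    then show ?thesis by (intro exI[of _ 0]) auto
  next
    case False
    then obtain f1 q where f1: "f1 \<in> M" "q \<in> U" "f1 q \<noteq> 0" by blast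
    \<comment> \<open>Normalised to the value 1 at q, so that subtracting f(q) f0 moves f into the
      subspace of functions vanishing at q.\<close>
    define f0 where "f0 x = inverse (f1 q) * f1 x" for x
    have f0: "f0 \<in> M" "f0 q = 1" using scale[OF f1(1), of "inverse (f1 q)"] f1(3) by (simp_all add: f0_def[abs_def])
    obtain c where c: "\<And>x. x \<in> U \<Longrightarrow> f0 x = (\<Sum>i\<in>I. c i * g i x)" using Suc.prems(3)[OF f0(1)] by blast
    have "\<exists>j\<in>I. c j \<noteq> 0"
    proof (rule ccontr)
      assume "\<not> (\<exists>j\<in>I. c j \<noteq> 0)"
      then have "f0 q = 0" using c[OF f1(2)] by simp
      then show False using f0(2) by simp
    qed
    then obtain j where j: "j \<in> I" "c j \<noteq> 0" by blast
    have c': "f0 x = c j * g j x + (\<Sum>i\<in>I - {j}. c i * g i x)" if "x \<in> U" for x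
      unfolding c[OF that] by (rule sum.remove[OF Suc.prems(1) j(1)])
    define M0 where "M0 = {f \<in> M. f q = 0}"
    \<comment> \<open>The subspace vanishing at q is spanned by one function less: c j is nonzero,
      so g j can be eliminated in favour of f0, and the correction by f0 makes each g' i vanish at
      q.\<close>
    define g' where "g' i x = g i x - g i q * f0 x" for i x
    have M0: "csubspace_fun M0" using Suc.prems(2) by (auto simp: csubspace_fun_def M0_def)
    have rep: "\<exists>d. \<forall>x\<in>U. f x = (\<Sum>i\<in>I - {j}. d i * g' i x)" if f: "f \<in> M0" for f
    proof -
      obtain d where d: "\<And>x. x \<in> U \<Longrightarrow> f x = (\<Sum>i\<in>I. d i * g i x)" using Suc.prems(3)[of f] f by (auto simp: M0_def)
      define \<alpha> where "\<alpha> = d j / c j"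
      define d' where "d' i = d i - \<alpha> * c i" for i
      have 1: "f x = \<alpha> * f0 x + (\<Sum>i\<in>I - {j}. d' i * g i x)" if x: "x \<in> U" for x
      proof -
        have "f x = d j * g j x + (\<Sum>i\<in>I - {j}. d i * g i x)"
          unfolding d[OF x] by (rule sum.remove[OF Suc.prems(1) j(1)])
        also have "\<dots> = \<alpha> * (c j * g j x + (\<Sum>i\<in>I - {j}. c i * g i x)) + (\<Sum>i\<in>I - {j}. d' i * g i x)"
          using j(2) by (simp add: \<alpha>_def d'_def algebra_simps sum_subtractf sum_distrib_left)
        finally show ?thesis unfolding c'[OF x] .
      qed
      have "f q = 0" using f by (simp add: M0_def)
      then have "\<alpha> = - (\<Sum>i\<in>I - {j}. d' i * g i q)" using 1[OF f1(2)] f0(2) by (simp add: add_eq_0_iff2)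
      then have "f x = (\<Sum>i\<in>I - {j}. d' i * g' i x)" if "x \<in> U" for x
        unfolding 1[OF that] g'_def by (simp add: algebra_simps sum_subtractf sum_distrib_left sum_distrib_right)
      then show ?thesis by blast
    qed
    have "m = card (I - {j})" using Suc.hyps(2) Suc.prems(1) j(1) by simp
    from Suc.hyps(1)[OF this _ M0 rep] Suc.prems(1) obtain n p h where IH:
      "\<And>j. j < n \<Longrightarrow> p j \<in> U \<and> h j \<in> M0" "\<And>f x. f \<in> M0 \<Longrightarrow> x \<in> U \<Longrightarrow> f x = (\<Sum>j<(n::nat). f (p j) * h j x)" by blast
    define h' where "h' = (\<lambda>x. f0 x - (\<Sum>j<n. f0 (p j) * h j x))"
    have hM: "h j \<in> M" if "j < n" for j using IH(1)[OF that] by (simp add: M0_def)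
    have h': "h' \<in> M" unfolding h'_def by (intro diff f0(1) sum hM)
    have "f x = (\<Sum>j<Suc n. f ((p(n := q)) j) * (h(n := h')) j x)" if f: "f \<in> M" and x: "x \<in> U" for f x
    proof -
      have "(\<lambda>x. f x - f q * f0 x) \<in> M0" using diff[OF f scale[OF f0(1)]] f0(2) by (simp add: M0_def)
      from IH(2)[OF this x] have "f x = f q * f0 x + (\<Sum>j<n. (f (p j) - f q * f0 (p j)) * h j x)" by (simp add: algebra_simps)
      also have "\<dots> = (\<Sum>j<n. f (p j) * h j x) + f q * h' x"
        by (simp add: h'_def algebra_simps sum_subtractf sum_distrib_left)
      finally show ?thesis by simp
    qed
    moreover have "\<forall>j<Suc n. (p(n := q)) j \<in> U \<and> (h(n := h')) j \<in> M"
      using IH(1) hM h' f1(2) by (auto simp: less_Suc_eq)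
    ultimately show ?thesis by blast
  qed
qed

lemma pointwise_limit:
  fixes M :: "('a \<Rightarrow> complex) set"
  assumes I: "finite I" and M: "csubspace_fun M" and g: "\<And>f. f \<in> M \<Longrightarrow> \<exists>c. \<forall>x\<in>U. f x = (\<Sum>i\<in>I. c i * g i x)"
    and f: "\<forall>\<^sub>F n in sequentially. f n \<in> M" and lim: "\<And>x. x \<in> U \<Longrightarrow> (\<lambda>n. f n x) \<longlonglongrightarrow> F x"
  shows "\<exists>h\<in>M. \<forall>x\<in>U. F x = h x"
proof -
  obtain n p h where h: "\<And>j. j < n \<Longrightarrow> p j \<in> U \<and> h j \<in> M" "\<And>f x. f \<in> M \<Longrightarrow> x \<in> U \<Longrightarrow> f x = (\<Sum>j<(n::nat). f (p j) * h j x)"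
    using interpolation[OF I M g] by blast
  have m: "(\<lambda>x. \<Sum>j<n. F (p j) * h j x) \<in> M"
    using h(1)
  proof (induction n)
    case (Suc n)
    then show ?case using M by (simp add: csubspace_fun_def)
  qed (use M in \<open>simp add: csubspace_fun_def\<close>)
  have e: "F x = (\<Sum>j<n. F (p j) * h j x)" if x: "x \<in> U" for x
  proof (rule LIMSEQ_unique[OF lim[OF x]])
    have "(\<lambda>m. \<Sum>j<n. f m (p j) * h j x) \<longlonglongrightarrow> (\<Sum>j<n. F (p j) * h j x)"
      by (intro tendsto_sum tendsto_mult lim tendsto_const) (use h(1) in simp)
    moreover have "\<forall>\<^sub>F m in sequentially. (\<Sum>j<n. f m (p j) * h j x) = f m x"
      using f by eventually_elim (simp add: h(2)[OF _ x, symmetric])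
    ultimately show "(\<lambda>m. f m x) \<longlonglongrightarrow> (\<Sum>j<n. F (p j) * h j x)" by (rule Lim_transform_eventually)
  qed
  show ?thesis by (rule bexI[OF _ m]) (rule ballI, rule e)
qed

text \<open>The boundary value problem only mentions real invariants, the space \<open>E(\<lambda>)\<close> all of them.\<close>

lemma real_invariant_parts:
  fixes p :: "'a::euclidean_space sympoly"
  assumes p: "p \<in> sym_algebra" "sym_invariant R p"
  obtains q r where "q \<in> real_sym_algebra" "r \<in> real_sym_algebra" "sym_invariant R q" "sym_invariant R r" "p = q + sym_const \<i> * r"
proof -
  define part where "part h = Poly_Mapping.map (\<lambda>c. complex_of_real (h c)) p" for h
  have lk: "Poly_Mapping.lookup (part h) m = complex_of_real (h (Poly_Mapping.lookup p m))" if "h 0 = 0" for h m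
    using that by (simp add: part_def Poly_Mapping.map.rep_eq when_def)
  have keys: "Poly_Mapping.keys (part h) \<subseteq> Poly_Mapping.keys p" if "h 0 = 0" for h
    using lk[of h, OF that] that by (auto simp: in_keys_iff)
  have real: "part h \<in> real_sym_algebra" if "h 0 = 0" for h
    using keys[of h, OF that] p(1) lk[of h, OF that] by (auto simp: real_sym_algebra_def sym_algebra_def)
  have ev: "sym_eval (real_point \<xi>) (part h) = complex_of_real (\<Sum>m\<in>Poly_Mapping.keys p. h (Poly_Mapping.lookup p m) * (\<Prod>b\<in>Basis. (\<xi> \<bullet> b) ^ Poly_Mapping.lookup m b))"
    if "h 0 = 0" for h and \<xi> :: 'a
  proof -
    have "sym_eval (real_point \<xi>) (part h) = (\<Sum>m\<in>Poly_Mapping.keys p. Poly_Mapping.lookup (part h) m * (\<Prod>b\<in>Basis. real_point \<xi> b ^ Poly_Mapping.lookup m b))"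
      unfolding sym_eval_def by (rule sum.mono_neutral_left) (use keys[of h, OF that] in \<open>auto simp: in_keys_iff\<close>)
    then show ?thesis by (simp add: lk[of h, OF that] real_point_def)
  qed
  have pe: "sym_eval (real_point \<xi>) p = (\<Sum>m\<in>Poly_Mapping.keys p. Poly_Mapping.lookup p m * complex_of_real (\<Prod>b\<in>Basis. (\<xi> \<bullet> b) ^ Poly_Mapping.lookup m b))" for \<xi> :: 'a
    by (simp add: sym_eval_def real_point_def)
  have re: "sym_eval (real_point \<xi>) (part Re) = complex_of_real (Re (sym_eval (real_point \<xi>) p))" for \<xi> :: 'a
    unfolding pe by (subst ev) (simp_all del: of_real_prod of_real_power)
  have im: "sym_eval (real_point \<xi>) (part Im) = complex_of_real (Im (sym_eval (real_point \<xi>) p))" for \<xi> :: 'a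
    unfolding pe by (subst ev) (simp_all del: of_real_prod of_real_power)
  have "p = part Re + sym_const \<i> * part Im"
    by (rule poly_mapping_eqI) (simp add: lookup_add lk sym_const_def mult_map_scale_conv_mult[symmetric] Poly_Mapping.map.rep_eq when_def complex_eq_iff)
  moreover have "sym_invariant R (part Re)" "sym_invariant R (part Im)"
    using p(2) unfolding sym_invariant_def by (simp_all add: re im)
  ultimately show ?thesis using that real[of Re] real[of Im] by simp
qed

context eigen
begin

theorem weak_solution_local:
  assumes F: "continuous_on UNIV F" and V: "open V" and x0: "x0 \<in> V"
    and weak: "\<And>p. p \<in> real_sym_algebra \<Longrightarrow> sym_invariant R p \<Longrightarrow> distributional_eigen V p (sym_eval lam p) F"
  shows "\<exists>U. open U \<and> x0 \<in> U \<and> (\<exists>f\<in>sol R lam UNIV. \<forall>x\<in>U. F x = f x)"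
proof -
  \<comment> \<open>Two nested boxes: the outer one is the domain of integration, and the inner one
    keeps a distance \<delta> from its boundary, so that kernels of radius below \<delta> centred
    there are test functions on V.\<close>
  obtain a b where K: "cbox a b \<subseteq> V" "x0 \<in> box a b" using open_contains_cbox[OF V x0] by metis
  obtain a' b' where U: "cbox a' b' \<subseteq> box a b" "x0 \<in> box a' b'" using open_contains_cbox[OF open_box K(2)] by metis
  obtain \<delta> where \<delta>: "\<delta> > 0" "(\<Union>x\<in>cbox a' b'. ball x \<delta>) \<subseteq> box a b"
    using compact_subset_open_imp_ball_epsilon_subset[OF compact_cbox open_box U(1)] by blast
  define U' where "U' = box a' b'"
  have U': "open U'" "x0 \<in> U'" unfolding U'_def using U(2) by auto
  have bx: "boxy U' x0" unfolding boxy_def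
  proof (intro conjI ballI)
    fix x c :: 'a and s :: real assume x: "x \<in> U'" and c: "c \<in> Basis" and s: "s \<in> {0..1}"
    have "a' \<bullet> i < (x + (s * ((x0 - x) \<bullet> c)) *\<^sub>R c) \<bullet> i \<and> (x + (s * ((x0 - x) \<bullet> c)) *\<^sub>R c) \<bullet> i < b' \<bullet> i" if i: "i \<in> Basis" for i
    proof (cases "i = c")
      case True
      have bnd: "a' \<bullet> c < x \<bullet> c" "x \<bullet> c < b' \<bullet> c" "a' \<bullet> c < x0 \<bullet> c" "x0 \<bullet> c < b' \<bullet> c"
        using x U' c unfolding U'_def mem_box by auto
      have "x \<bullet> c + s * ((x0 - x) \<bullet> c) \<in> {a' \<bullet> c <..< b' \<bullet> c}"
        using convexD_alt[OF convex_real_interval(8), of "x \<bullet> c" "a' \<bullet> c" "b' \<bullet> c" "x0 \<bullet> c" s] bnd s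
        by (simp add: algebra_simps)
      then show ?thesis using True c by (simp add: inner_add_left)
    next
      case False
      then show ?thesis using x i c unfolding U'_def mem_box by (simp add: inner_add_left inner_not_same_Basis)
    qed
    then show "x + (s * ((x0 - x) \<bullet> c)) *\<^sub>R c \<in> U'" unfolding U'_def mem_box by blast
  qed (rule U'(2))
  have cF: "continuous_on A F" for A using F continuous_on_subset by blast
  have ballK: "ball x \<delta> \<subseteq> cbox a b" if "x \<in> U'" for x
    using \<delta>(2) that box_subset_cbox unfolding U'_def by (meson UN_subset_iff subset_trans subsetD)
  let ?\<beta> = "\<lambda>n. bump 0 ((real n)\<^sup>2) :: 'a \<Rightarrow> complex"
  define G where "G n x = integral (cbox a b) (\<lambda>y. F y * ?\<beta> n (x - y))" for n x
  define e where "e n = (LINT y|lborel. ?\<beta> n y)" for n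
  obtain N :: nat where N: "1 / \<delta> < real N" using reals_Archimedean2 by blast
  have Gsol: "G n \<in> sol R lam U'" if n: "n \<ge> N" for n
  proof -
    have "0 < 1 / \<delta>" using \<delta>(1) by simp
    then have n0: "1 / \<delta> < real n" "n > 0" using N n by linarith+
    have inv: "1 / real n < \<delta>" using n0 \<delta>(1) by (simp add: field_simps)
    note \<beta> = bump_smooth[of 0 "(real n)\<^sup>2", where 'a='a]
    note sG = mollify_smooth(1)[OF cF[of "cbox a b"] \<beta>, folded G_def]
    have eqr: "pd p (G n) x = sym_eval lam p * G n x" if p: "p \<in> real_sym_algebra" "sym_invariant R p" and x: "x \<in> U'" for p x
    proof -
      let ?\<psi> = "\<lambda>y. ?\<beta> n (x - y)"
      have sm: "smooth_on UNIV ?\<psi>"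
        using smooth_on_affine[OF open_UNIV bounded_linear_minus[OF bounded_linear_ident] \<beta>, of UNIV x] by simp
      have z: "?\<beta> n (x - y) = 0" if "y \<notin> cball x (1 / real n)" for y
        by (rule bump_zero[OF n0(2)]) (use that in \<open>simp add: dist_norm\<close>)
      have "cball x (1 / real n) \<subseteq> ball x \<delta>" using inv by auto
      then have sub: "cball x (1 / real n) \<subseteq> cbox a b" "cball x (1 / real n) \<subseteq> V" using ballK[OF x] K(1) by auto
      have test: "test_function V ?\<psi>" unfolding test_function_def
        using sm sub(2) z by (intro conjI exI[of _ "cball x (1 / real n)"]) auto
      have z': "pd p (?\<beta> n) (x - y) = 0" if y: "y \<notin> cball x (1 / real n)" for y
      proof -
        have o: "open (- cball 0 (1 / real n))" by (simp add: open_Compl)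
        have "pd p (?\<beta> n) (x - y) = pd p (\<lambda>_. 0 * 0) (x - y)"
          by (rule pd_cong[OF o]) (use y n0(2) in \<open>auto simp: dist_norm norm_minus_commute intro!: bump_zero\<close>)
        also have "\<dots> = 0" using pd_fun_scale[OF open_UNIV smooth_on_const UNIV_I, of p 0 0] by simp
        finally show ?thesis .
      qed
      have L: "(LINT y:V|lborel. F y * h (x - y)) = integral (cbox a b) (\<lambda>y. F y * h (x - y))"
        if h: "continuous_on UNIV h" and hz: "\<And>y. y \<notin> cball x (1 / real n) \<Longrightarrow> h (x - y) = 0" for h
      proof -
        have c: "continuous_on (cbox a b) (\<lambda>y. F y * h (x - y))"
          by (intro continuous_on_mult cF continuous_on_compose2[OF h] continuous_intros) simp
        have hK: "h (x - y) = 0" if "y \<notin> cbox a b" for y using hz sub(1) that by blast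
        have hV: "h (x - y) = 0" if "y \<notin> V" for y using hz sub(2) that by blast
        have "(LINT y:V|lborel. F y * h (x - y)) = (LINT y|lborel. F y * h (x - y))"
          unfolding set_lebesgue_integral_def
          by (rule arg_cong[where f="integral\<^sup>L lborel"]) (use hV in \<open>auto simp: fun_eq_iff indicator_def\<close>)
        also have "\<dots> = integral (cbox a b) (\<lambda>y. F y * h (x - y))"
          by (rule lborel_integral_cbox(2)[OF c]) (simp add: hK)
        finally show ?thesis .
      qed
      have "pd p (G n) x = integral (cbox a b) (\<lambda>y. F y * pd p (?\<beta> n) (x - y))"
        unfolding G_def[abs_def] by (rule pd_mollify[OF cF \<beta> real_sym_algebraD[OF p(1)]])
      also have "\<dots> = (LINT y:V|lborel. F y * pd p (?\<beta> n) (x - y))"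
        by (rule L[symmetric, OF smooth_onD(3)[OF smooth_on_pd[OF open_UNIV \<beta>]] z'])
      also have "\<dots> = sym_eval lam p * (LINT y:V|lborel. F y * ?\<beta> n (x - y))"
      proof -
        have "npd p ?\<psi> = (\<lambda>y. pd p (?\<beta> n) (x - y))" by (rule ext) (rule npd_reflect[OF \<beta>])
        then show ?thesis using weak[OF p, unfolded distributional_eigen_def, rule_format, OF test] by (simp only:)
      qed
      also have "\<dots> = sym_eval lam p * G n x" unfolding G_def by (subst L[OF smooth_onD(3)[OF \<beta>] z]) simp_all
      finally show ?thesis .
    qed
    show ?thesis
    proof (rule solI[OF smooth_on_subset[OF sG subset_UNIV]])
      fix p :: "'a sympoly" and x assume p: "p \<in> sym_algebra" "sym_invariant R p" and x: "x \<in> U'"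
      obtain q r where qr: "q \<in> real_sym_algebra" "r \<in> real_sym_algebra" "sym_invariant R q" "sym_invariant R r" "p = q + sym_const \<i> * r"
        using real_invariant_parts[OF p] by metis
      show "pd p (G n) x = sym_eval lam p * G n x"
        unfolding qr(5) using eqr[OF qr(1,3) x] eqr[OF qr(2,4) x]
        by (simp add: pd_add pd_mult[OF open_UNIV sG UNIV_I] pd_const sym_eval_add sym_eval_mult distrib_right)
    qed
  qed
  have "\<exists>g. g \<in> sol R lam UNIV \<and> (\<forall>x\<in>U'. G n x = g x)" if "n \<ge> N" for n
    using sol_extension[OF U'(1) bx Gsol[OF that]] by blast
  then obtain g where g: "\<And>n. n \<ge> N \<Longrightarrow> g n \<in> sol R lam UNIV \<and> (\<forall>x\<in>U'. G n x = g n x)" by metis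
  have "\<exists>h\<in>sol R lam UNIV. \<forall>x\<in>U'. F x = h x"
  proof (rule pointwise_limit[of index_set _ _ "GG x0" "\<lambda>n x. inverse (e n) * g n x"])
    show "finite index_set" by (rule finite_index_set)
    show cs: "csubspace_fun (sol R lam UNIV)" by (rule sol_csubspace[OF open_UNIV])
    show "\<exists>c. \<forall>x\<in>U'. f x = (\<Sum>i\<in>index_set. c i * GG x0 i x)" if "f \<in> sol R lam UNIV" for f
      by (intro exI[of _ "\<lambda>m. pd (DD m) f x0"] ballI)
        (rule representation[OF open_UNIV boxy_UNIV sol_osol[OF open_UNIV that] UNIV_I])
    have "(\<lambda>x. inverse (e n) * g n x) \<in> sol R lam UNIV" if "n \<ge> N" for n
      using cs g[OF that] by (simp add: csubspace_fun_def)
    then show "\<forall>\<^sub>F n in sequentially. (\<lambda>x. inverse (e n) * g n x) \<in> sol R lam UNIV"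
      by (auto simp: eventually_sequentially)
    fix x assume x: "x \<in> U'"
    have "(\<lambda>n. G n x / e n) \<longlonglongrightarrow> F x" unfolding G_def e_def by (rule mollify_tendsto[OF F \<delta>(1) ballK[OF x]])
    moreover have "\<forall>\<^sub>F n in sequentially. G n x / e n = inverse (e n) * g n x"
      using eventually_ge_at_top[of N] by eventually_elim (use g x in \<open>simp add: divide_inverse\<close>)
    ultimately show "(\<lambda>n. inverse (e n) * g n x) \<longlonglongrightarrow> F x" by (rule Lim_transform_eventually)
  qed
  then show ?thesis using U' by blast
qed

end

section \<open>Solutions of the boundary value problem are propagated\<close>

text \<open>At a real point \<xi> the value is |\<xi>|^2 for every orthonormal basis; thus the basis
  may be adapted to a wall.\<close>

lemma laplacian_invariant:
  assumes S: "pairwise orthogonal S" "\<And>x. x \<in> S \<Longrightarrow> norm x = 1" "span S = UNIV" "finite S"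
  shows "sym_invariant R (\<Sum>e\<in>S. sym_vec e * sym_vec (e::'a::euclidean_space))"
proof -
  have "sym_eval (real_point \<xi>) (\<Sum>e\<in>S. sym_vec e * sym_vec e) = complex_of_real (\<xi> \<bullet> \<xi>)" for \<xi> :: 'a
  proof -
    have "linear (real_point \<xi>)"
      by (auto intro!: linearI simp: real_point_def inner_add_right scaleR_conv_of_real)
    then have "sym_eval (real_point \<xi>) (sym_vec e) = complex_of_real (\<xi> \<bullet> e)" for e :: 'a
      by (simp add: sym_eval_vec) (simp add: real_point_def)
    then have "sym_eval (real_point \<xi>) (\<Sum>e\<in>S. sym_vec e * sym_vec e) = complex_of_real (\<Sum>e\<in>S. (\<xi> \<bullet> e) * (\<xi> \<bullet> e))"
      by (simp add: sym_eval_sum sym_eval_mult)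
    also have "(\<Sum>e\<in>S. (\<xi> \<bullet> e) * (\<xi> \<bullet> e)) = \<xi> \<bullet> (\<Sum>e\<in>S. (\<xi> \<bullet> e) *\<^sub>R e)" by (simp add: inner_sum_right)
    also have "(\<Sum>e\<in>S. (\<xi> \<bullet> e) *\<^sub>R e) = \<xi>" by (rule orthonormal_basis_expand[OF S(1,2)]) (simp_all add: S(3,4))
    finally show ?thesis .
  qed
  then show ?thesis by (simp add: sym_invariant_def weyl_inner)
qed

lemma dir_deriv_tangential:
  assumes f: "smooth_on UNIV f" and N: "open N" and z: "z \<in> N" "aeval s z = 0" and e: "fst s \<bullet> e = 0"
    and f0: "\<And>z. z \<in> N \<Longrightarrow> aeval s z = 0 \<Longrightarrow> f z = 0"
  shows "dir_deriv e f z = 0"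
proof -
  have D: "((\<lambda>t. f (z + t *\<^sub>R e)) has_vector_derivative dir_deriv e f (z + 0 *\<^sub>R e)) (at 0)"
    by (rule has_vector_derivative_dir_deriv[where x=z and t=0 and v=e, OF smooth_onD(1)[OF f UNIV_I]])
  have "((\<lambda>t. f (z + t *\<^sub>R e)) has_vector_derivative 0) (at 0)"
  proof (rule has_vector_derivative_transform_within_open[OF has_vector_derivative_const])
    show "open ((\<lambda>t. z + t *\<^sub>R e) -` N)" by (intro open_vimage N continuous_intros)
    show "0 \<in> (\<lambda>t. z + t *\<^sub>R e) -` N" using z by simp
    show "\<And>t. t \<in> (\<lambda>t. z + t *\<^sub>R e) -` N \<Longrightarrow> 0 = f (z + t *\<^sub>R e)"
      using f0 z(2) e by (simp add: aeval_def inner_add_right)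
  qed
  then show ?thesis using vector_derivative_unique_at[OF D] by simp
qed

context hecke_setup
begin

text \<open>Cauchy data on a piece of a wall determine an eigenfunction, because the Laplacian is among the
  invariant operators: it expresses the second normal derivative by tangential ones.\<close>

lemma wall_vanish:
  assumes s: "s \<in> S" and h: "h \<in> EV" and N: "open N" and y: "y \<in> N" "aeval s y = 0"
    and z: "\<And>z. z \<in> N \<Longrightarrow> aeval s z = 0 \<Longrightarrow> h z = 0 \<and> dir_deriv (coroot (fst s)) h z = 0"
  shows "h = (\<lambda>x. 0)"
proof -
  define d where "d = coroot (fst s)"
  have dnz: "d \<noteq> 0" unfolding d_def by (rule coroot_nonzero[OF S_nz[OF s]])
  define e0 where "e0 = inverse (norm d) *\<^sub>R d"
  have "norm e0 = 1" using dnz by (simp add: e0_def)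
  then obtain O' where O': "e0 \<in> O'" "pairwise orthogonal O'" "\<And>x. x \<in> O' \<Longrightarrow> norm x = 1" "independent O'" "span O' = UNIV"
    using vector_in_orthonormal_basis[of e0] by metis
  have fO: "finite O'" using O'(4) by (rule independent_imp_finite)
  have tang: "fst s \<bullet> e = 0" if e: "e \<in> O'" "e \<noteq> e0" for e
  proof -
    have "e0 \<bullet> e = 0" using pairwiseD[OF O'(2,1) e(1)] e(2) by (auto simp: orthogonal_def)
    then show ?thesis using dnz S_nz[OF s] by (simp add: e0_def d_def coroot_def)
  qed
  \<comment> \<open>The solutions whose Cauchy data vanish on the wall inside N. This space turns
    out to be stable under all derivatives, so every derivative of h vanishes at y.\<close>
  define K where "K = {f \<in> EV. \<forall>z\<in>N. aeval s z = 0 \<longrightarrow> f z = 0 \<and> dir_deriv e0 f z = 0}"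
  have KEV: "f \<in> EV" if "f \<in> K" for f using that by (simp add: K_def)
  have K0: "f z = 0" "dir_deriv e0 f z = 0" if "f \<in> K" "z \<in> N" "aeval s z = 0" for f z using that by (auto simp: K_def)
  have Kadd: "(\<lambda>x. f x + g x) \<in> K" if "f \<in> K" "g \<in> K" for f g
    using that EV_add[OF KEV KEV, OF that] dir_deriv_add[OF smooth_onD(1)[OF EV_smooth[OF KEV[OF that(1)]] UNIV_I] smooth_onD(1)[OF EV_smooth[OF KEV[OF that(2)]] UNIV_I]]
    by (auto simp: K_def)
  have Kscale: "(\<lambda>x. c * f x) \<in> K" if "f \<in> K" for f c
    using that EV_scale[OF KEV[OF that]] dir_deriv_cmult[OF smooth_onD(1)[OF EV_smooth[OF KEV[OF that]] UNIV_I]]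
    by (auto simp: K_def)
  have Kzero: "(\<lambda>x. 0) \<in> K" using EV_zero by (simp add: K_def)
  have Ksum: "(\<lambda>x. \<Sum>e\<in>A. c e * f e x) \<in> K" if "\<And>e. e \<in> A \<Longrightarrow> f e \<in> K" for A :: "'a set" and c f
    using that
  proof (induction A rule: infinite_finite_induct)
    case (insert e A)
    then show ?case using Kadd[OF Kscale[of "f e" "c e"]] by simp
  qed (simp_all add: Kzero)
  have Ktang: "dir_deriv e f \<in> K" if e: "e \<in> O'" "e \<noteq> e0" and f: "f \<in> K" for e f
  proof -
    have "dir_deriv e f z = 0" if "z \<in> N" "aeval s z = 0" for z
      by (rule dir_deriv_tangential[OF EV_smooth[OF KEV[OF f]] N that tang[OF e] K0(1)[OF f]])
    moreover have "dir_deriv e0 (dir_deriv e f) z = 0" if "z \<in> N" "aeval s z = 0" for z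
    proof -
      have "dir_deriv e0 (dir_deriv e f) z = dir_deriv e (dir_deriv e0 f) z"
        by (rule dir_deriv_commute[OF open_UNIV smooth_onD(4)[OF EV_smooth[OF KEV[OF f]]] UNIV_I])
      also have "\<dots> = 0"
        by (rule dir_deriv_tangential[OF EV_smooth[OF EV_dir_deriv[OF KEV[OF f]]] N that tang[OF e] K0(2)[OF f]])
      finally show ?thesis .
    qed
    ultimately show ?thesis using EV_dir_deriv[OF KEV[OF f]] by (simp add: K_def)
  qed
  have Knorm: "dir_deriv e0 f \<in> K" if f: "f \<in> K" for f
  proof -
    note sf = EV_smooth[OF KEV[OF f]]
    let ?L = "\<Sum>e\<in>O'. sym_vec e * sym_vec e"
    have "dir_deriv e0 (dir_deriv e0 f) z = 0" if z: "z \<in> N" "aeval s z = 0" for z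
    proof -
      have L: "?L \<in> sym_algebra" by (intro sym_algebra_sum sym_algebra_mult sym_algebra_vec)
      have dd: "pd (sym_vec e * sym_vec e) f z = dir_deriv e (dir_deriv e f) z" for e
      proof -
        have "pd (sym_vec e * sym_vec e) f z = pd (sym_vec e) (pd (sym_vec e) f) z" by (rule pd_mult[OF open_UNIV sf UNIV_I])
        also have "pd (sym_vec e) f = dir_deriv e f" by (rule ext) (rule pd_vec[OF open_UNIV sf UNIV_I])
        also have "pd (sym_vec e) (dir_deriv e f) z = dir_deriv e (dir_deriv e f) z"
          by (rule pd_vec[OF open_UNIV smooth_onD(2)[OF sf] UNIV_I])
        finally show ?thesis .
      qed
      have "pd ?L f z = sym_eval lam ?L * f z"
        by (rule solD(2)[OF KEV[OF f] L laplacian_invariant[OF O'(2,3,5) fO] UNIV_I])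
      then have "(\<Sum>e\<in>O'. dir_deriv e (dir_deriv e f) z) = 0" by (simp add: pd_sum dd K0(1)[OF f z])
      moreover have "(\<Sum>e\<in>O' - {e0}. dir_deriv e (dir_deriv e f) z) = 0"
      proof (rule sum.neutral, rule ballI)
        fix e assume e: "e \<in> O' - {e0}"
        show "dir_deriv e (dir_deriv e f) z = 0"
          by (rule dir_deriv_tangential[OF EV_smooth[OF KEV[OF Ktang[OF _ _ f]]] N z tang K0(1)[OF Ktang[OF _ _ f]]]) (use e in auto)
      qed
      ultimately show ?thesis by (simp add: sum.remove[OF fO O'(1)])
    qed
    then show ?thesis using EV_dir_deriv[OF KEV[OF f]] K0(2)[OF f] by (simp add: K_def)
  qed
  have Kdd: "dir_deriv v f \<in> K" if f: "f \<in> K" for v f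
  proof -
    have v: "v = (\<Sum>e\<in>O'. (v \<bullet> e) *\<^sub>R e)"
      by (rule orthonormal_basis_expand[OF O'(2,3), symmetric]) (simp_all add: O'(5) fO)
    have "dir_deriv v f x = (\<Sum>e\<in>O'. complex_of_real (v \<bullet> e) * dir_deriv e f x)" for x
    proof -
      interpret linear "\<lambda>v. dir_deriv v f x" by (rule dir_deriv_linear[OF smooth_onD(1)[OF EV_smooth[OF KEV[OF f]] UNIV_I]])
      show ?thesis by (subst v) (simp add: sum scale scaleR_conv_of_real)
    qed
    moreover have "(\<lambda>x. \<Sum>e\<in>O'. complex_of_real (v \<bullet> e) * dir_deriv e f x) \<in> K"
      by (rule Ksum) (use Ktang Knorm f in blast)
    ultimately show ?thesis by presburger
  qed
  have hK: "h \<in> K"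
  proof -
    have "dir_deriv e0 h z = 0" if "z \<in> N" "aeval s z = 0" for z
    proof -
      interpret linear "\<lambda>v. dir_deriv v h z" by (rule dir_deriv_linear[OF smooth_onD(1)[OF EV_smooth[OF h] UNIV_I]])
      show ?thesis using z[OF that] by (simp add: e0_def scale d_def)
    qed
    then show ?thesis using h z by (simp add: K_def)
  qed
  have pdK: "pd q h \<in> K" if "q \<in> sym_algebra" for q
    using that
  proof (induction rule: sym_algebra_induct)
    case (const c)
    have "pd (sym_const c) h = (\<lambda>x. c * h x)" by (rule ext) (rule pd_const)
    then show ?case using Kscale[OF hK, of c] by (simp only:)
  next
    case (vec v q)
    have "pd (sym_vec v * q) h = dir_deriv v (pd q h)"
      unfolding pd_comp[OF h] by (rule ext) (rule pd_vec[OF open_UNIV EV_smooth[OF EV_pd[OF h]] UNIV_I])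
    then show ?case using Kdd[OF vec.IH] by (simp only:)
  next
    case (add p q)
    have "pd (p + q) h = (\<lambda>x. pd p h x + pd q h x)" by (rule ext) (rule pd_add)
    then show ?case using Kadd[OF add.IH] by (simp only:)
  qed
  show ?thesis
  proof (rule sol_unique[OF h EV_zero, of y])
    fix q :: "'a sympoly" assume "q \<in> sym_algebra"
    then have "pd q h y = 0" using K0(1)[OF pdK y] by simp
    moreover have "pd q (\<lambda>x. 0) y = 0"
      using pd_fun_scale[OF open_UNIV smooth_on_const UNIV_I, of q 0 0] by simp
    ultimately show "pd q h y = pd q (\<lambda>x. 0) y" by simp
  qed
qed

section \<open>From solutions of the boundary value problem back to eigenfunctions\<close>

lemma BVPD:
  assumes "F \<in> BVP R B \<phi> k lam"
  shows "continuous_on UNIV F"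
    and "a \<in> Pos \<Longrightarrow> subregular R B \<phi> a v \<Longrightarrow> jump_condition k a F v"
    and "p \<in> real_sym_algebra \<Longrightarrow> sym_invariant R p \<Longrightarrow> distributional_eigen reg p (sym_eval lam p) F"
  using assms by (auto simp: BVP_def CB1_def)

text \<open>Regularity produces an eigenfunction near each point only. By uniqueness the germs are
  locally constant, hence constant on the connected alcove, and continuity of F carries the equality
  to the closure.\<close>

lemma alcove_eigenfunction:
  assumes F: "F \<in> BVP R B \<phi> k lam" and w: "w \<in> W"
  shows "\<exists>g\<in>EV. \<forall>x. w x \<in> Cb \<longrightarrow> F x = g (w x)"
proof -
  define A where "A = w -` C"
  have A: "open A" "A = inv w ` C" unfolding A_def using open_preC[OF w] W_image[OF W_inv[OF w], of C] w
    by (simp_all add: inv_inv_eq W_bij)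
  have conA: "connected A" unfolding A(2)
    by (rule connected_continuous_image) (use W_continuous[OF W_inv[OF w]] continuous_on_subset convex_connected convex_C in blast)+
  have Areg: "A \<subseteq> reg" unfolding A_def using C_reg reg_W[OF w] by auto
  define nbh where "nbh x f U \<longleftrightarrow> open U \<and> x \<in> U \<and> (\<forall>z\<in>U. F z = f z)" for x f U
  define loc where "loc x f \<longleftrightarrow> f \<in> EV \<and> (\<exists>U. nbh x f U)" for x f
  have ex: "\<exists>f. loc x f" if "x \<in> A" for x
    using weak_solution_local[OF BVPD(1)[OF F] open_reg _ BVPD(3)[OF F], of x] that Areg unfolding loc_def nbh_def by blast
  have uniq: "f = f'" if l: "loc x f" "loc x f'" for x f f'
  proof -
    obtain U U' where nb: "nbh x f U" "nbh x f' U'" using l unfolding loc_def by blast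
    note U = nb(1)[unfolded nbh_def, THEN conjunct1] nb(1)[unfolded nbh_def, THEN conjunct2, THEN conjunct1]
      nb(1)[unfolded nbh_def, THEN conjunct2, THEN conjunct2]
    note U' = nb(2)[unfolded nbh_def, THEN conjunct1] nb(2)[unfolded nbh_def, THEN conjunct2, THEN conjunct1]
      nb(2)[unfolded nbh_def, THEN conjunct2, THEN conjunct2]
    have eq: "f z = f' z" if "z \<in> U \<inter> U'" for z using U(3) U'(3) that by (metis IntD1 IntD2)
    have EV: "f \<in> EV" "f' \<in> EV" using l by (simp_all add: loc_def)
    show ?thesis
      by (rule sol_eq_on_open[OF EV open_Int[OF U(1) U'(1)] _ eq]) (use U(2) U'(2) in blast)
  qed
  define germ where "germ x = (SOME f. loc x f)" for x
  have germ: "loc x (germ x)" if "x \<in> A" for x unfolding germ_def by (rule someI_ex[OF ex[OF that]])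
  have const: "germ x = germ x'" if "x \<in> A" "x' \<in> A" for x x'
  proof (rule connected_local_const[OF conA that], rule ballI)
    fix x assume x: "x \<in> A"
    obtain U where nb: "germ x \<in> EV" "nbh x (germ x) U" using germ[OF x] unfolding loc_def by blast
    have U: "open U" "x \<in> U" using nb(2) by (simp_all add: nbh_def)
    have "\<forall>\<^sub>F z in at x within A. z \<in> U \<and> z \<in> A"
      using eventually_at_in_open'[OF U] by (auto simp: eventually_at_filter elim: eventually_mono)
    then show "\<forall>\<^sub>F z in at x within A. germ x = germ z"
    proof eventually_elim
      case (elim z)
      then have "nbh z (germ x) U" using nb(2) by (simp add: nbh_def)
      then have "loc z (germ x)" using nb(1) unfolding loc_def by blast
      then show ?case by (rule uniq[OF _ germ]) (use elim in simp)
    qed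
  qed
  obtain c where "c \<in> C" using C_nonempty by blast
  then have c: "inv w c \<in> A" using A(2) by blast
  define f where "f = germ (inv w c)"
  have f: "f \<in> EV" unfolding f_def using germ[OF c] by (simp add: loc_def)
  have Ff: "F x = f x" if "x \<in> A" for x
    using germ[OF that] const[OF that c] unfolding f_def loc_def nbh_def by auto
  define g where "g x = f (inv w x)" for x
  have g: "g \<in> EV" unfolding g_def[abs_def] by (rule EV_W[OF f W_inv[OF w]])
  have "F (inv w y) = g y" if "y \<in> Cb" for y
  proof -
    have "closed {y. F (inv w y) = g y}"
      by (intro closed_Collect_eq smooth_onD(3)[OF EV_smooth[OF g]] continuous_on_compose2[OF BVPD(1)[OF F] W_continuous[OF W_inv[OF w]]]) simp
    moreover have "C \<subseteq> {y. F (inv w y) = g y}" using Ff A(2) by (auto simp: g_def)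
    ultimately have "closure C \<subseteq> {y. F (inv w y) = g y}" by (rule closure_minimal[rotated])
    then show ?thesis using that closure_C by blast
  qed
  then have "F x = g (w x)" if "w x \<in> Cb" for x using that w by (metis W_inv_simps(2))
  then show ?thesis using g by blast
qed

lemma jump_matching:
  assumes F: "F \<in> BVP R B \<phi> k lam" and w: "w \<in> W" and s: "s \<in> S" and a: "act (inv w) s \<in> Pos"
    and g: "g \<in> EV" "\<And>x. w x \<in> Cb \<Longrightarrow> F x = g (w x)"
    and g': "g' \<in> EV" "\<And>x. arefl s (w x) \<in> Cb \<Longrightarrow> F x = g' (arefl s (w x))"
  shows "g' = Q s g"
proof -
  have sS: "s \<in> Sig" using s S_Sig by blast
  have snz: "fst s \<noteq> 0" by (rule S_nz[OF s])
  define r where "r = act (inv w) s"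
  have r: "r \<in> Pos" "act w r = s" unfolding r_def by (rule a) (rule act_inv(1)[OF w])
  define d where "d = coroot (fst r)"
  define d' where "d' = coroot (fst s)"
  have wd: "lin w d = d'" unfolding d_def d'_def r(2)[symmetric] act_def by (simp add: coroot_weyl[OF lin(1)[OF w]])
  have rd: "inner (fst r) d = 2" using Sig_fst(3)[OF Pos_Sig[OF r(1)]] by (simp add: d_def coroot_inner)
  have sw: "aeval s (w x) = aeval r x" for x using aeval_act[OF w, of r x] r(2) by simp
  have refl_d': "refl (fst s) d' = - d'" using snz by (simp add: d'_def refl_def coroot_inner scaleR_2)
  have sd': "fst s \<bullet> d' = 2" using snz by (simp add: d'_def coroot_inner)
  let ?sw = "arefl s \<circ> w"
  have swW: "?sw \<in> W" by (rule W_comp[OF W_arefl[OF sS] w])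
  have Qg: "Q s g \<in> EV" by (rule Q_EV[OF g(1) sS])
  define h where "h x = g' x - Q s g x" for x
  have h: "h \<in> EV" unfolding h_def using EV_add[OF g'(1) EV_scale[OF Qg, of "-1"]] by simp
  have neg: "dir_deriv (- d') f x = - dir_deriv d' f x" if "f \<in> EV" for f x
    by (rule linear_neg[OF dir_deriv_linear[OF smooth_onD(1)[OF EV_smooth[OF that] UNIV_I]]])
  define N where "N = {z. \<forall>t\<in>S - {s}. aeval t z > 0 \<and> aeval t (arefl s z) > 0}"
  have cont: "continuous_on UNIV (\<lambda>y. aeval t (u y))" if "u \<in> W" for t u
    unfolding aeval_def by (intro continuous_intros W_continuous[OF that])
  have oN: "open N"
  proof -
    have "N = (\<Inter>t\<in>S - {s}. {y. 0 < aeval t (id y)} \<inter> {y. 0 < aeval t (arefl s y)})" by (auto simp: N_def)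
    also have "open \<dots>"
      by (intro open_INT finite_Diff finite_S ballI open_Int open_Collect_less continuous_on_const cont W_id W_arefl sS)
    finally show ?thesis .
  qed
  have near: "h z = 0 \<and> dir_deriv d' h z = 0" if zN: "z \<in> N" and z0: "aeval s z = 0" for z
  proof -
    have fixz: "arefl s z = z" using z0 by (simp add: arefl_def)
    have pos: "\<forall>t\<in>S - {s}. aeval t z > 0" using zN by (simp add: N_def)
    have "aeval t z \<ge> 0" if "t \<in> S" for t 
    proof (cases "t = s")
      case False
      then have "t \<in> S - {s}" using that by blast
      then show ?thesis by (intro less_imp_le bspec[OF pos])
    qed (simp add: z0)
    then have zCb: "z \<in> Cb" by (simp add: Cb_def)
    define v where "v = inv w z"
    have wv: "w v = z" unfolding v_def using w by simp
    have Fv: "F v = g z" "F v = g' z" using g(2)[of v] g'(2)[of v] zCb wv fixz by simp_all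
    have Qz: "Q s f z = f z" for f by (rule Q_wall[OF z0])
    have hz: "h z = 0" using Fv by (simp add: h_def Qz)
    \<comment> \<open>Another positive root vanishing at v would go, up to sign, to a positive root
      other than s vanishing at z, which \<open>Pos_wall_pos\<close> excludes.\<close>
    have "subregular R B \<phi> r v" unfolding subregular_def
    proof (intro conjI ballI impI)
      show "aeval r v = 0" using sw[of v] wv z0 by simp
      fix b assume b: "b \<in> Pos" "b \<noteq> r"
      have bS: "act w b \<in> Sig" by (rule act_Sig[OF w Pos_Sig[OF b(1)]])
      obtain c where c: "c \<in> Pos" "c = act w b \<or> c = - act w b" using Pos_cases[OF bS] by blast
      have "c \<noteq> s"
      proof
        assume cs: "c = s"
        have "b = r \<or> b = - r" using c(2) unfolding cs
        proof
          assume "s = act w b"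
          then show ?thesis unfolding r_def using act_inv(2)[OF w, of b] by simp
        next
          assume "s = - act w b"
          then have "r = - b" unfolding r_def using act_inv(2)[OF w, of b] act_uminus[OF W_inv[OF w], of "act w b"] by simp
          then show ?thesis by simp
        qed
        then show False using b r(1) Pos_not_uminus by (metis minus_minus)
      qed
      then have "aeval c z > 0" by (rule Pos_wall_pos[OF c(1) s _ z0 pos])
      then show "aeval b v \<noteq> 0" using c(2) aeval_act[OF w, of b v] wv by (auto simp: aeval_uminus)
    qed
    from BVPD(2)[OF F r(1) this] obtain l1 l2 where
      l1: "((\<lambda>t. dir_deriv d F (v + t *\<^sub>R d)) \<longlongrightarrow> l1) (at_right 0)" and
      l2: "((\<lambda>t. dir_deriv d F (v - t *\<^sub>R d)) \<longlongrightarrow> l2) (at_right 0)" and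
      l: "l1 - l2 = 2 * complex_of_real (k r) * F v"
      unfolding jump_condition_def Let_def d_def by blast
    define P1 where "P1 = w -` N \<inter> {y. 0 < aeval r y}"
    define P2 where "P2 = w -` N \<inter> {y. aeval r y < 0}"
    have oP: "open P1" "open P2" unfolding P1_def P2_def aeval_def
      by (intro open_Int open_vimage[OF oN W_continuous[OF w]] open_Collect_less continuous_intros)+
    have T1: "F y = g (w y)" if "y \<in> P1" for y
      by (rule g(2)) (use that sw in \<open>auto simp: P1_def N_def Cb_def intro: less_imp_le\<close>)
    have T2: "F y = g' (?sw y)" if y: "y \<in> P2" for y unfolding comp_apply
    proof (rule g'(2))
      have "aeval s (arefl s (w y)) > 0" using y sw aeval_arefl_self[OF snz] by (simp add: P2_def)
      then show "arefl s (w y) \<in> Cb" using y by (auto simp: P2_def N_def Cb_def intro: less_imp_le)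
    qed
    have D1: "dir_deriv d F y = dir_deriv d' g (w y)" if "y \<in> P1" for y
      using dir_deriv_cong_open[OF oP(1) that T1, where v=d] dir_deriv_W[OF EV_smooth[OF g(1)] w] wd by simp
    have D2: "dir_deriv d F y = - dir_deriv d' g' (?sw y)" if "y \<in> P2" for y
    proof -
      have "dir_deriv d F y = dir_deriv d (\<lambda>y. g' (?sw y)) y" by (rule dir_deriv_cong_open[OF oP(2) that T2])
      also have "\<dots> = dir_deriv (lin ?sw d) g' (?sw y)" by (rule dir_deriv_W[OF EV_smooth[OF g'(1)] swW])
      also have "lin ?sw d = - d'" unfolding lin_arefl_comp[OF w] wd refl_d' ..
      finally show ?thesis by (simp add: neg[OF g'(1)])
    qed
    have lim: "((\<lambda>t. f (u (v + (c * t) *\<^sub>R d))) \<longlongrightarrow> f (u v)) (at_right 0)" if "f \<in> EV" "u \<in> W" for f u and c :: real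
    proof -
      have "isCont (\<lambda>t. f (u (v + (c * t) *\<^sub>R d))) 0"
        by (rule continuous_on_interior[of UNIV])
          (intro continuous_on_compose2[OF smooth_onD(3)[OF EV_smooth[OF EV_W[OF that]]]] continuous_intros, simp_all)
      then show ?thesis by (simp add: isCont_def filterlim_at_split)
    qed
    have in_N: "\<forall>\<^sub>F t in at_right 0. w (v + (c * t) *\<^sub>R d) \<in> N" for c :: real
    proof -
      have "((\<lambda>t. v + (c * t) *\<^sub>R d) \<longlongrightarrow> v + (c * 0) *\<^sub>R d) (at_right 0)" by (intro tendsto_intros)
      then show ?thesis using topological_tendstoD[OF _ open_vimage[OF oN W_continuous[OF w]]] zN wv by fastforce
    qed
    have pos0: "\<forall>\<^sub>F t::real in at_right 0. t > 0" by (simp add: eventually_at_right_less)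
    have aval: "aeval r (v + t *\<^sub>R d) = 2 * t" for t
      using sw[of v] wv z0 rd by (simp add: aeval_def inner_add_right algebra_simps)
    have "((\<lambda>t. dir_deriv d F (v + t *\<^sub>R d)) \<longlongrightarrow> dir_deriv d' g z) (at_right 0)"
    proof (rule tendsto_cong[THEN iffD2])
      show "\<forall>\<^sub>F t in at_right 0. dir_deriv d F (v + t *\<^sub>R d) = dir_deriv d' g (w (v + (1 * t) *\<^sub>R d))"
        using in_N[of 1] pos0
      proof eventually_elim
        case (elim t)
        then show ?case using D1[of "v + t *\<^sub>R d"] aval[of t] by (simp add: P1_def)
      qed
      show "((\<lambda>t. dir_deriv d' g (w (v + (1 * t) *\<^sub>R d))) \<longlongrightarrow> dir_deriv d' g z) (at_right 0)"
        using lim[OF EV_dir_deriv[OF g(1)] w, where c=1] unfolding wv .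
    qed
    then have 1: "l1 = dir_deriv d' g z" using tendsto_unique[OF _ l1] by simp
    have "((\<lambda>t. dir_deriv d F (v - t *\<^sub>R d)) \<longlongrightarrow> - dir_deriv d' g' z) (at_right 0)"
    proof (rule tendsto_cong[THEN iffD2])
      show "\<forall>\<^sub>F t in at_right 0. dir_deriv d F (v - t *\<^sub>R d) = - dir_deriv d' g' (?sw (v + (- 1 * t) *\<^sub>R d))"
        using in_N[of "-1"] pos0
      proof eventually_elim
        case (elim t)
        then show ?case using D2[of "v - t *\<^sub>R d"] aval[of "- t"] by (simp add: P2_def)
      qed
      have "?sw v = z" using fixz wv by simp
      then show "((\<lambda>t. - dir_deriv d' g' (?sw (v + (- 1 * t) *\<^sub>R d))) \<longlongrightarrow> - dir_deriv d' g' z) (at_right 0)"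
        using tendsto_minus[OF lim[OF EV_dir_deriv[OF g'(1)] swW, where c="- 1"]] by (simp only:)
    qed
    then have 2: "l2 = - dir_deriv d' g' z" using tendsto_unique[OF _ l2] by simp
    have krs: "k s = k r" using k_act[OF w Pos_Sig[OF r(1)]] r(2) by simp
    \<comment> \<open>On the other side of the wall the normal derivative changes its sign, so the
      jump condition reads dg + dg' = 2 k g. This is what \<open>Q_dir_deriv\<close> yields for Q_s
      g on the wall.\<close>
    have Dg': "dir_deriv d' g' z = 2 * complex_of_real (k s) * g z - dir_deriv d' g z"
      using l unfolding 1 2 krs Fv(1) by (simp add: eq_diff_eq add.commute)
    have "dir_deriv d' (Q s g) z = - dir_deriv d' g z + 2 * complex_of_real (k s) * g z"
      unfolding Q_dir_deriv[OF EV_smooth[OF g(1)] sS] Qz refl_d' neg[OF g(1)] sd' by simp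
    moreover have "dir_deriv d' h z = dir_deriv d' g' z - dir_deriv d' (Q s g) z"
      unfolding h_def
      by (rule dir_deriv_eq) (intro derivative_intros has_derivative_dir_deriv smooth_onD(1)[OF EV_smooth[OF g'(1)]] smooth_onD(1)[OF EV_smooth[OF Qg]] UNIV_I)
    ultimately show ?thesis using hz by (simp add: Dg')
  qed
  obtain y where y: "aeval s y = 0" "\<forall>t\<in>S - {s}. aeval t y > 0" using wall_point[OF s] by blast
  have "y \<in> N" using y by (simp add: N_def arefl_def)
  then have "h = (\<lambda>x. 0)"
    by (rule wall_vanish[OF s h oN _ y(1)]) (use near d'_def in blast)
  then have "h x = 0" for x by simp
  then show ?thesis by (auto simp: h_def fun_eq_iff)
qed

theorem BVP_T: assumes F: "F \<in> BVP R B \<phi> k lam" shows "\<exists>f\<in>EV. F = T f"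
proof -
  obtain g where g: "\<And>w. w \<in> W \<Longrightarrow> g w \<in> EV" "\<And>w x. w \<in> W \<Longrightarrow> w x \<in> Cb \<Longrightarrow> F x = g w (w x)"
    using alcove_eigenfunction[OF F] by metis
  have step: "g (arefl s \<circ> w) = Q s (g w)" if s: "s \<in> S" and w: "w \<in> W" for s w
  proof -
    have sS: "s \<in> Sig" using s S_Sig by blast
    define w' where "w' = arefl s \<circ> w"
    have w': "w' \<in> W" unfolding w'_def by (rule W_comp[OF W_arefl[OF sS] w])
    have ss: "arefl s (w' x) = w x" "arefl s (w x) = w' x" for x using S_nz[OF s] by (simp_all add: w'_def)
    show ?thesis
    proof (cases "act (inv w) s \<in> Pos")
      case True
      show ?thesis unfolding w'_def[symmetric]
        by (rule jump_matching[OF F w s True g(1)[OF w] g(2)[OF w] g(1)[OF w']]) (use g(2)[OF w'] ss in simp_all)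
    next
      \<comment> \<open>The jump condition is stated for positive roots. Here the positive one
        belongs to s w, so w and s w exchange their roles, and Q_s is inverted as an
        involution.\<close>
      case False
      have "act w' (- act (inv w) s) = s"
        unfolding w'_def act_comp[OF W_arefl[OF sS] w] act_uminus[OF w] act_inv(1)[OF w] act_uminus[OF W_arefl[OF sS]] act_self[OF sS] by simp
      then have "act (inv w') s = - act (inv w) s" using act_inv(2)[OF w'] by metis
      then have pos: "act (inv w') s \<in> Pos"
        using Pos_cases[OF act_Sig[OF W_inv[OF w] sS]] False by simp
      have "g w = Q s (g w')"
        by (rule jump_matching[OF F w' s pos g(1)[OF w'] g(2)[OF w'] g(1)[OF w]]) (use g(2)[OF w] ss in simp_all)
      then show ?thesis unfolding w'_def[symmetric] using Q_Q[OF s g(1)[OF w']] by simp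
    qed
  qed
  have word: "set ws \<subseteq> S \<Longrightarrow> g (wmap ws) = Qw ws (g id)" for ws
  proof (induction ws)
    case Nil
    show ?case unfolding wmap_simps(1) Qw_Nil ..
  next
    case (Cons s ws)
    then have "s \<in> S" "set ws \<subseteq> S" by auto
    then show ?case unfolding wmap_simps(2) Qw_Cons using step[OF _ wmap_W] Cons.IH by metis
  qed
  have "F x = T (g id) x" for x
  proof -
    obtain w where w: "w \<in> W" "w x \<in> Cb" using to_chamber by blast
    obtain ws where ws: "set ws \<subseteq> S" "w = wmap ws" using W_word[OF w(1)] by blast
    have "QW w (g id) = g w" using word[OF ws(1)] QW_word[OF ws(1) g(1)[OF W_id]] unfolding ws(2) by metis
    then show ?thesis using T_eval[OF g(1)[OF W_id] w] g(2)[OF w] by metis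
  qed
  then show ?thesis using g(1)[OF W_id] by blast
qed

section \<open>The isomorphisms\<close>

text \<open>pi_k acts on functions on the regular set, so T is followed by restriction; no
  information is lost because f is already determined by T f on \<open>C\<close>.\<close>

abbreviation \<Phi> :: "('a \<Rightarrow> complex) \<Rightarrow> 'a \<Rightarrow> complex" where
  "\<Phi> f \<equiv> reg_restrict R B \<phi> (T f)"

lemma \<Phi>_inj: assumes "f \<in> EV" "g \<in> EV" "\<Phi> f = \<Phi> g" shows "f = g"
proof (rule T_inj[OF assms(1,2)])
  fix x assume "x \<in> C"
  then have "x \<in> reg" using C_reg by blast
  then show "T f x = T g x" using fun_cong[OF assms(3), of x] by (simp add: reg_restrict_def)
qed

lemma \<Phi>_linear: "clinear_fun_on EV \<Phi>"
  unfolding clinear_fun_on_def by (auto simp: T_add T_scale reg_restrict_def)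

lemma BVP_eq: "BVP R B \<phi> k lam = T ` EV"
  using T_BVP BVP_T by blast

lemma BVP_pi_eq: "BVP_pi R B \<phi> k lam = \<Phi> ` EV"
  unfolding BVP_pi_def BVP_eq image_image ..

lemma csubspace_image:
  assumes "csubspace_fun M" "clinear_fun_on M A" shows "csubspace_fun (A ` M)"
proof -
  note M = assms(1)[unfolded csubspace_fun_def] and A = assms(2)[unfolded clinear_fun_on_def]
  have z: "(\<lambda>x. 0) \<in> M" using M by blast
  have "A (\<lambda>x. 0 * (\<lambda>x. 0) x) = (\<lambda>x. 0 * A (\<lambda>x. 0) x)" by (rule A[THEN conjunct2, rule_format, OF z])
  then have z': "(\<lambda>x. 0) \<in> A ` M" using imageI[OF z, of A] by simp
  show ?thesis
    unfolding csubspace_fun_def ball_simps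
  proof (intro conjI ballI allI z')
    fix f assume f: "f \<in> M"
    show "(\<lambda>x. c * A f x) \<in> A ` M" for c
    proof -
      have "A (\<lambda>x. c * f x) = (\<lambda>x. c * A f x)" "(\<lambda>x. c * f x) \<in> M" using A M f by blast+
      then show ?thesis by (metis imageI)
    qed
    fix g assume g: "g \<in> M"
    have "A (\<lambda>x. f x + g x) = (\<lambda>x. A f x + A g x)" "(\<lambda>x. f x + g x) \<in> M" using A M f g by blast+
    then show "(\<lambda>x. A f x + A g x) \<in> A ` M" by (metis imageI)
  qed
qed

lemma pi_\<Phi>: "f \<in> EV \<Longrightarrow> h \<in> HC \<Longrightarrow> pi_rep R B \<phi> k h (\<Phi> f) = \<Phi> (QR h f)"
  unfolding reg_restrict_cut by (rule pi_T)

lemma pi_module: "hecke_module R mul (\<Phi> ` EV) (pi_rep R B \<phi> k)"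
proof -
  note lin = \<Phi>_linear[unfolded clinear_fun_on_def]
  have add: "\<Phi> (\<lambda>x. f x + g x) = (\<lambda>x. \<Phi> f x + \<Phi> g x)" if "f \<in> EV" "g \<in> EV" for f g using lin that by blast
  have scale: "\<Phi> (\<lambda>x. c * f x) = (\<lambda>x. c * \<Phi> f x)" if "f \<in> EV" for f c using lin that by blast
  have pi_add: "pi_rep R B \<phi> k h (\<lambda>x. \<Phi> f x + \<Phi> g x) = (\<lambda>x. pi_rep R B \<phi> k h (\<Phi> f) x + pi_rep R B \<phi> k h (\<Phi> g) x)"
    if "h \<in> HC" "f \<in> EV" "g \<in> EV" for h f g
    unfolding add[OF that(2,3), symmetric] pi_\<Phi>[OF EV_add[OF that(2,3)] that(1)] QR_lin(1)[OF that]
      add[OF QR_EV[OF that(1,2)] QR_EV[OF that(1,3)]] pi_\<Phi>[OF that(2,1)] pi_\<Phi>[OF that(3,1)] ..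
  have pi_scale: "pi_rep R B \<phi> k h (\<lambda>x. c * \<Phi> f x) = (\<lambda>x. c * pi_rep R B \<phi> k h (\<Phi> f) x)"
    if "h \<in> HC" "f \<in> EV" for h f c
    unfolding scale[OF that(2), symmetric] pi_\<Phi>[OF EV_scale[OF that(2)] that(1)] QR_lin(2)[OF that that(2)]
      scale[OF QR_EV[OF that]] pi_\<Phi>[OF that(2,1)] ..
  note Qm = Q_module[unfolded hecke_module_def]
  show ?thesis
    unfolding hecke_module_def clinear_fun_on_def ball_simps
  proof (intro conjI ballI allI)
    show "csubspace_fun (\<Phi> ` EV)" by (rule csubspace_image[OF EV_csub \<Phi>_linear])
    fix h assume h: "h \<in> HC"
    show "\<And>f g. f \<in> EV \<Longrightarrow> g \<in> EV \<Longrightarrow> pi_rep R B \<phi> k h (\<lambda>x. \<Phi> f x + \<Phi> g x) = (\<lambda>x. pi_rep R B \<phi> k h (\<Phi> f) x + pi_rep R B \<phi> k h (\<Phi> g) x)"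
      by (rule pi_add[OF h])
    show "\<And>c f. f \<in> EV \<Longrightarrow> pi_rep R B \<phi> k h (\<lambda>x. c * \<Phi> f x) = (\<lambda>x. c * pi_rep R B \<phi> k h (\<Phi> f) x)" by (rule pi_scale[OF h])
    show "\<And>f. f \<in> EV \<Longrightarrow> pi_rep R B \<phi> k h (\<Phi> f) \<in> \<Phi> ` EV" using pi_\<Phi>[OF _ h] QR_EV[OF h] by auto
    show "\<And>c f. f \<in> EV \<Longrightarrow> pi_rep R B \<phi> k (hecke_scale c h) (\<Phi> f) = (\<lambda>x. c * pi_rep R B \<phi> k h (\<Phi> f) x)"
      using h by (simp only: pi_\<Phi> HC_scale QR_scale scale[OF QR_EV])
    fix h' assume h': "h' \<in> HC"
    show "\<And>f. f \<in> EV \<Longrightarrow> pi_rep R B \<phi> k (h + h') (\<Phi> f) = (\<lambda>x. pi_rep R B \<phi> k h (\<Phi> f) x + pi_rep R B \<phi> k h' (\<Phi> f) x)"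
      using h h' by (simp only: pi_\<Phi> HC_add QR_add add[OF QR_EV QR_EV])
    show "pi_rep R B \<phi> k (mul h h') (\<Phi> f) = pi_rep R B \<phi> k h (pi_rep R B \<phi> k h' (\<Phi> f))" if "f \<in> EV" for f
    proof -
      have "QR (mul h h') f = QR h (QR h' f)" using acts_mult_all[OF h] h' that by (simp only: acts_mult_def)
      then show ?thesis using h h' that by (simp only: pi_\<Phi> mul_closed QR_EV)
    qed
  next
    show "\<And>f. f \<in> EV \<Longrightarrow> pi_rep R B \<phi> k (hecke_tensor 1 id) (\<Phi> f) = \<Phi> f"
      using Qm by (simp only: pi_\<Phi> HC_tensor sym_algebra_one W_id)
  qed
qed

lemma T_bij: "bij_betw T EV (BVP R B \<phi> k lam)"
  unfolding bij_betw_def BVP_eq by (auto intro!: inj_onI T_inj)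

lemma \<Phi>_iso: "hecke_module_iso R mul EV QR (BVP_pi R B \<phi> k lam) (pi_rep R B \<phi> k) \<Phi>"
  unfolding hecke_module_iso_def clinear_iso_def bij_betw_def BVP_pi_eq
  using Q_module pi_module EV_csub csubspace_image[OF EV_csub \<Phi>_linear] \<Phi>_linear
  by (auto intro!: inj_onI \<Phi>_inj simp: pi_\<Phi>)

definition EI :: "('a \<Rightarrow> complex) set" where "EI = {f \<in> EV. \<forall>w\<in>W. QW w f = f}"

lemma EI_csub: "csubspace_fun EI"
proof -
  have "QW w (\<lambda>x. 0) = (\<lambda>x. 0)" if "w \<in> W" for w
    using QW_lin(2)[OF that EV_zero EV_zero, of 0] by simp
  then show ?thesis
    using EV_csub unfolding csubspace_fun_def EI_def by (auto simp: QW_lin EV_zero)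
qed

lemma BVP_pi_inv_eq: "BVP_pi_inv R B \<phi> k lam = \<Phi> ` EI"
proof -
  have "(\<forall>w\<in>W. weyl_act w (\<Phi> f) = \<Phi> f) \<longleftrightarrow> (\<forall>w\<in>W. QW w f = f)" if f: "f \<in> EV" for f
  proof (rule ball_cong[OF refl])
    fix w assume w: "w \<in> W"
    have "weyl_act w (\<Phi> f) = \<Phi> (QW w f)" unfolding reg_restrict_cut by (rule weyl_act_T[OF f w])
    then show "weyl_act w (\<Phi> f) = \<Phi> f \<longleftrightarrow> QW w f = f" using \<Phi>_inj[OF QW_EV[OF w f] f] by metis
  qed
  then show ?thesis unfolding BVP_pi_inv_def BVP_pi_eq EI_def by blast
qed

text \<open>For invariant f every Q(w) f is f, so T f x is f(w x) for any w that moves x into the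
  closed alcove; by \<open>chamber_unique\<close> this point does not depend on w.\<close>

lemma G_T: assumes f: "f \<in> EI" shows "G_op R B \<phi> f = T f"
proof
  fix x
  obtain w where w: "w \<in> W" "w x \<in> Cb" using to_chamber by blast
  have "G_op R B \<phi> f x = f (w x)"
    unfolding G_op_def closure_C
  proof (rule the_equality)
    show "\<exists>u\<in>W. \<exists>v\<in>Cb. x = inv u v \<and> f (w x) = f v"
      by (rule bexI[of _ w], rule bexI[of _ "w x"]) (use w in auto)
    fix y assume "\<exists>u\<in>W. \<exists>v\<in>Cb. x = inv u v \<and> y = f v"
    then obtain u v where u: "u \<in> W" "v \<in> Cb" "x = inv u v" "y = f v" by blast
    then have "u x = v" by simp
    then show "y = f (w x)" using chamber_unique[OF u(1) w(1), of x] u w(2) by simp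
  qed
  also have "\<dots> = T f x" using T_eval[OF _ w] f w(1) by (auto simp: EI_def)
  finally show "G_op R B \<phi> f x = T f x" .
qed

lemma G_bij: "bij_betw (G_op R B \<phi>) EI {f \<in> BVP R B \<phi> k lam. reg_restrict R B \<phi> f \<in> BVP_pi_inv R B \<phi> k lam}"
proof -
  have EIV: "EI \<subseteq> EV" by (auto simp: EI_def)
  have im: "{f \<in> BVP R B \<phi> k lam. reg_restrict R B \<phi> f \<in> BVP_pi_inv R B \<phi> k lam} = T ` EI"
  proof
    show "T ` EI \<subseteq> {f \<in> BVP R B \<phi> k lam. reg_restrict R B \<phi> f \<in> BVP_pi_inv R B \<phi> k lam}"
      unfolding BVP_eq BVP_pi_inv_eq using EIV by auto
    show "{f \<in> BVP R B \<phi> k lam. reg_restrict R B \<phi> f \<in> BVP_pi_inv R B \<phi> k lam} \<subseteq> T ` EI"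
    proof
      fix F assume "F \<in> {f \<in> BVP R B \<phi> k lam. reg_restrict R B \<phi> f \<in> BVP_pi_inv R B \<phi> k lam}"
      then obtain f f' where f: "f \<in> EV" "F = T f" "f' \<in> EI" "\<Phi> f = \<Phi> f'" unfolding BVP_eq BVP_pi_inv_eq by blast
      then have "f = f'" using \<Phi>_inj EIV by blast
      then show "F \<in> T ` EI" using f by blast
    qed
  qed
  have "bij_betw T EI (T ` EI)"
    by (rule inj_on_imp_bij_betw, rule inj_on_subset[OF _ EIV]) (use T_bij in \<open>simp add: bij_betw_def\<close>)
  then show ?thesis unfolding im using bij_betw_cong[of EI "G_op R B \<phi>" T] G_T by blast
qed

lemma G_iso: "clinear_iso EI (BVP_pi_inv R B \<phi> k lam) (\<lambda>f. reg_restrict R B \<phi> (G_op R B \<phi> f))"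
proof -
  have EIV: "EI \<subseteq> EV" by (auto simp: EI_def)
  have lin: "clinear_fun_on EI \<Phi>" using \<Phi>_linear EIV unfolding clinear_fun_on_def by blast
  have cs: "csubspace_fun EI" by (rule EI_csub)
  have lin': "clinear_fun_on EI (\<lambda>f. reg_restrict R B \<phi> (G_op R B \<phi> f))"
    using lin cs unfolding clinear_fun_on_def csubspace_fun_def by (simp add: G_T)
  have "inj_on \<Phi> EI" using \<Phi>_inj EIV by (auto intro!: inj_onI)
  then have "bij_betw \<Phi> EI (\<Phi> ` EI)" by (rule inj_on_imp_bij_betw)
  then have "bij_betw (\<lambda>f. reg_restrict R B \<phi> (G_op R B \<phi> f)) EI (\<Phi> ` EI)"
    using bij_betw_cong[of EI "\<lambda>f. reg_restrict R B \<phi> (G_op R B \<phi> f)" \<Phi>] G_T by simp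
  then show ?thesis unfolding clinear_iso_def BVP_pi_inv_eq using cs csubspace_image[OF cs lin] lin' by blast
qed

end

theorem theorem6p3:
  fixes R B :: "'a::euclidean_space set" and \<phi> :: 'a
    and k :: "'a affine_functional \<Rightarrow> real"
    and mul :: "'a hecke \<Rightarrow> 'a hecke \<Rightarrow> 'a hecke"
    and lam :: "'a \<Rightarrow> complex"
  assumes "irreducible_root_system R"
    and "root_basis R B"
    and "highest_root R B \<phi>"
    and "multiplicity_function R k"
    and "hecke_mult R B \<phi> k mul"
    and "linear lam"
  shows "(bij_betw (T_op R B \<phi> k) (E_space R lam) (BVP R B \<phi> k lam) \<and>
          hecke_module_iso R mul
            (E_space R lam) (Q_rep B \<phi> k)
            (BVP_pi R B \<phi> k lam) (pi_rep R B \<phi> k)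
            (\<lambda>f. reg_restrict R B \<phi> (T_op R B \<phi> k f))) \<and>
         (bij_betw (G_op R B \<phi>) (E_Q_inv R B \<phi> k lam)
            {f \<in> BVP R B \<phi> k lam. reg_restrict R B \<phi> f \<in> BVP_pi_inv R B \<phi> k lam} \<and>
          clinear_iso (E_Q_inv R B \<phi> k lam) (BVP_pi_inv R B \<phi> k lam)
            (\<lambda>f. reg_restrict R B \<phi> (G_op R B \<phi> f)))"
proof -
  interpret hecke_setup R B \<phi> k mul lam
    by (intro hecke_setup.intro affine_weyl.intro hecke_setup_axioms.intro assms)
  have EI: "E_Q_inv R B \<phi> k lam = EI" by (simp add: E_Q_inv_def EI_def E_space_eq)
  show ?thesis
    unfolding E_space_eq EI by (intro conjI T_bij \<Phi>_iso G_bij G_iso)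
qed

end
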